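(* Let $p,q\in(0,1)$. The C*-algebra $\mathcal{C}(\mathrm{S}^3_q):=\mathcal{T}\bar\otimes\mathcal{C}(\mathrm{S}^1)\times_{(W\circ\pi_1,\pi_2)}\mathcal{T}\bar\otimes\mathcal{C}(\mathrm{S}^1)$ is the universal C*-algebra of $\mathcal{O}(\mathrm{S}^3_{pq})$ (with respect to the *-homomorphism $\iota:\mathcal{O}(\mathrm{S}^3_{pq})\to\mathcal{C}(\mathrm{S}^3_q)$ given in the context). For every $N\in\mathbb{Z}$, the associated quantum line bundle $$\mathcal{C}(\mathrm{S}^3_q)_N:=\{\,x\in\mathcal{C}(\mathrm{S}^3_q):\Delta_{\mathcal{C}(\mathrm{S}^3_q)}(x)=x\otimes U^N\,\}$$ is isomorphic, as a left $\mathcal{C}(\mathrm{S}^2_q)$-module, to $$\mathcal{T}\times_{(U^N\sigma,\sigma)}\mathcal{T}=\{(a_0,a_1)\in\mathcal{T}\times\mathcal{T}: U^N\sigma(a_0)=\sigma(a_1)\},$$ and $L_N\subset\mathcal{C}(\mathrm{S}^3_q)_N$, where $L_N=\{x\in\mathcal{O}(\mathrm{S}^3_{pq}):\Delta_{\mathcal{O}(\mathrm{S}^3_{pq})}(x)=x\otimes U^N\}$ is regarded as a subspace of $\mathcal{C}(\mathrm{S}^3_q)$ via $\iota$.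
   Context: Toeplitz algebra: $S$ is the unilateral shift $Se_n=e_{n+1}$ on $\ell^2(\mathbb{N}_0)$ with orthonormal basis $\{e_n\}_{n\in\mathbb{N}_0}$; $\mathcal{T}\subset\mathrm{B}(\ell^2(\mathbb{N}_0))$ is the C*-algebra generated by $S$. $U\in\mathcal{C}(\mathrm{S}^1)$ is $U(\mathrm{e}^{\mathrm{i}\phi})=\mathrm{e}^{\mathrm{i}\phi}$, and $\sigma:\mathcal{T}\to\mathcal{C}(\mathrm{S}^1)$ is the symbol map, the *-homomorphism with $\sigma(S)=U$ and kernel the compact operators. For $r\in(0,1)$ the quantum disc algebra $\mathcal{O}(\mathrm{D}^2_r)$ is the *-algebra generated by $x$ with $x^*x-r\,xx^*=1-r$; it is regarded as a dense *-subalgebra of $\mathcal{T}$ by $xe_n=\sqrt{1-r^{n+1}}\,e_{n+1}$, so $\sigma(x)=U$. Let $z\in\mathcal{T}$ and $y\in\mathcal{T}$ be the generators for $r=q$ and $r=p$, respectively. $\mathcal{C}(\mathrm{S}^2_q):=\{(a_0,a_1)\in\mathcal{T}\times\mathcal{T}:\sigma(a_0)=\sigma(a_1)\}$ (componentwise operations). It acts on $\mathcal{T}\times_{(U^N\sigma,\sigma)}\mathcal{T}$ by $(b_0,b_1).(a_0,a_1)=(b_0a_0,b_1a_1)$. $\mathcal{C}(\mathrm{S}^3_q)$: let $\bar\otimes$ be the C*-tensor product, $\pi_1=\pi_2=\sigma\bar\otimes\mathrm{id}:\mathcal{T}\bar\otimes\mathcal{C}(\mathrm{S}^1)\to\mathcal{C}(\mathrm{S}^1)\bar\otimes\mathcal{C}(\mathrm{S}^1)$,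 and $W:\mathcal{C}(\mathrm{S}^1)\bar\otimes\mathcal{C}(\mathrm{S}^1)\to\mathcal{C}(\mathrm{S}^1)\bar\otimes\mathcal{C}(\mathrm{S}^1)$, $W(f)(x,y)=f(x,xy)$, so $W(g\otimes U^N)=gU^N\otimes U^N$. Then $\mathcal{C}(\mathrm{S}^3_q)$ is the C*-algebra of pairs $(x_1,x_2)$ of elements of $\mathcal{T}\bar\otimes\mathcal{C}(\mathrm{S}^1)$ with $W(\pi_1(x_1))=\pi_2(x_2)$. The coproduct of $\mathcal{C}(\mathrm{S}^1)$ is $\Delta(f)(u,v)=f(uv)$ (so $\Delta(U^N)=U^N\otimes U^N$), and the right coaction $\Delta_{\mathcal{C}(\mathrm{S}^3_q)}$ of $\mathcal{C}(\mathrm{S}^1)$ on $\mathcal{C}(\mathrm{S}^3_q)$ is given by applying $\mathrm{id}\otimes\Delta$ in each of the two components. $\mathcal{C}(\mathrm{S}^2_q)$ acts on $\mathcal{C}(\mathrm{S}^3_q)$ (and on each $\mathcal{C}(\mathrm{S}^3_q)_N$) by left multiplication through $(b_0,b_1)\mapsto(b_0\otimes1,b_1\otimes1)$. $\mathcal{O}(\mathrm{S}^3_{pq})$ is the *-algebra generated by $a,a^*,b,b^*$ with relations $a^*a-qaa^*=1-q$, $b^*b-pbb^*=1-p$, $(1-aa^* )(1-bb^* )=0$, $ab=ba$, $a^*b=ba^*$. Its universal C*-algebra is its completion in the norm given by the supremum over all bounded Hilbert space *-representations. $\mathcal{O}(\mathrm{U}(1))=\mathrm{span}\{U^N:N\in\mathbb{Z}\}$,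 $\Delta(U^N)=U^N\otimes U^N$, and $\Delta_{\mathcal{O}(\mathrm{S}^3_{pq})}:\mathcal{O}(\mathrm{S}^3_{pq})\to\mathcal{O}(\mathrm{S}^3_{pq})\otimes\mathcal{O}(\mathrm{U}(1))$ is the *-homomorphism with $a\mapsto a\otimes U^*$, $b\mapsto b\otimes U$. $\iota:\mathcal{O}(\mathrm{S}^3_{pq})\to\mathcal{C}(\mathrm{S}^3_q)$ is the *-homomorphism with $\iota(a)=(z\otimes U^*,1\otimes U^* )$, $\iota(b)=(1\otimes U,y\otimes U)$. *)

theory Defs
  imports "HOL-Analysis.Analysis" "HOL-Library.Poly_Mapping"
begin

section \<open>Complex Hilbert spaces and their bounded operators\<close>

class scaleC =
  fixes scaleC :: "complex \<Rightarrow> 'a \<Rightarrow> 'a"  (infixr \<open>*\<^sub>C\<close> 75)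

class star =
  fixes star :: "'a \<Rightarrow> 'a"

class complex_vector = ab_group_add + scaleC +
  assumes scaleC_add_right: "c *\<^sub>C (x + y) = c *\<^sub>C x + c *\<^sub>C y"
    and scaleC_add_left: "(c + d) *\<^sub>C x = c *\<^sub>C x + d *\<^sub>C x"
    and scaleC_scaleC: "c *\<^sub>C d *\<^sub>C x = (c * d) *\<^sub>C x"
    and scaleC_one: "1 *\<^sub>C x = x"

global_interpretation complex_vector: vector_space "scaleC :: complex \<Rightarrow> 'a \<Rightarrow> 'a::complex_vector"
  defines complex_span = complex_vector.span
  by unfold_locales (simp_all add: scaleC_add_right scaleC_add_left scaleC_scaleC scaleC_one)

class complex_normed_vector = complex_vector + real_normed_vector +
  assumes scaleR_scaleC: "r *\<^sub>R x = complex_of_real r *\<^sub>C x"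
    and norm_scaleC: "norm (c *\<^sub>C x) = cmod c * norm x"

text \<open>The inner product is conjugate linear in its first argument.\<close>

class complex_hilbert = complex_normed_vector + complete_space +
  fixes cinner :: "'a \<Rightarrow> 'a \<Rightarrow> complex"
  assumes cinner_commute: "cinner x y = cnj (cinner y x)"
    and cinner_add_right: "cinner x (y + z) = cinner x y + cinner x z"
    and cinner_scaleC_right: "cinner x (c *\<^sub>C y) = c * cinner x y"
    and cinner_self: "cinner x x = complex_of_real ((norm x)\<^sup>2)"

lemma bounded_linear_scaleC: "bounded_linear (\<lambda>x::'a::complex_normed_vector. c *\<^sub>C x)"
proof (rule bounded_linear_intro[where K = "cmod c"])
  fix r and x :: 'a
  show "c *\<^sub>C r *\<^sub>R x = r *\<^sub>R c *\<^sub>C x"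
    by (simp add: scaleR_scaleC scaleC_scaleC mult.commute)
qed (simp_all add: scaleC_add_right norm_scaleC mult.commute)

lemma continuous_on_scaleC:
  fixes g :: "'x::topological_space \<Rightarrow> 'a::complex_normed_vector"
  assumes "continuous_on A f" "continuous_on A g"
  shows "continuous_on A (\<lambda>x. f x *\<^sub>C g x)"
proof -
  have "bounded_bilinear (\<lambda>c (x::'a). c *\<^sub>C x)"
  proof
    fix a b :: complex and r :: real and x y :: 'a
    show "(a + b) *\<^sub>C x = a *\<^sub>C x + b *\<^sub>C x" by (rule scaleC_add_left)
    show "a *\<^sub>C (x + y) = a *\<^sub>C x + a *\<^sub>C y" by (rule scaleC_add_right)
    show "(r *\<^sub>R a) *\<^sub>C x = r *\<^sub>R a *\<^sub>C x"
      by (simp add: scaleR_scaleC scaleC_scaleC scaleR_conv_of_real)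
    show "a *\<^sub>C r *\<^sub>R x = r *\<^sub>R a *\<^sub>C x"
      by (simp add: scaleR_scaleC scaleC_scaleC mult.commute)
    show "\<exists>K. \<forall>a (x::'a). norm (a *\<^sub>C x) \<le> norm a * norm x * K"
      by (rule exI[of _ 1]) (simp add: norm_scaleC)
  qed
  from bounded_bilinear.continuous_on[OF this assms] show ?thesis .
qed

instantiation complex :: "{complex_normed_vector, star}"
begin

definition scaleC_complex :: "complex \<Rightarrow> complex \<Rightarrow> complex"
  where "scaleC_complex c x = c * x"

definition star_complex :: "complex \<Rightarrow> complex"
  where "star_complex = cnj"

instance
  by standard (simp_all add: scaleC_complex_def algebra_simps scaleR_conv_of_real norm_mult)

end

typedef (overloaded) 'a cop =
  "{f :: 'a::complex_normed_vector \<Rightarrow>\<^sub>L 'a. \<forall>c x. f (c *\<^sub>C x) = c *\<^sub>C f x}"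
  by (rule exI[of _ 0]) (simp add: complex_vector.scale_zero_right)

setup_lifting type_definition_cop

definition cop_apply :: "'a::complex_normed_vector cop \<Rightarrow> 'a \<Rightarrow> 'a"
  where "cop_apply A = blinfun_apply (Rep_cop A)"

instantiation cop :: (complex_normed_vector) real_normed_algebra
begin

lift_definition zero_cop :: "'a cop" is 0
  by (simp add: complex_vector.scale_zero_right)

lift_definition plus_cop :: "'a cop \<Rightarrow> 'a cop \<Rightarrow> 'a cop" is "(+)"
  by (simp add: blinfun.add_left scaleC_add_right)

lift_definition minus_cop :: "'a cop \<Rightarrow> 'a cop \<Rightarrow> 'a cop" is "(-)"
  by (simp add: blinfun.diff_left complex_vector.scale_right_diff_distrib)

lift_definition uminus_cop :: "'a cop \<Rightarrow> 'a cop" is uminus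
  by (simp add: blinfun.minus_left complex_vector.scale_minus_right)

lift_definition times_cop :: "'a cop \<Rightarrow> 'a cop \<Rightarrow> 'a cop" is blinfun_compose
  by simp

lift_definition scaleR_cop :: "real \<Rightarrow> 'a cop \<Rightarrow> 'a cop" is scaleR
  by (simp add: blinfun.scaleR_left scaleR_scaleC scaleC_scaleC mult.commute)

lift_definition norm_cop :: "'a cop \<Rightarrow> real" is norm .

definition sgn_cop :: "'a cop \<Rightarrow> 'a cop"
  where "sgn_cop x = scaleR (inverse (norm x)) x"

definition dist_cop :: "'a cop \<Rightarrow> 'a cop \<Rightarrow> real"
  where "dist_cop x y = norm (x - y)"

definition uniformity_cop :: "('a cop \<times> 'a cop) filter"
  where [code del]: "uniformity_cop = (INF e\<in>{0<..}. principal {(x, y). dist x y < e})"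

definition open_cop :: "'a cop set \<Rightarrow> bool"
  where [code del]: "open_cop S = (\<forall>x\<in>S. \<forall>\<^sub>F (x', y) in uniformity. x' = x \<longrightarrow> y \<in> S)"

instance
proof
  fix a b d :: "'a cop" and r s :: real
  show "a + b + d = a + (b + d)" "a + b = b + a" "0 + a = a" "- a + a = 0" "a - b = a + - b"
    by (transfer, simp add: algebra_simps)+
  show "a * b * d = a * (b * d)"
    by (transfer, rule blinfun_eqI, simp)+
  show "(a + b) * d = a * d + b * d" "a * (b + d) = a * b + a * d"
    by (transfer, rule blinfun_eqI, simp add: blinfun.bilinear_simps)+
  show "r *\<^sub>R (a + b) = r *\<^sub>R a + r *\<^sub>R b" "(r + s) *\<^sub>R a = r *\<^sub>R a + s *\<^sub>R a"
    "r *\<^sub>R s *\<^sub>R a = (r * s) *\<^sub>R a" "1 *\<^sub>R a = a"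
    by (transfer, simp add: algebra_simps)+
  show "r *\<^sub>R a * b = r *\<^sub>R (a * b)" "a * r *\<^sub>R b = r *\<^sub>R (a * b)"
    by (transfer, rule blinfun_eqI, simp add: blinfun.bilinear_simps)+
  show "dist a b = norm (a - b)" by (rule dist_cop_def)
  show "sgn a = scaleR (inverse (norm a)) a" by (rule sgn_cop_def)
  show "uniformity = (INF e\<in>{0<..}. principal {(x :: 'a cop, y). dist x y < e})"
    by (rule uniformity_cop_def)
  show "open U = (\<forall>x\<in>U. \<forall>\<^sub>F (x', y) in uniformity. x' = x \<longrightarrow> y \<in> U)" for U :: "'a cop set"
    by (rule open_cop_def)
  show "(norm a = 0) = (a = 0)" by transfer simp
  show "norm (a + b) \<le> norm a + norm b" by transfer (rule norm_triangle_ineq)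
  show "norm (r *\<^sub>R a) = \<bar>r\<bar> * norm a" by transfer simp
  show "norm (a * b) \<le> norm a * norm b" by transfer (rule norm_blinfun_compose)
qed

end

lemma cop_eqI: "(\<And>x. cop_apply A x = cop_apply B x) \<Longrightarrow> A = B"
  unfolding cop_apply_def by (metis Rep_cop_inject blinfun_eqI)

lemma cop_apply_plus: "cop_apply (A + B) x = cop_apply A x + cop_apply B x"
  by (simp add: cop_apply_def plus_cop.rep_eq blinfun.add_left)

lemma cop_apply_scaleR: "cop_apply (r *\<^sub>R A) x = r *\<^sub>R cop_apply A x"
  by (simp add: cop_apply_def scaleR_cop.rep_eq blinfun.scaleR_left)

instantiation cop :: (complex_normed_vector) monoid_mult
begin

lift_definition one_cop :: "'a cop" is id_blinfun
  by simp

instance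
  by standard (rule mult.assoc, (transfer, rule blinfun_eqI, simp)+)

end

instantiation cop :: (complex_normed_vector) complex_normed_vector
begin

lift_definition scaleC_cop :: "complex \<Rightarrow> 'a cop \<Rightarrow> 'a cop"
  is "\<lambda>c f. Blinfun (\<lambda>x. c *\<^sub>C blinfun_apply f x)"
  by (simp add: bounded_linear_Blinfun_apply bounded_linear_compose[OF bounded_linear_scaleC]
      blinfun.bounded_linear_right scaleC_scaleC mult.commute)

lemma scaleC_cop_apply: "cop_apply (c *\<^sub>C A) x = c *\<^sub>C cop_apply A x"
  unfolding cop_apply_def scaleC_cop.rep_eq
  by (subst bounded_linear_Blinfun_apply)
    (rule bounded_linear_compose[OF bounded_linear_scaleC blinfun.bounded_linear_right], rule refl)

instance
proof
  fix a b :: "'a cop" and r :: real and c e :: complex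
  show "c *\<^sub>C (a + b) = c *\<^sub>C a + c *\<^sub>C b"
    by (rule cop_eqI) (simp only: scaleC_cop_apply cop_apply_plus scaleC_add_right)
  show "(c + e) *\<^sub>C a = c *\<^sub>C a + e *\<^sub>C a"
    by (rule cop_eqI) (simp only: scaleC_cop_apply cop_apply_plus scaleC_add_left)
  have sc: "c *\<^sub>C e *\<^sub>C a = (c * e) *\<^sub>C a" for c e and a :: "'a cop"
    by (rule cop_eqI) (simp only: scaleC_cop_apply scaleC_scaleC)
  have sc1: "1 *\<^sub>C a = a" for a :: "'a cop"
    by (rule cop_eqI) (simp only: scaleC_cop_apply scaleC_one)
  show "c *\<^sub>C e *\<^sub>C a = (c * e) *\<^sub>C a" "1 *\<^sub>C a = a"
    by (rule sc, rule sc1)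
  show "r *\<^sub>R a = complex_of_real r *\<^sub>C a"
    by (rule cop_eqI) (simp only: scaleC_cop_apply cop_apply_scaleR scaleR_scaleC)
  have le: "norm (c *\<^sub>C a) \<le> cmod c * norm a" for c and a :: "'a cop"
    unfolding norm_cop.rep_eq
  proof (rule norm_blinfun_bound)
    fix x
    have "norm (cop_apply (c *\<^sub>C a) x) \<le> cmod c * (norm (Rep_cop a) * norm x)"
      unfolding scaleC_cop_apply norm_scaleC unfolding cop_apply_def
      by (rule mult_left_mono[OF norm_blinfun norm_ge_zero])
    then show "norm (blinfun_apply (Rep_cop (c *\<^sub>C a)) x) \<le> cmod c * norm (Rep_cop a) * norm x"
      by (simp only: cop_apply_def mult.assoc)
  qed simp
  show "norm (c *\<^sub>C a) = cmod c * norm a"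
  proof (cases "c = 0")
    case True
    then show ?thesis using le[of c a] by simp
  next
    case False
    have eq: "inverse c *\<^sub>C c *\<^sub>C a = a"
      using False by (simp add: sc sc1)
    have "norm a \<le> cmod (inverse c) * norm (c *\<^sub>C a)"
      using le[of "inverse c" "c *\<^sub>C a"] unfolding eq .
    then have "cmod c * norm a \<le> cmod c * (cmod (inverse c) * norm (c *\<^sub>C a))"
      by (rule mult_left_mono) (rule norm_ge_zero)
    also have "\<dots> = norm (c *\<^sub>C a)"
      using False by (simp only: norm_inverse mult.assoc[symmetric] right_inverse norm_eq_zero mult_1_left not_False_eq_True)
    finally show ?thesis using le[of c a] by (rule antisym[rotated])
  qed
qed

end

instantiation cop :: (complex_hilbert) star
begin

definition star_cop :: "'a cop \<Rightarrow> 'a cop"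
  where "star_cop A = (THE B. \<forall>x y. cinner (cop_apply A x) y = cinner x (cop_apply B y))"

instance ..

end

definition compact_operator :: "'a::complex_normed_vector cop \<Rightarrow> bool"
  where "compact_operator A \<longleftrightarrow> compact (closure (cop_apply A ` cball 0 1))"

definition star_hom_on :: "'a set \<Rightarrow> ('a::{complex_vector,times,star} \<Rightarrow> 'b::{complex_vector,times,star}) \<Rightarrow> bool"
  where "star_hom_on A h \<longleftrightarrow>
    (\<forall>x\<in>A. \<forall>y\<in>A. h (x + y) = h x + h y \<and> h (x * y) = h x * h y) \<and>
    (\<forall>x\<in>A. h (star x) = star (h x) \<and> (\<forall>c. h (c *\<^sub>C x) = c *\<^sub>C h x))"

definition Cstar_generated :: "'a::complex_hilbert cop set \<Rightarrow> 'a cop set"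
  where "Cstar_generated X = \<Inter>{A. X \<subseteq> A \<and> closed A \<and>
    (\<forall>x\<in>A. \<forall>y\<in>A. x + y \<in> A \<and> x * y \<in> A) \<and>
    (\<forall>x\<in>A. star x \<in> A \<and> (\<forall>c. c *\<^sub>C x \<in> A))}"


section \<open>The Hilbert space of square summable sequences\<close>

typedef ell2 = "{f :: nat \<Rightarrow> complex. summable (\<lambda>n. (cmod (f n))\<^sup>2)}"
  morphisms ell2_coeff Abs_ell2
  by (rule exI[of _ "\<lambda>_. 0"]) simp

setup_lifting type_definition_ell2

lemma ell2_cauchy_schwarz:
  assumes "summable (\<lambda>n. (cmod (f n))\<^sup>2)" "summable (\<lambda>n. (cmod (g n))\<^sup>2)"
  shows "summable (\<lambda>n. cnj (f n) * g n)"
proof (rule summable_comparison_test)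
  show "summable (\<lambda>n. (cmod (f n))\<^sup>2 + (cmod (g n))\<^sup>2)"
    by (rule summable_add[OF assms])
  have "norm (cnj (f n) * g n) \<le> (cmod (f n))\<^sup>2 + (cmod (g n))\<^sup>2" for n
  proof -
    have "2 * (cmod (f n) * cmod (g n)) \<le> (cmod (f n))\<^sup>2 + (cmod (g n))\<^sup>2"
      using sum_squares_bound[of "cmod (f n)" "cmod (g n)"] by simp
    moreover have "0 \<le> cmod (f n) * cmod (g n)" by simp
    ultimately show ?thesis by (simp only: norm_mult complex_mod_cnj)
  qed
  then show "\<exists>N. \<forall>n\<ge>N. norm (cnj (f n) * g n) \<le> (cmod (f n))\<^sup>2 + (cmod (g n))\<^sup>2" by blast
qed

lemma ell2_add:
  assumes "summable (\<lambda>n. (cmod (f n))\<^sup>2)" "summable (\<lambda>n. (cmod (g n))\<^sup>2)"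
  shows "summable (\<lambda>n. (cmod (f n + g n))\<^sup>2)"
proof (rule summable_comparison_test)
  show "summable (\<lambda>n. 2 * ((cmod (f n))\<^sup>2 + (cmod (g n))\<^sup>2))"
    by (intro summable_mult summable_add assms)
  have "(cmod (f n + g n))\<^sup>2 \<le> 2 * ((cmod (f n))\<^sup>2 + (cmod (g n))\<^sup>2)" for n
  proof -
    have "(cmod (f n + g n))\<^sup>2 \<le> (cmod (f n) + cmod (g n))\<^sup>2"
      by (intro power_mono norm_triangle_ineq) simp
    also have "\<dots> \<le> 2 * ((cmod (f n))\<^sup>2 + (cmod (g n))\<^sup>2)"
      using sum_squares_bound[of "cmod (f n)" "cmod (g n)"] by (simp add: power2_sum)
    finally show ?thesis .
  qed
  then show "\<exists>N. \<forall>n\<ge>N. norm ((cmod (f n + g n))\<^sup>2) \<le> 2 * ((cmod (f n))\<^sup>2 + (cmod (g n))\<^sup>2)"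
    by simp
qed

lemma ell2_scale:
  "summable (\<lambda>n. (cmod (f n))\<^sup>2) \<Longrightarrow> summable (\<lambda>n. (cmod (c * f n))\<^sup>2)"
  by (simp add: norm_mult power_mult_distrib summable_mult)

instantiation ell2 :: real_inner
begin

lift_definition zero_ell2 :: ell2 is "\<lambda>_. 0"
  by simp

lift_definition plus_ell2 :: "ell2 \<Rightarrow> ell2 \<Rightarrow> ell2" is "\<lambda>f g n. f n + g n"
  by (rule ell2_add)

lift_definition uminus_ell2 :: "ell2 \<Rightarrow> ell2" is "\<lambda>f n. - f n"
  by simp

lift_definition minus_ell2 :: "ell2 \<Rightarrow> ell2 \<Rightarrow> ell2" is "\<lambda>f g n. f n - g n"
  using ell2_add[of _ "\<lambda>n. - _ n"] by simp

lift_definition scaleR_ell2 :: "real \<Rightarrow> ell2 \<Rightarrow> ell2" is "\<lambda>r f n. complex_of_real r * f n"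
  by (rule ell2_scale)

lift_definition inner_ell2 :: "ell2 \<Rightarrow> ell2 \<Rightarrow> real" is "\<lambda>f g. suminf (\<lambda>n. Re (cnj (f n) * g n))" .

definition norm_ell2 :: "ell2 \<Rightarrow> real"
  where "norm_ell2 x = sqrt (inner x x)"

definition sgn_ell2 :: "ell2 \<Rightarrow> ell2"
  where "sgn_ell2 x = scaleR (inverse (norm x)) x"

definition dist_ell2 :: "ell2 \<Rightarrow> ell2 \<Rightarrow> real"
  where "dist_ell2 x y = norm (x - y)"

definition uniformity_ell2 :: "(ell2 \<times> ell2) filter"
  where [code del]: "uniformity_ell2 = (INF e\<in>{0<..}. principal {(x, y). dist x y < e})"

definition open_ell2 :: "ell2 set \<Rightarrow> bool"
  where [code del]: "open_ell2 S = (\<forall>x\<in>S. \<forall>\<^sub>F (x', y) in uniformity. x' = x \<longrightarrow> y \<in> S)"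

instance
proof
  fix x y z :: ell2 and r s :: real
  have sq: "Re (cnj a * a) = (cmod a)\<^sup>2" for a
    unfolding cmod_power2 by (simp add: power2_eq_square)
  show "x + y + z = x + (y + z)" "x + y = y + x" "0 + x = x" "- x + x = 0" "x - y = x + - y"
    by (transfer, simp add: algebra_simps)+
  show "r *\<^sub>R (x + y) = r *\<^sub>R x + r *\<^sub>R y" "(r + s) *\<^sub>R x = r *\<^sub>R x + s *\<^sub>R x"
    "r *\<^sub>R s *\<^sub>R x = (r * s) *\<^sub>R x" "1 *\<^sub>R x = x"
    by (transfer, simp add: algebra_simps)+
  show "dist x y = norm (x - y)" by (rule dist_ell2_def)
  show "sgn x = scaleR (inverse (norm x)) x" by (rule sgn_ell2_def)
  show "uniformity = (INF e\<in>{0<..}. principal {(x :: ell2, y). dist x y < e})"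
    by (rule uniformity_ell2_def)
  show "open U = (\<forall>x\<in>U. \<forall>\<^sub>F (x', y) in uniformity. x' = x \<longrightarrow> y \<in> U)" for U :: "ell2 set"
    by (rule open_ell2_def)
  show "norm x = sqrt (x \<bullet> x)" by (rule norm_ell2_def)
  show "x \<bullet> y = y \<bullet> x" by transfer (simp add: mult.commute)
  show "(x + y) \<bullet> z = x \<bullet> z + y \<bullet> z"
  proof transfer
    fix f g h :: "nat \<Rightarrow> complex"
    assume s: "summable (\<lambda>n. (cmod (f n))\<^sup>2)" "summable (\<lambda>n. (cmod (g n))\<^sup>2)" "summable (\<lambda>n. (cmod (h n))\<^sup>2)"
    show "suminf (\<lambda>n. Re (cnj (f n + g n) * h n)) = (suminf (\<lambda>n. Re (cnj (f n) * h n))) + (suminf (\<lambda>n. Re (cnj (g n) * h n)))"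
      using suminf_add[OF summable_Re[OF ell2_cauchy_schwarz[OF s(1) s(3)]]
          summable_Re[OF ell2_cauchy_schwarz[OF s(2) s(3)]]]
      by (simp add: algebra_simps)
  qed
  show "(r *\<^sub>R x) \<bullet> y = r * (x \<bullet> y)"
  proof transfer
    fix r and f g :: "nat \<Rightarrow> complex"
    assume s: "summable (\<lambda>n. (cmod (f n))\<^sup>2)" "summable (\<lambda>n. (cmod (g n))\<^sup>2)"
    show "(suminf (\<lambda>n. Re (cnj (complex_of_real r * f n) * g n))) = r * (suminf (\<lambda>n. Re (cnj (f n) * g n)))"
      using suminf_mult[OF summable_Re[OF ell2_cauchy_schwarz[OF s]], of r]
      by (simp add: algebra_simps)
  qed
  show "0 \<le> x \<bullet> x"
    by transfer (simp only: sq suminf_nonneg zero_le_power2)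
  show "(x \<bullet> x = 0) = (x = 0)"
    by transfer (simp only: sq, subst suminf_eq_zero_iff, auto)
qed

end

lemma ell2_norm_sq: "(norm x)\<^sup>2 = (suminf (\<lambda>n. (cmod (ell2_coeff x n))\<^sup>2))"
proof -
  have "Re (cnj a * a) = (cmod a)\<^sup>2" for a
    unfolding cmod_power2 by (simp add: power2_eq_square)
  then have "x \<bullet> x = (suminf (\<lambda>n. (cmod (ell2_coeff x n))\<^sup>2))"
    by (simp only: inner_ell2.rep_eq)
  then show ?thesis by (simp only: dot_square_norm)
qed

lemma ell2_summable: "summable (\<lambda>n. (cmod (ell2_coeff x n))\<^sup>2)"
  using ell2_coeff[of x] by simp

lemma ell2_sum_le: "(\<Sum>n<k. (cmod (ell2_coeff x n))\<^sup>2) \<le> (norm x)\<^sup>2"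
  unfolding ell2_norm_sq by (intro sum_le_suminf ell2_summable) auto

lemma ell2_coeff_le: "cmod (ell2_coeff x n) \<le> norm x"
proof -
  have "(cmod (ell2_coeff x n))\<^sup>2 \<le> (\<Sum>i<Suc n. (cmod (ell2_coeff x i))\<^sup>2)"
    by (rule member_le_sum) auto
  also have "\<dots> \<le> (norm x)\<^sup>2" by (rule ell2_sum_le)
  finally show ?thesis by (rule power2_le_imp_le) simp
qed

lemma ell2_norm_le:
  assumes "\<And>k. (\<Sum>n<k. (cmod (ell2_coeff x n))\<^sup>2) \<le> b\<^sup>2" "0 \<le> b"
  shows "norm x \<le> b"
proof (rule power2_le_imp_le)
  show "(norm x)\<^sup>2 \<le> b\<^sup>2"
    unfolding ell2_norm_sq by (rule suminf_le_const[OF ell2_summable assms(1)])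
qed (rule assms(2))

instantiation ell2 :: complex_hilbert
begin

lift_definition scaleC_ell2 :: "complex \<Rightarrow> ell2 \<Rightarrow> ell2" is "\<lambda>c f n. c * f n"
  by (rule ell2_scale)

lift_definition cinner_ell2 :: "ell2 \<Rightarrow> ell2 \<Rightarrow> complex" is "\<lambda>f g. suminf (\<lambda>n. cnj (f n) * g n)" .

instance
proof
  fix x y z :: ell2 and c d :: complex and r :: real
  show "c *\<^sub>C (x + y) = c *\<^sub>C x + c *\<^sub>C y" "(c + d) *\<^sub>C x = c *\<^sub>C x + d *\<^sub>C x"
    "c *\<^sub>C d *\<^sub>C x = (c * d) *\<^sub>C x" "1 *\<^sub>C x = x" "r *\<^sub>R x = complex_of_real r *\<^sub>C x"
    by (transfer, simp add: algebra_simps)+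
  show "norm (c *\<^sub>C x) = cmod c * norm x"
  proof (rule power2_eq_imp_eq)
    show "(norm (c *\<^sub>C x))\<^sup>2 = (cmod c * norm x)\<^sup>2"
      by (simp add: power_mult_distrib ell2_norm_sq scaleC_ell2.rep_eq norm_mult
          suminf_mult[OF ell2_summable])
  qed auto
  show "cinner x y = cnj (cinner y x)"
  proof transfer
    fix f g :: "nat \<Rightarrow> complex"
    assume s: "summable (\<lambda>n. (cmod (f n))\<^sup>2)" "summable (\<lambda>n. (cmod (g n))\<^sup>2)"
    have "(\<lambda>n. cnj (cnj (g n) * f n)) sums cnj (suminf (\<lambda>n. cnj (g n) * f n))"
      by (subst sums_cnj) (rule summable_sums[OF ell2_cauchy_schwarz[OF s(2) s(1)]])
    from sums_unique[OF this]
    show "(suminf (\<lambda>n. cnj (f n) * g n)) = cnj (suminf (\<lambda>n. cnj (g n) * f n))" by (simp add: mult.commute)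
  qed
  show "cinner x (y + z) = cinner x y + cinner x z"
  proof transfer
    fix f g h :: "nat \<Rightarrow> complex"
    assume s: "summable (\<lambda>n. (cmod (f n))\<^sup>2)" "summable (\<lambda>n. (cmod (g n))\<^sup>2)" "summable (\<lambda>n. (cmod (h n))\<^sup>2)"
    show "(suminf (\<lambda>n. cnj (f n) * (g n + h n))) = (suminf (\<lambda>n. cnj (f n) * g n)) + (suminf (\<lambda>n. cnj (f n) * h n))"
      using suminf_add[OF ell2_cauchy_schwarz[OF s(1) s(2)] ell2_cauchy_schwarz[OF s(1) s(3)]]
      by (simp add: algebra_simps)
  qed
  show "cinner x (c *\<^sub>C y) = c * cinner x y"
  proof transfer
    fix c and f g :: "nat \<Rightarrow> complex"
    assume s: "summable (\<lambda>n. (cmod (f n))\<^sup>2)" "summable (\<lambda>n. (cmod (g n))\<^sup>2)"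
    show "(suminf (\<lambda>n. cnj (f n) * (c * g n))) = c * (suminf (\<lambda>n. cnj (f n) * g n))"
      using suminf_mult[OF ell2_cauchy_schwarz[OF s], of c] by (simp add: algebra_simps)
  qed
  show "cinner x x = complex_of_real ((norm x)\<^sup>2)"
  proof -
    have sq: "cnj a * a = complex_of_real ((cmod a)\<^sup>2)" for a
      by (simp add: mult.commute flip: complex_norm_square)
    show ?thesis
      by (simp only: cinner_ell2.rep_eq sq ell2_norm_sq suminf_of_real[OF ell2_summable])
  qed
  fix X :: "nat \<Rightarrow> ell2"
  assume X: "Cauchy X"
  have "Cauchy (\<lambda>m. ell2_coeff (X m) n)" for n
  proof (rule metric_CauchyI)
    fix e :: real assume "0 < e"
    from metric_CauchyD[OF X this] obtain M where M: "\<And>m k. m \<ge> M \<Longrightarrow> k \<ge> M \<Longrightarrow> dist (X m) (X k) < e"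
      by blast
    have "dist (ell2_coeff (X m) n) (ell2_coeff (X k) n) \<le> dist (X m) (X k)" for m k
      using ell2_coeff_le[of "X m - X k" n] by (simp add: minus_ell2.rep_eq dist_norm)
    with M show "\<exists>M. \<forall>m\<ge>M. \<forall>k\<ge>M. dist (ell2_coeff (X m) n) (ell2_coeff (X k) n) < e"
      by (meson le_less_trans)
  qed
  then have "\<forall>n. \<exists>l. (\<lambda>m. ell2_coeff (X m) n) \<longlonglongrightarrow> l"
    by (simp add: Cauchy_convergent_iff convergent_def)
  then obtain L where L: "\<And>n. (\<lambda>m. ell2_coeff (X m) n) \<longlonglongrightarrow> L n" by metis
  have bd: "\<exists>M. \<forall>m\<ge>M. \<forall>k. (\<Sum>n<k. (cmod (ell2_coeff (X m) n - L n))\<^sup>2) \<le> e\<^sup>2" if "0 < e" for e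
  proof -
    from metric_CauchyD[OF X that] obtain M where M: "\<And>m k. m \<ge> M \<Longrightarrow> k \<ge> M \<Longrightarrow> dist (X m) (X k) < e"
      by blast
    have "(\<Sum>n<k. (cmod (ell2_coeff (X m) n - L n))\<^sup>2) \<le> e\<^sup>2" if "m \<ge> M" for m k
    proof (rule LIMSEQ_le_const2)
      show "(\<lambda>j. \<Sum>n<k. (cmod (ell2_coeff (X m) n - ell2_coeff (X j) n))\<^sup>2)
          \<longlonglongrightarrow> (\<Sum>n<k. (cmod (ell2_coeff (X m) n - L n))\<^sup>2)"
        by (intro tendsto_intros L)
      have "(\<Sum>n<k. (cmod (ell2_coeff (X m) n - ell2_coeff (X j) n))\<^sup>2) \<le> e\<^sup>2" if "j \<ge> M" for j
      proof -
        have "(\<Sum>n<k. (cmod (ell2_coeff (X m) n - ell2_coeff (X j) n))\<^sup>2) \<le> (norm (X m - X j))\<^sup>2"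
          using ell2_sum_le[where x = "X m - X j"] by (simp add: minus_ell2.rep_eq)
        also have "\<dots> \<le> e\<^sup>2"
          using M[OF \<open>m \<ge> M\<close> that] by (intro power_mono) (auto simp: dist_norm)
        finally show ?thesis .
      qed
      then show "\<exists>N. \<forall>j\<ge>N. (\<Sum>n<k. (cmod (ell2_coeff (X m) n - ell2_coeff (X j) n))\<^sup>2) \<le> e\<^sup>2" by blast
    qed
    then show ?thesis by blast
  qed
  have summ: "summable (\<lambda>n. (cmod (L n))\<^sup>2)"
  proof -
    from bd[of 1] obtain M where M: "\<And>k. (\<Sum>n<k. (cmod (ell2_coeff (X M) n - L n))\<^sup>2) \<le> 1"
      by auto
    then have "summable (\<lambda>n. (cmod (ell2_coeff (X M) n - L n))\<^sup>2)"
      by (intro summableI_nonneg_bounded[where x = 1]) auto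
    then have "summable (\<lambda>n. (cmod (- (ell2_coeff (X M) n - L n)))\<^sup>2)"
      by (simp only: norm_minus_cancel)
    from ell2_add[OF ell2_summable[of "X M"] this] show ?thesis by simp
  qed
  define l where "l = Abs_ell2 L"
  have l: "ell2_coeff l = L"
    using summ by (simp add: l_def Abs_ell2_inverse)
  have "X \<longlonglongrightarrow> l"
  proof (rule metric_LIMSEQ_I)
    fix e :: real assume "0 < e"
    with bd[of "e / 2"] obtain M
      where M: "\<And>m k. m \<ge> M \<Longrightarrow> (\<Sum>n<k. (cmod (ell2_coeff (X m) n - L n))\<^sup>2) \<le> (e / 2)\<^sup>2"
      by auto
    have "dist (X m) l < e" if "m \<ge> M" for m
    proof -
      have "norm (X m - l) \<le> e / 2"
        using M[OF that] \<open>0 < e\<close> by (intro ell2_norm_le) (simp_all add: minus_ell2.rep_eq l)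
      then show ?thesis using \<open>0 < e\<close> by (simp add: dist_norm)
    qed
    then show "\<exists>M. \<forall>m\<ge>M. dist (X m) l < e" by blast
  qed
  then show "convergent X" by (rule convergentI)
qed

end

lift_definition ell2_basis :: "nat \<Rightarrow> ell2" is "\<lambda>n k. if k = n then 1 else 0"
  by (rule summable_finite[of "{_}"]) auto

definition weighted_shift :: "(nat \<Rightarrow> complex) \<Rightarrow> ell2 cop"
  where "weighted_shift w =
    Abs_cop (Blinfun (\<lambda>v. Abs_ell2 (\<lambda>n. case n of 0 \<Rightarrow> 0 | Suc m \<Rightarrow> w m * ell2_coeff v m)))"

lemma weighted_shift_coeff:
  assumes "bounded (range w)"
  shows "ell2_coeff (cop_apply (weighted_shift w) v) n =
    (case n of 0 \<Rightarrow> 0 | Suc m \<Rightarrow> w m * ell2_coeff v m)"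
proof -
  define s where "s = (\<lambda>v n. case n of 0 \<Rightarrow> 0 | Suc m \<Rightarrow> w m * ell2_coeff v m)"
  obtain K where K: "\<And>n. cmod (w n) \<le> K"
    using assms unfolding bounded_iff by auto
  then have K0: "0 \<le> K" using norm_ge_zero order_trans by blast
  have le: "(cmod (s v (Suc m)))\<^sup>2 \<le> K\<^sup>2 * (cmod (ell2_coeff v m))\<^sup>2" for v m
    using K[of m] by (simp add: s_def norm_mult power_mult_distrib mult_right_mono power_mono)
  have summ: "summable (\<lambda>n. (cmod (s v n))\<^sup>2)" for v
  proof -
    have "summable (\<lambda>m. (cmod (s v (Suc m)))\<^sup>2)"
      by (rule summable_comparison_test[OF _ summable_mult[OF ell2_summable[of v], of "K\<^sup>2"]])
        (use le in auto)
    then show ?thesis by (subst (asm) summable_Suc_iff)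
  qed
  have coeff: "ell2_coeff (Abs_ell2 (s v)) = s v" for v
    using summ[of v] by (simp add: Abs_ell2_inverse)
  have bl: "bounded_linear (\<lambda>v. Abs_ell2 (s v))"
  proof (rule bounded_linear_intro[where K = K])
    fix x y :: ell2 and r :: real
    show "Abs_ell2 (s (x + y)) = Abs_ell2 (s x) + Abs_ell2 (s y)"
      by (subst ell2_coeff_inject[symmetric])
        (simp only: coeff plus_ell2.rep_eq, auto simp: fun_eq_iff s_def plus_ell2.rep_eq scaleR_ell2.rep_eq scaleC_ell2.rep_eq algebra_simps split: nat.split)
    show "Abs_ell2 (s (r *\<^sub>R x)) = r *\<^sub>R Abs_ell2 (s x)"
      by (subst ell2_coeff_inject[symmetric])
        (simp only: coeff scaleR_ell2.rep_eq, auto simp: fun_eq_iff s_def plus_ell2.rep_eq scaleR_ell2.rep_eq scaleC_ell2.rep_eq algebra_simps split: nat.split)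
    show "norm (Abs_ell2 (s x)) \<le> norm x * K"
    proof (rule ell2_norm_le)
      fix k
      have "(\<Sum>n<k. (cmod (s x n))\<^sup>2) \<le> (\<Sum>n<Suc k. (cmod (s x n))\<^sup>2)"
        by (rule sum_mono2) auto
      also have "\<dots> = (\<Sum>m<k. (cmod (s x (Suc m)))\<^sup>2)"
        by (subst sum.lessThan_Suc_shift) (simp add: s_def)
      also have "\<dots> \<le> (\<Sum>m<k. K\<^sup>2 * (cmod (ell2_coeff x m))\<^sup>2)"
        by (intro sum_mono le)
      also have "\<dots> = K\<^sup>2 * (\<Sum>m<k. (cmod (ell2_coeff x m))\<^sup>2)"
        by (simp add: sum_distrib_left)
      also have "\<dots> \<le> K\<^sup>2 * (norm x)\<^sup>2"
        by (intro mult_left_mono ell2_sum_le) simp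
      finally show "(\<Sum>n<k. (cmod (ell2_coeff (Abs_ell2 (s x)) n))\<^sup>2) \<le> (norm x * K)\<^sup>2"
        by (simp add: coeff power_mult_distrib mult.commute)
    qed (use K0 in simp)
  qed
  have "Abs_ell2 (s (c *\<^sub>C x)) = c *\<^sub>C Abs_ell2 (s x)" for c x
    by (subst ell2_coeff_inject[symmetric])
      (simp only: coeff scaleC_ell2.rep_eq, auto simp: fun_eq_iff s_def plus_ell2.rep_eq scaleR_ell2.rep_eq scaleC_ell2.rep_eq algebra_simps split: nat.split)
  then have "cop_apply (Abs_cop (Blinfun (\<lambda>v. Abs_ell2 (s v)))) v = Abs_ell2 (s v)"
    unfolding cop_apply_def by (subst Abs_cop_inverse) (simp_all add: bounded_linear_Blinfun_apply[OF bl])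
  moreover have "weighted_shift w = Abs_cop (Blinfun (\<lambda>v. Abs_ell2 (s v)))"
    by (simp add: weighted_shift_def s_def)
  ultimately show ?thesis
    by (simp add: coeff) (simp add: s_def)
qed

lemma weighted_shift_basis:
  assumes "bounded (range w)"
  shows "cop_apply (weighted_shift w) (ell2_basis n) = w n *\<^sub>C ell2_basis (Suc n)"
  by (subst ell2_coeff_inject[symmetric], rule ext)
    (simp add: weighted_shift_coeff[OF assms] scaleC_ell2.rep_eq ell2_basis.rep_eq split: nat.split)


section \<open>The Toeplitz algebra and functions on the circle\<close>

definition unilateral_shift :: "ell2 cop"
  where "unilateral_shift = weighted_shift (\<lambda>_. 1)"

definition Toeplitz :: "ell2 cop set"
  where "Toeplitz = Cstar_generated {unilateral_shift}"

definition disc_gen :: "real \<Rightarrow> ell2 cop"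
  where "disc_gen r = weighted_shift (\<lambda>n. complex_of_real (sqrt (1 - r ^ Suc n)))"

lemma unilateral_shift_basis:
  "cop_apply unilateral_shift (ell2_basis n) = ell2_basis (Suc n)"
  unfolding unilateral_shift_def
  by (subst weighted_shift_basis) (simp_all add: scaleC_one)

lemma disc_gen_basis:
  assumes "0 < r" "r < 1"
  shows "cop_apply (disc_gen r) (ell2_basis n) =
    complex_of_real (sqrt (1 - r ^ Suc n)) *\<^sub>C ell2_basis (Suc n)"
  unfolding disc_gen_def
proof (rule weighted_shift_basis)
  have "cmod (complex_of_real (sqrt (1 - r ^ Suc n))) \<le> 1" for n
  proof -
    have "r ^ Suc n \<le> 1" using assms by (intro power_le_one) auto
    moreover have "0 \<le> r ^ Suc n" using assms by simp
    ultimately show ?thesis by (simp add: abs_of_nonneg real_le_lsqrt)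
  qed
  then show "bounded (range (\<lambda>n. complex_of_real (sqrt (1 - r ^ Suc n))))"
    unfolding bounded_iff by blast
qed

typedef circle = "sphere (0 :: complex) 1"
  morphisms circle_val Circle
  by (rule exI[of _ 1]) simp

setup_lifting type_definition_circle

instantiation circle :: comm_monoid_mult
begin

lift_definition one_circle :: circle is 1
  by simp

lift_definition times_circle :: "circle \<Rightarrow> circle \<Rightarrow> circle" is "(*)"
  by (simp add: norm_mult)

instance
  by standard (transfer, simp)+

end

instantiation circle :: metric_space
begin

definition dist_circle :: "circle \<Rightarrow> circle \<Rightarrow> real"
  where "dist_circle x y = dist (circle_val x) (circle_val y)"

definition uniformity_circle :: "(circle \<times> circle) filter"
  where [code del]: "uniformity_circle = (INF e\<in>{0<..}. principal {(x, y). dist x y < e})"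

definition open_circle :: "circle set \<Rightarrow> bool"
  where [code del]: "open_circle S = (\<forall>x\<in>S. \<forall>\<^sub>F (x', y) in uniformity. x' = x \<longrightarrow> y \<in> S)"

instance
  by standard (auto simp: dist_circle_def uniformity_circle_def open_circle_def circle_val_inject
      intro: dist_triangle2)

end

lemma continuous_on_circle_val: "continuous_on A circle_val"
  unfolding continuous_on_iff dist_circle_def by blast

lemma norm_circle_val: "norm (circle_val u) = 1"
  using circle_val[of u] by simp

text \<open>
  The type \<^typ>\<open>'x \<Rightarrow>\<^sub>C 'a\<close> of bounded continuous functions with the supremum norm carries
  the pointwise operations.
\<close>

setup_lifting type_definition_bcontfun

instantiation bcontfun :: (topological_space, complex_normed_vector) complex_normed_vector
begin

lift_definition scaleC_bcontfun :: "complex \<Rightarrow> 'a \<Rightarrow>\<^sub>C 'b \<Rightarrow> 'a \<Rightarrow>\<^sub>C 'b" is "\<lambda>c f x. c *\<^sub>C f x"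
proof -
  fix c and f :: "'a \<Rightarrow> 'b"
  assume f: "f \<in> bcontfun"
  then obtain b where "\<And>x. norm (f x) \<le> b" unfolding bcontfun_def bounded_iff by auto
  then have "norm (c *\<^sub>C f x) \<le> cmod c * b" for x
    by (simp add: norm_scaleC mult_left_mono)
  moreover have "continuous_on UNIV (\<lambda>x. c *\<^sub>C f x)"
    using f by (intro continuous_on_scaleC) (auto simp: bcontfun_def)
  ultimately show "(\<lambda>x. c *\<^sub>C f x) \<in> bcontfun" by (rule bcontfun_normI[rotated])
qed

instance
proof
  fix f g :: "'a \<Rightarrow>\<^sub>C 'b" and c d :: complex and r :: real
  show "c *\<^sub>C (f + g) = c *\<^sub>C f + c *\<^sub>C g" "(c + d) *\<^sub>C f = c *\<^sub>C f + d *\<^sub>C f"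
    "c *\<^sub>C d *\<^sub>C f = (c * d) *\<^sub>C f" "1 *\<^sub>C f = f" "r *\<^sub>R f = complex_of_real r *\<^sub>C f"
    by (rule bcontfun_eqI, simp add: scaleC_bcontfun.rep_eq scaleC_add_right scaleC_add_left
        scaleC_scaleC scaleC_one scaleR_scaleC)+
  have le: "norm (c *\<^sub>C f) \<le> cmod c * norm f" for c and f :: "'a \<Rightarrow>\<^sub>C 'b"
    by (rule norm_bound) (simp add: scaleC_bcontfun.rep_eq norm_scaleC mult_left_mono norm_bounded)
  show "norm (c *\<^sub>C f) = cmod c * norm f"
  proof (cases "c = 0")
    case True
    then show ?thesis using le[of c f] by simp
  next
    case False
    have eq: "inverse c *\<^sub>C c *\<^sub>C f = f"
      using False by (intro bcontfun_eqI) (simp add: scaleC_bcontfun.rep_eq scaleC_scaleC scaleC_one)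
    have "norm f \<le> cmod (inverse c) * norm (c *\<^sub>C f)"
      using le[of "inverse c" "c *\<^sub>C f"] unfolding eq .
    then have "cmod c * norm f \<le> cmod c * (cmod (inverse c) * norm (c *\<^sub>C f))"
      by (rule mult_left_mono) (rule norm_ge_zero)
    also have "\<dots> = norm (c *\<^sub>C f)"
      using False by (simp only: norm_inverse mult.assoc[symmetric] right_inverse norm_eq_zero mult_1_left not_False_eq_True)
    finally show ?thesis using le[of c f] by (rule antisym[rotated])
  qed
qed

end

instantiation bcontfun :: (topological_space, "{real_normed_algebra, monoid_mult}") monoid_mult
begin

lift_definition one_bcontfun :: "'a \<Rightarrow>\<^sub>C 'b" is "\<lambda>_. 1"
  by (rule const_bcontfun)

lift_definition times_bcontfun :: "'a \<Rightarrow>\<^sub>C 'b \<Rightarrow> 'a \<Rightarrow>\<^sub>C 'b \<Rightarrow> 'a \<Rightarrow>\<^sub>C 'b" is "\<lambda>f g x. f x * g x"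
proof -
  fix f g :: "'a \<Rightarrow> 'b"
  assume fg: "f \<in> bcontfun" "g \<in> bcontfun"
  then obtain b c where b: "\<And>x. norm (f x) \<le> b" and c: "\<And>x. norm (g x) \<le> c"
    unfolding bcontfun_def bounded_iff by auto
  have "norm (f x * g x) \<le> b * c" for x
  proof -
    have "norm (f x * g x) \<le> norm (f x) * norm (g x)" by (rule norm_mult_ineq)
    also have "\<dots> \<le> b * c"
      by (rule mult_mono[OF b c order_trans[OF norm_ge_zero b] norm_ge_zero])
    finally show ?thesis .
  qed
  moreover have "continuous_on UNIV (\<lambda>x. f x * g x)"
    using fg by (intro continuous_intros) (auto simp: bcontfun_def)
  ultimately show "(\<lambda>x. f x * g x) \<in> bcontfun" by (rule bcontfun_normI[rotated])
qed

instance
  by standard (transfer, simp add: mult.assoc)+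

end

instantiation bcontfun :: (topological_space, "{metric_space, star}") star
begin

definition star_bcontfun :: "'a \<Rightarrow>\<^sub>C 'b \<Rightarrow> 'a \<Rightarrow>\<^sub>C 'b"
  where "star_bcontfun f = Bcontfun (\<lambda>x. star (apply_bcontfun f x))"

instance ..

end

text \<open>The function \<open>U\<^sup>N\<close> in \<open>C(S\<^sup>1)\<close>.\<close>

lift_definition U_pow :: "int \<Rightarrow> circle \<Rightarrow>\<^sub>C complex" is "\<lambda>N u. circle_val u powi N"
proof (rule bcontfun_normI)
  fix N u
  show "norm (circle_val u powi N) \<le> 1"
    by (simp add: norm_power_int norm_circle_val)
  have "circle_val u \<noteq> 0" for u
    using norm_circle_val[of u] by auto
  then show "continuous_on UNIV (\<lambda>u. circle_val u powi N)"
    by (intro continuous_on_power_int continuous_on_circle_val) auto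
qed

definition symbol_map :: "(ell2 cop \<Rightarrow> circle \<Rightarrow>\<^sub>C complex) \<Rightarrow> bool"
  where "symbol_map \<sigma> \<longleftrightarrow> star_hom_on Toeplitz \<sigma> \<and> \<sigma> unilateral_shift = U_pow 1 \<and>
    {t \<in> Toeplitz. \<sigma> t = 0} = Collect compact_operator"


section \<open>Tensor products with function algebras\<close>

text \<open>
  The C*-tensor product of an algebra \<open>A\<close> of operators with \<open>C(X)\<close>, for a compact space \<open>X\<close>, is
  realised by functions on \<open>X\<close> with the supremum norm: the elementary tensor \<open>t \<otimes> f\<close> is the
  function \<open>u \<mapsto> f(u) t\<close>, and the tensor product is the closed linear span of these.  Since
  \<open>C(X)\<close> is nuclear, the C*-norm is unique.  In the same way \<open>C(S\<^sup>1) \<otimes> C(S\<^sup>1)\<close> is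
  \<open>C(S\<^sup>1 \<times> S\<^sup>1)\<close>, with the first tensor factor being the first variable.
\<close>

lift_definition tensor :: "'a::complex_normed_vector \<Rightarrow> ('x::topological_space \<Rightarrow>\<^sub>C complex) \<Rightarrow> 'x \<Rightarrow>\<^sub>C 'a"
  is "\<lambda>t f u. f u *\<^sub>C t"
proof -
  fix t :: 'a and f :: "'x \<Rightarrow> complex"
  assume f: "f \<in> bcontfun"
  then obtain b where "\<And>x. norm (f x) \<le> b" unfolding bcontfun_def bounded_iff by auto
  then have "norm (f x *\<^sub>C t) \<le> b * norm t" for x
    by (simp add: norm_scaleC mult_right_mono)
  moreover have "continuous_on UNIV (\<lambda>x. f x *\<^sub>C t)"
    using f by (intro continuous_on_scaleC continuous_on_const) (auto simp: bcontfun_def)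
  ultimately show "(\<lambda>x. f x *\<^sub>C t) \<in> bcontfun" by (rule bcontfun_normI[rotated])
qed

definition Toeplitz_circle :: "(circle \<Rightarrow>\<^sub>C ell2 cop) set"
  where "Toeplitz_circle = closure (complex_span {tensor t f | t f. t \<in> Toeplitz})"

text \<open>\<open>\<sigma> \<otimes> id\<close>; on elementary tensors see \<open>symbol_tensor_id_tensor\<close> below.\<close>

definition symbol_tensor_id ::
    "(ell2 cop \<Rightarrow> circle \<Rightarrow>\<^sub>C complex) \<Rightarrow> (circle \<Rightarrow>\<^sub>C ell2 cop) \<Rightarrow> (circle \<times> circle) \<Rightarrow>\<^sub>C complex"
  where "symbol_tensor_id \<sigma> F =
    Bcontfun (\<lambda>(u, v). apply_bcontfun (\<sigma> (apply_bcontfun F v)) u)"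

definition W_twist :: "((circle \<times> circle) \<Rightarrow>\<^sub>C complex) \<Rightarrow> (circle \<times> circle) \<Rightarrow>\<^sub>C complex"
  where "W_twist f = Bcontfun (\<lambda>(x, y). apply_bcontfun f (x, x * y))"

text \<open>
  \<open>id \<otimes> \<Delta>\<close> on \<open>T \<otimes> C(S\<^sup>1)\<close>, with values in \<open>T \<otimes> C(S\<^sup>1) \<otimes> C(S\<^sup>1)\<close>, and the tensor \<open>F \<otimes> g\<close>
  in the latter algebra.
\<close>

definition id_tensor_coproduct :: "(circle \<Rightarrow>\<^sub>C ell2 cop) \<Rightarrow> (circle \<times> circle) \<Rightarrow>\<^sub>C ell2 cop"
  where "id_tensor_coproduct F = Bcontfun (\<lambda>(u, v). apply_bcontfun F (u * v))"

definition tensor_circle :: "(circle \<Rightarrow>\<^sub>C ell2 cop) \<Rightarrow> (circle \<Rightarrow>\<^sub>C complex) \<Rightarrow> (circle \<times> circle) \<Rightarrow>\<^sub>C ell2 cop"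
  where "tensor_circle F g = Bcontfun (\<lambda>(u, v). apply_bcontfun g v *\<^sub>C apply_bcontfun F u)"

lemma symbol_tensor_id_tensor:
  assumes "symbol_map \<sigma>" "t \<in> Toeplitz"
  shows "apply_bcontfun (symbol_tensor_id \<sigma> (tensor t f)) (u, v) =
    apply_bcontfun (\<sigma> t) u * apply_bcontfun f v"
proof -
  have "\<sigma> (c *\<^sub>C t) = c *\<^sub>C \<sigma> t" for c
    using assms by (auto simp: symbol_map_def star_hom_on_def)
  then have *: "(\<lambda>(u, v). apply_bcontfun (\<sigma> (apply_bcontfun (tensor t f) v)) u) =
      (\<lambda>p. apply_bcontfun f (snd p) *\<^sub>C apply_bcontfun (\<sigma> t) (fst p))"
    by (auto simp: tensor.rep_eq scaleC_bcontfun.rep_eq fun_eq_iff)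
  have "(\<lambda>p. apply_bcontfun f (snd p) *\<^sub>C apply_bcontfun (\<sigma> t) (fst p)) \<in> bcontfun"
  proof (rule bcontfun_normI)
    show "continuous_on UNIV (\<lambda>p. apply_bcontfun f (snd p) *\<^sub>C apply_bcontfun (\<sigma> t) (fst p))"
      by (intro continuous_on_scaleC continuous_on_compose2[OF continuous_on_apply_bcontfun[of UNIV]]
          continuous_intros) auto
    show "norm (apply_bcontfun f (snd p) *\<^sub>C apply_bcontfun (\<sigma> t) (fst p)) \<le> norm f * norm (\<sigma> t)" for p
      by (simp add: norm_scaleC mult_mono norm_bounded)
  qed
  then show ?thesis
    by (simp add: symbol_tensor_id_def * Bcontfun_inverse scaleC_complex_def mult.commute)
qed


section \<open>The quantum sphere algebras as fibre products\<close>

instantiation prod :: (times, times) times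
begin
definition times_prod :: "'a \<times> 'b \<Rightarrow> 'a \<times> 'b \<Rightarrow> 'a \<times> 'b"
  where "times_prod x y = (fst x * fst y, snd x * snd y)"
instance ..
end

instantiation prod :: (one, one) one
begin
definition one_prod :: "'a \<times> 'b"
  where "one_prod = (1, 1)"
instance ..
end

instance prod :: (monoid_mult, monoid_mult) monoid_mult
  by standard (simp_all add: times_prod_def one_prod_def mult.assoc)

instantiation prod :: (star, star) star
begin
definition star_prod :: "'a \<times> 'b \<Rightarrow> 'a \<times> 'b"
  where "star_prod x = (star (fst x), star (snd x))"
instance ..
end

instantiation prod :: (complex_vector, complex_vector) complex_vector
begin
definition scaleC_prod :: "complex \<Rightarrow> 'a \<times> 'b \<Rightarrow> 'a \<times> 'b"
  where "scaleC_prod c x = (c *\<^sub>C fst x, c *\<^sub>C snd x)"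
instance
  by standard (auto simp: scaleC_prod_def scaleC_add_right scaleC_add_left scaleC_scaleC scaleC_one
      prod_eq_iff)
end

text \<open>The library norm on a product type is Euclidean; the C*-norm is the maximum.\<close>

definition max_norm :: "'a::real_normed_vector \<times> 'b::real_normed_vector \<Rightarrow> real"
  where "max_norm x = max (norm (fst x)) (norm (snd x))"

definition C_S2 :: "(ell2 cop \<Rightarrow> circle \<Rightarrow>\<^sub>C complex) \<Rightarrow> (ell2 cop \<times> ell2 cop) set"
  where "C_S2 \<sigma> = {(a0, a1). a0 \<in> Toeplitz \<and> a1 \<in> Toeplitz \<and> \<sigma> a0 = \<sigma> a1}"

definition Toeplitz_fibre :: "(ell2 cop \<Rightarrow> circle \<Rightarrow>\<^sub>C complex) \<Rightarrow> int \<Rightarrow> (ell2 cop \<times> ell2 cop) set"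
  where "Toeplitz_fibre \<sigma> N = {(a0, a1). a0 \<in> Toeplitz \<and> a1 \<in> Toeplitz \<and> U_pow N * \<sigma> a0 = \<sigma> a1}"

definition C_S3 :: "(ell2 cop \<Rightarrow> circle \<Rightarrow>\<^sub>C complex) \<Rightarrow>
    ((circle \<Rightarrow>\<^sub>C ell2 cop) \<times> (circle \<Rightarrow>\<^sub>C ell2 cop)) set"
  where "C_S3 \<sigma> = {(x1, x2). x1 \<in> Toeplitz_circle \<and> x2 \<in> Toeplitz_circle \<and>
    W_twist (symbol_tensor_id \<sigma> x1) = symbol_tensor_id \<sigma> x2}"

definition C_S3_coaction :: "(circle \<Rightarrow>\<^sub>C ell2 cop) \<times> (circle \<Rightarrow>\<^sub>C ell2 cop) \<Rightarrow>
    ((circle \<times> circle) \<Rightarrow>\<^sub>C ell2 cop) \<times> ((circle \<times> circle) \<Rightarrow>\<^sub>C ell2 cop)"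
  where "C_S3_coaction = map_prod id_tensor_coproduct id_tensor_coproduct"

definition C_S3_line :: "(ell2 cop \<Rightarrow> circle \<Rightarrow>\<^sub>C complex) \<Rightarrow> int \<Rightarrow>
    ((circle \<Rightarrow>\<^sub>C ell2 cop) \<times> (circle \<Rightarrow>\<^sub>C ell2 cop)) set"
  where "C_S3_line \<sigma> N = {x \<in> C_S3 \<sigma>.
    C_S3_coaction x = (tensor_circle (fst x) (U_pow N), tensor_circle (snd x) (U_pow N))}"

definition C_S3_action :: "ell2 cop \<times> ell2 cop \<Rightarrow>
    (circle \<Rightarrow>\<^sub>C ell2 cop) \<times> (circle \<Rightarrow>\<^sub>C ell2 cop) \<Rightarrow> (circle \<Rightarrow>\<^sub>C ell2 cop) \<times> (circle \<Rightarrow>\<^sub>C ell2 cop)"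
  where "C_S3_action b x = (tensor (fst b) 1, tensor (snd b) 1) * x"

text \<open>A set \<open>M\<close> is a left module over the unital algebra \<open>B\<close> under the action \<open>act\<close>.\<close>

definition left_module_on ::
    "'b::{complex_vector,monoid_mult} set \<Rightarrow> ('b \<Rightarrow> 'm::complex_vector \<Rightarrow> 'm) \<Rightarrow> 'm set \<Rightarrow> bool"
  where "left_module_on B act M \<longleftrightarrow>
    complex_vector.subspace M \<and>
    (\<forall>b\<in>B. \<forall>x\<in>M. act b x \<in> M) \<and>
    (\<forall>x\<in>M. act 1 x = x) \<and>
    (\<forall>b\<in>B. \<forall>b'\<in>B. \<forall>x\<in>M. act (b * b') x = act b (act b' x) \<and> act (b + b') x = act b x + act b' x) \<and>
    (\<forall>b\<in>B. \<forall>x\<in>M. \<forall>y\<in>M. act b (x + y) = act b x + act b y) \<and>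
    (\<forall>b\<in>B. \<forall>c. \<forall>x\<in>M. act (c *\<^sub>C b) x = c *\<^sub>C act b x \<and> act b (c *\<^sub>C x) = c *\<^sub>C act b x)"

definition left_module_isomorphic ::
    "'b::{complex_vector,monoid_mult} set \<Rightarrow>
      ('b \<Rightarrow> 'm::complex_vector \<Rightarrow> 'm) \<Rightarrow> 'm set \<Rightarrow> ('b \<Rightarrow> 'n::complex_vector \<Rightarrow> 'n) \<Rightarrow> 'n set \<Rightarrow> bool"
  where "left_module_isomorphic B act M act' M' \<longleftrightarrow>
    left_module_on B act M \<and> left_module_on B act' M' \<and>
    (\<exists>\<phi>. bij_betw \<phi> M M' \<and>
      (\<forall>x\<in>M. \<forall>y\<in>M. \<phi> (x + y) = \<phi> x + \<phi> y) \<and>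
      (\<forall>c. \<forall>x\<in>M. \<phi> (c *\<^sub>C x) = c *\<^sub>C \<phi> x) \<and>
      (\<forall>b\<in>B. \<forall>x\<in>M. \<phi> (act b x) = act' b (\<phi> x)))"


section \<open>Free *-algebras\<close>

text \<open>
  A letter \<open>(g, True)\<close> stands for the adjoint of the generator \<open>g\<close>.  Written additively, words
  form the monoid underlying the convolution product of \<open>'g word \<Rightarrow>\<^sub>0 complex\<close>, which is
  thus the free unital complex *-algebra on \<^typ>\<open>'g\<close>.
\<close>

datatype 'g word = Word (letters: "('g \<times> bool) list")

type_synonym 'g free_star_algebra = "'g word \<Rightarrow>\<^sub>0 complex"

instantiation word :: (type) "{monoid_add, star}"
begin

definition zero_word :: "'a word"
  where "zero_word = Word []"

definition plus_word :: "'a word \<Rightarrow> 'a word \<Rightarrow> 'a word"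
  where "plus_word v w = Word (letters v @ letters w)"

definition star_word :: "'a word \<Rightarrow> 'a word"
  where "star_word w = Word (rev (map (\<lambda>(g, b). (g, \<not> b)) (letters w)))"

instance
  by standard (simp_all add: zero_word_def plus_word_def)

end

text \<open>
  The group ring \<^typ>\<open>int \<Rightarrow>\<^sub>0 'a\<close> is \<open>A \<otimes> O(U(1))\<close>, with \<open>x \<otimes> U\<^sup>N\<close> being
  \<^term>\<open>Poly_Mapping.single (N::int) x\<close>; the involution of the exponent group accounts for
  \<open>(U\<^sup>N)\<^sup>* = U\<^sup>-\<^sup>N\<close>.
\<close>

instantiation int :: star
begin
definition star_int :: "int \<Rightarrow> int"
  where "star_int = uminus"
instance ..
end

instantiation poly_mapping :: (star, "{comm_monoid_add, star}") star
begin
definition star_poly_mapping :: "('a \<Rightarrow>\<^sub>0 'b) \<Rightarrow> 'a \<Rightarrow>\<^sub>0 'b"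
  where "star_poly_mapping P =
    (\<Sum>k\<in>Poly_Mapping.keys P. Poly_Mapping.single (star k) (star (Poly_Mapping.lookup P k)))"
instance ..
end

instantiation poly_mapping :: (type, complex_vector) complex_vector
begin

lift_definition scaleC_poly_mapping :: "complex \<Rightarrow> ('a \<Rightarrow>\<^sub>0 'b) \<Rightarrow> 'a \<Rightarrow>\<^sub>0 'b" is "\<lambda>c f k. c *\<^sub>C f k"
proof -
  fix c and f :: "'a \<Rightarrow> 'b"
  assume "finite {k. f k \<noteq> 0}"
  then show "finite {k. c *\<^sub>C f k \<noteq> 0}"
    by (rule rev_finite_subset) (auto simp: complex_vector.scale_zero_right)
qed

instance
  by standard (transfer, simp add: scaleC_add_right scaleC_add_left scaleC_scaleC scaleC_one)+

end

definition free_gen :: "'g \<Rightarrow> 'g free_star_algebra"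
  where "free_gen g = Poly_Mapping.single (Word [(g, False)]) 1"

text \<open>The unital *-homomorphism on the free *-algebra extending \<open>v\<close> on the generators.\<close>

definition star_eval :: "('g \<Rightarrow> 'r::{complex_vector,monoid_mult,star}) \<Rightarrow> 'g free_star_algebra \<Rightarrow> 'r"
  where "star_eval v P = (\<Sum>w\<in>Poly_Mapping.keys P. Poly_Mapping.lookup P w *\<^sub>C
    prod_list (map (\<lambda>(g, b). if b then star (v g) else v g) (letters w)))"

inductive_set star_ideal :: "'r::{ring_1,star} set \<Rightarrow> 'r set" for R :: "'r set" where
  base: "x \<in> R \<Longrightarrow> x \<in> star_ideal R"
| zero: "0 \<in> star_ideal R"
| add: "x \<in> star_ideal R \<Longrightarrow> y \<in> star_ideal R \<Longrightarrow> x + y \<in> star_ideal R"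
| mult_left: "x \<in> star_ideal R \<Longrightarrow> r * x \<in> star_ideal R"
| mult_right: "x \<in> star_ideal R \<Longrightarrow> x * r \<in> star_ideal R"
| star: "x \<in> star_ideal R \<Longrightarrow> star x \<in> star_ideal R"


section \<open>The coordinate algebra of the quantum 3-sphere\<close>

datatype S3_gen = Gen_a | Gen_b

type_synonym S3_free = "S3_gen free_star_algebra"

definition S3_relations :: "real \<Rightarrow> real \<Rightarrow> S3_free set"
  where "S3_relations p q = (let a = free_gen Gen_a; b = free_gen Gen_b in
    {star a * a - complex_of_real q *\<^sub>C (a * star a) - complex_of_real (1 - q) *\<^sub>C 1,
     star b * b - complex_of_real p *\<^sub>C (b * star b) - complex_of_real (1 - p) *\<^sub>C 1,
     (1 - a * star a) * (1 - b * star b),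
     a * b - b * a,
     star a * b - b * star a})"

text \<open>
  \<open>O(S\<^sup>3\<^sub>p\<^sub>q)\<close> is the quotient of the free *-algebra by the *-ideal of the relations.  Its elements
  are cosets, with \<open>S3_class p q f\<close> the class of \<open>f\<close>; operations are those of representatives.
\<close>

definition S3_rel :: "real \<Rightarrow> real \<Rightarrow> (S3_free \<times> S3_free) set"
  where "S3_rel p q = {(f, g). f - g \<in> star_ideal (S3_relations p q)}"

definition O_S3 :: "real \<Rightarrow> real \<Rightarrow> S3_free set set"
  where "O_S3 p q = UNIV // S3_rel p q"

definition S3_class :: "real \<Rightarrow> real \<Rightarrow> S3_free \<Rightarrow> S3_free set"
  where "S3_class p q f = S3_rel p q `` {f}"

definition O_S3_star_hom :: "real \<Rightarrow> real \<Rightarrow>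
    (S3_free set \<Rightarrow> 'r::{complex_vector,monoid_mult,star}) \<Rightarrow> bool"
  where "O_S3_star_hom p q h \<longleftrightarrow>
    (\<forall>f g. h (S3_class p q (f + g)) = h (S3_class p q f) + h (S3_class p q g)) \<and>
    (\<forall>f g. h (S3_class p q (f * g)) = h (S3_class p q f) * h (S3_class p q g)) \<and>
    (\<forall>c f. h (S3_class p q (c *\<^sub>C f)) = c *\<^sub>C h (S3_class p q f)) \<and>
    (\<forall>f. h (S3_class p q (star f)) = star (h (S3_class p q f))) \<and>
    h (S3_class p q 1) = 1"

text \<open>
  The homomorphism \<open>a \<mapsto> a \<otimes> U\<^sup>*, b \<mapsto> b \<otimes> U\<close> on the free algebra descends to the coaction of
  \<open>O(U(1))\<close> on \<open>O(S\<^sup>3\<^sub>p\<^sub>q)\<close>.  An element of \<open>O(S\<^sup>3\<^sub>p\<^sub>q) \<otimes> O(U(1))\<close> is given by the function that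
  assigns to \<open>k\<close> the coefficient in \<open>O(S\<^sup>3\<^sub>p\<^sub>q)\<close> of \<open>U\<^sup>k\<close>.
\<close>

definition S3_free_coaction :: "S3_free \<Rightarrow> int \<Rightarrow>\<^sub>0 S3_free"
  where "S3_free_coaction = star_eval (\<lambda>g. case g of
      Gen_a \<Rightarrow> Poly_Mapping.single (-1) (free_gen Gen_a)
    | Gen_b \<Rightarrow> Poly_Mapping.single 1 (free_gen Gen_b))"

definition O_S3_coaction :: "real \<Rightarrow> real \<Rightarrow> S3_free set \<Rightarrow> int \<Rightarrow> S3_free set"
  where "O_S3_coaction p q X =
    the_elem ((\<lambda>f k. S3_class p q (Poly_Mapping.lookup (S3_free_coaction f) k)) ` X)"

definition O_S3_tensor_U :: "real \<Rightarrow> real \<Rightarrow> S3_free set \<Rightarrow> int \<Rightarrow> int \<Rightarrow> S3_free set"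
  where "O_S3_tensor_U p q X N = (\<lambda>k. if k = N then X else S3_class p q 0)"

definition L_S3 :: "real \<Rightarrow> real \<Rightarrow> int \<Rightarrow> S3_free set set"
  where "L_S3 p q N = {X \<in> O_S3 p q. O_S3_coaction p q X = O_S3_tensor_U p q X N}"

definition iota :: "real \<Rightarrow> real \<Rightarrow> S3_free set \<Rightarrow> (circle \<Rightarrow>\<^sub>C ell2 cop) \<times> (circle \<Rightarrow>\<^sub>C ell2 cop)"
  where "iota p q X = the_elem (star_eval (\<lambda>g. case g of
      Gen_a \<Rightarrow> (tensor (disc_gen q) (U_pow (-1)), tensor 1 (U_pow (-1)))
    | Gen_b \<Rightarrow> (tensor 1 (U_pow 1), tensor (disc_gen p) (U_pow 1))) ` X)"


section \<open>The universal C*-algebra\<close>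

text \<open>
  A representation on a Hilbert space is a unital *-homomorphism into its bounded operators.
  As \<open>O(S\<^sup>3\<^sub>p\<^sub>q)\<close> has countable dimension, its cyclic representations are on separable spaces, so
  that representations on \<^typ>\<open>ell2\<close> suffice for the supremum defining the universal norm.
\<close>

definition universal_norm :: "real \<Rightarrow> real \<Rightarrow> S3_free set \<Rightarrow> real"
  where "universal_norm p q X =
    (SUP \<rho>\<in>{\<rho> :: S3_free set \<Rightarrow> ell2 cop. O_S3_star_hom p q \<rho>}. norm (\<rho> X))"

text \<open>
  \<open>C\<close> with norm \<open>nrm\<close>, a closed subset of the ambient complete algebra, is via \<open>i\<close> the completion
  of \<open>O(S\<^sup>3\<^sub>p\<^sub>q)\<close> in the universal norm, which is the supremum over the representations on all
  Hilbert spaces: a bound for those on the arbitrary Hilbert space \<open>'h\<close> is part of the condition.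
\<close>

definition universal_Cstar_algebra :: "'h::complex_hilbert itself \<Rightarrow> real \<Rightarrow> real \<Rightarrow>
    'r::{complex_vector,monoid_mult,star,topological_space} set \<Rightarrow> ('r \<Rightarrow> real) \<Rightarrow> (S3_free set \<Rightarrow> 'r) \<Rightarrow> bool"
  where "universal_Cstar_algebra _ p q C nrm i \<longleftrightarrow>
    O_S3_star_hom p q i \<and> inj_on i (O_S3 p q) \<and> closure (i ` O_S3 p q) = C \<and>
    (\<forall>X\<in>O_S3 p q. nrm (i X) = universal_norm p q X) \<and>
    (\<forall>\<rho> :: S3_free set \<Rightarrow> 'h cop. O_S3_star_hom p q \<rho> \<longrightarrow>
      (\<forall>X\<in>O_S3 p q. norm (\<rho> X) \<le> universal_norm p q X))"

end

theory Submission
  imports Defs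
begin

text \<open>
  \<^bold>\<open>The universal norm.\<close>  Let \<open>A\<close> and \<open>B\<close> be operators on a Hilbert space that satisfy the
  relations of \<open>a\<close> and \<open>b\<close>, with defects \<open>D = 1 - A A\<^sup>*\<close> and \<open>E = 1 - B B\<^sup>*\<close>.  Since \<open>D E = 0\<close>, the
  orthogonal complement of \<open>ker D\<close> lies in \<open>ker E\<close>, and both subspaces reduce \<open>A\<close> and \<open>B\<close>; so it
  suffices to bound a *-polynomial \<open>f(A, B)\<close> on each kernel.  On \<open>ker D\<close> the operator \<open>A\<close> is unitary
  and commutes with \<open>B\<close> and \<open>B\<^sup>*\<close>.  Two estimates then lead to the norm of \<open>\<iota>(f)\<close>.

  First, a commuting unitary may be replaced by scalars of modulus one
  (\<open>norm_star_eval_le_scalars\<close>).  Along the orbit \<open>V\<^sup>n \<xi>\<close>, \<open>0 \<le> n < R\<close>, the polynomial acts as a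
  convolution up to boundedly many boundary terms, and by Parseval's identity over roots of unity a
  convolution is bounded by the maximum of its Fourier transform.

  Secondly, any operator \<open>B\<close> with \<open>B\<^sup>*B = r B B\<^sup>* + 1 - r\<close> may be replaced by the weighted shift on the
  square summable sequences (\<open>norm_star_eval_le_disc_gen\<close>).  By an analogue of the Wold
  decomposition the space is the sum of \<open>ker E\<close>, where \<open>B\<close> is unitary, and of the closed span of the
  vectors \<open>B\<^sup>n k\<close> with \<open>k \<in> ker B\<^sup>*\<close>, where \<open>B\<close> is a multiple of the weighted shift.  The unitary part
  is again replaced by scalars, and a scalar evaluation is a character of the Toeplitz algebra,
  given by the symbol, so that it does not exceed the norm.  Conversely, evaluating \<open>\<iota>\<close> at
  the points of the circle gives representations on the sequence space, so the bound is attained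
  (\<open>universal_norm_eq\<close>).

  \<^bold>\<open>Injectivity.\<close>  The relations bring every element of the coordinate algebra to a combination of
  the monomials \<open>a\<^sup>(\<^sup>k\<^sup>) D\<^sup>n b\<^sup>(\<^sup>l\<^sup>) E\<^sup>m\<close> with \<open>n = 0\<close> or \<open>m = 0\<close>, where negative exponents \<open>k\<close>, \<open>l\<close> stand for
  powers of the adjoint.  In the first component of \<open>\<iota>\<close> only the terms with \<open>m = 0\<close> survive.  A
  matrix coefficient between basis vectors isolates \<open>k\<close>, comparing Fourier coefficients isolates
  \<open>l\<close>, and what is left is a polynomial in \<open>q\<^sup>j\<close> that vanishes for all large \<open>j\<close>.  The second component
  treats the terms with \<open>n = 0\<close> in the same way (\<open>inj_on_iota\<close>).

  \<^bold>\<open>Density.\<close>  The closure of the image contains the powers of \<open>D\<close>, hence their limit, a rank one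
  projection in the first component, and therefore all \<open>(e\<^sub>i\<^sub>j \<otimes> U\<^sup>m, 0)\<close>; likewise \<open>(0, e\<^sub>i\<^sub>j \<otimes> U\<^sup>m)\<close>.  As
  the weighted shift differs from the unilateral shift by a limit of combinations of matrix units,
  the closure contains \<open>(T\<^sub>k \<otimes> U\<^sup>m, T\<^sub>k\<^sub>+\<^sub>m \<otimes> U\<^sup>m)\<close> for the Toeplitz operators \<open>T\<^sub>k\<close> with symbol \<open>U\<^sup>k\<close>.
  Given a pair in the fibre product, approximate both components by combinations of \<open>T\<^sub>k \<otimes> U\<^sup>m\<close> and
  \<open>e\<^sub>i\<^sub>j \<otimes> U\<^sup>m\<close>.  The symbols of the two Toeplitz parts nearly match, and since a Toeplitz operator is
  bounded by its symbol, the second part can be corrected at small cost to match exactly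
  (\<open>C_S3_subset_closure\<close>).

  \<^bold>\<open>Line bundles.\<close>  An element \<open>x\<close> of degree \<open>N\<close> satisfies \<open>x(u v) = v\<^sup>N x(u)\<close>, so it is \<open>U\<^sup>N\<close> times its
  value at \<open>1\<close>, and evaluation at \<open>1\<close> is the isomorphism (\<open>line_bundle_isomorphic\<close>).
\<close>

section \<open>Geometry of complex Hilbert spaces\<close>

lemma cinner_add_left: "cinner (x + y) z = cinner x z + cinner y z"
  by (metis cinner_add_right cinner_commute complex_cnj_add)

lemma cinner_scaleC_left: "cinner (c *\<^sub>C x) y = cnj c * cinner x y"
  by (metis cinner_commute cinner_scaleC_right complex_cnj_mult)

lemma cinner_zero_right [simp]: "cinner x 0 = 0"
  using cinner_add_right[of x 0 0] by simp

lemma cinner_zero_left [simp]: "cinner 0 x = 0"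
  using cinner_add_left[of 0 0 x] by simp

lemma cinner_minus_right: "cinner x (- y) = - cinner x y"
  using cinner_add_right[of x y "- y"] by (simp add: eq_neg_iff_add_eq_0 add.commute)

lemma cinner_minus_left: "cinner (- x) y = - cinner x y"
  using cinner_add_left[of x "- x" y] by (simp add: eq_neg_iff_add_eq_0 add.commute)

lemma cinner_diff_right: "cinner x (y - z) = cinner x y - cinner x z"
  using cinner_add_right[of x y "- z"] by (simp add: cinner_minus_right)

lemma cinner_diff_left: "cinner (x - y) z = cinner x z - cinner y z"
  using cinner_add_left[of x "- y" z] by (simp add: cinner_minus_left)

lemma cinner_sum_right: "cinner x (sum f I) = (\<Sum>i\<in>I. cinner x (f i))"
  by (induction I rule: infinite_finite_induct) (simp_all add: cinner_add_right)

lemma cinner_sum_left: "cinner (sum f I) x = (\<Sum>i\<in>I. cinner (f i) x)"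
  by (induction I rule: infinite_finite_induct) (simp_all add: cinner_add_left)

lemmas cinner_simps = cinner_add_left cinner_add_right cinner_scaleC_left cinner_scaleC_right
  cinner_minus_left cinner_minus_right cinner_diff_left cinner_diff_right

lemma cinner_eq_zero_commute: "cinner x y = 0 \<longleftrightarrow> cinner y x = 0"
  by (metis cinner_commute complex_cnj_zero)

lemma norm_sq_eq_Re_cinner: "(norm x)\<^sup>2 = Re (cinner x x)"
  by (simp add: cinner_self)

lemma cinner_self_eq_zero [simp]: "cinner x x = 0 \<longleftrightarrow> x = 0"
  by (simp add: cinner_self)

lemma norm_add_sq: "(norm (x + y))\<^sup>2 = (norm x)\<^sup>2 + 2 * Re (cinner x y) + (norm y)\<^sup>2"
proof -
  have "Re (cinner y x) = Re (cinner x y)" by (metis cinner_commute complex_cnj_cancel_iff cnj.simps(1))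
  then show ?thesis unfolding norm_sq_eq_Re_cinner by (simp add: cinner_simps)
qed

lemma norm_diff_sq: "(norm (x - y))\<^sup>2 = (norm x)\<^sup>2 - 2 * Re (cinner x y) + (norm y)\<^sup>2"
  using norm_add_sq[of x "- y"] by (simp add: cinner_minus_right)

lemma pythagoras: "cinner x y = 0 \<Longrightarrow> (norm (x + y))\<^sup>2 = (norm x)\<^sup>2 + (norm y)\<^sup>2"
  by (simp add: norm_add_sq)

lemma pythagoras_sum:
  assumes "finite I" "\<And>i j. i \<in> I \<Longrightarrow> j \<in> I \<Longrightarrow> i \<noteq> j \<Longrightarrow> cinner (f i) (f j) = 0"
  shows "(norm (\<Sum>i\<in>I. f i))\<^sup>2 = (\<Sum>i\<in>I. (norm (f i))\<^sup>2)"
  using assms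
proof (induction I rule: finite_induct)
  case (insert i I)
  have "cinner (f i) (\<Sum>i\<in>I. f i) = 0"
    unfolding cinner_sum_right using insert.hyps insert.prems by (intro sum.neutral) auto
  then show ?case using insert by (simp add: pythagoras)
qed simp

lemma cauchy_schwarz: "cmod (cinner x y) \<le> norm x * norm y"
proof (cases "y = 0")
  case False
  then have ny: "norm y > 0" by simp
  define c where "c = cinner y x / complex_of_real ((norm y)\<^sup>2)"
  have "cinner y (x - c *\<^sub>C y) = 0"
    using ny by (simp add: cinner_simps cinner_self c_def)
  then have orth: "cinner (x - c *\<^sub>C y) (c *\<^sub>C y) = 0"
    by (simp add: cinner_scaleC_right cinner_eq_zero_commute)
  have "(norm x)\<^sup>2 = (norm (x - c *\<^sub>C y))\<^sup>2 + (norm (c *\<^sub>C y))\<^sup>2"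
    using pythagoras[OF orth] by simp
  then have "(norm (c *\<^sub>C y))\<^sup>2 \<le> (norm x)\<^sup>2" by simp
  then have "norm (c *\<^sub>C y) \<le> norm x" by (rule power2_le_imp_le) simp
  then have "cmod c * norm y \<le> norm x" by (simp add: norm_scaleC)
  moreover have "cmod c = cmod (cinner y x) / (norm y)\<^sup>2"
    by (simp add: c_def norm_divide norm_power)
  ultimately have "cmod (cinner y x) \<le> norm x * norm y"
    using ny by (simp add: field_simps power2_eq_square)
  then show ?thesis by (metis cinner_commute complex_mod_cnj)
qed simp

lemma bounded_linear_cinner_right: "bounded_linear (\<lambda>y. cinner x y)"
  by (rule bounded_linear_intro[where K = "norm x"])
    (simp_all add: cinner_simps scaleR_scaleC scaleC_complex_def cauchy_schwarz mult.commute[of _ "norm x"])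

lemma closed_orthogonal: "closed {y. cinner x y = 0}"
  by (intro closed_Collect_eq continuous_on_const
      linear_continuous_on bounded_linear_cinner_right)

lemma parallelogram: "(norm (x - y))\<^sup>2 + (norm (x + y))\<^sup>2 = 2 * (norm x)\<^sup>2 + 2 * (norm y)\<^sup>2"
  for x y :: "'h::complex_hilbert"
  by (simp add: norm_add_sq norm_diff_sq)

text \<open>
  A minimising sequence for the distance from \<open>x\<close> to \<open>S\<close> is Cauchy by the parallelogram law;
  its limit is the foot of the perpendicular, since moving from it within \<open>S\<close> cannot decrease the
  distance.
\<close>

theorem orthogonal_projection_exists:
  fixes S :: "'h::complex_hilbert set"
  assumes sub: "complex_vector.subspace S" and cl: "closed S"
  obtains m where "m \<in> S" "\<And>s. s \<in> S \<Longrightarrow> cinner s (x - m) = 0"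
proof -
  have S0: "0 \<in> S" and Sadd: "\<And>s t. s \<in> S \<Longrightarrow> t \<in> S \<Longrightarrow> s + t \<in> S"
    and Ssc: "\<And>c s. s \<in> S \<Longrightarrow> c *\<^sub>C s \<in> S"
    using sub by (auto simp: complex_vector.subspace_def)
  define d where "d = (INF s\<in>S. (norm (x - s))\<^sup>2)"
  have bb: "bdd_below ((\<lambda>s. (norm (x - s))\<^sup>2) ` S)" by (rule bdd_belowI[of _ 0]) auto
  have dle: "d \<le> (norm (x - s))\<^sup>2" if "s \<in> S" for s
    unfolding d_def using that by (intro cINF_lower bb)
  have "\<exists>s\<in>S. (norm (x - s))\<^sup>2 < d + inverse (Suc n)" for n
  proof -
    have "d < d + inverse (real (Suc n))" by simp
    then show ?thesis unfolding d_def using S0 by (subst (asm) cINF_less_iff) (auto simp: bb)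
  qed
  then obtain s where sS: "\<And>n. s n \<in> S" and sd: "\<And>n. (norm (x - s n))\<^sup>2 < d + inverse (Suc n)"
    by metis
  have key: "(norm (s m - s n))\<^sup>2 \<le> 2 * inverse (Suc m) + 2 * inverse (Suc n)" for m n
  proof -
    have "(1/2) *\<^sub>C (s m + s n) \<in> S" by (intro Ssc Sadd sS)
    then have h: "(1/2) *\<^sub>R (s m + s n) \<in> S" by (simp add: scaleR_scaleC)
    have "(x - s m) + (x - s n) = 2 *\<^sub>R (x - (1/2) *\<^sub>R (s m + s n))"
      by (simp add: algebra_simps scaleR_2)
    then have "norm ((x - s m) + (x - s n)) = 2 * norm (x - (1/2) *\<^sub>R (s m + s n))"
      by (metis abs_numeral norm_scaleR)
    then have "(norm ((x - s m) + (x - s n)))\<^sup>2 = 4 * (norm (x - (1/2) *\<^sub>R (s m + s n)))\<^sup>2"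
      by (simp add: power_mult_distrib)
    then have "(norm ((x - s m) + (x - s n)))\<^sup>2 \<ge> 4 * d" using dle[OF h] by simp
    moreover have "(norm ((x - s m) - (x - s n)))\<^sup>2 + (norm ((x - s m) + (x - s n)))\<^sup>2 =
        2 * (norm (x - s m))\<^sup>2 + 2 * (norm (x - s n))\<^sup>2"
      by (rule parallelogram)
    moreover have "norm ((x - s m) - (x - s n)) = norm (s m - s n)"
      by (simp add: norm_minus_commute)
    ultimately show ?thesis using sd[of m] sd[of n] by simp
  qed
  have "Cauchy s"
  proof (rule metric_CauchyI)
    fix e :: real assume e: "0 < e"
    obtain N where N: "inverse (real (Suc N)) < e\<^sup>2 / 4"
      using e reals_Archimedean[of "e\<^sup>2/4"] by auto
    have "dist (s m) (s n) < e" if "m \<ge> N" "n \<ge> N" for m n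
    proof -
      have "inverse (real (Suc m)) \<le> inverse (Suc N)" "inverse (real (Suc n)) \<le> inverse (Suc N)"
        using that by (simp_all)
      then have "(norm (s m - s n))\<^sup>2 < e\<^sup>2" using key[of m n] N by linarith
      then show ?thesis using e by (simp add: dist_norm power2_less_imp_less)
    qed
    then show "\<exists>M. \<forall>m\<ge>M. \<forall>n\<ge>M. dist (s m) (s n) < e" by blast
  qed
  then obtain m where lim: "s \<longlonglongrightarrow> m" by (auto simp: Cauchy_convergent_iff convergent_def)
  have mS: "m \<in> S" using closed_sequentially[OF cl _ lim] sS by blast
  have md: "(norm (x - m))\<^sup>2 \<le> d"
  proof (rule LIMSEQ_le)
    show "(\<lambda>n. (norm (x - s n))\<^sup>2) \<longlonglongrightarrow> (norm (x - m))\<^sup>2" by (intro tendsto_intros lim)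
    show "(\<lambda>n. d + inverse (real (Suc n))) \<longlonglongrightarrow> d" by (rule LIMSEQ_inverse_real_of_nat_add)
    show "\<exists>N. \<forall>n\<ge>N. (norm (x - s n))\<^sup>2 \<le> d + inverse (real (Suc n))" using sd less_imp_le by blast
  qed
  have "cinner t (x - m) = 0" if t: "t \<in> S" for t
  proof (cases "t = 0")
    case False
    define c where "c = cinner t (x - m) / complex_of_real ((norm t)\<^sup>2)"
    define y where "y = x - m - c *\<^sub>C t"
    have "cinner t y = 0"
      using False by (simp add: y_def cinner_simps cinner_self c_def)
    then have o: "cinner y (c *\<^sub>C t) = 0" by (simp add: cinner_scaleC_right cinner_eq_zero_commute)
    have "(norm (x - m))\<^sup>2 = (norm y)\<^sup>2 + (norm (c *\<^sub>C t))\<^sup>2"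
      using pythagoras[OF o] by (simp add: y_def)
    moreover have "d \<le> (norm y)\<^sup>2"
      using dle[OF Sadd[OF mS Ssc[OF t, of c]]] by (simp add: y_def algebra_simps)
    ultimately have "(norm (c *\<^sub>C t))\<^sup>2 \<le> 0" using md by linarith
    then have "c = 0" using False by (simp add: norm_scaleC)
    then show ?thesis using False by (simp add: c_def)
  qed simp
  with mS that show ?thesis by blast
qed

text \<open>
  If \<open>\<phi> \<noteq> 0\<close>, the vector representing it spans the orthogonal complement of the closed subspace \<open>ker \<phi>\<close>.
\<close>

theorem riesz_representation:
  fixes \<phi> :: "'h::complex_hilbert \<Rightarrow> complex"
  assumes bl: "bounded_linear \<phi>" and sc: "\<And>c x. \<phi> (c *\<^sub>C x) = c * \<phi> x"
  obtains z where "\<And>x. \<phi> x = cinner z x"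
proof (cases "\<forall>x. \<phi> x = 0")
  case True
  then show ?thesis using that[of 0] by simp
next
  case False
  then obtain x where x: "\<phi> x \<noteq> 0" by blast
  interpret bounded_linear \<phi> by (rule bl)
  have "complex_vector.subspace {y. \<phi> y = 0}"
    by (auto simp: complex_vector.subspace_def add sc zero)
  moreover have "closed {y. \<phi> y = 0}"
    by (intro closed_Collect_eq continuous_on_const linear_continuous_on bl)
  ultimately obtain m where m: "\<phi> m = 0" "\<And>s. \<phi> s = 0 \<Longrightarrow> cinner s (x - m) = 0"
    by (rule orthogonal_projection_exists[where x = x]) auto
  define w where "w = x - m"
  have pw: "\<phi> w = \<phi> x" using m(1) by (simp add: w_def diff)
  then have w0: "w \<noteq> 0" using x zero by auto
  define z where "z = cnj (\<phi> w / complex_of_real ((norm w)\<^sup>2)) *\<^sub>C w"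
  have "\<phi> y = cinner z y" for y
  proof -
    have "\<phi> (y - (\<phi> y / \<phi> w) *\<^sub>C w) = 0" using x pw by (simp add: diff sc)
    from m(2)[OF this] have "cinner w (y - (\<phi> y / \<phi> w) *\<^sub>C w) = 0"
      by (simp add: w_def cinner_eq_zero_commute)
    then have "cinner w y = (\<phi> y / \<phi> w) * complex_of_real ((norm w)\<^sup>2)"
      by (simp add: cinner_simps cinner_self)
    then show ?thesis using x pw w0 by (simp add: z_def cinner_scaleC_left)
  qed
  then show ?thesis by (rule that)
qed

section \<open>The *-algebra of bounded operators\<close>

lemma cop_apply_bounded_linear: "bounded_linear (cop_apply A)"
  unfolding cop_apply_def by (rule blinfun.bounded_linear_right)

lemma cop_apply_add: "cop_apply A (x + y) = cop_apply A x + cop_apply A y"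
  by (simp add: cop_apply_def blinfun.add_right)

lemma cop_apply_diff: "cop_apply A (x - y) = cop_apply A x - cop_apply A y"
  by (simp add: cop_apply_def blinfun.diff_right)

lemma cop_apply_minus: "cop_apply A (- x) = - cop_apply A x"
  by (simp add: cop_apply_def blinfun.minus_right)

lemma cop_apply_zero [simp]: "cop_apply A 0 = 0"
  by (simp add: cop_apply_def)

lemma cop_apply_scaleC: "cop_apply A (c *\<^sub>C x) = c *\<^sub>C cop_apply A x"
  using Rep_cop[of A] by (simp add: cop_apply_def)

lemma cop_apply_sum: "cop_apply A (sum f I) = (\<Sum>i\<in>I. cop_apply A (f i))"
  by (induction I rule: infinite_finite_induct) (simp_all add: cop_apply_add)

lemma times_cop_apply: "cop_apply (A * B) x = cop_apply A (cop_apply B x)"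
  by (simp add: cop_apply_def times_cop.rep_eq)

lemma one_cop_apply [simp]: "cop_apply 1 x = x"
  by (simp add: cop_apply_def one_cop.rep_eq)

lemma zero_cop_apply [simp]: "cop_apply 0 x = 0"
  by (simp add: cop_apply_def zero_cop.rep_eq)

lemma minus_cop_apply: "cop_apply (A - B) x = cop_apply A x - cop_apply B x"
  by (simp add: cop_apply_def minus_cop.rep_eq blinfun.diff_left)

lemma uminus_cop_apply: "cop_apply (- A) x = - cop_apply A x"
  by (simp add: cop_apply_def uminus_cop.rep_eq blinfun.minus_left)

lemma sum_cop_apply: "cop_apply (sum F I) x = (\<Sum>i\<in>I. cop_apply (F i) x)"
  by (induction I rule: infinite_finite_induct) (simp_all add: cop_apply_plus)

lemmas cop_simps = cop_apply_plus times_cop_apply minus_cop_apply uminus_cop_apply scaleC_cop_apply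
lemmas cop_linear = cop_apply_add cop_apply_diff cop_apply_minus cop_apply_scaleC

lemma norm_cop_apply: "norm (cop_apply A x) \<le> norm A * norm x"
  by (simp add: cop_apply_def norm_cop.rep_eq norm_blinfun)

lemma norm_cop_bound:
  assumes "0 \<le> b" "\<And>x. norm (cop_apply A x) \<le> b * norm x"
  shows "norm A \<le> b"
  unfolding norm_cop.rep_eq using assms by (intro norm_blinfun_bound) (simp_all add: cop_apply_def)

lemma scaleC_times_left: "(c *\<^sub>C A) * B = c *\<^sub>C (A * B)" for A :: "'h::complex_normed_vector cop"
  by (rule cop_eqI) (simp add: cop_simps)

lemma scaleC_times_right: "A * (c *\<^sub>C B) = c *\<^sub>C (A * B)" for A :: "'h::complex_normed_vector cop"
  by (rule cop_eqI) (simp add: cop_simps cop_linear)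

lemma cop_of_function:
  fixes f :: "'h::complex_normed_vector \<Rightarrow> 'h"
  assumes "\<And>x y. f (x + y) = f x + f y" "\<And>c x. f (c *\<^sub>C x) = c *\<^sub>C f x"
    "\<And>x. norm (f x) \<le> norm x * K"
  obtains A where "\<And>x. cop_apply A x = f x"
proof -
  have bl: "bounded_linear f"
    by (rule bounded_linear_intro[where K = K]) (simp_all add: assms scaleR_scaleC)
  have "cop_apply (Abs_cop (Blinfun f)) x = f x" for x
    unfolding cop_apply_def
    by (subst Abs_cop_inverse) (simp_all add: bounded_linear_Blinfun_apply[OF bl] assms)
  then show ?thesis by (rule that)
qed

lemma cinner_eqI:
  assumes "\<And>x. cinner x y = cinner x z"
  shows "y = z"
proof -
  have "cinner (y - z) (y - z) = 0" by (simp only: cinner_diff_right assms diff_self)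
  then show ?thesis by simp
qed

lemma star_cop_eqI:
  fixes A B :: "'h::complex_hilbert cop"
  assumes "\<And>x y. cinner (cop_apply A x) y = cinner x (cop_apply B y)"
  shows "star A = B"
  unfolding star_cop_def
proof (rule the_equality)
  fix C assume C: "\<forall>x y. cinner (cop_apply A x) y = cinner x (cop_apply C y)"
  show "C = B"
  proof (rule cop_eqI, rule cinner_eqI)
    fix x y
    show "cinner y (cop_apply C x) = cinner y (cop_apply B x)"
      using C assms[of y x] by metis
  qed
qed (use assms in blast)

text \<open>
  The definite description that defines \<open>star\<close> denotes the adjoint, which exists by Riesz'
  representation theorem; its bound comes from \<open>\<parallel>A\<^sup>*x\<parallel>\<^sup>2 = \<langle>A A\<^sup>*x, x\<rangle>\<close>.
\<close>

theorem cinner_star_right: "cinner x (cop_apply (star A) y) = cinner (cop_apply A x) y"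
  for A :: "'h::complex_hilbert cop"
proof -
  have "\<exists>z. \<forall>x. cinner y (cop_apply A x) = cinner z x" for y
    by (rule riesz_representation[of "\<lambda>x. cinner y (cop_apply A x)"])
      (auto intro: bounded_linear_compose[OF bounded_linear_cinner_right cop_apply_bounded_linear]
        simp: cinner_simps cop_linear)
  then obtain f where f: "\<And>y x. cinner y (cop_apply A x) = cinner (f y) x" by metis
  have f': "cinner (cop_apply A x) y = cinner x (f y)" for x y
    by (metis f cinner_commute)
  obtain B where B: "\<And>y. cop_apply B y = f y"
  proof (rule cop_of_function[of f "norm A"])
    fix x y :: 'h and c
    show "f (x + y) = f x + f y" "f (c *\<^sub>C x) = c *\<^sub>C f x"
      by (rule cinner_eqI, simp add: cinner_simps flip: f')+
    have "(norm (f x))\<^sup>2 = Re (cinner (cop_apply A (f x)) x)"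
      by (simp add: norm_sq_eq_Re_cinner f')
    also have "\<dots> \<le> norm (cop_apply A (f x)) * norm x"
      using complex_Re_le_cmod cauchy_schwarz order_trans by blast
    also have "\<dots> \<le> norm A * norm (f x) * norm x"
      by (intro mult_right_mono norm_cop_apply) simp
    finally have "norm (f x) * norm (f x) \<le> (norm x * norm A) * norm (f x)"
      by (simp add: power2_eq_square mult.commute mult.left_commute)
    then show "norm (f x) \<le> norm x * norm A"
      by (cases "norm (f x) = 0") (auto simp: mult_le_cancel_right)
  qed blast
  have "star A = B" by (rule star_cop_eqI) (simp add: B f')
  then show ?thesis by (simp add: B f')
qed

lemma cinner_star_left: "cinner (cop_apply (star A) x) y = cinner x (cop_apply A y)"
  for A :: "'h::complex_hilbert cop"
  by (metis cinner_commute cinner_star_right)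

lemma star_star_cop [simp]: "star (star A) = A" for A :: "'h::complex_hilbert cop"
  by (rule star_cop_eqI) (rule cinner_star_left)

lemma star_times_cop: "star (A * B) = star B * star A" for A B :: "'h::complex_hilbert cop"
  by (rule star_cop_eqI) (simp add: cop_simps cinner_star_right)

lemma star_plus_cop: "star (A + B) = star A + star B" for A B :: "'h::complex_hilbert cop"
  by (rule star_cop_eqI) (simp add: cop_simps cinner_simps cinner_star_right)

lemma star_diff_cop: "star (A - B) = star A - star B" for A B :: "'h::complex_hilbert cop"
  by (rule star_cop_eqI) (simp add: cop_simps cinner_simps cinner_star_right)

lemma star_scaleC_cop: "star (c *\<^sub>C A) = cnj c *\<^sub>C star A" for A :: "'h::complex_hilbert cop"
  by (rule star_cop_eqI) (simp add: cop_simps cinner_simps cinner_star_right)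

lemma star_one_cop [simp]: "star (1 :: 'h::complex_hilbert cop) = 1"
  by (rule star_cop_eqI) simp

lemma star_zero_cop [simp]: "star (0 :: 'h::complex_hilbert cop) = 0"
  by (rule star_cop_eqI) simp

lemma star_power_cop: "star (A ^ n) = star A ^ n" for A :: "'h::complex_hilbert cop"
  by (induction n) (simp_all add: star_times_cop power_commutes)

lemma norm_star_cop [simp]: "norm (star A) = norm A" for A :: "'h::complex_hilbert cop"
proof -
  have le: "norm (star A) \<le> norm A" for A :: "'h cop"
  proof (rule norm_cop_bound)
    fix x
    let ?y = "cop_apply (star A) x"
    have "(norm ?y)\<^sup>2 = Re (cinner (cop_apply A ?y) x)"
      by (simp add: norm_sq_eq_Re_cinner cinner_star_right)
    also have "\<dots> \<le> norm (cop_apply A ?y) * norm x"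
      using complex_Re_le_cmod cauchy_schwarz order_trans by blast
    also have "\<dots> \<le> norm A * norm ?y * norm x"
      by (intro mult_right_mono norm_cop_apply) simp
    finally have "norm ?y * norm ?y \<le> (norm A * norm x) * norm ?y"
      by (simp add: power2_eq_square mult.commute mult.left_commute)
    then show "norm ?y \<le> norm A * norm x"
      by (cases "norm ?y = 0") (auto simp: mult_le_cancel_right)
  qed simp
  show ?thesis using le[of A] le[of "star A"] by simp
qed

section \<open>Evaluation of noncommutative *-polynomials\<close>

definition eval_letter :: "('g \<Rightarrow> 'r::star) \<Rightarrow> 'g \<times> bool \<Rightarrow> 'r"
  where "eval_letter v = (\<lambda>(g, b). if b then star (v g) else v g)"

definition eval_word :: "('g \<Rightarrow> 'r::{monoid_mult,star}) \<Rightarrow> ('g \<times> bool) list \<Rightarrow> 'r"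
  where "eval_word v l = prod_list (map (eval_letter v) l)"

lemma eval_letter_simps [simp]:
  "eval_letter v (g, False) = v g" "eval_letter v (g, True) = star (v g)"
  by (simp_all add: eval_letter_def)

lemma eval_word_simps [simp]:
  "eval_word v [] = 1" "eval_word v (x # l) = eval_letter v x * eval_word v l"
  by (simp_all add: eval_word_def)

lemma eval_word_append: "eval_word v (l @ l') = eval_word v l * eval_word v l'"
  by (simp add: eval_word_def)

lemma star_eval_eq_sum:
  assumes "finite K" "Poly_Mapping.keys f \<subseteq> K"
  shows "star_eval v f = (\<Sum>w\<in>K. Poly_Mapping.lookup f w *\<^sub>C eval_word v (letters w))"
  unfolding star_eval_def eval_word_def eval_letter_def using assms
  by (intro sum.mono_neutral_left) (auto simp: in_keys_iff complex_vector.scale_zero_left)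

lemma star_eval_zero [simp]: "star_eval v 0 = 0"
  by (simp add: star_eval_def)

lemma star_eval_add: "star_eval v (f + g) = star_eval v f + star_eval v g"
proof -
  let ?K = "Poly_Mapping.keys f \<union> Poly_Mapping.keys g"
  have fin: "finite ?K" by simp
  have sub: "Poly_Mapping.keys (f + g) \<subseteq> ?K" by (rule keys_add)
  show ?thesis
    by (simp add: star_eval_eq_sum[OF fin sub] star_eval_eq_sum[OF fin, of f] star_eval_eq_sum[OF fin, of g]
        lookup_add scaleC_add_left sum.distrib)
qed

lemma star_eval_single:
  "star_eval v (Poly_Mapping.single w c) = c *\<^sub>C eval_word v (letters w)"
  using star_eval_eq_sum[of "{w}" "Poly_Mapping.single w c" v] by simp

lemma star_eval_scaleC: "star_eval v (c *\<^sub>C f) = c *\<^sub>C star_eval v f"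
proof -
  have "Poly_Mapping.keys (c *\<^sub>C f) \<subseteq> Poly_Mapping.keys f"
    by (auto simp: in_keys_iff scaleC_poly_mapping.rep_eq complex_vector.scale_zero_right)
  then have "star_eval v (c *\<^sub>C f) = (\<Sum>w\<in>Poly_Mapping.keys f.
      Poly_Mapping.lookup (c *\<^sub>C f) w *\<^sub>C eval_word v (letters w))"
    by (intro star_eval_eq_sum) auto
  then show ?thesis
    by (simp add: star_eval_eq_sum[OF _ order_refl] complex_vector.scale_sum_right
        scaleC_poly_mapping.rep_eq scaleC_complex_def scaleC_scaleC)
qed

lemma star_eval_one [simp]: "star_eval v 1 = 1"
  unfolding single_one[symmetric] star_eval_single by (simp add: zero_word_def scaleC_one)

lemma star_eval_minus: "star_eval v (- f) = - star_eval v f"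
  using star_eval_add[of v f "- f"] by (simp add: eq_neg_iff_add_eq_0 add.commute)

lemma star_eval_diff: "star_eval v (f - g) = star_eval v f - star_eval v g"
  using star_eval_add[of v f "- g"] by (simp add: star_eval_minus)

lemma free_star_algebra_induct [case_names zero single add]:
  fixes f :: "'g free_star_algebra"
  assumes "P 0" "\<And>w c. P (Poly_Mapping.single w c)" "\<And>f g. P f \<Longrightarrow> P g \<Longrightarrow> P (f + g)"
  shows "P f"
proof -
  have "P (\<Sum>w\<in>K. Poly_Mapping.single w (Poly_Mapping.lookup f w))" if "finite K" for K
    using that by (induction K rule: finite_induct) (auto intro: assms)
  moreover have "(\<Sum>w\<in>Poly_Mapping.keys f. Poly_Mapping.single w (Poly_Mapping.lookup f w)) = f"
    by (rule poly_mapping_eqI) (auto simp: lookup_sum lookup_single when_def in_keys_iff)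
  ultimately show ?thesis by (metis finite_keys)
qed

lemma scaleC_single: "c *\<^sub>C Poly_Mapping.single w d = Poly_Mapping.single w (c * d)"
  for d :: complex
  by (rule poly_mapping_eqI)
    (simp add: scaleC_poly_mapping.rep_eq scaleC_complex_def lookup_single when_def)

lemma scaleC_free: "c *\<^sub>C f = Poly_Mapping.single 0 c * f" for f :: "'g free_star_algebra"
  by (induction f rule: free_star_algebra_induct)
    (simp_all add: scaleC_single mult_single scaleC_add_right distrib_left complex_vector.scale_zero_right)

lemma scaleC_free_mult_left: "(c *\<^sub>C f) * g = c *\<^sub>C (f * g)" for f :: "'g free_star_algebra"
  by (simp add: scaleC_free mult.assoc)

lemma scaleC_free_mult_right: "f * (c *\<^sub>C g) = c *\<^sub>C (f * g)" for f :: "'g free_star_algebra"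
proof -
  have "f * Poly_Mapping.single 0 c = Poly_Mapping.single 0 c * f"
    by (induction f rule: free_star_algebra_induct)
      (simp_all add: mult_single mult.commute distrib_left distrib_right)
  then show ?thesis by (simp add: scaleC_free flip: mult.assoc)
qed

subsection \<open>The involution of the free *-algebra\<close>

definition star_letters :: "('g \<times> bool) list \<Rightarrow> ('g \<times> bool) list"
  where "star_letters l = rev (map (\<lambda>(g, b). (g, \<not> b)) l)"

lemma letters_star [simp]: "letters (star w) = star_letters (letters w)"
  by (simp add: star_word_def star_letters_def)

lemma star_letters_star_letters [simp]: "star_letters (star_letters l) = l"
  by (simp add: star_letters_def rev_map comp_def case_prod_beta)

lemma star_star_word [simp]: "star (star w) = w" for w :: "'g word"
  by (rule word.expand) simp

lemma star_poly_mapping_eq_sum: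
  fixes f :: "'g free_star_algebra"
  assumes "finite K" "Poly_Mapping.keys f \<subseteq> K"
  shows "star f = (\<Sum>k\<in>K. Poly_Mapping.single (star k) (cnj (Poly_Mapping.lookup f k)))"
  unfolding star_poly_mapping_def star_complex_def using assms
  by (intro sum.mono_neutral_left) (auto simp: in_keys_iff)

lemma star_free_zero [simp]: "star (0 :: 'g free_star_algebra) = 0"
  by (simp add: star_poly_mapping_def)

lemma star_free_add: "star (f + g) = star f + star g" for f g :: "'g free_star_algebra"
proof -
  let ?K = "Poly_Mapping.keys f \<union> Poly_Mapping.keys g"
  have fin: "finite ?K" by simp
  have sub: "Poly_Mapping.keys (f + g) \<subseteq> ?K" by (rule keys_add)
  show ?thesis
    by (simp add: star_poly_mapping_eq_sum[OF fin sub] star_poly_mapping_eq_sum[OF fin, of f]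
        star_poly_mapping_eq_sum[OF fin, of g] lookup_add single_add sum.distrib)
qed

lemma star_free_single: "star (Poly_Mapping.single w c) = Poly_Mapping.single (star w) (cnj c)"
  for w :: "'g word" and c :: complex
  using star_poly_mapping_eq_sum[of "{w}" "Poly_Mapping.single w c"] by simp

lemma star_free_minus: "star (- f) = - star f" for f :: "'g free_star_algebra"
  using star_free_add[of f "- f"] by (simp add: eq_neg_iff_add_eq_0 add.commute)

lemma star_free_diff: "star (f - g) = star f - star g" for f g :: "'g free_star_algebra"
  using star_free_add[of f "- g"] by (simp add: star_free_minus)

lemma star_free_mult: "star (f * g) = star g * star f" for f g :: "'g free_star_algebra"
proof -
  have w: "star (v + w) = star w + star v" for v w :: "'g word"
    by (simp add: star_word_def plus_word_def)
  have *: "star (Poly_Mapping.single w c * g) = star g * Poly_Mapping.single (star w) (cnj c)"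
    for w :: "'g word" and c
    by (induction g rule: free_star_algebra_induct)
      (simp_all add: distrib_left distrib_right star_free_add star_free_single mult_single w mult.commute)
  show ?thesis
    by (induction f rule: free_star_algebra_induct)
      (simp_all add: distrib_left distrib_right star_free_add star_free_single *)
qed

lemma star_free_star [simp]: "star (star f) = f" for f :: "'g free_star_algebra"
  by (induction f rule: free_star_algebra_induct) (simp_all add: star_free_add star_free_single)

subsection \<open>Homomorphism properties\<close>

lemma star_eval_mult: "star_eval v (f * g) = star_eval v f * star_eval v g"
  for v :: "'g \<Rightarrow> 'h::complex_hilbert cop"
proof -
  have *: "star_eval v (Poly_Mapping.single w c * g) = star_eval v (Poly_Mapping.single w c) * star_eval v g"
    for w c
    by (induction g rule: free_star_algebra_induct)
      (simp_all add: distrib_left star_eval_add star_eval_single mult_single plus_word_def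
        eval_word_append scaleC_times_left scaleC_times_right scaleC_scaleC mult.commute)
  show ?thesis
    by (induction f rule: free_star_algebra_induct) (simp_all add: distrib_right star_eval_add *)
qed

lemma star_eval_star: "star_eval v (star f) = star (star_eval v f)"
  for v :: "'g \<Rightarrow> 'h::complex_hilbert cop"
proof -
  have "eval_word v (star_letters l) = star (eval_word v l)" for l
  proof (induction l)
    case Nil
    then show ?case by (simp add: star_letters_def)
  next
    case (Cons x l)
    obtain g b where x: "x = (g, b)" by (cases x)
    show ?case using Cons
      by (cases b) (simp_all add: x star_letters_def eval_word_append star_times_cop)
  qed
  then show ?thesis
    by (induction f rule: free_star_algebra_induct)
      (simp_all add: star_eval_add star_free_add star_free_single star_eval_single star_plus_cop star_scaleC_cop)
qed

lemma star_eval_free_gen: "star_eval v (free_gen g) = v g"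
  by (simp add: free_gen_def star_eval_single scaleC_one)

lemma star_free_gen: "star (free_gen g) = Poly_Mapping.single (Word [(g, True)]) 1"
  by (simp add: free_gen_def star_free_single star_word_def)

text \<open>By multiplicativity the values on the letters fix those on the words, which span.\<close>

lemma free_star_hom_eq_star_eval:
  fixes h :: "'g free_star_algebra \<Rightarrow> 'r::{complex_vector,monoid_mult,star}"
  assumes add: "\<And>f g. h (f + g) = h f + h g" and mult: "\<And>f g. h (f * g) = h f * h g"
    and sc: "\<And>c f. h (c *\<^sub>C f) = c *\<^sub>C h f" and st: "\<And>g. h (star (free_gen g)) = star (h (free_gen g))"
    and one: "h 1 = 1"
  shows "h f = star_eval (\<lambda>g. h (free_gen g)) f"
proof -
  have word: "h (Poly_Mapping.single (Word l) 1) = eval_word (\<lambda>g. h (free_gen g)) l" for l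
  proof (induction l)
    case Nil
    have "Poly_Mapping.single (Word []) 1 = (1 :: 'g free_star_algebra)"
      by (simp flip: single_one add: zero_word_def)
    then show ?case by (simp add: one)
  next
    case (Cons x l)
    obtain g b where x: "x = (g, b)" by (cases x)
    have "(Poly_Mapping.single (Word (x # l)) 1 :: 'g free_star_algebra) =
        Poly_Mapping.single (Word [x]) 1 * Poly_Mapping.single (Word l) 1"
      by (simp add: mult_single plus_word_def)
    moreover have "h (Poly_Mapping.single (Word [x]) 1) = eval_letter (\<lambda>g. h (free_gen g)) x"
      using st[of g] by (cases b) (simp_all add: x star_free_gen, simp_all add: free_gen_def)
    ultimately show ?case by (simp add: mult Cons)
  qed
  have "h 0 = 0" using sc[of 0 0] by (simp add: complex_vector.scale_zero_left)
  then show ?thesis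
  proof (induction f rule: free_star_algebra_induct)
    case (single w c)
    have "Poly_Mapping.single w c = c *\<^sub>C Poly_Mapping.single (Word (letters w)) 1"
      by (simp add: scaleC_single)
    then have "h (Poly_Mapping.single w c) = c *\<^sub>C eval_word (\<lambda>g. h (free_gen g)) (letters w)"
      by (simp only: sc word)
    then show ?case by (simp add: star_eval_single)
  qed (simp_all add: add star_eval_add)
qed

lemma hom_star_eval:
  fixes \<pi> :: "'r::{complex_vector,monoid_mult,star} \<Rightarrow> 's::{complex_vector,monoid_mult,star}"
  assumes add: "\<And>x y. \<pi> (x + y) = \<pi> x + \<pi> y" and mult: "\<And>x y. \<pi> (x * y) = \<pi> x * \<pi> y"
    and sc: "\<And>c x. \<pi> (c *\<^sub>C x) = c *\<^sub>C \<pi> x" and one: "\<pi> 1 = 1"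
    and st: "\<And>g. \<pi> (star (v g)) = star (\<pi> (v g))"
  shows "\<pi> (star_eval v f) = star_eval (\<lambda>g. \<pi> (v g)) f"
proof -
  have w: "\<pi> (eval_word v l) = eval_word (\<lambda>g. \<pi> (v g)) l" for l
    by (induction l) (auto simp: one mult eval_letter_def st)
  have "\<pi> 0 = 0" using sc[of 0 0] by (simp add: complex_vector.scale_zero_left)
  then show ?thesis
    by (induction f rule: free_star_algebra_induct) (simp_all add: star_eval_add add star_eval_single sc w)
qed

text \<open>
  This transports a *-polynomial along an intertwining relation.  The diagonal instances say that
  a subspace invariant under the letters is invariant under all *-polynomials.
\<close>

lemma star_eval_related:
  fixes v :: "'g \<Rightarrow> 'h::complex_hilbert cop" and v' :: "'g \<Rightarrow> 'k::complex_hilbert cop"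
  assumes zero: "R 0 0" and add: "\<And>x t y s. R x t \<Longrightarrow> R y s \<Longrightarrow> R (x + y) (t + s)"
    and sc: "\<And>c x t. R x t \<Longrightarrow> R (c *\<^sub>C x) (c *\<^sub>C t)"
    and gen: "\<And>g x t. R x t \<Longrightarrow> R (cop_apply (v g) x) (cop_apply (v' g) t)"
    and st: "\<And>g x t. R x t \<Longrightarrow> R (cop_apply (star (v g)) x) (cop_apply (star (v' g)) t)"
    and x: "R x t"
  shows "R (cop_apply (star_eval v f) x) (cop_apply (star_eval v' f) t)"
proof -
  have w: "R (cop_apply (eval_word v l) x) (cop_apply (eval_word v' l) t)" for l
    by (induction l) (auto simp: x times_cop_apply eval_letter_def intro: gen st)
  show ?thesis
    by (induction f rule: free_star_algebra_induct)
      (simp_all add: zero star_eval_add cop_apply_plus add star_eval_single scaleC_cop_apply sc w)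
qed

definition reducing :: "'h::complex_hilbert set \<Rightarrow> ('g \<Rightarrow> 'h cop) \<Rightarrow> bool"
  where "reducing N v \<longleftrightarrow> complex_vector.subspace N \<and>
    (\<forall>g. \<forall>x\<in>N. cop_apply (v g) x \<in> N \<and> cop_apply (star (v g)) x \<in> N)"

definition orth :: "'h::complex_hilbert set \<Rightarrow> 'h set"
  where "orth N = {x. \<forall>s\<in>N. cinner s x = 0}"

lemma subspace_orth: "complex_vector.subspace (orth N)"
  by (auto simp: complex_vector.subspace_def orth_def cinner_simps)

lemma closed_orth: "closed (orth N)"
proof -
  have "orth N = (\<Inter>s\<in>N. {x. cinner s x = 0})" by (auto simp: orth_def)
  then show ?thesis by (simp add: closed_INT closed_orthogonal)
qed

lemma reducing_orth: "reducing N v \<Longrightarrow> reducing (orth N) v"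
  unfolding reducing_def
  by (auto simp: subspace_orth) (auto simp: orth_def cinner_star_right simp flip: cinner_star_left)

lemma reducing_star_eval:
  assumes "reducing N v" "x \<in> N"
  shows "cop_apply (star_eval v f) x \<in> N"
  using assms
  by (intro star_eval_related[where R = "\<lambda>x _. x \<in> N" and v' = v and t = x])
    (auto simp: reducing_def complex_vector.subspace_def)

text \<open>
  The images of two orthogonal reducing subspaces are again orthogonal, so that Pythagoras'
  theorem applies both before and after the polynomial acts.
\<close>

lemma norm_le_by_reducing:
  assumes N: "reducing N v" and x: "x = y + z" "y \<in> N" "z \<in> orth N"
    and b: "norm (cop_apply (star_eval v f) y) \<le> C * norm y"
      "norm (cop_apply (star_eval v f) z) \<le> C * norm z" and "0 \<le> C"
  shows "norm (cop_apply (star_eval v f) x) \<le> C * norm x"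
proof (rule power2_le_imp_le)
  let ?F = "cop_apply (star_eval v f)"
  have "?F y \<in> N" "?F z \<in> orth N"
    using N x by (auto intro: reducing_star_eval reducing_orth)
  then have "cinner (?F y) (?F z) = 0" by (simp add: orth_def)
  then have "(norm (?F x))\<^sup>2 = (norm (?F y))\<^sup>2 + (norm (?F z))\<^sup>2"
    by (simp add: x cop_linear pythagoras)
  also have "\<dots> \<le> (C * norm y)\<^sup>2 + (C * norm z)\<^sup>2"
    using b by (intro add_mono power_mono) auto
  also have "\<dots> = C\<^sup>2 * (norm x)\<^sup>2"
    using x by (simp add: pythagoras orth_def power_mult_distrib distrib_left)
  finally show "(norm (?F x))\<^sup>2 \<le> (C * norm x)\<^sup>2" by (simp add: power_mult_distrib)
qed (use \<open>0 \<le> C\<close> in simp)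

section \<open>Operator-valued Laurent polynomials\<close>

lemma sum_roots_of_unity:
  fixes M :: nat and d :: int
  assumes "M > 0"
  shows "(\<Sum>k<M. cis (2 * pi * real k / real M) powi d) = (if int M dvd d then of_nat M else 0)"
proof -
  define z where "z = cis (2 * pi * real_of_int d / real M)"
  have pw: "cis (2 * pi * real k / real M) powi d = z ^ k" for k
    by (simp add: z_def cis_power_int Complex.DeMoivre mult_ac)
  show ?thesis
  proof (cases "int M dvd d")
    case True
    then obtain e where "d = int M * e" by (elim dvdE)
    then have "2 * pi * real_of_int d / real M = 2 * pi * real_of_int e" using assms by simp
    then have "z = cis (2 * pi * real_of_int e)" by (simp only: z_def)
    then have "z = 1" using cis_multiple_2pi[OF Ints_of_int[of e]] by simp
    then show ?thesis using True by (simp add: pw)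
  next
    case False
    have "z \<noteq> 1"
    proof
      assume "z = 1"
      then have "cos (2 * pi * real_of_int d / real M) = 1" by (simp add: z_def complex_eq_iff)
      then obtain e :: int where "2 * pi * real_of_int d / real M = real_of_int e * 2 * pi"
        by (auto simp: cos_one_2pi_int)
      then have "real_of_int d = real_of_int (int M * e)" using assms by (simp add: field_simps)
      then have "d = int M * e" by linarith
      then show False using False by simp
    qed
    moreover have "z ^ M = 1"
      using assms by (simp add: z_def Complex.DeMoivre cis_multiple_2pi)
    ultimately show ?thesis using False by (simp add: pw geometric_sum)
  qed
qed

lemma cnj_powi: "cmod u = 1 \<Longrightarrow> cnj (u powi k) = u powi (- k)"
  by (metis complex_cnj_power_int power_int_minus divide_conv_cnj inverse_eq_divide mult_1
      power_int_inverse mult.left_neutral complex_cnj_mult)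

lemma norm_sum_scaleC_sq:
  "complex_of_real ((norm (\<Sum>j\<in>J. a j *\<^sub>C h j))\<^sup>2) = (\<Sum>i\<in>J. \<Sum>j\<in>J. cnj (a i) * a j * cinner (h i) (h j))"
  unfolding cinner_self[symmetric] cinner_sum_left cinner_sum_right
  by (subst sum.swap, intro sum.cong refl) (simp add: cinner_scaleC_left cinner_scaleC_right)

lemma parseval_roots_of_unity:
  fixes h :: "int \<Rightarrow> 'h::complex_hilbert"
  assumes M: "M > 0" and J: "finite J" and inj: "\<And>i j. i \<in> J \<Longrightarrow> j \<in> J \<Longrightarrow> int M dvd i - j \<Longrightarrow> i = j"
  shows "(\<Sum>k<M. (norm (\<Sum>j\<in>J. (cis (2 * pi * real k / real M) powi (- j)) *\<^sub>C h j))\<^sup>2) =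
    real M * (\<Sum>j\<in>J. (norm (h j))\<^sup>2)"
proof -
  let ?u = "\<lambda>k. cis (2 * pi * real k / real M)"
  have "complex_of_real (\<Sum>k<M. (norm (\<Sum>j\<in>J. (?u k powi (- j)) *\<^sub>C h j))\<^sup>2) =
      (\<Sum>k<M. \<Sum>i\<in>J. \<Sum>j\<in>J. ?u k powi (i - j) * cinner (h i) (h j))"
  proof -
    have "complex_of_real ((norm (\<Sum>j\<in>J. (?u k powi (- j)) *\<^sub>C h j))\<^sup>2) =
        (\<Sum>i\<in>J. \<Sum>j\<in>J. ?u k powi (i - j) * cinner (h i) (h j))" for k
    proof -
      have "cnj (?u k powi (- i)) * (?u k powi (- j)) = ?u k powi (i - j)" for i j
        by (subst cnj_powi) (simp_all add: power_int_diff power_int_minus divide_inverse)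
      then show ?thesis
        by (simp only: norm_sum_scaleC_sq)
    qed
    then show ?thesis by simp
  qed
  also have "\<dots> = (\<Sum>i\<in>J. \<Sum>j\<in>J. (\<Sum>k<M. ?u k powi (i - j)) * cinner (h i) (h j))"
    by (subst sum.swap, rule sum.cong[OF refl], subst sum.swap) (simp add: sum_distrib_right)
  also have "\<dots> = (\<Sum>i\<in>J. \<Sum>j\<in>J. if i = j then of_nat M * cinner (h i) (h j) else 0)"
    unfolding sum_roots_of_unity[OF M] by (intro sum.cong refl) (auto dest: inj)
  also have "\<dots> = complex_of_real (real M * (\<Sum>j\<in>J. (norm (h j))\<^sup>2))"
    using J by (simp add: cinner_self sum_distrib_left)
  finally show ?thesis unfolding of_real_eq_iff .
qed

text \<open>
  By Parseval's identity, multiplication by an operator-valued Laurent polynomial that is bounded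
  by \<open>C\<close> on the circle is, as a convolution on coefficients, bounded by \<open>C\<close> as well.
\<close>

lemma convolution_bound:
  fixes T :: "'i \<Rightarrow> 'h::complex_hilbert cop" and d :: "'i \<Rightarrow> int" and g :: "int \<Rightarrow> 'h"
  assumes I: "finite I" and N: "complex_vector.subspace N" and C: "0 \<le> C"
    and bound: "\<And>u \<eta>. cmod u = 1 \<Longrightarrow> \<eta> \<in> N \<Longrightarrow>
      norm (\<Sum>i\<in>I. (u powi d i) *\<^sub>C cop_apply (T i) \<eta>) \<le> C * norm \<eta>"
    and g: "\<And>n. g n \<in> N" "\<And>n. n \<notin> J\<^sub>0 \<Longrightarrow> g n = 0" and J0: "finite J\<^sub>0" and J: "finite J"
  shows "(\<Sum>m\<in>J. (norm (\<Sum>i\<in>I. cop_apply (T i) (g (m + d i))))\<^sup>2) \<le> C\<^sup>2 * (\<Sum>n\<in>J\<^sub>0. (norm (g n))\<^sup>2)"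
proof -
  define h where "h m = (\<Sum>i\<in>I. cop_apply (T i) (g (m + d i)))" for m
  define J1 where "J1 = J \<union> J\<^sub>0 \<union> (\<Union>i\<in>I. (\<lambda>n. n - d i) ` J\<^sub>0)"
  have J1: "finite J1" unfolding J1_def using I J J0 by auto
  obtain L where L: "\<And>j. j \<in> J1 \<Longrightarrow> \<bar>j\<bar> \<le> L" "0 \<le> L"
  proof -
    have "finite (abs ` J1)" using J1 by simp
    then have "\<And>j. j \<in> J1 \<Longrightarrow> \<bar>j\<bar> \<le> Max (insert 0 (abs ` J1))" "0 \<le> Max (insert 0 (abs ` J1))"
      by auto
    then show ?thesis by (rule that)
  qed
  \<comment> \<open>With more roots of unity than frequencies in \<open>[-L, L]\<close>, these frequencies are distinct modulo \<open>M\<close>.\<close>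
  define M where "M = nat (2 * L + 1)"
  have M: "M > 0" "int M = 2 * L + 1" using L(2) by (auto simp: M_def)
  have inj: "i = j" if "i \<in> J1" "j \<in> J1" "int M dvd i - j" for i j
  proof (rule ccontr)
    assume "i \<noteq> j"
    then have "int M \<le> \<bar>i - j\<bar>" using that(3) by (intro zdvd_imp_le) auto
    then show False using L(1)[OF that(1)] L(1)[OF that(2)] M(2) by linarith
  qed
  let ?u = "\<lambda>k. cis (2 * pi * real k / real M)"
  let ?G = "\<lambda>k. \<Sum>n\<in>J\<^sub>0. (?u k powi (- n)) *\<^sub>C g n"
  have GN: "?G k \<in> N" for k
    using N g(1) by (intro complex_vector.subspace_sum) (auto intro: complex_vector.subspace_scale)
  \<comment> \<open>Convolution on coefficients is multiplication of Fourier transforms.\<close>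
  have conv: "(\<Sum>m\<in>J1. (?u k powi (- m)) *\<^sub>C h m) = (\<Sum>i\<in>I. (?u k powi d i) *\<^sub>C cop_apply (T i) (?G k))" for k
  proof -
    have "(\<Sum>m\<in>J1. (?u k powi (- m)) *\<^sub>C h m) =
        (\<Sum>i\<in>I. \<Sum>m\<in>J1. (?u k powi (- m)) *\<^sub>C cop_apply (T i) (g (m + d i)))"
      unfolding h_def complex_vector.scale_sum_right by (rule sum.swap)
    also have "\<dots> = (\<Sum>i\<in>I. (?u k powi d i) *\<^sub>C cop_apply (T i) (?G k))"
    proof (rule sum.cong[OF refl])
      fix i assume i: "i \<in> I"
      let ?\<phi> = "\<lambda>m. (?u k powi (- m)) *\<^sub>C cop_apply (T i) (g (m + d i))"
      have "sum ?\<phi> J1 = sum ?\<phi> ((\<lambda>n. n - d i) ` J\<^sub>0)"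
      proof (rule sum.mono_neutral_right[OF J1])
        show "(\<lambda>n. n - d i) ` J\<^sub>0 \<subseteq> J1" using i by (auto simp: J1_def)
        show "\<forall>m\<in>J1 - (\<lambda>n. n - d i) ` J\<^sub>0. ?\<phi> m = 0"
        proof
          fix m assume m: "m \<in> J1 - (\<lambda>n. n - d i) ` J\<^sub>0"
          have "m + d i \<notin> J\<^sub>0"
          proof
            assume "m + d i \<in> J\<^sub>0"
            then have "m \<in> (\<lambda>n. n - d i) ` J\<^sub>0" by (intro image_eqI[of _ _ "m + d i"]) simp_all
            with m show False by blast
          qed
          then show "?\<phi> m = 0" by (simp add: g(2) complex_vector.scale_zero_right)
        qed
      qed
      also have "\<dots> = (\<Sum>n\<in>J\<^sub>0. ?\<phi> (n - d i))"
        by (subst sum.reindex) (auto simp: inj_on_def)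
      also have "\<dots> = (?u k powi d i) *\<^sub>C cop_apply (T i) (?G k)"
        by (simp add: cop_apply_sum cop_apply_scaleC complex_vector.scale_sum_right scaleC_scaleC
            power_int_diff power_int_minus divide_inverse)
      finally show "sum ?\<phi> J1 = (?u k powi d i) *\<^sub>C cop_apply (T i) (?G k)" .
    qed
    finally show ?thesis .
  qed
  have "real M * (\<Sum>m\<in>J. (norm (h m))\<^sup>2) \<le> real M * (\<Sum>m\<in>J1. (norm (h m))\<^sup>2)"
    using J1 by (intro mult_left_mono sum_mono2) (auto simp: J1_def)
  also have "\<dots> = (\<Sum>k<M. (norm (\<Sum>m\<in>J1. (?u k powi (- m)) *\<^sub>C h m))\<^sup>2)"
    by (rule parseval_roots_of_unity[OF M(1) J1 inj, symmetric])
  also have "\<dots> \<le> (\<Sum>k<M. (C * norm (?G k))\<^sup>2)"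
    unfolding conv by (intro sum_mono power_mono bound GN) auto
  also have "\<dots> = C\<^sup>2 * (\<Sum>k<M. (norm (?G k))\<^sup>2)"
    by (simp add: power_mult_distrib sum_distrib_left)
  also have "(\<Sum>k<M. (norm (?G k))\<^sup>2) = real M * (\<Sum>n\<in>J\<^sub>0. (norm (g n))\<^sup>2)"
    by (rule parseval_roots_of_unity[OF M(1) J0]) (auto intro: inj simp: J1_def)
  finally show ?thesis using M(1) by (simp add: h_def mult.left_commute)
qed

section \<open>Replacing a unitary by scalars\<close>

definition letter_degree :: "'g \<Rightarrow> 'g \<times> bool \<Rightarrow> int"
  where "letter_degree g\<^sub>0 = (\<lambda>(g, b). if g = g\<^sub>0 then (if b then - 1 else 1) else 0)"

definition word_degree :: "'g \<Rightarrow> ('g \<times> bool) list \<Rightarrow> int"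
  where "word_degree g\<^sub>0 l = sum_list (map (letter_degree g\<^sub>0) l)"

lemma word_degree_simps [simp]:
  "word_degree g\<^sub>0 [] = 0" "word_degree g\<^sub>0 (x # l) = letter_degree g\<^sub>0 x + word_degree g\<^sub>0 l"
  by (simp_all add: word_degree_def)

lemma word_degree_le: "\<bar>word_degree g\<^sub>0 l\<bar> \<le> int (length l)"
  by (induction l) (auto simp: letter_degree_def split: prod.splits)

lemma eval_word_scalar:
  fixes v :: "'g \<Rightarrow> 'h::complex_hilbert cop"
  assumes u: "cmod u = 1"
  shows "eval_word (v(g\<^sub>0 := u *\<^sub>C 1)) l = (u powi word_degree g\<^sub>0 l) *\<^sub>C eval_word (v(g\<^sub>0 := 1)) l"
proof (induction l)
  case Nil
  then show ?case by (simp add: scaleC_one)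
next
  case (Cons x l)
  obtain g b where x: "x = (g, b)" by (cases x)
  have u0: "u \<noteq> 0" using u by auto
  have "eval_letter (v(g\<^sub>0 := u *\<^sub>C 1)) x = (u powi letter_degree g\<^sub>0 x) *\<^sub>C eval_letter (v(g\<^sub>0 := 1)) x"
    using cnj_powi[OF u, of 1]
    by (cases b) (auto simp: x letter_degree_def star_scaleC_cop scaleC_one)
  then show ?case
    by (simp add: Cons scaleC_times_left scaleC_times_right scaleC_scaleC power_int_add u0 mult.commute
        del: fun_upd_apply)
qed

lemma le_of_linear_bound:
  fixes a b c :: real
  assumes "\<And>R::nat. real R * a \<le> real R * b + c"
  shows "a \<le> b"
proof (rule ccontr)
  assume "\<not> a \<le> b"
  then obtain R :: nat where "c < real R * (a - b)" using reals_Archimedean3[of "a - b"] by auto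
  with assms[of R] show False by (simp add: algebra_simps)
qed

text \<open>
  The vectors \<open>V\<^sup>n \<xi>\<close>, \<open>0 \<le> n < R\<close>, form an almost invariant sequence: up to boundary terms, whose
  number does not grow with \<open>R\<close>, a *-polynomial acts on it by convolution, and by
  \<open>convolution_bound\<close> it suffices to bound the polynomial with \<open>V\<close> replaced by scalars.
\<close>

theorem norm_star_eval_le_scalars:
  fixes v :: "'g \<Rightarrow> 'h::complex_hilbert cop"
  assumes N: "reducing N v" and C: "0 \<le> C"
    and unit: "\<And>x. x \<in> N \<Longrightarrow> cop_apply (star (v g\<^sub>0)) (cop_apply (v g\<^sub>0) x) = x"
      "\<And>x. x \<in> N \<Longrightarrow> cop_apply (v g\<^sub>0) (cop_apply (star (v g\<^sub>0)) x) = x"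
    and comm: "\<And>g. g \<noteq> g\<^sub>0 \<Longrightarrow> v g * v g\<^sub>0 = v g\<^sub>0 * v g"
      "\<And>g. g \<noteq> g\<^sub>0 \<Longrightarrow> star (v g) * v g\<^sub>0 = v g\<^sub>0 * star (v g)"
    and bound: "\<And>u \<eta>. cmod u = 1 \<Longrightarrow> \<eta> \<in> N \<Longrightarrow>
      norm (cop_apply (star_eval (v(g\<^sub>0 := u *\<^sub>C 1)) f) \<eta>) \<le> C * norm \<eta>"
    and \<xi>: "\<xi> \<in> N"
  shows "norm (cop_apply (star_eval v f) \<xi>) \<le> C * norm \<xi>"
proof -
  let ?V = "v g\<^sub>0" and ?deg = "\<lambda>w. word_degree g\<^sub>0 (letters w)" and ?K = "Poly_Mapping.keys f"
  define T where "T w = Poly_Mapping.lookup f w *\<^sub>C eval_word (v(g\<^sub>0 := 1)) (letters w)" for w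
  have sub: "complex_vector.subspace N" using N by (simp add: reducing_def)
  have wN: "cop_apply (eval_word v l) x \<in> N" if "x \<in> N" for l x
    using N that by (induction l) (auto simp: times_cop_apply eval_letter_def reducing_def)
  have pN: "cop_apply (?V ^ n) x \<in> N" if "x \<in> N" for n x
    using N that by (induction n) (auto simp: times_cop_apply reducing_def)
  have pnorm: "norm (cop_apply (?V ^ n) x) = norm x" if "x \<in> N" for n x
  proof (induction n)
    case (Suc n)
    let ?y = "cop_apply (?V ^ n) x"
    have "(norm (cop_apply ?V ?y))\<^sup>2 = (norm ?y)\<^sup>2"
      by (simp add: norm_sq_eq_Re_cinner unit(1)[OF pN[OF that]] flip: cinner_star_right)
    then show ?case using Suc by (simp add: times_cop_apply)
  qed simp
  \<comment> \<open>Moving \<open>V\<^sup>m\<close> to the right past a word absorbs the letters \<open>V\<close> and \<open>V\<^sup>*\<close> into the exponent, which stays nonnegative as \<open>m\<close> bounds the length.\<close>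
  have shift: "cop_apply (?V ^ m) (cop_apply (eval_word v l) x) =
      cop_apply (eval_word (v(g\<^sub>0 := 1)) l) (cop_apply (?V ^ nat (int m + word_degree g\<^sub>0 l)) x)"
    if "length l \<le> m" "x \<in> N" for l m x
    using that
  proof (induction l arbitrary: m)
    case (Cons a l)
    obtain g b where a: "a = (g, b)" by (cases a)
    let ?y = "cop_apply (eval_word v l) x"
    have yN: "?y \<in> N" using wN Cons.prems by blast
    show ?case
    proof (cases "g = g\<^sub>0")
      case False
      have "eval_letter v a * ?V = ?V * eval_letter v a"
        using comm[OF False] by (cases b) (simp_all add: a)
      then have "eval_letter v a * ?V ^ m = ?V ^ m * eval_letter v a"
        by (rule power_commuting_commutes[symmetric, OF sym])
      then have "cop_apply (?V ^ m) (cop_apply (eval_letter v a) ?y) =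
          cop_apply (eval_letter v a) (cop_apply (?V ^ m) ?y)"
        by (metis times_cop_apply)
      moreover have "eval_letter (v(g\<^sub>0 := 1)) a = eval_letter v a"
        using False by (cases b) (simp_all add: a)
      ultimately show ?thesis
        using False Cons.IH[of m] Cons.prems by (simp add: times_cop_apply a letter_degree_def del: fun_upd_apply)
    next
      case True
      show ?thesis
      proof (cases b)
        case False
        have "cop_apply (?V ^ m) (cop_apply ?V ?y) = cop_apply (?V ^ Suc m) ?y"
          by (simp only: power_Suc2 times_cop_apply)
        then show ?thesis using Cons.IH[of "Suc m"] Cons.prems True False
          by (simp add: times_cop_apply a letter_degree_def add_ac del: power_Suc)
      next
        case b: True
        obtain m' where m: "m = Suc m'" using Cons.prems by (cases m) auto
        have "cop_apply (?V ^ m) (cop_apply (star ?V) ?y) = cop_apply (?V ^ m') ?y"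
          by (simp only: m power_Suc2 times_cop_apply unit(2)[OF yN])
        then show ?thesis using Cons.IH[of m'] Cons.prems True b
          by (simp add: times_cop_apply a letter_degree_def m)
      qed
    qed
  qed simp
  obtain L where L: "\<And>w. w \<in> ?K \<Longrightarrow> length (letters w) \<le> L"
    using finite_nat_set_iff_bounded_le[of "(\<lambda>w. length (letters w)) ` ?K"] by auto
  have expand: "star_eval v f = (\<Sum>w\<in>?K. Poly_Mapping.lookup f w *\<^sub>C eval_word v (letters w))"
    by (rule star_eval_eq_sum) auto
  have pair: "norm (\<Sum>w\<in>?K. (u powi ?deg w) *\<^sub>C cop_apply (T w) \<eta>) \<le> C * norm \<eta>"
    if "cmod u = 1" "\<eta> \<in> N" for u \<eta>
  proof -
    have "star_eval (v(g\<^sub>0 := u *\<^sub>C 1)) f = (\<Sum>w\<in>?K. (u powi ?deg w) *\<^sub>C T w)"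
      by (subst star_eval_eq_sum[of ?K])
        (simp_all add: eval_word_scalar[OF that(1)] T_def scaleC_scaleC mult.commute)
    then show ?thesis using bound[OF that] by (simp add: sum_cop_apply scaleC_cop_apply)
  qed
  have Fsub: "cop_apply (star_eval v f) \<xi> \<in> N" by (rule reducing_star_eval[OF N \<xi>])
  have main: "real R * (norm (cop_apply (star_eval v f) \<xi>))\<^sup>2 \<le>
      real R * (C * norm \<xi>)\<^sup>2 + 2 * real L * (norm (cop_apply (star_eval v f) \<xi>))\<^sup>2" for R :: nat
  proof -
    define g where "g n = (if 0 \<le> n \<and> n < int R then cop_apply (?V ^ nat n) \<xi> else 0)" for n
    \<comment> \<open>For \<open>m\<close> in this range all positions \<open>m + deg w\<close> lie in \<open>[0, R)\<close>, so that no boundary term occurs.\<close>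
    let ?J = "{int L..<int R - int L}"
    have "(\<Sum>m\<in>?J. (norm (\<Sum>w\<in>?K. cop_apply (T w) (g (m + ?deg w))))\<^sup>2)
        \<le> C\<^sup>2 * (\<Sum>n\<in>{0..<int R}. (norm (g n))\<^sup>2)"
      using pN[OF \<xi>] complex_vector.subspace_0[OF sub]
      by (intro convolution_bound[OF _ sub C pair]) (auto simp: g_def)
    also have "(\<Sum>n\<in>{0..<int R}. (norm (g n))\<^sup>2) = (\<Sum>n\<in>{0..<int R}. (norm \<xi>)\<^sup>2)"
      by (intro sum.cong refl) (simp add: g_def pnorm[OF \<xi>])
    also have "(\<Sum>m\<in>?J. (norm (\<Sum>w\<in>?K. cop_apply (T w) (g (m + ?deg w))))\<^sup>2) =
        (\<Sum>m\<in>?J. (norm (cop_apply (star_eval v f) \<xi>))\<^sup>2)"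
    proof (intro sum.cong refl)
      fix m assume m: "m \<in> ?J"
      have "(\<Sum>w\<in>?K. cop_apply (T w) (g (m + ?deg w))) = cop_apply (?V ^ nat m) (cop_apply (star_eval v f) \<xi>)"
        unfolding expand sum_cop_apply cop_apply_sum
      proof (intro sum.cong refl)
        fix w assume w: "w \<in> ?K"
        have "\<bar>?deg w\<bar> \<le> int L" using word_degree_le[of g\<^sub>0 "letters w"] L[OF w] by linarith
        moreover have "length (letters w) \<le> nat m" using L[OF w] m by auto
        ultimately show "cop_apply (T w) (g (m + ?deg w)) = cop_apply (?V ^ nat m)
            (cop_apply (Poly_Mapping.lookup f w *\<^sub>C eval_word v (letters w)) \<xi>)"
          using m by (auto simp: T_def g_def scaleC_cop_apply cop_apply_scaleC shift[OF _ \<xi>])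
      qed
      then show "(norm (\<Sum>w\<in>?K. cop_apply (T w) (g (m + ?deg w))))\<^sup>2 = (norm (cop_apply (star_eval v f) \<xi>))\<^sup>2"
        by (simp add: pnorm[OF Fsub])
    qed
    finally have "real (nat (int R - 2 * int L)) * (norm (cop_apply (star_eval v f) \<xi>))\<^sup>2 \<le> C\<^sup>2 * (real R * (norm \<xi>)\<^sup>2)"
      by (simp add: algebra_simps)
    moreover have "real R * a - 2 * real L * a \<le> real (nat (int R - 2 * int L)) * a" if "0 \<le> a" for a
    proof -
      have "real R - 2 * real L \<le> real (nat (int R - 2 * int L))" by linarith
      from mult_right_mono[OF this that] show ?thesis by (simp add: algebra_simps)
    qed
    ultimately show ?thesis
      by (smt (verit) mult.left_commute power_mult_distrib zero_le_power2)
  qed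
  have "(norm (cop_apply (star_eval v f) \<xi>))\<^sup>2 \<le> (C * norm \<xi>)\<^sup>2"
    using le_of_linear_bound[OF main] .
  then show ?thesis by (rule power2_le_imp_le) (use C in simp)
qed

section \<open>Representations of the quantum disc\<close>

lemma subspace_closure:
  fixes S :: "'a::complex_normed_vector set"
  assumes "complex_vector.subspace S"
  shows "complex_vector.subspace (closure S)"
  unfolding complex_vector.subspace_def
proof (intro conjI ballI allI)
  have S: "0 \<in> S" "\<And>x y. x \<in> S \<Longrightarrow> y \<in> S \<Longrightarrow> x + y \<in> S" "\<And>c x. x \<in> S \<Longrightarrow> c *\<^sub>C x \<in> S"
    using assms by (auto simp: complex_vector.subspace_def)
  show "0 \<in> closure S" using S(1) closure_subset by blast
  fix x assume x: "x \<in> closure S"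
  then obtain X where X: "\<And>n. X n \<in> S" "X \<longlonglongrightarrow> x" by (auto simp: closure_sequential)
  show "c *\<^sub>C x \<in> closure S" for c
    unfolding closure_sequential
    by (intro exI[of _ "\<lambda>n. c *\<^sub>C X n"] conjI allI S(3) X
        bounded_linear.tendsto[OF bounded_linear_scaleC])
  fix y assume "y \<in> closure S"
  then obtain Y where Y: "\<And>n. Y n \<in> S" "Y \<longlonglongrightarrow> y" by (auto simp: closure_sequential)
  show "x + y \<in> closure S"
    unfolding closure_sequential
    by (intro exI[of _ "\<lambda>n. X n + Y n"] conjI allI S(2) X Y tendsto_add)
qed

lemma gram_schmidt:
  fixes X :: "'h::complex_hilbert set"
  assumes "finite X"
  obtains Q where "finite Q" "Q \<subseteq> complex_span X" "X \<subseteq> complex_span Q"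
    "\<And>x. x \<in> Q \<Longrightarrow> norm x = 1" "\<And>x y. x \<in> Q \<Longrightarrow> y \<in> Q \<Longrightarrow> x \<noteq> y \<Longrightarrow> cinner x y = 0"
proof -
  have "\<exists>Q. finite Q \<and> Q \<subseteq> complex_span X \<and> X \<subseteq> complex_span Q \<and> (\<forall>x\<in>Q. norm x = 1) \<and>
      (\<forall>x\<in>Q. \<forall>y\<in>Q. x \<noteq> y \<longrightarrow> cinner x y = 0)"
    using assms
  proof (induction X rule: finite_induct)
    case empty
    show ?case by (rule exI[of _ "{}"]) simp
  next
    case (insert k X)
    from insert.IH obtain Q where *: "finite Q \<and> Q \<subseteq> complex_span X \<and> X \<subseteq> complex_span Q \<and>
        (\<forall>x\<in>Q. norm x = 1) \<and> (\<forall>x\<in>Q. \<forall>y\<in>Q. x \<noteq> y \<longrightarrow> cinner x y = 0)"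
      by (rule exE)
    then have Q: "finite Q" "Q \<subseteq> complex_span X" "X \<subseteq> complex_span Q"
      "\<forall>x\<in>Q. norm x = 1" "\<forall>x\<in>Q. \<forall>y\<in>Q. x \<noteq> y \<longrightarrow> cinner x y = 0"
      by simp_all
    define s where "s = (\<Sum>q\<in>Q. cinner q k *\<^sub>C q)"
    define k' where "k' = k - s"
    have sQ: "s \<in> complex_span Q"
      unfolding s_def by (intro complex_vector.span_sum complex_vector.span_scale complex_vector.span_base)
    have orth: "cinner q k' = 0" if q: "q \<in> Q" for q
    proof -
      have "cinner q s = (\<Sum>p\<in>Q. if p = q then cinner q k else 0)"
        unfolding s_def cinner_sum_right using Q q
        by (intro sum.cong refl) (auto simp: cinner_scaleC_right cinner_self)
      then show ?thesis using Q(1) q by (simp add: k'_def cinner_diff_right)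
    qed
    have mono: "complex_span X \<subseteq> complex_span (insert k X)"
      by (intro complex_vector.span_mono) auto
    show ?case
    proof (cases "k' = 0")
      case True
      then have "k \<in> complex_span Q" using sQ by (simp add: k'_def)
      then show ?thesis using Q mono by (intro exI[of _ Q]) auto
    next
      case False
      define e where "e = complex_of_real (inverse (norm k')) *\<^sub>C k'"
      have e1: "norm e = 1" using False by (simp add: e_def norm_scaleC norm_inverse)
      have eo: "cinner q e = 0" "cinner e q = 0" if "q \<in> Q" for q
        using orth[OF that] cinner_eq_zero_commute[of q k']
        by (simp_all add: e_def cinner_scaleC_right cinner_scaleC_left)
      have "s \<in> complex_span X"
        unfolding s_def using Q(2) by (intro complex_vector.span_sum complex_vector.span_scale) auto
      then have s: "s \<in> complex_span (insert k X)" using mono by blast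
      have "k' \<in> complex_span (insert k X)"
        unfolding k'_def by (rule complex_vector.span_diff[OF complex_vector.span_base[OF insertI1] s])
      then have "e \<in> complex_span (insert k X)"
        unfolding e_def by (rule complex_vector.span_scale)
      moreover have "k \<in> complex_span (insert e Q)"
      proof -
        have "k = complex_of_real (norm k') *\<^sub>C e + s"
          using False by (simp add: e_def scaleC_scaleC k'_def scaleC_one flip: of_real_mult)
        moreover have "s \<in> complex_span (insert e Q)"
          using sQ complex_vector.span_mono[of Q "insert e Q"] by blast
        ultimately show ?thesis
          by (metis complex_vector.span_add complex_vector.span_scale complex_vector.span_base insertI1)
      qed
      moreover have "X \<subseteq> complex_span (insert e Q)"
        using Q(3) complex_vector.span_mono[of Q "insert e Q"] by blast
      ultimately show ?thesis using Q mono e1 eo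
        by (intro exI[of _ "insert e Q"]) auto
    qed
  qed
  then obtain Q where *: "finite Q \<and> Q \<subseteq> complex_span X \<and> X \<subseteq> complex_span Q \<and>
      (\<forall>x\<in>Q. norm x = 1) \<and> (\<forall>x\<in>Q. \<forall>y\<in>Q. x \<noteq> y \<longrightarrow> cinner x y = 0)"
    by (rule exE)
  show ?thesis by (rule that[of Q]) (use * in simp_all)
qed

lemma subset_orth_orth: "closure (complex_span W) \<subseteq> orth (orth W)"
proof (rule closure_minimal[OF _ closed_orth], rule complex_vector.span_minimal[OF _ subspace_orth])
  show "W \<subseteq> orth (orth W)" by (auto simp: orth_def cinner_eq_zero_commute)
qed

lemma orthogonal_decomposition:
  fixes W :: "'h::complex_hilbert set"
  obtains m n where "x = m + n" "m \<in> closure (complex_span W)" "n \<in> orth W"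
proof -
  obtain m where m: "m \<in> closure (complex_span W)" "\<And>s. s \<in> closure (complex_span W) \<Longrightarrow> cinner s (x - m) = 0"
    by (rule orthogonal_projection_exists[of "closure (complex_span W)" x])
      (auto intro: subspace_closure complex_vector.subspace_span)
  have "x - m \<in> orth W"
    unfolding orth_def using m(2) complex_vector.span_base closure_subset by blast
  then show ?thesis using that[of m "x - m"] m(1) by simp
qed

text \<open>
  Bounded representations of the quantum disc algebra with parameter \<open>r\<close>.  The \<^emph>\<open>defect\<close> \<open>1 - B B\<^sup>*\<close>
  measures how far \<open>B\<close> is from being unitary.
\<close>

locale quantum_disc =
  fixes r :: real and B :: "'h::complex_hilbert cop"
  assumes r: "0 < r" "r < 1"
    and rel: "star B * B = complex_of_real r *\<^sub>C (B * star B) + complex_of_real (1 - r) *\<^sub>C 1"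
begin

abbreviation "b \<equiv> cop_apply B"
abbreviation "bs \<equiv> cop_apply (star B)"

definition defect :: "'h cop"
  where "defect = 1 - B * star B"

abbreviation "e \<equiv> cop_apply defect"

lemma b_bs: "b (bs x) = x - e x"
  by (simp add: defect_def cop_simps)

lemma bs_b: "bs (b x) = x - complex_of_real r *\<^sub>C e x"
proof -
  have "bs (b x) = complex_of_real r *\<^sub>C b (bs x) + complex_of_real (1 - r) *\<^sub>C x"
    using arg_cong[OF rel, of "\<lambda>A. cop_apply A x"] by (simp add: cop_simps)
  then show ?thesis
    by (simp add: b_bs complex_vector.scale_right_diff_distrib complex_vector.scale_left_diff_distrib scaleC_one)
qed

lemma e_b: "e (b x) = complex_of_real r *\<^sub>C b (e x)"
  using b_bs[of "b x"] by (simp add: bs_b cop_linear)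

lemma bs_e: "bs (e x) = complex_of_real r *\<^sub>C e (bs x)"
  using bs_b[of "bs x"] by (simp add: b_bs cop_linear)

lemma star_defect: "star defect = defect"
  by (simp add: defect_def star_diff_cop star_times_cop)

lemma e_self_adjoint: "cinner (e x) y = cinner x (e y)"
  using cinner_star_right[of x defect y] by (simp add: star_defect)

lemma e_form: "Re (cinner (e x) x) = (norm x)\<^sup>2 - (norm (bs x))\<^sup>2"
proof -
  have "cinner (e x) x = cinner x x - cinner (b (bs x)) x"
    using b_bs[of x] by (simp flip: cinner_diff_left)
  then show ?thesis by (simp add: norm_sq_eq_Re_cinner cinner_star_right)
qed

text \<open>
  From \<open>\<parallel>B x\<parallel>\<^sup>2 = r \<parallel>B\<^sup>*x\<parallel>\<^sup>2 + (1 - r) \<parallel>x\<parallel>\<^sup>2\<close> one gets \<open>\<parallel>B\<parallel>\<^sup>2 \<le> r \<parallel>B\<parallel>\<^sup>2 + (1 - r)\<close>.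
\<close>

lemma norm_b: "norm (b x) \<le> norm x"
proof -
  have "norm B \<le> 1"
  proof (rule power2_le_imp_le[of "norm B" 1])
    define C where "C = r * (norm B)\<^sup>2 + (1 - r)"
    have C0: "0 \<le> C" using r by (simp add: C_def)
    have "norm B \<le> sqrt C"
    proof (rule norm_cop_bound)
      fix x
      have "(norm (b x))\<^sup>2 = Re (cinner (bs (b x)) x)"
        by (simp add: norm_sq_eq_Re_cinner cinner_star_left)
      also have "\<dots> = (norm x)\<^sup>2 - r * Re (cinner (e x) x)"
        by (simp add: bs_b cinner_simps norm_sq_eq_Re_cinner)
      also have "\<dots> = r * (norm (bs x))\<^sup>2 + (1 - r) * (norm x)\<^sup>2"
        by (simp add: e_form algebra_simps)
      also have "\<dots> \<le> r * (norm B * norm x)\<^sup>2 + (1 - r) * (norm x)\<^sup>2"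
        using r norm_cop_apply[of "star B" x] by (intro add_mono mult_left_mono power_mono) auto
      also have "\<dots> = C * (norm x)\<^sup>2" by (simp add: C_def power_mult_distrib algebra_simps)
      finally have "(norm (b x))\<^sup>2 \<le> (sqrt C * norm x)\<^sup>2" using C0 by (simp add: power_mult_distrib)
      then show "norm (b x) \<le> sqrt C * norm x" by (rule power2_le_imp_le) (use C0 in simp)
    qed (use C0 in simp)
    then have "(norm B)\<^sup>2 \<le> (sqrt C)\<^sup>2" by (rule power_mono) simp
    then have "(norm B)\<^sup>2 \<le> C" using C0 by simp
    then have "(1 - r) * (norm B)\<^sup>2 \<le> (1 - r) * 1" by (simp add: C_def algebra_simps)
    then show "(norm B)\<^sup>2 \<le> 1\<^sup>2" using r by simp
  qed simp
  then show ?thesis using norm_cop_apply[of B x] mult_right_mono[of "norm B" 1 "norm x"] by simp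
qed

lemma norm_e_sq_le: "(norm (e x))\<^sup>2 \<le> Re (cinner (e x) x)"
proof -
  have "e x = x - b (bs x)" by (simp add: b_bs)
  then have "(norm (e x))\<^sup>2 = (norm x)\<^sup>2 - 2 * Re (cinner x (b (bs x))) + (norm (b (bs x)))\<^sup>2"
    by (simp only: norm_diff_sq)
  also have "Re (cinner x (b (bs x))) = (norm (bs x))\<^sup>2"
    by (simp add: norm_sq_eq_Re_cinner cinner_star_left)
  also have "(norm (b (bs x)))\<^sup>2 \<le> (norm (bs x))\<^sup>2" by (intro power_mono norm_b) simp
  finally show ?thesis by (simp add: e_form)
qed

text \<open>
  As in Wold's decomposition, the kernel of \<open>B\<^sup>*\<close> generates the part on which \<open>B\<close> is a shift; these
  vectors are eigenvectors of the defect, with eigenvalues \<open>r\<^sup>n\<close>.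
\<close>

definition wandering :: "'h set"
  where "wandering = {cop_apply (B ^ n) k | n k. bs k = 0}"

lemma e_wandering: "bs k = 0 \<Longrightarrow> e (cop_apply (B ^ n) k) = complex_of_real (r ^ n) *\<^sub>C cop_apply (B ^ n) k"
proof (induction n)
  case 0
  then show ?case using b_bs[of k] by (simp add: scaleC_one)
next
  case (Suc n)
  then show ?case by (simp add: times_cop_apply e_b cop_linear scaleC_scaleC)
qed

lemma bs_wandering:
  "bs k = 0 \<Longrightarrow> bs (cop_apply (B ^ Suc n) k) = complex_of_real (1 - r ^ Suc n) *\<^sub>C cop_apply (B ^ n) k"
  by (simp add: times_cop_apply bs_b e_wandering scaleC_scaleC complex_vector.scale_left_diff_distrib scaleC_one)

abbreviation "residual \<equiv> orth wandering"

lemma residual_b: "x \<in> residual \<Longrightarrow> b x \<in> residual"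
  unfolding orth_def
proof (clarify)
  fix s assume x: "\<forall>s\<in>wandering. cinner s x = 0" and "s \<in> wandering"
  then obtain n k where s: "s = cop_apply (B ^ n) k" "bs k = 0" by (auto simp: wandering_def)
  have "cinner (bs s) x = 0"
  proof (cases n)
    case (Suc m)
    have "cop_apply (B ^ m) k \<in> wandering" using s by (auto simp: wandering_def)
    then show ?thesis using x s Suc by (simp add: bs_wandering cinner_scaleC_left del: power_Suc)
  qed (use s in simp)
  then show "cinner s (b x) = 0" by (simp add: cinner_star_left)
qed

lemma residual_bs: "x \<in> residual \<Longrightarrow> bs x \<in> residual"
  unfolding orth_def
proof (clarify)
  fix s assume x: "\<forall>s\<in>wandering. cinner s x = 0" and "s \<in> wandering"
  then obtain n k where "s = cop_apply (B ^ n) k" "bs k = 0" by (auto simp: wandering_def)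
  then have "b s = cop_apply (B ^ Suc n) k" "bs k = 0" by (simp_all add: times_cop_apply)
  then have "b s \<in> wandering" unfolding wandering_def by blast
  then show "cinner s (bs x) = 0" using x by (simp add: cinner_star_right)
qed

text \<open>
  A vector of the residual space orthogonal to \<open>B\<close> applied to that space is killed by \<open>B\<^sup>*\<close>; then it is
  itself a wandering vector, hence orthogonal to itself.
\<close>

lemma residual_dense_range: "residual \<subseteq> closure (b ` residual)"
proof
  fix x assume x: "x \<in> residual"
  have subR: "complex_vector.subspace residual" by (rule subspace_orth)
  have subbR: "complex_vector.subspace (b ` residual)"
    unfolding complex_vector.subspace_def
  proof (intro conjI ballI allI)
    show "0 \<in> b ` residual" using complex_vector.subspace_0[OF subR] by (intro image_eqI[of _ _ 0]) auto
    fix y assume "y \<in> b ` residual"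
    then obtain y' where y: "y = b y'" "y' \<in> residual" by blast
    then show "c *\<^sub>C y \<in> b ` residual" for c
      using complex_vector.subspace_scale[OF subR y(2), of c]
      by (intro image_eqI[of _ _ "c *\<^sub>C y'"]) (simp_all add: cop_linear)
    fix z assume "z \<in> b ` residual"
    then obtain z' where z: "z = b z'" "z' \<in> residual" by blast
    then show "y + z \<in> b ` residual"
      using complex_vector.subspace_add[OF subR y(2) z(2)] y
      by (intro image_eqI[of _ _ "y' + z'"]) (simp_all add: cop_linear)
  qed
  obtain m where m: "m \<in> closure (b ` residual)"
      "\<And>s. s \<in> closure (b ` residual) \<Longrightarrow> cinner s (x - m) = 0"
    by (rule orthogonal_projection_exists[of "closure (b ` residual)" x])
      (auto intro: subspace_closure subbR)
  have "closure (b ` residual) \<subseteq> residual"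
    by (intro closure_minimal closed_orth) (auto intro: residual_b)
  then have n: "x - m \<in> residual" by (intro complex_vector.subspace_diff[OF subR] x subsetD[OF _ m(1)])
  have "b (bs (x - m)) \<in> closure (b ` residual)"
    by (rule subsetD[OF closure_subset imageI[OF residual_bs[OF n]]])
  from m(2)[OF this] have "cinner (bs (x - m)) (bs (x - m)) = 0" by (simp add: cinner_star_right)
  then have "bs (x - m) = 0" by simp
  then have "x - m \<in> wandering" unfolding wandering_def by (auto intro: exI[of _ 0] exI[of _ "x - m"])
  with n have "cinner (x - m) (x - m) = 0" by (simp add: orth_def)
  then show "x \<in> closure (b ` residual)" using m(1) by simp
qed

text \<open>
  On the orthogonal complement of the wandering vectors \<open>B\<close> has dense range, and passing from
  \<open>w\<close> to \<open>B w\<close> shrinks the Rayleigh quotient of the defect by the factor \<open>r\<close>.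
\<close>

lemma residual_rayleigh: "x \<in> residual \<Longrightarrow> Re (cinner (e x) x) \<le> r ^ n * (norm x)\<^sup>2"
proof (induction n arbitrary: x)
  case 0
  show ?case by (simp add: e_form)
next
  case (Suc n)
  let ?Q = "{x. Re (cinner (e x) x) \<le> r ^ Suc n * (norm x)\<^sup>2}"
  have "closed ?Q"
    unfolding e_form
    by (intro closed_Collect_le continuous_intros linear_continuous_on cop_apply_bounded_linear)
  moreover have "b ` residual \<subseteq> ?Q"
  proof clarify
    fix w assume w: "w \<in> residual"
    define t where "t = Re (cinner (e w) w)"
    define s where "s = (norm (e w))\<^sup>2"
    define W where "W = (norm w)\<^sup>2"
    have "cinner (e (b w)) (b w) = complex_of_real r * (cinner (e w) w - complex_of_real r * cinner (e w) (e w))"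
      by (simp add: e_b cinner_scaleC_left cinner_simps bs_b flip: cinner_star_right)
    then have lhs: "Re (cinner (e (b w)) (b w)) = r * (t - r * s)"
      by (simp add: t_def s_def norm_sq_eq_Re_cinner)
    have bw: "(norm (b w))\<^sup>2 = W - r * t"
    proof -
      have "(norm (b w))\<^sup>2 = Re (cinner (bs (b w)) w)"
        by (simp add: norm_sq_eq_Re_cinner cinner_star_left)
      then show ?thesis by (simp add: bs_b cinner_simps t_def W_def norm_sq_eq_Re_cinner)
    qed
    have "t - r * s \<le> r ^ n * (W - r * t)"
    proof (cases "w = 0")
      case False
      then have W: "W > 0" by (simp add: W_def)
      have "\<bar>t\<bar> \<le> norm (e w) * norm w"
        unfolding t_def using abs_Re_le_cmod cauchy_schwarz order_trans by blast
      then have "\<bar>t\<bar>\<^sup>2 \<le> (norm (e w) * norm w)\<^sup>2" by (rule power_mono) simp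
      then have "t\<^sup>2 \<le> s * W" by (simp add: s_def W_def power_mult_distrib)
      then have "t\<^sup>2 / W \<le> s" using W by (simp add: field_simps)
      then have "r * (t\<^sup>2 / W) \<le> r * s" using r by (intro mult_left_mono) auto
      then have "t - r * s \<le> t - r * (t\<^sup>2 / W)" by simp
      also have "\<dots> = (t / W) * (W - r * t)" using W by (simp add: field_simps power2_eq_square)
      also have "\<dots> \<le> r ^ n * (W - r * t)"
      proof (rule mult_right_mono)
        show "t / W \<le> r ^ n" using Suc.IH[OF w] W by (simp add: t_def W_def field_simps)
        show "0 \<le> W - r * t" unfolding bw[symmetric] by simp
      qed
      finally show ?thesis .
    qed (simp add: t_def s_def W_def)
    then show "Re (cinner (e (b w)) (b w)) \<le> r ^ Suc n * (norm (b w))\<^sup>2"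
      using r by (simp add: lhs bw)
  qed
  ultimately have "closure (b ` residual) \<subseteq> ?Q" by (rule closure_minimal[rotated])
  then show ?case using Suc.prems residual_dense_range by blast
qed

text \<open>
  By iteration the quadratic form of the positive operator \<open>e\<close> vanishes on the residual space.
\<close>

lemma residual_e: 
  assumes "x \<in> residual"
  shows "e x = 0"
proof -
  have "(\<lambda>n. r ^ n * (norm x)\<^sup>2) \<longlonglongrightarrow> 0 * (norm x)\<^sup>2"
    using r by (intro tendsto_mult LIMSEQ_power_zero tendsto_const) auto
  then have "Re (cinner (e x) x) \<le> 0 * (norm x)\<^sup>2"
    by (rule LIMSEQ_le_const) (use residual_rayleigh[OF assms] in blast)
  then have "(norm (e x))\<^sup>2 \<le> 0" using norm_e_sq_le[of x] by linarith
  then show ?thesis by simp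
qed

lemma unitary_on_ker_defect:
  assumes "e x = 0"
  shows "bs (b x) = x" "b (bs x) = x"
  using assms by (simp_all add: bs_b b_bs complex_vector.scale_zero_right)

subsection \<open>The ladder generated by a wandering vector\<close>

definition weight :: "nat \<Rightarrow> real"
  where "weight n = sqrt (1 - r ^ Suc n)"

lemma weight_pos: "weight n > 0"
  using r power_Suc_less_one[of r n] by (simp add: weight_def)

lemma weight_sq: "(weight n)\<^sup>2 = 1 - r ^ Suc n"
  using weight_pos[of n] by (simp add: weight_def)

text \<open>The normalised vectors \<open>B\<^sup>n k\<close>: the factors are the weights of the disc generator.\<close>

primrec ladder :: "'h \<Rightarrow> nat \<Rightarrow> 'h" where
  "ladder k 0 = k"
| "ladder k (Suc n) = complex_of_real (inverse (weight n)) *\<^sub>C b (ladder k n)"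

lemma b_ladder: "b (ladder k n) = complex_of_real (weight n) *\<^sub>C ladder k (Suc n)"
  using weight_pos[of n] by (simp add: scaleC_scaleC scaleC_one)

lemma e_ladder: "bs k = 0 \<Longrightarrow> e (ladder k n) = complex_of_real (r ^ n) *\<^sub>C ladder k n"
proof (induction n)
  case 0
  then show ?case using b_bs[of k] by (simp add: scaleC_one)
next
  case (Suc n)
  then show ?case by (simp add: cop_linear e_b scaleC_scaleC mult_ac)
qed

lemma bs_ladder:
  assumes "bs k = 0"
  shows "bs (ladder k (Suc n)) = complex_of_real (weight n) *\<^sub>C ladder k n"
proof -
  have "bs (ladder k (Suc n)) = complex_of_real (inverse (weight n) * (weight n)\<^sup>2) *\<^sub>C ladder k n"
    by (simp add: cop_linear bs_b e_ladder[OF assms] scaleC_scaleC weight_sq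
        complex_vector.scale_left_diff_distrib complex_vector.scale_right_diff_distrib scaleC_one algebra_simps)
  then show ?thesis using weight_pos[of n] by (simp add: power2_eq_square)
qed

text \<open>
  Different rungs are eigenvectors of the self-adjoint defect for different eigenvalues.
\<close>

lemma cinner_ladder:
  assumes k: "bs k = 0" "bs k' = 0"
  shows "cinner (ladder k m) (ladder k' n) = (if m = n then cinner k k' else 0)"
proof (cases "m = n")
  case True
  have "cinner (ladder k n) (ladder k' n) = cinner k k'"
  proof (induction n)
    case (Suc n)
    have "cinner (ladder k (Suc n)) (ladder k' (Suc n)) =
        complex_of_real (inverse (weight n)) * cinner (ladder k n) (bs (ladder k' (Suc n)))"
      by (simp add: cinner_simps cinner_star_right)
    also have "\<dots> = cinner (ladder k n) (ladder k' n)"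
      unfolding bs_ladder[OF k(2)] using weight_pos[of n] by (simp add: cinner_simps)
    finally show ?case using Suc by simp
  qed simp
  then show ?thesis using True by simp
next
  case False
  have "complex_of_real (r ^ m) * cinner (ladder k m) (ladder k' n) =
      complex_of_real (r ^ n) * cinner (ladder k m) (ladder k' n)"
    using e_self_adjoint[of "ladder k m" "ladder k' n"]
    by (simp add: e_ladder k cinner_simps)
  moreover have "complex_of_real (r ^ m) \<noteq> complex_of_real (r ^ n)"
    unfolding of_real_eq_iff using r False by (simp add: power_inject_exp')
  ultimately show ?thesis using False by (simp del: of_real_power)
qed

lemma power_eq_ladder: "\<exists>c. cop_apply (B ^ n) k = c *\<^sub>C ladder k n"
proof (induction n)
  case 0
  show ?case by (intro exI[of _ 1]) (simp add: scaleC_one)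
next
  case (Suc n)
  then obtain c where "cop_apply (B ^ n) k = c *\<^sub>C ladder k n" by blast
  then show ?case
    by (intro exI[of _ "c * complex_of_real (weight n)"])
      (simp add: times_cop_apply cop_linear b_ladder scaleC_scaleC del: ladder.simps)
qed

end

section \<open>Operators on square summable sequences\<close>

lemma ell2_eqI: "(\<And>n. ell2_coeff x n = ell2_coeff y n) \<Longrightarrow> x = y"
  by (simp add: ell2_coeff_inject[symmetric] fun_eq_iff)

lemma cinner_basis_left: "cinner (ell2_basis n) x = ell2_coeff x n"
proof -
  have "(\<lambda>k. cnj (if k = n then 1 else 0) * ell2_coeff x k) = (\<lambda>k. if k = n then ell2_coeff x k else 0)"
    by auto
  then show ?thesis
    using sums_unique[OF sums_single[of n "ell2_coeff x"]]
    by (simp add: cinner_ell2.rep_eq ell2_basis.rep_eq)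
qed

lemma cinner_basis_basis: "cinner (ell2_basis m) (ell2_basis n) = (if m = n then 1 else 0)"
  by (simp add: cinner_basis_left ell2_basis.rep_eq)

lemma norm_basis [simp]: "norm (ell2_basis n) = 1"
proof -
  have "(norm (ell2_basis n))\<^sup>2 = 1" by (simp add: norm_sq_eq_Re_cinner cinner_basis_basis)
  then show ?thesis by (simp add: power2_eq_1_iff) (metis norm_ge_zero neg_0_le_iff_le not_one_le_zero)
qed

lemma ell2_coeff_star: "ell2_coeff (cop_apply (star A) x) n = cinner (cop_apply A (ell2_basis n)) x"
  by (simp add: cinner_star_right flip: cinner_basis_left)

text \<open>
  Two operators that agree on the basis have adjoints with the same coefficients.
\<close>

lemma cop_eq_on_basis:
  assumes "\<And>n. cop_apply A (ell2_basis n) = cop_apply B (ell2_basis n)"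
  shows "A = B"
proof -
  have "star A = star B" by (intro cop_eqI ell2_eqI) (simp add: ell2_coeff_star assms)
  then show ?thesis by (metis star_star_cop)
qed

lemma ell2_coeff_scaleC [simp]: "ell2_coeff (c *\<^sub>C x) n = c * ell2_coeff x n"
  by (simp add: scaleC_ell2.rep_eq)

lemma ell2_coeff_add [simp]: "ell2_coeff (x + y) n = ell2_coeff x n + ell2_coeff y n"
  by (simp add: plus_ell2.rep_eq)

lemma ell2_coeff_diff [simp]: "ell2_coeff (x - y) n = ell2_coeff x n - ell2_coeff y n"
  by (simp add: minus_ell2.rep_eq)

lemma ell2_coeff_zero [simp]: "ell2_coeff 0 n = 0"
  by (simp add: zero_ell2.rep_eq)

lemma ell2_coeff_sum: "ell2_coeff (sum f I) n = (\<Sum>i\<in>I. ell2_coeff (f i) n)"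
  by (induction I rule: infinite_finite_induct) simp_all

lemma ell2_coeff_basis: "ell2_coeff (ell2_basis n) k = (if k = n then 1 else 0)"
  by (simp add: ell2_basis.rep_eq)

lemma star_weighted_shift_basis:
  assumes "bounded (range w)"
  shows "cop_apply (star (weighted_shift w)) (ell2_basis n) =
    (case n of 0 \<Rightarrow> 0 | Suc m \<Rightarrow> cnj (w m) *\<^sub>C ell2_basis m)"
  by (rule ell2_eqI)
    (auto simp: ell2_coeff_star weighted_shift_basis[OF assms] cinner_simps cinner_basis_basis
      ell2_coeff_basis split: nat.split)

lemma norm_weighted_shift_le:
  assumes b: "\<And>n. cmod (w n) \<le> b"
  shows "norm (weighted_shift w) \<le> b"
proof (rule norm_cop_bound)
  show b0: "0 \<le> b" using b[of 0] norm_ge_zero order_trans by blast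
  fix x
  have bw: "bounded (range w)" using b by (auto simp: bounded_iff)
  show "norm (cop_apply (weighted_shift w) x) \<le> b * norm x"
  proof (rule ell2_norm_le)
    fix k
    let ?s = "\<lambda>n. (cmod (ell2_coeff (cop_apply (weighted_shift w) x) n))\<^sup>2"
    have "sum ?s {..<k} \<le> sum ?s {..<Suc k}" by (rule sum_mono2) auto
    also have "\<dots> = (\<Sum>m<k. (cmod (w m * ell2_coeff x m))\<^sup>2)"
      by (subst sum.lessThan_Suc_shift) (simp add: weighted_shift_coeff[OF bw])
    also have "\<dots> \<le> (\<Sum>m<k. b\<^sup>2 * (cmod (ell2_coeff x m))\<^sup>2)"
      using b by (intro sum_mono) (simp add: norm_mult power_mult_distrib mult_right_mono power_mono)
    also have "\<dots> = b\<^sup>2 * (\<Sum>m<k. (cmod (ell2_coeff x m))\<^sup>2)" by (simp add: sum_distrib_left)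
    also have "\<dots> \<le> b\<^sup>2 * (norm x)\<^sup>2" by (intro mult_left_mono ell2_sum_le) simp
    finally show "sum ?s {..<k} \<le> (b * norm x)\<^sup>2" by (simp add: power_mult_distrib)
  qed (use b0 in simp)
qed

abbreviation "shift \<equiv> unilateral_shift"

lemma bounded_range_one: "bounded (range (\<lambda>_::nat. 1 :: complex))"
  by simp

lemma shift_coeff: "ell2_coeff (cop_apply shift x) n = (case n of 0 \<Rightarrow> 0 | Suc m \<Rightarrow> ell2_coeff x m)"
  by (simp add: unilateral_shift_def weighted_shift_coeff[OF bounded_range_one] split: nat.split)

lemma star_shift_coeff: "ell2_coeff (cop_apply (star shift) x) n = ell2_coeff x (Suc n)"
  by (simp add: ell2_coeff_star unilateral_shift_basis cinner_basis_left)

lemma star_shift_shift: "star shift * shift = 1"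
  by (intro cop_eqI ell2_eqI) (simp add: times_cop_apply star_shift_coeff shift_coeff)

lemma shift_power_coeff:
  "ell2_coeff (cop_apply (shift ^ k) x) n = (if k \<le> n then ell2_coeff x (n - k) else 0)"
  by (induction k arbitrary: n) (auto simp: times_cop_apply shift_coeff split: nat.split)

lemma star_shift_power_coeff: "ell2_coeff (cop_apply (star shift ^ k) x) n = ell2_coeff x (n + k)"
  by (induction k arbitrary: n) (auto simp: times_cop_apply star_shift_coeff)

definition matrix_unit :: "nat \<Rightarrow> nat \<Rightarrow> ell2 cop"
  where "matrix_unit m n = shift ^ m * (1 - shift * star shift) * star shift ^ n"

lemma matrix_unit_apply: "cop_apply (matrix_unit m n) x = ell2_coeff x n *\<^sub>C ell2_basis m"
proof (rule ell2_eqI)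
  fix k
  have "k + n - m = Suc (j + n)" if "k - m = Suc j" for j using that by linarith
  then show "ell2_coeff (cop_apply (matrix_unit m n) x) k = ell2_coeff (ell2_coeff x n *\<^sub>C ell2_basis m) k"
    by (auto simp: matrix_unit_def cop_simps shift_power_coeff star_shift_power_coeff shift_coeff
      star_shift_coeff ell2_coeff_basis split: nat.split)
qed

lemma disc_weight_bounds:
  assumes "0 < r" "r < 1"
  shows "0 \<le> 1 - r ^ Suc n" "sqrt (1 - r ^ Suc n) \<le> 1" "1 - r ^ Suc n \<le> sqrt (1 - r ^ Suc n)"
proof -
  show *: "0 \<le> 1 - r ^ Suc n" using assms power_le_one[of r "Suc n"] by linarith
  have "0 \<le> r ^ Suc n" using assms by simp
  then show "sqrt (1 - r ^ Suc n) \<le> 1" by simp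
  show "1 - r ^ Suc n \<le> sqrt (1 - r ^ Suc n)"
  proof (rule real_le_rsqrt)
    have "(1 - r ^ Suc n) * (1 - r ^ Suc n) \<le> (1 - r ^ Suc n) * 1"
      using * \<open>0 \<le> r ^ Suc n\<close> by (intro mult_left_mono) auto
    then show "(1 - r ^ Suc n)\<^sup>2 \<le> 1 - r ^ Suc n" by (simp add: power2_eq_square)
  qed
qed

lemma disc_bounded:
  assumes "0 < r" "r < 1"
  shows "bounded (range (\<lambda>n. complex_of_real (sqrt (1 - r ^ Suc n))))"
  unfolding bounded_iff using disc_weight_bounds[OF assms] by (auto intro!: exI[of _ 1])

lemma star_disc_gen_basis:
  assumes "0 < r" "r < 1"
  shows "cop_apply (star (disc_gen r)) (ell2_basis n) =
    (case n of 0 \<Rightarrow> 0 | Suc m \<Rightarrow> complex_of_real (sqrt (1 - r ^ Suc m)) *\<^sub>C ell2_basis m)"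
  unfolding disc_gen_def star_weighted_shift_basis[OF disc_bounded[OF assms]] by (simp split: nat.split)

lemma disc_gen_defect_basis:
  assumes "0 < r" "r < 1"
  shows "cop_apply (1 - disc_gen r * star (disc_gen r)) (ell2_basis n) = complex_of_real (r ^ n) *\<^sub>C ell2_basis n"
proof (cases n)
  case 0
  then show ?thesis by (simp add: cop_simps star_disc_gen_basis[OF assms] scaleC_one)
next
  case (Suc m)
  let ?w = "sqrt (1 - r ^ Suc m)"
  have "complex_of_real ?w * complex_of_real ?w = complex_of_real (1 - r ^ Suc m)"
    unfolding of_real_mult[symmetric] using disc_weight_bounds(1)[OF assms, of m] by simp
  then have "cop_apply (disc_gen r * star (disc_gen r)) (ell2_basis n) =
      complex_of_real (1 - r ^ Suc m) *\<^sub>C ell2_basis n"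
    by (simp add: Suc times_cop_apply star_disc_gen_basis[OF assms] disc_gen_basis[OF assms] cop_linear
        scaleC_scaleC del: power_Suc of_real_diff)
  then show ?thesis
    by (simp add: minus_cop_apply Suc complex_vector.scale_left_diff_distrib scaleC_one)
qed

lemma quantum_disc_disc_gen:
  assumes "0 < r" "r < 1"
  shows "quantum_disc r (disc_gen r)"
proof
  show "star (disc_gen r) * disc_gen r =
      complex_of_real r *\<^sub>C (disc_gen r * star (disc_gen r)) + complex_of_real (1 - r) *\<^sub>C 1"
  proof (rule cop_eq_on_basis)
    fix n
    have "complex_of_real (sqrt (1 - r ^ Suc n)) * complex_of_real (sqrt (1 - r ^ Suc n)) = complex_of_real (1 - r ^ Suc n)"
      unfolding of_real_mult[symmetric] using disc_weight_bounds(1)[OF assms, of n] by simp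
    then have 1: "cop_apply (star (disc_gen r) * disc_gen r) (ell2_basis n) = complex_of_real (1 - r ^ Suc n) *\<^sub>C ell2_basis n"
      by (simp add: times_cop_apply star_disc_gen_basis[OF assms] disc_gen_basis[OF assms] cop_linear
        scaleC_scaleC del: power_Suc of_real_diff)
    have 2: "cop_apply (disc_gen r * star (disc_gen r)) (ell2_basis n) = complex_of_real (1 - r ^ n) *\<^sub>C ell2_basis n"
      using disc_gen_defect_basis[OF assms, of n]
      by (simp add: minus_cop_apply complex_vector.scale_left_diff_distrib scaleC_one algebra_simps)
    have "r * (1 - r ^ n) + (1 - r) = 1 - r ^ Suc n" by (simp add: algebra_simps)
    then show "cop_apply (star (disc_gen r) * disc_gen r) (ell2_basis n) =
      cop_apply (complex_of_real r *\<^sub>C (disc_gen r * star (disc_gen r)) + complex_of_real (1 - r) *\<^sub>C 1) (ell2_basis n)"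
      by (simp only: 1 cop_apply_plus scaleC_cop_apply one_cop_apply 2 scaleC_scaleC
          scaleC_add_left[symmetric] of_real_mult[symmetric] of_real_add[symmetric])
  qed
qed (use assms in auto)

text \<open>
  The difference is the weighted shift with weights \<open>\<surd>(1 - r\<^sup>n\<^sup>+\<^sup>1) - 1\<close>, of modulus at most \<open>r\<^sup>n\<^sup>+\<^sup>1\<close>, and its
  truncations are combinations of matrix units.
\<close>

lemma disc_gen_minus_shift:
  assumes "0 < r" "r < 1"
  shows "disc_gen r - shift \<in> closure (complex_span {matrix_unit m n | m n. True})"
proof -
  let ?w = "\<lambda>n. complex_of_real (sqrt (1 - r ^ Suc n))"
  let ?F = "\<lambda>N. \<Sum>n<N. (?w n - 1) *\<^sub>C matrix_unit (Suc n) n"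
  have bound: "norm (?F N - (disc_gen r - shift)) \<le> r ^ Suc N" for N
  proof -
    let ?t = "\<lambda>n. if n < N then 0 else 1 - ?w n"
    have tb: "cmod (?t n) \<le> r ^ Suc N" for n
    proof (cases "n < N")
      case False
      have "cmod (1 - ?w n) = \<bar>1 - sqrt (1 - r ^ Suc n)\<bar>"
        by (metis norm_of_real of_real_1 of_real_diff)
      also have "\<dots> \<le> r ^ Suc n" using disc_weight_bounds[OF assms, of n] by linarith
      also have "\<dots> \<le> r ^ Suc N" using assms False by (intro power_decreasing) auto
      finally show ?thesis using False by simp
    qed (use assms in simp)
    then have bt: "bounded (range ?t)" unfolding bounded_iff by blast
    have "?F N - (disc_gen r - shift) = weighted_shift ?t"
    proof (rule cop_eq_on_basis)
      fix n
      have "cop_apply (?F N) (ell2_basis n) = (\<Sum>i<N. if i = n then (?w n - 1) *\<^sub>C ell2_basis (Suc n) else 0)"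
        unfolding sum_cop_apply
        by (intro sum.cong refl)
          (auto simp: scaleC_cop_apply matrix_unit_apply ell2_coeff_basis scaleC_one
            complex_vector.scale_zero_left complex_vector.scale_zero_right)
      also have "\<dots> = (if n < N then (?w n - 1) *\<^sub>C ell2_basis (Suc n) else 0)" by simp
      finally show "cop_apply (?F N - (disc_gen r - shift)) (ell2_basis n) = cop_apply (weighted_shift ?t) (ell2_basis n)"
        by (simp add: minus_cop_apply weighted_shift_basis[OF bt] disc_gen_basis[OF assms]
            unilateral_shift_basis complex_vector.scale_left_diff_distrib scaleC_one complex_vector.scale_zero_left)
    qed
    then show ?thesis using norm_weighted_shift_le[OF tb] by simp
  qed
  have "?F \<longlonglongrightarrow> disc_gen r - shift"
  proof (rule LIM_zero_cancel, rule Lim_null_comparison)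
    show "\<forall>\<^sub>F N in sequentially. norm (?F N - (disc_gen r - shift)) \<le> r ^ Suc N"
      using bound by simp
    show "(\<lambda>N. r ^ Suc N) \<longlonglongrightarrow> 0" using assms by (intro LIMSEQ_Suc LIMSEQ_power_zero) auto
  qed
  moreover have "?F N \<in> complex_span {matrix_unit m n | m n. True}" for N
    by (intro complex_vector.span_sum complex_vector.span_scale complex_vector.span_base) blast
  ultimately show ?thesis unfolding closure_sequential by (intro exI[of _ ?F] conjI allI)
qed

section \<open>The Toeplitz algebra and the symbol map\<close>

lemma shift_in_Toeplitz: "shift \<in> Toeplitz"
  by (auto simp: Toeplitz_def Cstar_generated_def)

lemma closed_Toeplitz: "closed Toeplitz"
  unfolding Toeplitz_def Cstar_generated_def by (rule closed_Inter) auto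

lemma Toeplitz_add: "x \<in> Toeplitz \<Longrightarrow> y \<in> Toeplitz \<Longrightarrow> x + y \<in> Toeplitz"
  and Toeplitz_mult: "x \<in> Toeplitz \<Longrightarrow> y \<in> Toeplitz \<Longrightarrow> x * y \<in> Toeplitz"
  and Toeplitz_star: "x \<in> Toeplitz \<Longrightarrow> star x \<in> Toeplitz"
  and Toeplitz_scaleC: "x \<in> Toeplitz \<Longrightarrow> c *\<^sub>C x \<in> Toeplitz"
  unfolding Toeplitz_def Cstar_generated_def by blast+

lemma Toeplitz_one: "1 \<in> Toeplitz"
  using Toeplitz_mult[OF Toeplitz_star[OF shift_in_Toeplitz] shift_in_Toeplitz] by (simp add: star_shift_shift)

lemma Toeplitz_zero: "0 \<in> Toeplitz"
  using Toeplitz_scaleC[OF Toeplitz_one, of 0] by (simp add: complex_vector.scale_zero_left)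

lemma Toeplitz_minus: "x \<in> Toeplitz \<Longrightarrow> - x \<in> Toeplitz"
  using Toeplitz_scaleC[of x "-1"] by (simp add: complex_vector.scale_minus_left scaleC_one)

lemma Toeplitz_diff: "x \<in> Toeplitz \<Longrightarrow> y \<in> Toeplitz \<Longrightarrow> x - y \<in> Toeplitz"
  using Toeplitz_add[of x "- y"] Toeplitz_minus[of y] by simp

lemma subspace_Toeplitz: "complex_vector.subspace Toeplitz"
  by (simp add: complex_vector.subspace_def Toeplitz_zero Toeplitz_add Toeplitz_scaleC)

lemma Toeplitz_power: "x \<in> Toeplitz \<Longrightarrow> x ^ n \<in> Toeplitz"
  by (induction n) (auto intro: Toeplitz_one Toeplitz_mult)

lemma Toeplitz_sum: "(\<And>i. i \<in> I \<Longrightarrow> f i \<in> Toeplitz) \<Longrightarrow> sum f I \<in> Toeplitz"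
  by (rule complex_vector.subspace_sum[OF subspace_Toeplitz])

lemma matrix_unit_in_Toeplitz: "matrix_unit m n \<in> Toeplitz"
  unfolding matrix_unit_def
  by (intro Toeplitz_mult Toeplitz_diff Toeplitz_power Toeplitz_star Toeplitz_one shift_in_Toeplitz)

lemma disc_gen_in_Toeplitz:
  assumes "0 < r" "r < 1"
  shows "disc_gen r \<in> Toeplitz"
proof -
  have "closure (complex_span {matrix_unit m n | m n. True}) \<subseteq> Toeplitz"
    by (intro closure_minimal closed_Toeplitz complex_vector.span_minimal subspace_Toeplitz)
      (auto intro: matrix_unit_in_Toeplitz)
  then have "disc_gen r - shift \<in> Toeplitz" using disc_gen_minus_shift[OF assms] by blast
  from Toeplitz_add[OF this shift_in_Toeplitz] show ?thesis by simp
qed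

subsection \<open>Completeness of the space of operators\<close>

instance cop :: (complex_hilbert) banach
proof
  fix X :: "nat \<Rightarrow> 'a cop"
  assume X: "Cauchy X"
  have pc: "Cauchy (\<lambda>n. cop_apply (X n) x)" for x
  proof (rule metric_CauchyI)
    fix \<epsilon> :: real assume \<epsilon>: "0 < \<epsilon>"
    then have "0 < \<epsilon> / (norm x + 1)" by (simp add: add_nonneg_pos)
    from metric_CauchyD[OF X this] obtain M where
      M: "\<And>m n. m \<ge> M \<Longrightarrow> n \<ge> M \<Longrightarrow> dist (X m) (X n) < \<epsilon> / (norm x + 1)" by blast
    have "dist (cop_apply (X m) x) (cop_apply (X n) x) < \<epsilon>" if "m \<ge> M" "n \<ge> M" for m n
    proof -
      have "dist (cop_apply (X m) x) (cop_apply (X n) x) \<le> norm (X m - X n) * norm x"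
        using norm_cop_apply[of "X m - X n" x] by (simp add: dist_norm minus_cop_apply)
      also have "\<dots> \<le> norm (X m - X n) * (norm x + 1)" by (intro mult_left_mono) auto
      also have "\<dots> < \<epsilon>" using M[OF that] by (simp add: dist_norm pos_less_divide_eq add_nonneg_pos)
      finally show ?thesis .
    qed
    then show "\<exists>M. \<forall>m\<ge>M. \<forall>n\<ge>M. dist (cop_apply (X m) x) (cop_apply (X n) x) < \<epsilon>" by blast
  qed
  define f where "f x = lim (\<lambda>n. cop_apply (X n) x)" for x
  have f: "(\<lambda>n. cop_apply (X n) x) \<longlonglongrightarrow> f x" for x
    unfolding f_def using Cauchy_convergent[OF pc] by (simp add: convergent_LIMSEQ_iff)
  obtain K where K: "\<And>n. norm (X n) \<le> K"
    using cauchy_imp_bounded[OF X] unfolding bounded_iff by auto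
  have tail: "norm (cop_apply (X n) x - f x) \<le> \<epsilon> * norm x"
    if h: "\<And>m. m \<ge> M \<Longrightarrow> norm (X n - X m) \<le> \<epsilon>" for n x \<epsilon> M
  proof (rule LIMSEQ_le_const2)
    show "(\<lambda>m. norm (cop_apply (X n) x - cop_apply (X m) x)) \<longlonglongrightarrow> norm (cop_apply (X n) x - f x)"
      by (intro tendsto_intros f)
    have "norm (cop_apply (X n) x - cop_apply (X m) x) \<le> \<epsilon> * norm x" if m: "m \<ge> M" for m
      using norm_cop_apply[of "X n - X m" x] mult_right_mono[OF h[OF m], of "norm x"]
      by (simp add: minus_cop_apply)
    then show "\<exists>N. \<forall>m\<ge>N. norm (cop_apply (X n) x - cop_apply (X m) x) \<le> \<epsilon> * norm x" by blast
  qed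
  obtain A where A: "\<And>x. cop_apply A x = f x"
  proof (rule cop_of_function[of f K])
    fix x y :: 'a and c
    show "f (x + y) = f x + f y"
      by (rule LIMSEQ_unique[OF f]) (simp add: cop_linear tendsto_add f)
    show "f (c *\<^sub>C x) = c *\<^sub>C f x"
      by (rule LIMSEQ_unique[OF f]) (simp add: cop_linear bounded_linear.tendsto[OF bounded_linear_scaleC f])
    show "norm (f x) \<le> norm x * K"
    proof (rule LIMSEQ_le_const2[OF tendsto_norm[OF f]])
      have "norm (cop_apply (X n) x) \<le> norm x * K" for n
        using norm_cop_apply[of "X n" x] mult_right_mono[OF K[of n], of "norm x"] by (simp add: mult.commute)
      then show "\<exists>N. \<forall>n\<ge>N. norm (cop_apply (X n) x) \<le> norm x * K" by blast
    qed
  qed blast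
  have "X \<longlonglongrightarrow> A"
  proof (rule LIMSEQ_I)
    fix \<epsilon> :: real assume \<epsilon>: "0 < \<epsilon>"
    then have "0 < \<epsilon> / 2" by simp
    from metric_CauchyD[OF X this] obtain M where
      M: "\<And>m n. m \<ge> M \<Longrightarrow> n \<ge> M \<Longrightarrow> dist (X m) (X n) < \<epsilon> / 2" by blast
    have "norm (X n - A) < \<epsilon>" if n: "n \<ge> M" for n
    proof -
      have "norm (cop_apply (X n) x - f x) \<le> \<epsilon> / 2 * norm x" for x
        by (rule tail[where M = M]) (use M[OF n] in \<open>simp add: dist_norm less_imp_le\<close>)
      then have "norm (X n - A) \<le> \<epsilon> / 2"
        using \<epsilon> by (intro norm_cop_bound) (simp_all add: minus_cop_apply A)
      then show ?thesis using \<epsilon> by simp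
    qed
    then show "\<exists>M. \<forall>n\<ge>M. norm (X n - A) < \<epsilon>" by blast
  qed
  then show "convergent X" by (rule convergentI)
qed

lemma neumann_series:
  fixes s :: "'h::complex_hilbert cop"
  assumes "norm s < 1"
  obtains Y where "Y = s + s * Y" "(\<lambda>n. \<Sum>i<n. s ^ Suc i) \<longlonglongrightarrow> Y"
proof -
  have n: "norm (s ^ Suc i) \<le> norm s ^ Suc i" for i
  proof (induction i)
    case (Suc i)
    have "norm (s ^ Suc (Suc i)) \<le> norm s * norm (s ^ Suc i)"
      unfolding power_Suc[of s "Suc i"] by (rule norm_mult_ineq)
    also have "\<dots> \<le> norm s * norm s ^ Suc i" by (intro mult_left_mono Suc) simp
    finally show ?case by simp
  qed simp
  have "summable (\<lambda>i. norm s ^ Suc i)"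
    using assms by (simp add: summable_mult summable_geometric)
  then have sm: "summable (\<lambda>i. s ^ Suc i)"
    by (rule summable_comparison_test[rotated]) (use n in blast)
  define Y where "Y = suminf (\<lambda>i. s ^ Suc i)"
  have "Y = s ^ Suc 0 + suminf (\<lambda>i. s ^ Suc (Suc i))"
    unfolding Y_def using suminf_split_head[OF sm] by (simp add: algebra_simps)
  also have "suminf (\<lambda>i. s ^ Suc (Suc i)) = s * Y"
    unfolding Y_def power_Suc[of s "Suc _"]
    by (rule bounded_linear.suminf[OF bounded_linear_mult_right sm, symmetric])
  finally have "Y = s + s * Y" by simp
  moreover have "(\<lambda>n. \<Sum>i<n. s ^ Suc i) \<longlonglongrightarrow> Y"
    using summable_LIMSEQ[OF sm] by (simp only: Y_def)
  ultimately show ?thesis by (rule that)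
qed

subsection \<open>Operations on continuous functions\<close>

lemma bcontfun_apply_simps [simp]:
  "apply_bcontfun (f * g) u = apply_bcontfun f u * apply_bcontfun g u"
  "apply_bcontfun (1 :: 'x::topological_space \<Rightarrow>\<^sub>C 'b::{real_normed_algebra,monoid_mult}) u = 1"
  by (simp_all add: times_bcontfun.rep_eq one_bcontfun.rep_eq)

lemma bcontfun_apply_scaleC [simp]: "apply_bcontfun (c *\<^sub>C F) u = c *\<^sub>C apply_bcontfun F u"
  by (simp add: scaleC_bcontfun.rep_eq)

lemma scaleC_complex_mult [simp]: "c *\<^sub>C (x :: complex) = c * x"
  by (simp add: scaleC_complex_def)

lemma apply_star_bcontfun:
  fixes F :: "'x::topological_space \<Rightarrow>\<^sub>C 'b::{metric_space,star}"
  assumes "\<And>x y :: 'b. dist (star x) (star y) \<le> dist x y"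
  shows "apply_bcontfun (star F) u = star (apply_bcontfun F u)"
proof -
  have "(\<lambda>u. star (apply_bcontfun F u)) \<in> bcontfun"
    unfolding bcontfun_def mem_Collect_eq
  proof
    have "continuous_on UNIV (star :: 'b \<Rightarrow> 'b)"
      unfolding continuous_on_iff using assms le_less_trans by blast
    then show "continuous_on UNIV (\<lambda>u. star (apply_bcontfun F u))"
      by (rule continuous_on_compose2) auto
    obtain a K where "\<And>u. dist a (apply_bcontfun F u) \<le> K"
      using apply_bcontfun[of F] unfolding bcontfun_def bounded_def by auto
    then have "dist (star a) (star (apply_bcontfun F u)) \<le> K" for u
      using assms[of a "apply_bcontfun F u"] by (meson order_trans)
    then show "bounded (range (\<lambda>u. star (apply_bcontfun F u)))"
      unfolding bounded_def by blast
  qed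
  then show ?thesis by (simp add: star_bcontfun_def Bcontfun_inverse)
qed

lemma apply_star_complex [simp]: "apply_bcontfun (star f) u = cnj (apply_bcontfun f u)"
  for f :: "'x::topological_space \<Rightarrow>\<^sub>C complex"
  by (subst apply_star_bcontfun) (simp_all add: star_complex_def dist_norm flip: complex_cnj_diff)

lemma apply_star_cop [simp]: "apply_bcontfun (star F) u = star (apply_bcontfun F u)"
  for F :: "'x::topological_space \<Rightarrow>\<^sub>C 'h::complex_hilbert cop"
  by (subst apply_star_bcontfun) (simp_all add: dist_norm flip: star_diff_cop)

lemma tensor_apply [simp]: "apply_bcontfun (tensor t f) u = apply_bcontfun f u *\<^sub>C t"
  by (simp add: tensor.rep_eq)

lemma U_pow_apply: "apply_bcontfun (U_pow k) u = circle_val u powi k"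
  by (simp add: U_pow.rep_eq)

lemma circle_val_nz [simp]: "circle_val u \<noteq> 0"
  using norm_circle_val[of u] by auto

lemma circle_val_one [simp]: "circle_val 1 = 1"
  by (rule one_circle.rep_eq)

lemma circle_val_mult: "circle_val (u * v) = circle_val u * circle_val v"
  by (rule times_circle.rep_eq)

lemma U_pow_mult: "U_pow k * U_pow l = U_pow (k + l)"
  by (rule bcontfun_eqI) (simp add: U_pow_apply power_int_add)

lemma U_pow_zero: "U_pow 0 = 1"
  by (rule bcontfun_eqI) (simp add: U_pow_apply)

lemma star_U_pow: "star (U_pow k) = U_pow (- k)"
  by (rule bcontfun_eqI) (simp only: apply_star_complex U_pow_apply cnj_powi norm_circle_val)

lemma continuous_on_circle_times: "continuous_on UNIV (\<lambda>p :: circle \<times> circle. fst p * snd p)"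
proof -
  have "continuous_on UNIV (\<lambda>p. circle_val (fst p) * circle_val (snd p))"
    by (intro continuous_intros continuous_on_compose2[OF continuous_on_circle_val[of UNIV]]) auto
  then show ?thesis
    unfolding continuous_on_iff by (simp add: dist_circle_def circle_val_mult)
qed

lemma apply_W_twist: "apply_bcontfun (W_twist f) (x, y) = apply_bcontfun f (x, x * y)"
proof -
  have "(\<lambda>(x, y). apply_bcontfun f (x, x * y)) = (\<lambda>p. apply_bcontfun f (fst p, fst p * snd p))"
    by auto
  moreover have "(\<lambda>p. apply_bcontfun f (fst p, fst p * snd p)) \<in> bcontfun"
  proof (rule bcontfun_normI)
    show "continuous_on UNIV (\<lambda>p. apply_bcontfun f (fst p, fst p * snd p))"
      by (intro continuous_on_compose2[OF continuous_on_apply_bcontfun[of UNIV]] continuous_intros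
        continuous_on_circle_times) auto
  qed (rule norm_bounded)
  ultimately show ?thesis by (simp add: W_twist_def Bcontfun_inverse)
qed

subsection \<open>The symbol map is contractive\<close>

locale symbol =
  fixes \<sigma> :: "ell2 cop \<Rightarrow> circle \<Rightarrow>\<^sub>C complex"
  assumes symbol_map: "symbol_map \<sigma>"
begin

lemma symbol_add: "x \<in> Toeplitz \<Longrightarrow> y \<in> Toeplitz \<Longrightarrow> \<sigma> (x + y) = \<sigma> x + \<sigma> y"
  and symbol_mult: "x \<in> Toeplitz \<Longrightarrow> y \<in> Toeplitz \<Longrightarrow> \<sigma> (x * y) = \<sigma> x * \<sigma> y"
  and symbol_star: "x \<in> Toeplitz \<Longrightarrow> \<sigma> (star x) = star (\<sigma> x)"
  and symbol_scaleC: "x \<in> Toeplitz \<Longrightarrow> \<sigma> (c *\<^sub>C x) = c *\<^sub>C \<sigma> x"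
  and symbol_shift: "\<sigma> shift = U_pow 1"
  using symbol_map by (auto simp: symbol_map_def star_hom_on_def)

lemma symbol_one: "\<sigma> 1 = 1"
proof -
  have "\<sigma> (star shift * shift) = U_pow (-1) * U_pow 1"
    by (simp add: symbol_mult symbol_star symbol_shift Toeplitz_star shift_in_Toeplitz star_U_pow)
  then show ?thesis by (simp add: star_shift_shift U_pow_mult U_pow_zero)
qed

lemma symbol_zero: "\<sigma> 0 = 0"
  using symbol_scaleC[OF Toeplitz_zero, of 0] by (simp add: complex_vector.scale_zero_left)

lemma symbol_minus: "x \<in> Toeplitz \<Longrightarrow> \<sigma> (- x) = - \<sigma> x"
  using symbol_scaleC[of x "-1"] by (simp add: complex_vector.scale_minus_left scaleC_one)

lemma symbol_diff: "x \<in> Toeplitz \<Longrightarrow> y \<in> Toeplitz \<Longrightarrow> \<sigma> (x - y) = \<sigma> x - \<sigma> y"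
  using symbol_add[of x "- y"] by (simp add: symbol_minus Toeplitz_minus)

lemma symbol_sum: "(\<And>i. i \<in> I \<Longrightarrow> f i \<in> Toeplitz) \<Longrightarrow> \<sigma> (sum f I) = (\<Sum>i\<in>I. \<sigma> (f i))"
  by (induction I rule: infinite_finite_induct) (simp_all add: symbol_zero symbol_add Toeplitz_sum)

text \<open>
  A character takes no value larger than the norm: if \<open>\<chi>(s) = 1\<close> with \<open>\<parallel>s\<parallel> < 1\<close>, the sum
  \<open>Y = s + s\<^sup>2 + \<dots>\<close> satisfies \<open>Y = s + s Y\<close>, whence \<open>\<chi>(Y) = 1 + \<chi>(Y)\<close>.
\<close>

lemma cmod_symbol_le:
  assumes t: "t \<in> Toeplitz"
  shows "cmod (apply_bcontfun (\<sigma> t) u) \<le> norm t"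
proof (rule ccontr)
  define c where "c = apply_bcontfun (\<sigma> t) u"
  assume "\<not> cmod (apply_bcontfun (\<sigma> t) u) \<le> norm t"
  then have c: "norm t < cmod c" by (simp add: c_def)
  then have c0: "cmod c > 0" using norm_ge_zero[of t] by linarith
  define s where "s = inverse c *\<^sub>C t"
  have sT: "s \<in> Toeplitz" unfolding s_def by (rule Toeplitz_scaleC[OF t])
  have "norm s < 1" using c c0 by (simp add: s_def norm_scaleC norm_divide field_simps)
  then obtain Y where Y: "Y = s + s * Y" "(\<lambda>n. \<Sum>i<n. s ^ Suc i) \<longlonglongrightarrow> Y" by (rule neumann_series)
  have "(\<Sum>i<n. s ^ Suc i) \<in> Toeplitz" for n
    by (intro Toeplitz_sum Toeplitz_power sT)
  then have YT: "Y \<in> Toeplitz" using closed_sequentially[OF closed_Toeplitz _ Y(2)] by blast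
  have "apply_bcontfun (\<sigma> s) u = 1" using c0 by (simp add: s_def symbol_scaleC[OF t] c_def)
  moreover have "apply_bcontfun (\<sigma> Y) u = apply_bcontfun (\<sigma> (s + s * Y)) u" using Y(1) by simp
  ultimately show False by (simp add: symbol_add symbol_mult sT YT Toeplitz_mult)
qed

lemma norm_symbol_le: "t \<in> Toeplitz \<Longrightarrow> norm (\<sigma> t) \<le> norm t"
  by (rule norm_bound) (rule cmod_symbol_le)

lemma symbol_matrix_unit: "\<sigma> (matrix_unit m n) = 0"
proof -
  have "\<sigma> (1 - shift * star shift) = 0"
    by (simp add: symbol_diff symbol_mult symbol_star symbol_shift symbol_one star_U_pow U_pow_mult U_pow_zero
        Toeplitz_one Toeplitz_mult Toeplitz_star shift_in_Toeplitz)
  moreover have "f * 0 * g = 0" for f g :: "circle \<Rightarrow>\<^sub>C complex" by (rule bcontfun_eqI) simp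
  ultimately show ?thesis
    by (simp add: matrix_unit_def symbol_mult Toeplitz_mult Toeplitz_power Toeplitz_diff Toeplitz_one
        Toeplitz_star shift_in_Toeplitz)
qed

lemma symbol_continuous: "continuous_on Toeplitz \<sigma>"
  unfolding continuous_on_iff
proof (intro ballI allI impI)
  fix x and \<epsilon> :: real assume x: "x \<in> Toeplitz" "0 < \<epsilon>"
  have "dist (\<sigma> y) (\<sigma> x) \<le> dist y x" if "y \<in> Toeplitz" for y
    using norm_symbol_le[OF Toeplitz_diff[OF that x(1)]] by (simp add: dist_norm symbol_diff that x)
  then show "\<exists>d>0. \<forall>y\<in>Toeplitz. dist y x < d \<longrightarrow> dist (\<sigma> y) (\<sigma> x) < \<epsilon>"
    using x(2) le_less_trans by blast
qed

lemma closed_symbol_kernel: "closed {t \<in> Toeplitz. \<sigma> t = 0}"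
proof -
  have "{t \<in> Toeplitz. \<sigma> t = 0} = Toeplitz \<inter> \<sigma> -` {0}" by auto
  then show ?thesis
    using continuous_closed_preimage[OF symbol_continuous closed_Toeplitz, of "{0}"] by simp
qed

text \<open>
  The symbol vanishes on \<open>1 - S S\<^sup>*\<close>, hence on matrix units, hence by continuity on the difference of
  the disc generator and the shift.
\<close>

lemma symbol_disc_gen:
  assumes "0 < r" "r < 1"
  shows "\<sigma> (disc_gen r) = U_pow 1"
proof -
  have "complex_vector.subspace {t \<in> Toeplitz. \<sigma> t = 0}"
    by (auto simp: complex_vector.subspace_def Toeplitz_zero symbol_zero Toeplitz_add symbol_add
        Toeplitz_scaleC symbol_scaleC complex_vector.scale_zero_right)
  then have "closure (complex_span {matrix_unit m n | m n. True}) \<subseteq> {t \<in> Toeplitz. \<sigma> t = 0}"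
    by (intro closure_minimal closed_symbol_kernel complex_vector.span_minimal)
      (auto simp: matrix_unit_in_Toeplitz symbol_matrix_unit)
  then have "\<sigma> (disc_gen r - shift) = 0" using disc_gen_minus_shift[OF assms] by blast
  then show ?thesis
    by (simp add: symbol_diff disc_gen_in_Toeplitz[OF assms] shift_in_Toeplitz symbol_shift)
qed

end

section \<open>The disc generator attains all norms\<close>

lemma star_eval_scalar_one:
  "star_eval (\<lambda>g. \<alpha> g *\<^sub>C (1 :: 'h::complex_hilbert cop)) f = star_eval \<alpha> f *\<^sub>C 1"
proof -
  have "star_eval \<alpha> f *\<^sub>C (1 :: 'h cop) = star_eval (\<lambda>g. \<alpha> g *\<^sub>C (1 :: 'h cop)) f"
    by (rule hom_star_eval)
      (simp_all add: scaleC_add_left scaleC_times_left scaleC_scaleC scaleC_one star_scaleC_cop star_complex_def)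
  then show ?thesis ..
qed

lemma (in symbol) symbol_star_eval:
  assumes "\<And>g. v g \<in> Toeplitz"
  shows "star_eval v f \<in> Toeplitz" "\<sigma> (star_eval v f) = star_eval (\<lambda>g. \<sigma> (v g)) f"
proof -
  have w: "eval_word v l \<in> Toeplitz \<and> \<sigma> (eval_word v l) = eval_word (\<lambda>g. \<sigma> (v g)) l" for l
  proof (induction l)
    case (Cons x l)
    have "eval_letter v x \<in> Toeplitz \<and> \<sigma> (eval_letter v x) = eval_letter (\<lambda>g. \<sigma> (v g)) x"
      using assms by (auto simp: eval_letter_def Toeplitz_star symbol_star split: prod.split)
    then show ?case using Cons by (simp add: Toeplitz_mult symbol_mult)
  qed (simp add: Toeplitz_one symbol_one)
  have "star_eval v f \<in> Toeplitz \<and> \<sigma> (star_eval v f) = star_eval (\<lambda>g. \<sigma> (v g)) f"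
    by (induction f rule: free_star_algebra_induct)
      (simp_all add: Toeplitz_zero symbol_zero star_eval_single w Toeplitz_scaleC symbol_scaleC
        star_eval_add Toeplitz_add symbol_add)
  then show "star_eval v f \<in> Toeplitz" "\<sigma> (star_eval v f) = star_eval (\<lambda>g. \<sigma> (v g)) f" by simp_all
qed

lemma apply_star_eval_complex:
  fixes v :: "'g \<Rightarrow> 'x::topological_space \<Rightarrow>\<^sub>C complex"
  shows "apply_bcontfun (star_eval v f) u = star_eval (\<lambda>g. apply_bcontfun (v g) u) f"
  by (rule hom_star_eval[where \<pi> = "\<lambda>F. apply_bcontfun F u"]) (simp_all add: star_complex_def)

lemma circle_obtain:
  assumes "cmod c = 1"
  obtains u where "circle_val u = c"
  using assms Circle_inverse[of c] that by auto

context quantum_disc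
begin

text \<open>
  The ladder over a unit vector \<open>k\<close> in the kernel of \<open>B\<^sup>*\<close> is a copy of the standard basis;
  \<open>ladder_pairs k\<close> is the graph of the resulting identification on finite linear combinations.
\<close>

definition ladder_pairs :: "'h \<Rightarrow> ('h \<times> ell2) set"
  where "ladder_pairs k = complex_span {(ladder k n, ell2_basis n) | n. True}"

lemma cinner_ladder_pairs:
  assumes k: "bs k = 0" "bs k' = 0" and x: "(x, t) \<in> ladder_pairs k" and x': "(x', t') \<in> ladder_pairs k'"
  shows "cinner x x' = cinner k k' * cinner t t'"
proof -
  have 1: "cinner (ladder k n) (fst X) = cinner k k' * cinner (ell2_basis n) (snd X)"
    if "X \<in> ladder_pairs k'" for X n
    using that unfolding ladder_pairs_def
  proof (rule complex_vector.span_induct)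
    show "complex_vector.subspace {X. cinner (ladder k n) (fst X) = cinner k k' * cinner (ell2_basis n) (snd X)}"
      by (auto simp: complex_vector.subspace_def cinner_simps scaleC_prod_def algebra_simps)
  qed (auto simp: cinner_ladder k cinner_basis_basis)
  have "cinner (fst X) x' = cinner k k' * cinner (snd X) t'" if "X \<in> ladder_pairs k" for X
    using that unfolding ladder_pairs_def
  proof (rule complex_vector.span_induct)
    show "complex_vector.subspace {X. cinner (fst X) x' = cinner k k' * cinner (snd X) t'}"
      by (auto simp: complex_vector.subspace_def cinner_simps scaleC_prod_def algebra_simps)
  qed (use 1[OF x'] in auto)
  from this[OF x] show ?thesis by simp
qed

lemma subspace_ladder_pairs: "complex_vector.subspace (ladder_pairs k)"
  unfolding ladder_pairs_def by (rule complex_vector.subspace_span)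

lemma ladder_pairs_linear:
  shows "(0, 0) \<in> ladder_pairs k"
    and "(x, t) \<in> ladder_pairs k \<Longrightarrow> (y, s) \<in> ladder_pairs k \<Longrightarrow> (x + y, t + s) \<in> ladder_pairs k"
    and "(x, t) \<in> ladder_pairs k \<Longrightarrow> (c *\<^sub>C x, c *\<^sub>C t) \<in> ladder_pairs k"
  using complex_vector.subspace_0[OF subspace_ladder_pairs]
    complex_vector.subspace_add[OF subspace_ladder_pairs, of "(x, t)" k "(y, s)"]
    complex_vector.subspace_scale[OF subspace_ladder_pairs, of "(x, t)" k c]
  by (simp_all add: zero_prod_def scaleC_prod_def)

lemma ladder_pairs_disc:
  assumes k: "bs k = 0" and x: "(x, t) \<in> ladder_pairs k"
  shows "(b x, cop_apply (disc_gen r) t) \<in> ladder_pairs k"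
    and "(bs x, cop_apply (star (disc_gen r)) t) \<in> ladder_pairs k"
proof -
  have base: "(ladder k n, ell2_basis n) \<in> ladder_pairs k" for n
    unfolding ladder_pairs_def by (rule complex_vector.span_base) blast
  have "(b (fst X), cop_apply (disc_gen r) (snd X)) \<in> ladder_pairs k \<and>
      (bs (fst X), cop_apply (star (disc_gen r)) (snd X)) \<in> ladder_pairs k" if "X \<in> ladder_pairs k" for X
    using that unfolding ladder_pairs_def[of k]
  proof (rule complex_vector.span_induct, fold ladder_pairs_def)
    show "complex_vector.subspace {X. (b (fst X), cop_apply (disc_gen r) (snd X)) \<in> ladder_pairs k \<and>
      (bs (fst X), cop_apply (star (disc_gen r)) (snd X)) \<in> ladder_pairs k}"
      by (auto simp: complex_vector.subspace_def ladder_pairs_linear cop_linear scaleC_prod_def)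
    fix X :: "'h \<times> ell2" assume "X \<in> {(ladder k n, ell2_basis n) | n. True}"
    then obtain n where X: "X = (ladder k n, ell2_basis n)" by blast
    have "(b (ladder k n), cop_apply (disc_gen r) (ell2_basis n)) \<in> ladder_pairs k"
      using ladder_pairs_linear(3)[OF base[of "Suc n"], of "complex_of_real (weight n)"]
      by (simp add: b_ladder disc_gen_basis[OF r] weight_def del: ladder.simps)
    moreover have "(bs (ladder k n), cop_apply (star (disc_gen r)) (ell2_basis n)) \<in> ladder_pairs k"
    proof (cases n)
      case 0
      then show ?thesis by (simp add: k star_disc_gen_basis[OF r] ladder_pairs_linear)
    next
      case (Suc m)
      then show ?thesis
        using ladder_pairs_linear(3)[OF base[of m], of "complex_of_real (weight m)"]
        by (simp add: bs_ladder[OF k] star_disc_gen_basis[OF r] weight_def del: ladder.simps)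
    qed
    ultimately show "(b (fst X), cop_apply (disc_gen r) (snd X)) \<in> ladder_pairs k \<and>
      (bs (fst X), cop_apply (star (disc_gen r)) (snd X)) \<in> ladder_pairs k" by (simp add: X)
  qed
  from this[OF x] show "(b x, cop_apply (disc_gen r) t) \<in> ladder_pairs k"
    "(bs x, cop_apply (star (disc_gen r)) t) \<in> ladder_pairs k" by simp_all
qed

text \<open>
  Orthonormalising the finitely many vectors of \<open>ker B\<^sup>*\<close> that occur in \<open>x\<close> makes the ladders over them
  orthogonal to each other.
\<close>

lemma wandering_span_ladders:
  assumes "x \<in> complex_span wandering"
  obtains Q where "finite Q" "\<And>k. k \<in> Q \<Longrightarrow> bs k = 0" "\<And>k. k \<in> Q \<Longrightarrow> norm k = 1"
    "\<And>k k'. k \<in> Q \<Longrightarrow> k' \<in> Q \<Longrightarrow> k \<noteq> k' \<Longrightarrow> cinner k k' = 0"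
    "x \<in> complex_span {ladder k n | k n. k \<in> Q}"
proof -
  obtain F a where F: "finite F" "F \<subseteq> wandering" "x = (\<Sum>w\<in>F. a w *\<^sub>C w)"
    using assms unfolding complex_vector.span_explicit by blast
  have "\<forall>w\<in>F. \<exists>p. w = cop_apply (B ^ fst p) (snd p) \<and> bs (snd p) = 0"
    using F(2) by (auto simp: wandering_def)
  then obtain P where P: "\<And>w. w \<in> F \<Longrightarrow> w = cop_apply (B ^ fst (P w)) (snd (P w))"
    "\<And>w. w \<in> F \<Longrightarrow> bs (snd (P w)) = 0"
    unfolding bchoice_iff by blast
  let ?K = "(\<lambda>w. snd (P w)) ` F"
  have "finite ?K" using F(1) by simp
  then obtain Q where Q: "finite Q" "Q \<subseteq> complex_span ?K" "?K \<subseteq> complex_span Q"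
    "\<And>x. x \<in> Q \<Longrightarrow> norm x = 1" "\<And>x y. x \<in> Q \<Longrightarrow> y \<in> Q \<Longrightarrow> x \<noteq> y \<Longrightarrow> cinner x y = 0"
    using gram_schmidt[of ?K] by metis
  have "complex_vector.subspace {k. bs k = 0}"
    by (auto simp: complex_vector.subspace_def cop_linear complex_vector.scale_zero_right)
  then have "complex_span ?K \<subseteq> {k. bs k = 0}"
    by (intro complex_vector.span_minimal) (auto simp: P(2))
  with Q(2) have Qker: "bs k = 0" if "k \<in> Q" for k using that by blast
  let ?L = "{ladder k n | k n. k \<in> Q}"
  have "w \<in> complex_span ?L" if w: "w \<in> F" for w
  proof -
    let ?n = "fst (P w)"
    have "complex_vector.subspace {k. cop_apply (B ^ ?n) k \<in> complex_span ?L}"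
      by (auto simp: complex_vector.subspace_def cop_linear complex_vector.span_add complex_vector.span_scale
          complex_vector.span_zero)
    moreover have "cop_apply (B ^ ?n) k \<in> complex_span ?L" if "k \<in> Q" for k
    proof -
      obtain c where c: "cop_apply (B ^ ?n) k = c *\<^sub>C ladder k ?n" using power_eq_ladder by blast
      have "ladder k ?n \<in> ?L" using that by blast
      then show ?thesis unfolding c by (intro complex_vector.span_scale complex_vector.span_base)
    qed
    ultimately have "complex_span Q \<subseteq> {k. cop_apply (B ^ ?n) k \<in> complex_span ?L}"
      by (intro complex_vector.span_minimal) auto
    moreover have "snd (P w) \<in> complex_span Q" using Q(3) w by blast
    ultimately have "cop_apply (B ^ ?n) (snd (P w)) \<in> complex_span ?L" by blast
    then show ?thesis using P(1)[OF w] by simp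
  qed
  then have "x \<in> complex_span ?L"
    unfolding F(3) by (intro complex_vector.span_sum complex_vector.span_scale)
  then show ?thesis by (intro that[of Q] Q Qker) auto
qed

lemma ladder_decomposition:
  assumes Q: "finite Q" and x: "x \<in> complex_span {ladder k n | k n. k \<in> Q}"
  obtains y t where "x = (\<Sum>k\<in>Q. y k)" "\<And>k. k \<in> Q \<Longrightarrow> (y k, t k) \<in> ladder_pairs k"
proof -
  have "\<exists>y t. x = (\<Sum>k\<in>Q. y k) \<and> (\<forall>k\<in>Q. (y k, t k) \<in> ladder_pairs k)"
    using x
  proof (rule complex_vector.span_induct)
    show "complex_vector.subspace {x. \<exists>y t. x = (\<Sum>k\<in>Q. y k) \<and> (\<forall>k\<in>Q. (y k, t k) \<in> ladder_pairs k)}"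
      unfolding complex_vector.subspace_def
    proof (intro conjI ballI allI)
      show "0 \<in> {x. \<exists>y t. x = (\<Sum>k\<in>Q. y k) \<and> (\<forall>k\<in>Q. (y k, t k) \<in> ladder_pairs k)}"
        by (auto intro!: exI[of _ "\<lambda>_. 0"] ladder_pairs_linear)
      fix x assume "x \<in> {x. \<exists>y t. x = (\<Sum>k\<in>Q. y k) \<and> (\<forall>k\<in>Q. (y k, t k) \<in> ladder_pairs k)}"
      then obtain y t where x: "x = (\<Sum>k\<in>Q. y k)" "\<forall>k\<in>Q. (y k, t k) \<in> ladder_pairs k" by blast
      show "c *\<^sub>C x \<in> {x. \<exists>y t. x = (\<Sum>k\<in>Q. y k) \<and> (\<forall>k\<in>Q. (y k, t k) \<in> ladder_pairs k)}" for c
        using x by (auto intro!: exI[of _ "\<lambda>k. c *\<^sub>C y k"] exI[of _ "\<lambda>k. c *\<^sub>C t k"] ladder_pairs_linear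
            simp: complex_vector.scale_sum_right)
      fix x' assume "x' \<in> {x. \<exists>y t. x = (\<Sum>k\<in>Q. y k) \<and> (\<forall>k\<in>Q. (y k, t k) \<in> ladder_pairs k)}"
      then obtain y' t' where x': "x' = (\<Sum>k\<in>Q. y' k)" "\<forall>k\<in>Q. (y' k, t' k) \<in> ladder_pairs k" by blast
      show "x + x' \<in> {x. \<exists>y t. x = (\<Sum>k\<in>Q. y k) \<and> (\<forall>k\<in>Q. (y k, t k) \<in> ladder_pairs k)}"
        using x x' by (auto intro!: exI[of _ "\<lambda>k. y k + y' k"] exI[of _ "\<lambda>k. t k + t' k"] ladder_pairs_linear
            simp: sum.distrib)
    qed
    fix l assume "l \<in> {ladder k n | k n. k \<in> Q}"
    then obtain k n where l: "l = ladder k n" "k \<in> Q" by blast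
    have "(ladder k n, ell2_basis n) \<in> ladder_pairs k"
      unfolding ladder_pairs_def by (rule complex_vector.span_base) blast
    moreover have "l = (\<Sum>j\<in>Q. if j = k then ladder k n else 0)" using Q l by simp
    ultimately show "\<exists>y t. l = (\<Sum>k\<in>Q. y k) \<and> (\<forall>k\<in>Q. (y k, t k) \<in> ladder_pairs k)"
      using ladder_pairs_linear(1)
      by (intro exI[of _ "\<lambda>j. if j = k then ladder k n else 0"] exI[of _ "\<lambda>j. if j = k then ell2_basis n else 0"])
        auto
  qed
  then show ?thesis using that by blast
qed

text \<open>
  On a sum over pairwise orthogonal ladders the polynomial acts as on a finite sum of copies of
  the sequence space.
\<close>

lemma norm_star_eval_le_wandering:
  fixes f :: "'g free_star_algebra" and g\<^sub>0 :: 'g and c d :: complex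
  defines "v \<equiv> \<lambda>g. if g = g\<^sub>0 then c *\<^sub>C B else d *\<^sub>C 1"
    and "w \<equiv> \<lambda>g. if g = g\<^sub>0 then c *\<^sub>C disc_gen r else d *\<^sub>C 1"
  assumes x: "x \<in> closure (complex_span wandering)"
  shows "norm (cop_apply (star_eval v f) x) \<le> norm (star_eval w f) * norm x"
proof -
  let ?F = "cop_apply (star_eval v f)" and ?G = "cop_apply (star_eval w f)" and ?C = "norm (star_eval w f)"
  have "norm (?F x) \<le> ?C * norm x" if x: "x \<in> complex_span wandering" for x
  proof -
    obtain Q where Q: "finite Q" "\<And>k. k \<in> Q \<Longrightarrow> bs k = 0" "\<And>k. k \<in> Q \<Longrightarrow> norm k = 1"
      "\<And>k k'. k \<in> Q \<Longrightarrow> k' \<in> Q \<Longrightarrow> k \<noteq> k' \<Longrightarrow> cinner k k' = 0"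
      "x \<in> complex_span {ladder k n | k n. k \<in> Q}"
      by (rule wandering_span_ladders[OF x]) blast
    obtain y t where yt: "x = (\<Sum>k\<in>Q. y k)" "\<And>k. k \<in> Q \<Longrightarrow> (y k, t k) \<in> ladder_pairs k"
      by (rule ladder_decomposition[OF Q(1,5)]) blast
    have Fyt: "(?F (y k), ?G (t k)) \<in> ladder_pairs k" if k: "k \<in> Q" for k
      by (rule star_eval_related[where R = "\<lambda>x t. (x, t) \<in> ladder_pairs k", OF _ _ _ _ _ yt(2)[OF k]])
        (auto simp: v_def w_def star_scaleC_cop scaleC_cop_apply
          intro: ladder_pairs_linear ladder_pairs_disc Q(2)[OF k])
    have isom: "(norm x)\<^sup>2 = (\<Sum>k\<in>Q. (norm (s k))\<^sup>2)"
      if "x = (\<Sum>k\<in>Q. z k)" "\<And>k. k \<in> Q \<Longrightarrow> (z k, s k) \<in> ladder_pairs k" for x z s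
    proof -
      have "(norm x)\<^sup>2 = (\<Sum>k\<in>Q. (norm (z k))\<^sup>2)"
        unfolding that(1)
      proof (rule pythagoras_sum[OF Q(1)])
        fix i j assume ij: "i \<in> Q" "j \<in> Q" "i \<noteq> j"
        show "cinner (z i) (z j) = 0"
          using cinner_ladder_pairs[OF Q(2)[OF ij(1)] Q(2)[OF ij(2)] that(2)[OF ij(1)] that(2)[OF ij(2)]] Q(4)[OF ij]
          by simp
      qed
      also have "\<dots> = (\<Sum>k\<in>Q. (norm (s k))\<^sup>2)"
      proof (rule sum.cong[OF refl])
        fix k assume k: "k \<in> Q"
        have "cinner k k = 1" using Q(3)[OF k] by (simp add: cinner_self)
        then show "(norm (z k))\<^sup>2 = (norm (s k))\<^sup>2"
          using cinner_ladder_pairs[OF Q(2)[OF k] Q(2)[OF k] that(2)[OF k] that(2)[OF k]]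
          by (simp add: norm_sq_eq_Re_cinner)
      qed
      finally show ?thesis .
    qed
    have "?F x = (\<Sum>k\<in>Q. ?F (y k))" by (simp add: yt(1) cop_apply_sum)
    then have "(norm (?F x))\<^sup>2 = (\<Sum>k\<in>Q. (norm (?G (t k)))\<^sup>2)" using Fyt by (rule isom)
    also have "\<dots> \<le> (\<Sum>k\<in>Q. (?C * norm (t k))\<^sup>2)"
      by (intro sum_mono power_mono norm_cop_apply) simp
    also have "\<dots> = (?C * norm x)\<^sup>2"
      using isom[OF yt] by (simp add: power_mult_distrib sum_distrib_left)
    finally show ?thesis by (rule power2_le_imp_le) simp
  qed
  moreover have "closed {x. norm (?F x) \<le> ?C * norm x}"
    by (intro closed_Collect_le continuous_intros linear_continuous_on cop_apply_bounded_linear)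
  ultimately have "closure (complex_span wandering) \<subseteq> {x. norm (?F x) \<le> ?C * norm x}"
    by (intro closure_minimal) auto
  then show ?thesis using x by blast
qed

end

text \<open>
  The scalars \<open>c\<close> and \<open>d\<close> allow for the circle parameter in the two components of \<open>\<iota>\<close>, where one
  generator of the sphere is a multiple of the disc generator and the other one is a scalar.
\<close>

theorem (in symbol) norm_star_eval_le_disc_gen:
  fixes B :: "'h::complex_hilbert cop" and f :: "'g free_star_algebra"
  assumes disc: "quantum_disc r B" and c: "cmod c = 1" and d: "cmod d = 1"
  shows "norm (star_eval (\<lambda>g. if g = g\<^sub>0 then c *\<^sub>C B else d *\<^sub>C 1) f) \<le>
    norm (star_eval (\<lambda>g. if g = g\<^sub>0 then c *\<^sub>C disc_gen r else d *\<^sub>C 1) f)"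
proof -
  interpret quantum_disc r B by (rule disc)
  define v where "v = (\<lambda>g. if g = g\<^sub>0 then c *\<^sub>C B else d *\<^sub>C 1)"
  define w where "w = (\<lambda>g. if g = g\<^sub>0 then c *\<^sub>C disc_gen r else d *\<^sub>C 1)"
  let ?C = "norm (star_eval w f)"
  have cc: "cnj c * c = 1" "c * cnj c = 1" using c by (simp_all add: complex_norm_square[symmetric] mult.commute)
  have red: "reducing residual v"
    using complex_vector.subspace_scale[OF subspace_orth, of _ wandering]
    by (auto simp: reducing_def subspace_orth v_def star_scaleC_cop scaleC_cop_apply
        intro: residual_b residual_bs)
  have unitary: "norm (cop_apply (star_eval v f) \<xi>) \<le> ?C * norm \<xi>" if \<xi>: "\<xi> \<in> residual" for \<xi>
  proof (rule norm_star_eval_le_scalars[OF red _ _ _ _ _ _ \<xi>, of _ g\<^sub>0])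
    fix x assume "x \<in> residual"
    then have "e x = 0" by (rule residual_e)
    then show "cop_apply (star (v g\<^sub>0)) (cop_apply (v g\<^sub>0) x) = x" "cop_apply (v g\<^sub>0) (cop_apply (star (v g\<^sub>0)) x) = x"
      by (simp_all add: v_def star_scaleC_cop scaleC_cop_apply cop_linear scaleC_scaleC cc unitary_on_ker_defect scaleC_one)
  next
    fix u :: complex and \<eta> :: 'h assume u: "cmod u = 1"
    \<comment> \<open>At this point of the circle the symbol of \<open>c\<close> times the disc generator takes the value \<open>u\<close>.\<close>
    have "cmod (cnj c * u) = 1" using u c by (simp add: norm_mult)
    then obtain a where a: "circle_val a = cnj c * u" by (rule circle_obtain)
    define \<alpha> where "\<alpha> g = (if g = g\<^sub>0 then u else d)" for g
    have "v(g\<^sub>0 := u *\<^sub>C 1) = (\<lambda>g. \<alpha> g *\<^sub>C 1)" by (auto simp: v_def \<alpha>_def)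
    then have eq: "star_eval (v(g\<^sub>0 := u *\<^sub>C 1)) f = star_eval \<alpha> f *\<^sub>C 1"
      by (simp only: star_eval_scalar_one)
    have wT: "w g \<in> Toeplitz" for g
      by (simp add: w_def Toeplitz_scaleC disc_gen_in_Toeplitz[OF r] Toeplitz_one)
    have "apply_bcontfun (\<sigma> (w g)) a = \<alpha> g" for g
      using cc by (simp add: w_def \<alpha>_def symbol_scaleC disc_gen_in_Toeplitz[OF r] Toeplitz_one
          symbol_disc_gen[OF r] symbol_one U_pow_apply a flip: mult.assoc)
    then have "apply_bcontfun (\<sigma> (star_eval w f)) a = star_eval \<alpha> f"
      by (simp add: symbol_star_eval(2)[of w, OF wT] apply_star_eval_complex)
    then have "cmod (star_eval \<alpha> f) \<le> ?C"
      using cmod_symbol_le[OF symbol_star_eval(1)[of w, OF wT], of f a] by simp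
    then show "norm (cop_apply (star_eval (v(g\<^sub>0 := u *\<^sub>C 1)) f) \<eta>) \<le> ?C * norm \<eta>"
      by (simp add: eq scaleC_cop_apply norm_scaleC mult_right_mono)
  qed (simp_all add: v_def star_scaleC_cop scaleC_times_left scaleC_times_right)
  have "norm (star_eval v f) \<le> ?C"
  proof (rule norm_cop_bound)
    fix x
    obtain m n where mn: "x = m + n" "m \<in> closure (complex_span wandering)" "n \<in> residual"
      by (rule orthogonal_decomposition)
    have "m \<in> orth residual" using mn(2) subset_orth_orth by blast
    then show "norm (cop_apply (star_eval v f) x) \<le> ?C * norm x"
      using mn unitary[OF mn(3)] norm_star_eval_le_wandering[OF mn(2), of g\<^sub>0 c d f]
      by (intro norm_le_by_reducing[OF red, of x n m]) (simp_all add: v_def w_def add.commute)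
  qed simp
  then show ?thesis by (simp only: v_def w_def)
qed

section \<open>Representations of the relations of the quantum sphere\<close>

lemma norm_cop_apply_le: "norm A \<le> C \<Longrightarrow> norm (cop_apply A x) \<le> C * norm x"
  by (rule order_trans[OF norm_cop_apply mult_right_mono]) simp_all

lemma quantum_disc_scale:
  assumes "quantum_disc r B" "cmod c = 1"
  shows "quantum_disc r (c *\<^sub>C B)"
proof -
  interpret quantum_disc r B by fact
  have "cnj c * c = 1" "c * cnj c = 1" using assms(2) by (simp_all add: complex_norm_square[symmetric] mult.commute)
  then show ?thesis
    by unfold_locales (simp_all add: r rel star_scaleC_cop scaleC_times_left scaleC_times_right scaleC_scaleC scaleC_one)
qed

lemma reducing_ker_defect:
  assumes "quantum_disc r (v g\<^sub>0)"
    and comm: "\<And>g. g \<noteq> g\<^sub>0 \<Longrightarrow> v g * v g\<^sub>0 = v g\<^sub>0 * v g" "\<And>g. g \<noteq> g\<^sub>0 \<Longrightarrow> star (v g) * v g\<^sub>0 = v g\<^sub>0 * star (v g)"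
  shows "reducing {x. cop_apply (1 - v g\<^sub>0 * star (v g\<^sub>0)) x = 0} v"
proof -
  interpret quantum_disc r "v g\<^sub>0" by fact
  have "X * defect = defect * X" if "X * v g\<^sub>0 = v g\<^sub>0 * X" "X * star (v g\<^sub>0) = star (v g\<^sub>0) * X" for X
    using that by (simp add: defect_def algebra_simps) (metis mult.assoc)
  moreover have "v g * star (v g\<^sub>0) = star (v g\<^sub>0) * v g" "star (v g) * star (v g\<^sub>0) = star (v g\<^sub>0) * star (v g)"
    if "g \<noteq> g\<^sub>0" for g
    using arg_cong[OF comm(1)[OF that], of star] arg_cong[OF comm(2)[OF that], of star]
    by (simp_all add: star_times_cop)
  ultimately have "v g * defect = defect * v g" "star (v g) * defect = defect * star (v g)" if "g \<noteq> g\<^sub>0" for g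
    using comm that by blast+
  then have other: "e (cop_apply (v g) x) = 0" "e (cop_apply (star (v g)) x) = 0"
    if "g \<noteq> g\<^sub>0" "e x = 0" for g x
    using that by (metis times_cop_apply cop_apply_zero)+
  have "e (bs x) = 0" if "e x = 0" for x
    using bs_e[of x] that r by simp
  then have "e (cop_apply (v g) x) = 0 \<and> e (cop_apply (star (v g)) x) = 0" if "e x = 0" for g x
    using other[OF _ that] that e_b[of x]
    by (cases "g = g\<^sub>0") (simp_all add: complex_vector.scale_zero_right)
  then show ?thesis
    unfolding reducing_def defect_def[symmetric]
    by (auto simp: complex_vector.subspace_def cop_linear complex_vector.scale_zero_right)
qed

text \<open>
  On the kernel of the defect of one generator that generator is unitary, and the orthogonal
  complement of this kernel lies in the kernel of the defect of the other generator.
\<close>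

theorem (in symbol) norm_star_eval_S3_le:
  fixes A B :: "'h::complex_hilbert cop" and f :: S3_free
  assumes A: "quantum_disc q A" and B: "quantum_disc p B"
    and orth: "(1 - A * star A) * (1 - B * star B) = 0"
    and comm: "A * B = B * A" "star A * B = B * star A"
    and C: "\<And>u. cmod u = 1 \<Longrightarrow>
        norm (star_eval (case_S3_gen (cnj u *\<^sub>C disc_gen q) (u *\<^sub>C 1)) f) \<le> C"
      "\<And>u. cmod u = 1 \<Longrightarrow>
        norm (star_eval (case_S3_gen (cnj u *\<^sub>C 1) (u *\<^sub>C disc_gen p)) f) \<le> C"
  shows "norm (star_eval (case_S3_gen A B) f) \<le> C"
proof -
  interpret A: quantum_disc q A by fact
  interpret B: quantum_disc p B by fact
  have C0: "0 \<le> C" by (rule order_trans[OF norm_ge_zero C(1)[OF norm_one]])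
  have comm': "star B * A = A * star B"
    by (metis comm(2) star_times_cop star_star_cop)
  define v where "v = case_S3_gen A B"
  have gen_neq: "g \<noteq> Gen_a \<longleftrightarrow> g = Gen_b" "g \<noteq> Gen_b \<longleftrightarrow> g = Gen_a" for g by (cases g; simp)+
  have redA: "reducing {x. A.e x = 0} v"
    using reducing_ker_defect[of q v Gen_a] A
    by (simp add: v_def gen_neq A.defect_def comm(1)[symmetric] comm')
  have redB: "reducing {x. B.e x = 0} v"
    using reducing_ker_defect[of p v Gen_b] B
    by (simp add: v_def gen_neq B.defect_def comm)
  have onA: "norm (cop_apply (star_eval v f) \<xi>) \<le> C * norm \<xi>" if \<xi>: "A.e \<xi> = 0" for \<xi>
  proof (rule norm_star_eval_le_scalars[where N = "{x. A.e x = 0}" and g\<^sub>0 = Gen_a])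
    show "reducing {x. A.e x = 0} v"
      by (rule redA)
    fix u :: complex and \<eta> :: 'h assume u: "cmod u = 1"
    then have uu: "cnj u * u = 1" by (simp add: complex_norm_square[symmetric] mult.commute)
    \<comment> \<open>Writing \<open>B\<close> as \<open>u\<^sup>*\<close> times the disc representation \<open>u B\<close> gives the scalars of the second component of \<open>\<iota>\<close>.\<close>
    have eq: "v(Gen_a := u *\<^sub>C 1) = (\<lambda>g. if g = Gen_b then cnj u *\<^sub>C (u *\<^sub>C B) else u *\<^sub>C 1)"
      using uu by (auto simp: v_def fun_eq_iff scaleC_scaleC scaleC_one split: S3_gen.split)
    have eq': "case_S3_gen (u *\<^sub>C 1) (cnj u *\<^sub>C disc_gen p) = (\<lambda>g. if g = Gen_b then cnj u *\<^sub>C disc_gen p else u *\<^sub>C 1)"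
      by (auto simp: fun_eq_iff split: S3_gen.split)
    have "norm (star_eval (v(Gen_a := u *\<^sub>C 1)) f) \<le> C"
      unfolding eq using norm_star_eval_le_disc_gen[OF quantum_disc_scale[OF B u], of "cnj u" u Gen_b f]
        C(2)[of "cnj u"] u by (simp add: eq')
    then show "norm (cop_apply (star_eval (v(Gen_a := u *\<^sub>C 1)) f) \<eta>) \<le> C * norm \<eta>"
      by (rule norm_cop_apply_le)
  qed (use \<xi> C0 in \<open>simp_all add: v_def gen_neq A.unitary_on_ker_defect comm(1)[symmetric] comm'\<close>)
  have onB: "norm (cop_apply (star_eval v f) \<xi>) \<le> C * norm \<xi>" if \<xi>: "B.e \<xi> = 0" for \<xi>
  proof (rule norm_star_eval_le_scalars[where N = "{x. B.e x = 0}" and g\<^sub>0 = Gen_b])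
    show "reducing {x. B.e x = 0} v"
      by (rule redB)
    fix u :: complex and \<eta> :: 'h assume u: "cmod u = 1"
    then have uu: "cnj u * u = 1" by (simp add: complex_norm_square[symmetric] mult.commute)
    have eq: "v(Gen_b := u *\<^sub>C 1) = (\<lambda>g. if g = Gen_a then cnj u *\<^sub>C (u *\<^sub>C A) else u *\<^sub>C 1)"
      using uu by (auto simp: v_def fun_eq_iff scaleC_scaleC scaleC_one split: S3_gen.split)
    have eq': "case_S3_gen (cnj u *\<^sub>C disc_gen q) (u *\<^sub>C 1) = (\<lambda>g. if g = Gen_a then cnj u *\<^sub>C disc_gen q else u *\<^sub>C 1)"
      by (auto simp: fun_eq_iff split: S3_gen.split)
    have "norm (star_eval (v(Gen_b := u *\<^sub>C 1)) f) \<le> C"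
      unfolding eq using norm_star_eval_le_disc_gen[OF quantum_disc_scale[OF A u], of "cnj u" u Gen_a f]
        C(1)[of u] u by (simp add: eq')
    then show "norm (cop_apply (star_eval (v(Gen_b := u *\<^sub>C 1)) f) \<eta>) \<le> C * norm \<eta>"
      by (rule norm_cop_apply_le)
  qed (use \<xi> C0 in \<open>simp_all add: v_def gen_neq B.unitary_on_ker_defect comm\<close>)
  have "norm (star_eval v f) \<le> C"
  proof (rule norm_cop_bound[OF C0])
    fix x
    have cl: "closed {x. A.e x = 0}"
      by (intro closed_Collect_eq continuous_on_const linear_continuous_on cop_apply_bounded_linear)
    have sub: "complex_vector.subspace {x. A.e x = 0}" using redA by (simp add: reducing_def)
    obtain y where y: "y \<in> {x. A.e x = 0}" "\<And>s. s \<in> {x. A.e x = 0} \<Longrightarrow> cinner s (x - y) = 0"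
      by (rule orthogonal_projection_exists[OF sub cl, of x]) blast
    have DE: "A.e (B.e s) = 0" for s
      using arg_cong[OF orth, of "\<lambda>X. cop_apply X s"] by (simp add: times_cop_apply A.defect_def B.defect_def)
    \<comment> \<open>\<open>x - y\<close> is orthogonal to the kernel of \<open>D\<close>, which contains the range of \<open>E\<close>.\<close>
    have "cinner (B.e (B.e (x - y))) (x - y) = 0" by (rule y(2)) (simp add: DE)
    then have "cinner (B.e (x - y)) (B.e (x - y)) = 0" by (simp add: B.e_self_adjoint)
    then have "B.e (x - y) = 0" by simp
    from onB[OF this] onA[of y] y
    show "norm (cop_apply (star_eval v f) x) \<le> C * norm x"
      by (intro norm_le_by_reducing[OF redA _ _ _ _ _ C0, of x y "x - y"]) (auto simp: orth_def)
  qed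
  then show ?thesis by (simp add: v_def)
qed

section \<open>The coordinate algebra and its representations\<close>

abbreviation "S3_ideal p q \<equiv> star_ideal (S3_relations p q)"

lemma star_ideal_minus: "x \<in> star_ideal R \<Longrightarrow> - x \<in> star_ideal R"
  using star_ideal.mult_left[of x R "-1"] by simp

lemma star_ideal_diff: "x \<in> star_ideal R \<Longrightarrow> y \<in> star_ideal R \<Longrightarrow> x - y \<in> star_ideal R"
  using star_ideal.add[of x R "- y"] star_ideal_minus[of y R] by simp

lemma star_ideal_scaleC: "f \<in> star_ideal R \<Longrightarrow> c *\<^sub>C f \<in> star_ideal R" for f :: "'g free_star_algebra"
  unfolding scaleC_free by (rule star_ideal.mult_left)

lemma S3_class_eq_iff: "S3_class p q f = S3_class p q g \<longleftrightarrow> f - g \<in> S3_ideal p q"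
proof -
  have "equiv UNIV (S3_rel p q)"
  proof (rule equivI)
    show "refl_on UNIV (S3_rel p q)" by (auto simp: refl_on_def S3_rel_def star_ideal.zero)
    show "sym (S3_rel p q)"
    proof (rule symI)
      fix f g assume "(f, g) \<in> S3_rel p q"
      then show "(g, f) \<in> S3_rel p q" using star_ideal_minus[of "f - g"] by (simp add: S3_rel_def)
    qed
    show "trans (S3_rel p q)"
    proof (rule transI)
      fix f g h assume "(f, g) \<in> S3_rel p q" "(g, h) \<in> S3_rel p q"
      then show "(f, h) \<in> S3_rel p q" using star_ideal.add[of "f - g" _ "g - h"] by (simp add: S3_rel_def)
    qed
  qed simp
  then have "S3_class p q f = S3_class p q g \<longleftrightarrow> (f, g) \<in> S3_rel p q"
    unfolding S3_class_def by (rule eq_equiv_class_iff) auto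
  then show ?thesis by (simp add: S3_rel_def)
qed

lemma mem_S3_class: "g \<in> S3_class p q f \<longleftrightarrow> f - g \<in> S3_ideal p q"
  by (simp add: S3_class_def S3_rel_def)

lemma O_S3_eq_range: "O_S3 p q = range (S3_class p q)"
  by (auto simp: O_S3_def S3_class_def quotient_def)

lemma the_elem_image_class:
  assumes "\<And>g. f - g \<in> S3_ideal p q \<Longrightarrow> h g = h f"
  shows "the_elem (h ` S3_class p q f) = h f"
proof -
  have "f \<in> S3_class p q f" by (simp add: mem_S3_class star_ideal.zero)
  moreover have "h g = h f" if "g \<in> S3_class p q f" for g
    using that by (intro assms) (simp add: mem_S3_class)
  ultimately have "h ` S3_class p q f = {h f}" by blast
  then show ?thesis by simp
qed

definition S3_relations_hold :: "real \<Rightarrow> real \<Rightarrow> 'h::complex_hilbert cop \<Rightarrow> 'h cop \<Rightarrow> bool"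
  where "S3_relations_hold p q A B \<longleftrightarrow>
    star A * A = complex_of_real q *\<^sub>C (A * star A) + complex_of_real (1 - q) *\<^sub>C 1 \<and>
    star B * B = complex_of_real p *\<^sub>C (B * star B) + complex_of_real (1 - p) *\<^sub>C 1 \<and>
    (1 - A * star A) * (1 - B * star B) = 0 \<and> A * B = B * A \<and> star A * B = B * star A"

lemma star_eval_S3_relations:
  fixes v :: "S3_gen \<Rightarrow> 'h::complex_hilbert cop"
  shows "(\<forall>f\<in>S3_relations p q. star_eval v f = 0) \<longleftrightarrow> S3_relations_hold p q (v Gen_a) (v Gen_b)"
proof -
  have "x - y - z = 0 \<longleftrightarrow> x = y + z" for x y z :: "'h cop" by (auto simp: algebra_simps)
  then show ?thesis
    by (simp add: S3_relations_def S3_relations_hold_def Let_def star_eval_diff star_eval_mult star_eval_star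
        star_eval_scaleC star_eval_free_gen)
qed

lemma star_eval_S3_ideal:
  fixes v :: "S3_gen \<Rightarrow> 'h::complex_hilbert cop"
  assumes "S3_relations_hold p q (v Gen_a) (v Gen_b)" "f \<in> S3_ideal p q"
  shows "star_eval v f = 0"
  using assms(2)
  by (induction rule: star_ideal.induct)
    (use assms(1) star_eval_S3_relations in \<open>auto simp: star_eval_add star_eval_mult star_eval_star\<close>)

lemma O_S3_star_hom_eq_star_eval:
  fixes \<rho> :: "S3_free set \<Rightarrow> 'r::{complex_vector,monoid_mult,star}"
  assumes "O_S3_star_hom p q \<rho>"
  shows "\<rho> (S3_class p q f) = star_eval (\<lambda>g. \<rho> (S3_class p q (free_gen g))) f"
  using assms unfolding O_S3_star_hom_def
  by (intro free_star_hom_eq_star_eval[where h = "\<lambda>f. \<rho> (S3_class p q f)"]) auto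

lemma O_S3_star_hom_pair:
  fixes \<rho> :: "S3_free set \<Rightarrow> 'h::complex_hilbert cop"
  assumes "O_S3_star_hom p q \<rho>"
  shows "S3_relations_hold p q (\<rho> (S3_class p q (free_gen Gen_a))) (\<rho> (S3_class p q (free_gen Gen_b)))"
proof -
  let ?v = "\<lambda>g. \<rho> (S3_class p q (free_gen g))"
  have "star_eval ?v f = 0" if "f \<in> S3_relations p q" for f
  proof -
    have "S3_class p q f = S3_class p q 0"
      using that by (simp add: S3_class_eq_iff star_ideal.base)
    then show ?thesis
      using O_S3_star_hom_eq_star_eval[OF assms, of f] O_S3_star_hom_eq_star_eval[OF assms, of 0] by simp
  qed
  then show ?thesis using star_eval_S3_relations[of p q ?v] by simp
qed

lemma S3_relations_hold_disc:
  assumes "0 < p" "p < 1" "0 < q" "q < 1" "S3_relations_hold p q A B"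
  shows "quantum_disc q A" "quantum_disc p B"
  using assms by (auto simp: quantum_disc_def S3_relations_hold_def)

lemma S3_relations_hold_disc_gen_left:
  assumes "0 < q" "q < 1" "cmod u = 1"
  shows "S3_relations_hold p q (cnj u *\<^sub>C disc_gen q) (u *\<^sub>C 1)"
proof -
  interpret quantum_disc q "cnj u *\<^sub>C disc_gen q"
    using assms by (intro quantum_disc_scale quantum_disc_disc_gen) auto
  have "cnj u * u = 1" "u * cnj u = 1" using assms(3) by (simp_all add: complex_norm_square[symmetric] mult.commute)
  moreover have "complex_of_real p *\<^sub>C (1 :: ell2 cop) + (1 - complex_of_real p) *\<^sub>C 1 = 1"
    by (simp add: scaleC_one flip: scaleC_add_left)
  ultimately show ?thesis
    using rel by (simp add: S3_relations_hold_def star_scaleC_cop scaleC_times_left scaleC_times_right scaleC_scaleC scaleC_one mult.commute)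
qed

lemma S3_relations_hold_disc_gen_right:
  assumes "0 < p" "p < 1" "cmod u = 1"
  shows "S3_relations_hold p q (cnj u *\<^sub>C 1) (u *\<^sub>C disc_gen p)"
proof -
  interpret quantum_disc p "u *\<^sub>C disc_gen p"
    using assms by (intro quantum_disc_scale quantum_disc_disc_gen) auto
  have "cnj u * u = 1" "u * cnj u = 1" using assms(3) by (simp_all add: complex_norm_square[symmetric] mult.commute)
  moreover have "complex_of_real q *\<^sub>C (1 :: ell2 cop) + (1 - complex_of_real q) *\<^sub>C 1 = 1"
    by (simp add: scaleC_one flip: scaleC_add_left)
  ultimately show ?thesis
    using rel by (simp add: S3_relations_hold_def star_scaleC_cop scaleC_times_left scaleC_times_right scaleC_scaleC scaleC_one mult.commute)
qed

section \<open>The homomorphism into the fibre product\<close>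

definition iota_gen :: "real \<Rightarrow> real \<Rightarrow> S3_gen \<Rightarrow> (circle \<Rightarrow>\<^sub>C ell2 cop) \<times> (circle \<Rightarrow>\<^sub>C ell2 cop)"
  where "iota_gen p q = (\<lambda>g. case g of
      Gen_a \<Rightarrow> (tensor (disc_gen q) (U_pow (-1)), tensor 1 (U_pow (-1)))
    | Gen_b \<Rightarrow> (tensor 1 (U_pow 1), tensor (disc_gen p) (U_pow 1)))"

lemma circle_val_powi_minus: "circle_val u powi - 1 = cnj (circle_val u)"
  using cnj_powi[OF norm_circle_val, of u 1] by simp

lemma apply_star_eval_iota_gen:
  "apply_bcontfun (fst (star_eval (iota_gen p q) f)) u =
    star_eval (case_S3_gen (cnj (circle_val u) *\<^sub>C disc_gen q) (circle_val u *\<^sub>C 1)) f"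
  "apply_bcontfun (snd (star_eval (iota_gen p q) f)) u =
    star_eval (case_S3_gen (cnj (circle_val u) *\<^sub>C 1) (circle_val u *\<^sub>C disc_gen p)) f"
proof -
  have "(\<lambda>g. apply_bcontfun (fst (iota_gen p q g)) u) =
      case_S3_gen (cnj (circle_val u) *\<^sub>C disc_gen q) (circle_val u *\<^sub>C 1)"
    "(\<lambda>g. apply_bcontfun (snd (iota_gen p q g)) u) =
      case_S3_gen (cnj (circle_val u) *\<^sub>C 1) (circle_val u *\<^sub>C disc_gen p)"
    using circle_val_powi_minus[of u]
    by (auto simp: fun_eq_iff iota_gen_def U_pow_apply split: S3_gen.split)
  moreover have "apply_bcontfun (fst (star_eval (iota_gen p q) f)) u =
      star_eval (\<lambda>g. apply_bcontfun (fst (iota_gen p q g)) u) f"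
    by (rule hom_star_eval[where \<pi> = "\<lambda>x. apply_bcontfun (fst x) u"])
      (simp_all add: times_prod_def scaleC_prod_def one_prod_def star_prod_def)
  moreover have "apply_bcontfun (snd (star_eval (iota_gen p q) f)) u =
      star_eval (\<lambda>g. apply_bcontfun (snd (iota_gen p q g)) u) f"
    by (rule hom_star_eval[where \<pi> = "\<lambda>x. apply_bcontfun (snd x) u"])
      (simp_all add: times_prod_def scaleC_prod_def one_prod_def star_prod_def)
  ultimately show "apply_bcontfun (fst (star_eval (iota_gen p q) f)) u =
    star_eval (case_S3_gen (cnj (circle_val u) *\<^sub>C disc_gen q) (circle_val u *\<^sub>C 1)) f"
  "apply_bcontfun (snd (star_eval (iota_gen p q) f)) u =
    star_eval (case_S3_gen (cnj (circle_val u) *\<^sub>C 1) (circle_val u *\<^sub>C disc_gen p)) f"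
    by simp_all
qed

lemma pair_bcontfun_eqI:
  assumes "\<And>u. apply_bcontfun (fst x) u = apply_bcontfun (fst y) u"
    "\<And>u. apply_bcontfun (snd x) u = apply_bcontfun (snd y) u"
  shows "x = y"
  using assms by (auto intro: prod_eqI bcontfun_eqI)

locale quantum_sphere = symbol \<sigma> for \<sigma> +
  fixes p q :: real
  assumes pq: "0 < p" "p < 1" "0 < q" "q < 1"
begin

lemma star_eval_iota_gen_ideal:
  assumes "f \<in> S3_ideal p q"
  shows "star_eval (iota_gen p q) f = 0"
  by (rule pair_bcontfun_eqI)
    (simp_all add: apply_star_eval_iota_gen
      star_eval_S3_ideal[OF _ assms] S3_relations_hold_disc_gen_left S3_relations_hold_disc_gen_right pq norm_circle_val)

lemma iota_class: "iota p q (S3_class p q f) = star_eval (iota_gen p q) f"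
  unfolding iota_def iota_gen_def[symmetric]
proof (rule the_elem_image_class)
  fix g assume "f - g \<in> S3_ideal p q"
  then show "star_eval (iota_gen p q) g = star_eval (iota_gen p q) f"
    using star_eval_iota_gen_ideal[of "f - g"] by (simp add: star_eval_diff)
qed

lemma O_S3_star_hom_iota: "O_S3_star_hom p q (iota p q)"
  unfolding O_S3_star_hom_def iota_class
  by (intro conjI allI; rule pair_bcontfun_eqI)
    (simp_all add: apply_star_eval_iota_gen star_eval_add star_eval_mult star_eval_scaleC star_eval_star
      times_prod_def scaleC_prod_def one_prod_def star_prod_def)

lemma O_S3_star_hom_point:
  "O_S3_star_hom p q (\<lambda>X. apply_bcontfun (fst (iota p q X)) u)"
  "O_S3_star_hom p q (\<lambda>X. apply_bcontfun (snd (iota p q X)) u)"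
  using O_S3_star_hom_iota unfolding O_S3_star_hom_def
  by (simp_all add: times_prod_def scaleC_prod_def one_prod_def star_prod_def)

text \<open>
  The operators that \<open>norm_star_eval_S3_le\<close> compares with are the values of the two components of \<open>\<iota>\<close>
  at the points of the circle.
\<close>

lemma norm_representation_le:
  fixes \<rho> :: "S3_free set \<Rightarrow> 'h::complex_hilbert cop"
  assumes \<rho>: "O_S3_star_hom p q \<rho>" and X: "X \<in> O_S3 p q"
  shows "norm (\<rho> X) \<le> max_norm (iota p q X)"
proof -
  obtain f where f: "X = S3_class p q f" using X by (auto simp: O_S3_eq_range)
  let ?A = "\<rho> (S3_class p q (free_gen Gen_a))" and ?B = "\<rho> (S3_class p q (free_gen Gen_b))"
  have pair: "S3_relations_hold p q ?A ?B" by (rule O_S3_star_hom_pair[OF \<rho>])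
  have "(\<lambda>g. \<rho> (S3_class p q (free_gen g))) = case_S3_gen ?A ?B"
    by (auto simp: fun_eq_iff split: S3_gen.split)
  then have "\<rho> X = star_eval (case_S3_gen ?A ?B) f"
    using O_S3_star_hom_eq_star_eval[OF \<rho>, of f] by (simp only: f)
  moreover have "norm (star_eval (case_S3_gen ?A ?B) f) \<le> max_norm (iota p q X)"
  proof (rule norm_star_eval_S3_le[OF S3_relations_hold_disc[OF pq pair]])
    fix u :: complex assume "cmod u = 1"
    then obtain w where w: "circle_val w = u" by (rule circle_obtain)
    show "norm (star_eval (case_S3_gen (cnj u *\<^sub>C disc_gen q) (u *\<^sub>C 1)) f) \<le> max_norm (iota p q X)"
      using norm_bounded[of "fst (iota p q X)" w]
      by (simp add: f iota_class apply_star_eval_iota_gen w max_norm_def)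
    show "norm (star_eval (case_S3_gen (cnj u *\<^sub>C 1) (u *\<^sub>C disc_gen p)) f) \<le> max_norm (iota p q X)"
      using norm_bounded[of "snd (iota p q X)" w]
      by (simp add: f iota_class apply_star_eval_iota_gen w max_norm_def)
  qed (use pair in \<open>simp_all add: S3_relations_hold_def\<close>)
  ultimately show ?thesis by simp
qed

theorem universal_norm_eq:
  assumes X: "X \<in> O_S3 p q"
  shows "universal_norm p q X = max_norm (iota p q X)"
proof (rule antisym)
  let ?R = "{\<rho> :: S3_free set \<Rightarrow> ell2 cop. O_S3_star_hom p q \<rho>}"
  have bdd: "bdd_above ((\<lambda>\<rho>. norm (\<rho> X)) ` ?R)"
    using norm_representation_le[OF _ X] by (intro bdd_aboveI[of _ "max_norm (iota p q X)"]) auto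
  show "universal_norm p q X \<le> max_norm (iota p q X)"
    unfolding universal_norm_def
    using O_S3_star_hom_point(1) norm_representation_le[OF _ X] by (intro cSUP_least) auto
  have "norm (apply_bcontfun (fst (iota p q X)) u) \<le> universal_norm p q X" for u
    unfolding universal_norm_def by (rule cSUP_upper2[OF bdd]) (use O_S3_star_hom_point(1) in auto)
  moreover have "norm (apply_bcontfun (snd (iota p q X)) u) \<le> universal_norm p q X" for u
    unfolding universal_norm_def by (rule cSUP_upper2[OF bdd]) (use O_S3_star_hom_point(2) in auto)
  ultimately show "max_norm (iota p q X) \<le> universal_norm p q X"
    unfolding max_norm_def by (intro max.boundedI norm_bound)
qed

end

section \<open>The fibre product\<close>

lemma bounded_linear_apply_bcontfun: "bounded_linear (\<lambda>F. apply_bcontfun F u)"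
  by (rule bounded_linear_intro[where K = 1]) (simp_all add: norm_bounded)

lemma tensor_in_Toeplitz_circle: "t \<in> Toeplitz \<Longrightarrow> tensor t f \<in> Toeplitz_circle"
  unfolding Toeplitz_circle_def
  by (rule subsetD[OF closure_subset], rule complex_vector.span_base) blast

lemma subspace_Toeplitz_circle: "complex_vector.subspace Toeplitz_circle"
  unfolding Toeplitz_circle_def by (intro subspace_closure complex_vector.subspace_span)

lemma closed_Toeplitz_circle: "closed Toeplitz_circle"
  by (simp add: Toeplitz_circle_def)

lemma Toeplitz_circle_apply:
  assumes "F \<in> Toeplitz_circle"
  shows "apply_bcontfun F u \<in> Toeplitz"
proof -
  have "complex_vector.subspace {F. apply_bcontfun F u \<in> Toeplitz}"
    by (auto simp: complex_vector.subspace_def Toeplitz_zero Toeplitz_add Toeplitz_scaleC)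
  moreover have "closed {F. apply_bcontfun F u \<in> Toeplitz}"
    using closed_vimage[OF closed_Toeplitz linear_continuous_on[OF bounded_linear_apply_bcontfun[of u]]]
    by (simp add: vimage_def)
  ultimately have "Toeplitz_circle \<subseteq> {F. apply_bcontfun F u \<in> Toeplitz}"
    unfolding Toeplitz_circle_def
    by (intro closure_minimal complex_vector.span_minimal) (auto simp: Toeplitz_scaleC)
  then show ?thesis using assms by blast
qed

lemma tensor_mult: "tensor t f * tensor s g = tensor (t * s) (f * g)"
  for t s :: "'h::complex_hilbert cop"
  by (rule bcontfun_eqI) (simp add: scaleC_times_left scaleC_times_right scaleC_scaleC mult.commute)

lemma star_tensor: "star (tensor t f) = tensor (star t) (star f)" for t :: "'h::complex_hilbert cop"
  by (rule bcontfun_eqI) (simp add: star_scaleC_cop)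

lemma one_tensor: "tensor (1 :: 'h::complex_hilbert cop) 1 = 1"
  by (rule bcontfun_eqI) (simp add: scaleC_one)

lemma tensor_add_left: "tensor (t + s) f = tensor t f + tensor s f"
  by (rule bcontfun_eqI) (simp add: scaleC_add_right)

lemma tensor_scaleC_left: "tensor (c *\<^sub>C t) f = c *\<^sub>C tensor t f"
  by (rule bcontfun_eqI) (simp add: scaleC_scaleC mult.commute)

context symbol
begin

lemma apply_symbol_tensor_id:
  assumes "F \<in> Toeplitz_circle"
  shows "apply_bcontfun (symbol_tensor_id \<sigma> F) (u, v) = apply_bcontfun (\<sigma> (apply_bcontfun F v)) u"
proof -
  let ?G = "\<lambda>v. \<sigma> (apply_bcontfun F v)"
  have diff_bound: "norm (apply_bcontfun f u - apply_bcontfun g u) \<le> norm (f - g)"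
    for f g :: "circle \<Rightarrow>\<^sub>C complex" and u
    using norm_bounded[of "f - g" u] by simp
  have G: "continuous_on UNIV ?G"
    by (rule continuous_on_compose2[OF symbol_continuous continuous_on_apply_bcontfun])
      (use Toeplitz_circle_apply[OF assms] in auto)
  have "(\<lambda>p. apply_bcontfun (?G (snd p)) (fst p)) \<in> bcontfun"
  proof (rule bcontfun_normI)
    show "norm (apply_bcontfun (?G (snd p)) (fst p)) \<le> norm F" for p
      using cmod_symbol_le[OF Toeplitz_circle_apply[OF assms], of "snd p" "fst p"] norm_bounded[of F "snd p"]
      by simp
    show "continuous_on UNIV (\<lambda>p. apply_bcontfun (?G (snd p)) (fst p))"
      unfolding continuous_on_def
    proof
      fix p :: "circle \<times> circle"
      have Gp: "continuous_on UNIV (\<lambda>p' :: circle \<times> circle. ?G (snd p'))"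
        by (rule continuous_on_compose2[OF G]) (auto intro: continuous_intros)
      have "((\<lambda>p'. apply_bcontfun (?G (snd p')) (fst p') - apply_bcontfun (?G (snd p)) (fst p')) \<longlongrightarrow> 0) (at p)"
      proof (rule Lim_null_comparison)
        show "\<forall>\<^sub>F p' in at p. norm (apply_bcontfun (?G (snd p')) (fst p') - apply_bcontfun (?G (snd p)) (fst p'))
            \<le> norm (?G (snd p') - ?G (snd p))"
          by (intro always_eventually allI diff_bound)
        show "((\<lambda>p'. norm (?G (snd p') - ?G (snd p))) \<longlongrightarrow> 0) (at p)"
          by (intro tendsto_norm_zero LIM_zero Gp[unfolded continuous_on_def, rule_format]) simp
      qed
      moreover have "((\<lambda>p'. apply_bcontfun (?G (snd p)) (fst p')) \<longlongrightarrow> apply_bcontfun (?G (snd p)) (fst p)) (at p)"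
      proof -
        have "continuous_on UNIV (\<lambda>p' :: circle \<times> circle. apply_bcontfun (?G (snd p)) (fst p'))"
          by (intro continuous_on_compose2[OF continuous_on_apply_bcontfun[of UNIV]] continuous_intros) auto
        from this[unfolded continuous_on_def, rule_format, of p] show ?thesis by simp
      qed
      ultimately show "((\<lambda>p. apply_bcontfun (?G (snd p)) (fst p)) \<longlongrightarrow> apply_bcontfun (?G (snd p)) (fst p)) (at p)"
        using tendsto_add by fastforce
    qed
  qed
  moreover have "(\<lambda>(u, v). apply_bcontfun (?G v) u) = (\<lambda>p. apply_bcontfun (?G (snd p)) (fst p))" by auto
  ultimately show ?thesis by (simp add: symbol_tensor_id_def Bcontfun_inverse)
qed

lemma C_S3_iff:
  "x \<in> C_S3 \<sigma> \<longleftrightarrow> fst x \<in> Toeplitz_circle \<and> snd x \<in> Toeplitz_circle \<and>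
    (\<forall>u v. apply_bcontfun (\<sigma> (apply_bcontfun (fst x) (u * v))) u = apply_bcontfun (\<sigma> (apply_bcontfun (snd x) v)) u)"
proof (cases "fst x \<in> Toeplitz_circle \<and> snd x \<in> Toeplitz_circle")
  case True
  then have "W_twist (symbol_tensor_id \<sigma> (fst x)) = symbol_tensor_id \<sigma> (snd x) \<longleftrightarrow>
    (\<forall>u v. apply_bcontfun (\<sigma> (apply_bcontfun (fst x) (u * v))) u = apply_bcontfun (\<sigma> (apply_bcontfun (snd x) v)) u)"
    by (simp add: apply_bcontfun_inject[symmetric] fun_eq_iff apply_W_twist apply_symbol_tensor_id)
  then show ?thesis using True by (auto simp: C_S3_def case_prod_beta)
qed (auto simp: C_S3_def case_prod_beta)

text \<open>
  The matching condition can be tested pointwise, and each test is continuous as the symbol map is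
  contractive.
\<close>

lemma closed_C_S3: "closed (C_S3 \<sigma>)"
proof (rule closed_sequential_limits[THEN iffD2], intro allI impI)
  fix X x assume "(\<forall>n. X n \<in> C_S3 \<sigma>) \<and> X \<longlonglongrightarrow> x"
  then have X: "\<And>n. X n \<in> C_S3 \<sigma>" and lim: "X \<longlonglongrightarrow> x" by auto
  have T: "fst (X n) \<in> Toeplitz_circle" "snd (X n) \<in> Toeplitz_circle" for n
    using X[of n] by (simp_all add: C_S3_iff)
  have lims: "(\<lambda>n. fst (X n)) \<longlonglongrightarrow> fst x" "(\<lambda>n. snd (X n)) \<longlonglongrightarrow> snd x"
    by (intro tendsto_intros lim)+
  have xT: "fst x \<in> Toeplitz_circle" "snd x \<in> Toeplitz_circle"
    using closed_sequentially[OF closed_Toeplitz_circle _ lims(1)] T(1)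
      closed_sequentially[OF closed_Toeplitz_circle _ lims(2)] T(2) by blast+
  have ev: "(\<lambda>n. apply_bcontfun (\<sigma> (apply_bcontfun (F n) v)) u) \<longlonglongrightarrow> apply_bcontfun (\<sigma> (apply_bcontfun G v)) u"
    if F: "F \<longlonglongrightarrow> G" and FT: "\<And>n. F n \<in> Toeplitz_circle" "G \<in> Toeplitz_circle" for F G u v
  proof (rule LIM_zero_cancel, rule Lim_null_comparison)
    have "norm (apply_bcontfun (\<sigma> (apply_bcontfun (F n) v)) u - apply_bcontfun (\<sigma> (apply_bcontfun G v)) u)
        \<le> norm (F n - G)" for n
    proof -
      have "cmod (apply_bcontfun (\<sigma> (apply_bcontfun (F n) v - apply_bcontfun G v)) u)
          \<le> norm (apply_bcontfun (F n - G) v)"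
        using cmod_symbol_le[OF Toeplitz_diff[OF Toeplitz_circle_apply[OF FT(1)] Toeplitz_circle_apply[OF FT(2)]]]
        by simp
      also have "\<dots> \<le> norm (F n - G)" by (rule norm_bounded)
      finally show ?thesis by (simp add: symbol_diff Toeplitz_circle_apply FT)
    qed
    then show "\<forall>\<^sub>F n in sequentially. norm (apply_bcontfun (\<sigma> (apply_bcontfun (F n) v)) u
        - apply_bcontfun (\<sigma> (apply_bcontfun G v)) u) \<le> norm (F n - G)" by simp
    show "(\<lambda>n. norm (F n - G)) \<longlonglongrightarrow> 0" using F by (intro tendsto_norm_zero LIM_zero)
  qed
  have "apply_bcontfun (\<sigma> (apply_bcontfun (fst x) (u * v))) u = apply_bcontfun (\<sigma> (apply_bcontfun (snd x) v)) u" for u v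
  proof (rule LIMSEQ_unique[OF ev[OF lims(1) T(1) xT(1)]])
    have "(\<lambda>n. apply_bcontfun (\<sigma> (apply_bcontfun (fst (X n)) (u * v))) u) =
        (\<lambda>n. apply_bcontfun (\<sigma> (apply_bcontfun (snd (X n)) v)) u)"
      using X by (simp add: C_S3_iff)
    then show "(\<lambda>n. apply_bcontfun (\<sigma> (apply_bcontfun (fst (X n)) (u * v))) u) \<longlonglongrightarrow>
        apply_bcontfun (\<sigma> (apply_bcontfun (snd x) v)) u"
      using ev[OF lims(2) T(2) xT(2)] by simp
  qed
  then show "x \<in> C_S3 \<sigma>" using xT by (simp add: C_S3_iff)
qed

end

section \<open>The grading\<close>

definition S3_letter_degree :: "S3_gen \<times> bool \<Rightarrow> int"
  where "S3_letter_degree = (\<lambda>(g, b). (case g of Gen_a \<Rightarrow> -1 | Gen_b \<Rightarrow> 1) * (if b then -1 else 1))"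

definition S3_degree :: "S3_gen word \<Rightarrow> int"
  where "S3_degree w = sum_list (map S3_letter_degree (letters w))"

lemma S3_degree_plus: "S3_degree (v + w) = S3_degree v + S3_degree w"
  by (simp add: S3_degree_def plus_word_def)

lemma S3_degree_star: "S3_degree (star w) = - S3_degree w"
proof -
  have "sum_list (map S3_letter_degree (star_letters l)) = - sum_list (map S3_letter_degree l)" for l
    by (induction l) (auto simp: star_letters_def S3_letter_degree_def)
  then show ?thesis by (simp add: S3_degree_def)
qed

definition component :: "int \<Rightarrow> S3_free \<Rightarrow> S3_free"
  where "component k f = (\<Sum>w\<in>Poly_Mapping.keys f.
    if S3_degree w = k then Poly_Mapping.single w (Poly_Mapping.lookup f w) else 0)"

lemma lookup_component:
  "Poly_Mapping.lookup (component k f) w = (if S3_degree w = k then Poly_Mapping.lookup f w else 0)"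
proof -
  have "Poly_Mapping.lookup (component k f) w = (\<Sum>v\<in>Poly_Mapping.keys f.
      if v = w then (if S3_degree w = k then Poly_Mapping.lookup f w else 0) else 0)"
    unfolding component_def lookup_sum by (intro sum.cong refl) (auto simp: lookup_single when_def)
  then show ?thesis by (simp add: in_keys_iff)
qed

lemma component_add: "component k (f + g) = component k f + component k g"
  by (rule poly_mapping_eqI) (simp add: lookup_component lookup_add)

lemma component_zero [simp]: "component k 0 = 0"
  by (rule poly_mapping_eqI) (simp add: lookup_component)

lemma component_minus: "component k (- f) = - component k f"
  by (rule poly_mapping_eqI) (simp add: lookup_component)

lemma component_diff: "component k (f - g) = component k f - component k g"
  using component_add[of k f "- g"] by (simp add: component_minus)

lemma component_single:
  "component k (Poly_Mapping.single w c) = (if S3_degree w = k then Poly_Mapping.single w c else 0)"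
  by (rule poly_mapping_eqI) (auto simp: lookup_component lookup_single when_def)

lemma component_mult_left:
  "component k (Poly_Mapping.single w c * f) = Poly_Mapping.single w c * component (k - S3_degree w) f"
  by (induction f rule: free_star_algebra_induct)
    (auto simp: component_add distrib_left mult_single component_single S3_degree_plus)

lemma component_mult_right:
  "component k (f * Poly_Mapping.single w c) = component (k - S3_degree w) f * Poly_Mapping.single w c"
  by (induction f rule: free_star_algebra_induct)
    (auto simp: component_add distrib_right mult_single component_single S3_degree_plus)

lemma component_star: "component k (star f) = star (component (- k) f)"
  by (induction f rule: free_star_algebra_induct)
    (auto simp: component_add star_free_add star_free_single component_single S3_degree_star)

definition homogeneous :: "int \<Rightarrow> S3_free \<Rightarrow> bool"
  where "homogeneous d f \<longleftrightarrow> (\<forall>w\<in>Poly_Mapping.keys f. S3_degree w = d)"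

lemma component_homogeneous: "homogeneous d f \<Longrightarrow> component k f = (if k = d then f else 0)"
  by (rule poly_mapping_eqI) (auto simp: homogeneous_def lookup_component in_keys_iff)

lemma homogeneous_component: "homogeneous k (component k f)"
  by (auto simp: homogeneous_def in_keys_iff lookup_component split: if_splits)

lemma homogeneous_diff: "homogeneous d f \<Longrightarrow> homogeneous d g \<Longrightarrow> homogeneous d (f - g)"
  using keys_diff[of f g] by (auto simp: homogeneous_def)

lemma homogeneous_mult: "homogeneous d f \<Longrightarrow> homogeneous e g \<Longrightarrow> homogeneous (d + e) (f * g)"
  using keys_mult[of f g] by (fastforce simp: homogeneous_def S3_degree_plus)

lemma homogeneous_scaleC: "homogeneous d f \<Longrightarrow> homogeneous d (c *\<^sub>C f)"
  by (auto simp: homogeneous_def in_keys_iff scaleC_poly_mapping.rep_eq)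

lemma homogeneous_one: "homogeneous 0 1"
  by (auto simp: homogeneous_def S3_degree_def zero_word_def simp flip: single_one split: if_splits)

lemma homogeneous_gen:
  "homogeneous (-1) (free_gen Gen_a)" "homogeneous 1 (free_gen Gen_b)" "homogeneous 1 (star (free_gen Gen_a))"
  "homogeneous (-1) (star (free_gen Gen_b))"
  by (simp_all add: star_free_gen) (simp_all add: free_gen_def homogeneous_def S3_degree_def S3_letter_degree_def)

lemma homogeneous_relations:
  assumes "f \<in> S3_relations p q"
  shows "\<exists>d. homogeneous d f"
proof -
  note h = homogeneous_gen homogeneous_one
  let ?a = "free_gen Gen_a" and ?b = "free_gen Gen_b"
  have aa: "homogeneous 0 (star ?a * ?a)" "homogeneous 0 (?a * star ?a)"
    using homogeneous_mult[OF h(3) h(1)] homogeneous_mult[OF h(1) h(3)] by simp_all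
  have bb: "homogeneous 0 (star ?b * ?b)" "homogeneous 0 (?b * star ?b)"
    using homogeneous_mult[OF h(4) h(2)] homogeneous_mult[OF h(2) h(4)] by simp_all
  have "homogeneous 0 (star ?a * ?a - complex_of_real q *\<^sub>C (?a * star ?a) - complex_of_real (1 - q) *\<^sub>C 1)"
    "homogeneous 0 (star ?b * ?b - complex_of_real p *\<^sub>C (?b * star ?b) - complex_of_real (1 - p) *\<^sub>C 1)"
    by (intro homogeneous_diff homogeneous_scaleC aa bb h)+
  moreover have "homogeneous 0 ((1 - ?a * star ?a) * (1 - ?b * star ?b))"
    using homogeneous_mult[OF homogeneous_diff[OF h(5) aa(2)] homogeneous_diff[OF h(5) bb(2)]] by simp
  moreover have "homogeneous 0 (?a * ?b - ?b * ?a)"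
    using homogeneous_diff[OF homogeneous_mult[OF h(1) h(2)]] homogeneous_mult[OF h(2) h(1)] by simp
  moreover have "homogeneous 2 (star ?a * ?b - ?b * star ?a)"
    using homogeneous_diff[OF homogeneous_mult[OF h(3) h(2)]] homogeneous_mult[OF h(2) h(3)] by simp
  ultimately show ?thesis using assms unfolding S3_relations_def Let_def by blast
qed

text \<open>
  Homogeneous relations generate a graded ideal, which makes the coaction well defined on classes.
\<close>

lemma component_S3_ideal:
  assumes "f \<in> S3_ideal p q"
  shows "component k f \<in> S3_ideal p q"
  using assms
proof (induction arbitrary: k rule: star_ideal.induct)
  case (base x)
  then obtain d where "homogeneous d x" using homogeneous_relations by blast
  then show ?case using base by (simp add: component_homogeneous star_ideal.base star_ideal.zero)
next
  case (mult_left x r)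
  show ?case
    by (induction r rule: free_star_algebra_induct)
      (auto simp: component_mult_left distrib_right component_add
        intro: star_ideal.zero star_ideal.add star_ideal.mult_left mult_left)
next
  case (mult_right x r)
  show ?case
    by (induction r rule: free_star_algebra_induct)
      (auto simp: component_mult_right distrib_left component_add
        intro: star_ideal.zero star_ideal.add star_ideal.mult_right mult_right)
qed (auto simp: component_add component_star intro: star_ideal.zero star_ideal.add star_ideal.star)

lemma scaleC_single_poly_mapping: "c *\<^sub>C Poly_Mapping.single k x = Poly_Mapping.single k (c *\<^sub>C x)"
  for x :: "'b::complex_vector"
  by (rule poly_mapping_eqI)
    (simp add: scaleC_poly_mapping.rep_eq lookup_single when_def complex_vector.scale_zero_right)

lemma star_single_coefficient:
  "star (Poly_Mapping.single k f) = Poly_Mapping.single (- k) (star f)" for k :: int and f :: S3_free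
  by (simp add: star_poly_mapping_def[of "Poly_Mapping.single k f"] star_int_def)

lemma lookup_S3_free_coaction: "Poly_Mapping.lookup (S3_free_coaction f) k = component k f"
proof -
  let ?v = "\<lambda>g. case g of Gen_a \<Rightarrow> Poly_Mapping.single (-1 :: int) (free_gen Gen_a)
    | Gen_b \<Rightarrow> Poly_Mapping.single 1 (free_gen Gen_b)"
  have letter: "eval_letter ?v x = Poly_Mapping.single (S3_letter_degree x) (Poly_Mapping.single (Word [x]) 1)" for x
  proof (cases x)
    case (Pair g b)
    then show ?thesis
      by (cases g; cases b)
        (simp_all add: S3_letter_degree_def star_single_coefficient star_free_gen, simp_all add: free_gen_def)
  qed
  have word: "eval_word ?v l = Poly_Mapping.single (S3_degree (Word l)) (Poly_Mapping.single (Word l) 1)" for l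
  proof (induction l)
    case Nil
    have "Poly_Mapping.single (Word []) 1 = (1 :: S3_free)" by (simp flip: single_one add: zero_word_def)
    then show ?case by (simp add: S3_degree_def)
  next
    case (Cons x l)
    then show ?case by (simp add: letter mult_single S3_degree_def plus_word_def)
  qed
  show ?thesis unfolding S3_free_coaction_def
  proof (induction f rule: free_star_algebra_induct)
    case (single w c)
    then show ?case
      by (simp add: star_eval_single word scaleC_single_poly_mapping lookup_single when_def component_single scaleC_single)
  qed (simp_all add: star_eval_add lookup_add component_add)
qed

lemma O_S3_coaction_class: "O_S3_coaction p q (S3_class p q f) = (\<lambda>k. S3_class p q (component k f))"
  unfolding O_S3_coaction_def lookup_S3_free_coaction
proof (rule the_elem_image_class)
  fix g assume "f - g \<in> S3_ideal p q"
  then have "component k f - component k g \<in> S3_ideal p q" for k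
    using component_S3_ideal[of "f - g" p q k] by (simp add: component_diff)
  then show "(\<lambda>k. S3_class p q (component k g)) = (\<lambda>k. S3_class p q (component k f))"
    by (simp add: S3_class_eq_iff fun_eq_iff) (metis minus_diff_eq star_ideal_minus)
qed

lemma eval_word_iota_gen:
  "eval_word (iota_gen p q) (letters w) =
    (tensor (eval_word (case_S3_gen (disc_gen q) 1) (letters w)) (U_pow (S3_degree w)),
     tensor (eval_word (case_S3_gen 1 (disc_gen p)) (letters w)) (U_pow (S3_degree w)))"
proof -
  have letter: "eval_letter (iota_gen p q) x =
      (tensor (eval_letter (case_S3_gen (disc_gen q) 1) x) (U_pow (S3_letter_degree x)),
       tensor (eval_letter (case_S3_gen 1 (disc_gen p)) x) (U_pow (S3_letter_degree x)))" for x
  proof (cases x)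
    case (Pair g b)
    then show ?thesis
      by (cases g; cases b) (simp_all add: iota_gen_def S3_letter_degree_def star_prod_def star_tensor star_U_pow)
  qed
  have "eval_word (iota_gen p q) l =
      (tensor (eval_word (case_S3_gen (disc_gen q) 1) l) (U_pow (S3_degree (Word l))),
       tensor (eval_word (case_S3_gen 1 (disc_gen p)) l) (U_pow (S3_degree (Word l))))" for l
    by (induction l)
      (simp_all add: one_prod_def one_tensor S3_degree_def U_pow_zero letter times_prod_def tensor_mult U_pow_mult)
  from this[of "letters w"] show ?thesis by simp
qed

lemma star_eval_iota_gen_homogeneous:
  assumes "homogeneous N f"
  shows "star_eval (iota_gen p q) f =
    (tensor (star_eval (case_S3_gen (disc_gen q) 1) f) (U_pow N), tensor (star_eval (case_S3_gen 1 (disc_gen p)) f) (U_pow N))"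
proof -
  have "star_eval (iota_gen p q) f = (\<Sum>w\<in>Poly_Mapping.keys f. Poly_Mapping.lookup f w *\<^sub>C
    (tensor (eval_word (case_S3_gen (disc_gen q) 1) (letters w)) (U_pow N),
     tensor (eval_word (case_S3_gen 1 (disc_gen p)) (letters w)) (U_pow N)))"
    unfolding star_eval_eq_sum[OF finite_keys order_refl] using assms
    by (intro sum.cong refl) (simp add: eval_word_iota_gen homogeneous_def)
  moreover have "tensor (\<Sum>w\<in>K. c w *\<^sub>C t w) g = (\<Sum>w\<in>K. c w *\<^sub>C tensor (t w) g)"
    for K and c :: "S3_gen word \<Rightarrow> complex" and t :: "S3_gen word \<Rightarrow> ell2 cop" and g :: "circle \<Rightarrow>\<^sub>C complex"
  proof (induction K rule: infinite_finite_induct)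
    case (insert x F)
    then show ?case by (simp add: tensor_add_left tensor_scaleC_left)
  qed (auto intro!: bcontfun_eqI simp: complex_vector.scale_zero_right)
  ultimately show ?thesis
    by (simp add: star_eval_eq_sum[OF finite_keys order_refl] prod_eq_iff fst_sum snd_sum scaleC_prod_def)
qed

context quantum_sphere
begin

text \<open>
  Both sides of the matching condition are characters of the free *-algebra, so it is enough to
  compare them on the generators.
\<close>

lemma iota_in_C_S3: "iota p q (S3_class p q f) \<in> C_S3 \<sigma>"
proof -
  have T: "case_S3_gen (disc_gen q) 1 g \<in> Toeplitz" "case_S3_gen 1 (disc_gen p) g \<in> Toeplitz" for g
    by (auto simp: disc_gen_in_Toeplitz pq Toeplitz_one split: S3_gen.split)
  have eT: "eval_word v l \<in> Toeplitz" if "\<And>g. v g \<in> Toeplitz" for v :: "S3_gen \<Rightarrow> ell2 cop" and l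
    using symbol_star_eval(1)[OF that, where f = "Poly_Mapping.single (Word l) 1"]
    by (simp add: star_eval_single scaleC_one)
  have "fst (star_eval (iota_gen p q) f) \<in> Toeplitz_circle \<and> snd (star_eval (iota_gen p q) f) \<in> Toeplitz_circle"
    unfolding star_eval_eq_sum[OF finite_keys order_refl] fst_sum snd_sum
    by (intro conjI complex_vector.subspace_sum[OF subspace_Toeplitz_circle])
      (auto simp: scaleC_prod_def eval_word_iota_gen
        intro!: complex_vector.subspace_scale[OF subspace_Toeplitz_circle] tensor_in_Toeplitz_circle eT T)
  moreover have "apply_bcontfun (\<sigma> (apply_bcontfun (fst (star_eval (iota_gen p q) f)) (u * v))) u =
      apply_bcontfun (\<sigma> (apply_bcontfun (snd (star_eval (iota_gen p q) f)) v)) u" for u v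
  proof -
    let ?w = "circle_val (u * v)"
    have T1: "case_S3_gen (cnj ?w *\<^sub>C disc_gen q) (?w *\<^sub>C 1) g \<in> Toeplitz"
      "case_S3_gen (cnj (circle_val v) *\<^sub>C 1) (circle_val v *\<^sub>C disc_gen p) g \<in> Toeplitz" for g
      by (auto simp: disc_gen_in_Toeplitz pq Toeplitz_one Toeplitz_scaleC split: S3_gen.split)
    have "cnj (circle_val u) * circle_val u = 1"
      using norm_circle_val[of u] by (simp add: complex_norm_square[symmetric] mult.commute)
    then have "(\<lambda>g. apply_bcontfun (\<sigma> (case_S3_gen (cnj ?w *\<^sub>C disc_gen q) (?w *\<^sub>C 1) g)) u) =
        (\<lambda>g. apply_bcontfun (\<sigma> (case_S3_gen (cnj (circle_val v) *\<^sub>C 1) (circle_val v *\<^sub>C disc_gen p) g)) u)"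
      by (auto simp: fun_eq_iff symbol_scaleC disc_gen_in_Toeplitz pq Toeplitz_one symbol_disc_gen symbol_one
          U_pow_apply circle_val_mult split: S3_gen.split)
    then show ?thesis
      by (simp add: apply_star_eval_iota_gen symbol_star_eval(2)[OF T1(1)] symbol_star_eval(2)[OF T1(2)]
          apply_star_eval_complex)
  qed
  ultimately show ?thesis by (simp add: C_S3_iff iota_class)
qed

end

section \<open>The line bundles\<close>

lemma apply_id_tensor_coproduct: "apply_bcontfun (id_tensor_coproduct F) (u, v) = apply_bcontfun F (u * v)"
proof -
  have "(\<lambda>(u, v). apply_bcontfun F (u * v)) = (\<lambda>p. apply_bcontfun F (fst p * snd p))" by auto
  moreover have "(\<lambda>p. apply_bcontfun F (fst p * snd p)) \<in> bcontfun"
  proof (rule bcontfun_normI)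
    show "continuous_on UNIV (\<lambda>p. apply_bcontfun F (fst p * snd p))"
      by (rule continuous_on_compose2[OF continuous_on_apply_bcontfun[of UNIV] continuous_on_circle_times]) simp
  qed (rule norm_bounded)
  ultimately show ?thesis by (simp add: id_tensor_coproduct_def Bcontfun_inverse)
qed

lemma apply_tensor_circle: "apply_bcontfun (tensor_circle F g) (u, v) = apply_bcontfun g v *\<^sub>C apply_bcontfun F u"
proof -
  have "(\<lambda>(u, v). apply_bcontfun g v *\<^sub>C apply_bcontfun F u) = (\<lambda>p. apply_bcontfun g (snd p) *\<^sub>C apply_bcontfun F (fst p))"
    by auto
  moreover have "(\<lambda>p. apply_bcontfun g (snd p) *\<^sub>C apply_bcontfun F (fst p)) \<in> bcontfun"
  proof (rule bcontfun_normI)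
    show "continuous_on UNIV (\<lambda>p. apply_bcontfun g (snd p) *\<^sub>C apply_bcontfun F (fst p))"
      by (intro continuous_on_scaleC continuous_on_compose2[OF continuous_on_apply_bcontfun[of UNIV]]
          continuous_intros) auto
    show "norm (apply_bcontfun g (snd p) *\<^sub>C apply_bcontfun F (fst p)) \<le> norm g * norm F" for p
      by (simp add: norm_scaleC mult_mono norm_bounded)
  qed
  ultimately show ?thesis by (simp add: tensor_circle_def Bcontfun_inverse)
qed

lemma coaction_homogeneous_iff:
  "id_tensor_coproduct F = tensor_circle F (U_pow N) \<longleftrightarrow> F = tensor (apply_bcontfun F 1) (U_pow N)"
proof
  assume "id_tensor_coproduct F = tensor_circle F (U_pow N)"
  then have F: "apply_bcontfun F (1 * v) = apply_bcontfun (U_pow N) v *\<^sub>C apply_bcontfun F 1" for v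
    by (metis apply_id_tensor_coproduct apply_tensor_circle)
  show "F = tensor (apply_bcontfun F 1) (U_pow N)"
    by (rule bcontfun_eqI) (simp only: tensor_apply F[unfolded mult_1_left, symmetric])
next
  assume "F = tensor (apply_bcontfun F 1) (U_pow N)"
  then have F: "apply_bcontfun F u = apply_bcontfun (U_pow N) u *\<^sub>C apply_bcontfun F 1" for u
    by (metis tensor_apply)
  show "id_tensor_coproduct F = tensor_circle F (U_pow N)"
  proof (rule bcontfun_eqI)
    fix p :: "circle \<times> circle"
    obtain u v where p: "p = (u, v)" by (cases p)
    show "apply_bcontfun (id_tensor_coproduct F) p = apply_bcontfun (tensor_circle F (U_pow N)) p"
      unfolding p apply_id_tensor_coproduct apply_tensor_circle F[of "u * v"] F[of u]
      by (simp add: U_pow_apply circle_val_mult power_int_mult_distrib scaleC_scaleC mult.commute)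
  qed
qed

context symbol
begin

lemma C_S3_tensor_iff:
  "(tensor t\<^sub>0 (U_pow N), tensor t\<^sub>1 (U_pow N)) \<in> C_S3 \<sigma> \<longleftrightarrow> (t\<^sub>0, t\<^sub>1) \<in> Toeplitz_fibre \<sigma> N"
proof -
  have T: "tensor t (U_pow N) \<in> Toeplitz_circle \<longleftrightarrow> t \<in> Toeplitz" for t
  proof
    assume "tensor t (U_pow N) \<in> Toeplitz_circle"
    from Toeplitz_circle_apply[OF this, of 1] show "t \<in> Toeplitz" by (simp add: U_pow_apply scaleC_one)
  qed (rule tensor_in_Toeplitz_circle)
  have "(\<forall>u v. apply_bcontfun (\<sigma> (apply_bcontfun (tensor t\<^sub>0 (U_pow N)) (u * v))) u =
      apply_bcontfun (\<sigma> (apply_bcontfun (tensor t\<^sub>1 (U_pow N)) v)) u) \<longleftrightarrow> U_pow N * \<sigma> t\<^sub>0 = \<sigma> t\<^sub>1" (is "?L \<longleftrightarrow> ?R")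
    if t: "t\<^sub>0 \<in> Toeplitz" "t\<^sub>1 \<in> Toeplitz"
  proof -
    have "?L \<longleftrightarrow> (\<forall>u v. circle_val v powi N * (circle_val u powi N * apply_bcontfun (\<sigma> t\<^sub>0) u) =
        circle_val v powi N * apply_bcontfun (\<sigma> t\<^sub>1) u)"
      by (simp add: symbol_scaleC t U_pow_apply circle_val_mult power_int_mult_distrib mult_ac)
    also have "\<dots> \<longleftrightarrow> ?R"
      by (simp add: apply_bcontfun_inject[symmetric] fun_eq_iff U_pow_apply)
    finally show ?thesis .
  qed
  then show ?thesis by (auto simp: C_S3_iff T Toeplitz_fibre_def)
qed

lemma C_S3_line_iff:
  "x \<in> C_S3_line \<sigma> N \<longleftrightarrow> (\<exists>t\<in>Toeplitz_fibre \<sigma> N. x = (tensor (fst t) (U_pow N), tensor (snd t) (U_pow N)))"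
proof
  assume x: "x \<in> C_S3_line \<sigma> N"
  let ?t = "(apply_bcontfun (fst x) 1, apply_bcontfun (snd x) 1)"
  have eq: "x = (tensor (fst ?t) (U_pow N), tensor (snd ?t) (U_pow N))"
    using x by (simp add: C_S3_line_def C_S3_coaction_def map_prod_def case_prod_beta coaction_homogeneous_iff prod_eq_iff)
  moreover have "x \<in> C_S3 \<sigma>" using x by (simp add: C_S3_line_def)
  ultimately have "?t \<in> Toeplitz_fibre \<sigma> N" using C_S3_tensor_iff by (metis fst_conv snd_conv)
  with eq show "\<exists>t\<in>Toeplitz_fibre \<sigma> N. x = (tensor (fst t) (U_pow N), tensor (snd t) (U_pow N))" by blast
next
  assume "\<exists>t\<in>Toeplitz_fibre \<sigma> N. x = (tensor (fst t) (U_pow N), tensor (snd t) (U_pow N))"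
  then obtain t where t: "t \<in> Toeplitz_fibre \<sigma> N" and x: "x = (tensor (fst t) (U_pow N), tensor (snd t) (U_pow N))" by blast
  have "x \<in> C_S3 \<sigma>" unfolding x C_S3_tensor_iff using t by simp
  moreover have "id_tensor_coproduct (tensor s (U_pow N)) = tensor_circle (tensor s (U_pow N)) (U_pow N)" for s :: "ell2 cop"
    unfolding coaction_homogeneous_iff by (rule bcontfun_eqI) (simp add: U_pow_apply scaleC_one)
  ultimately show "x \<in> C_S3_line \<sigma> N"
    by (simp add: C_S3_line_def C_S3_coaction_def x)
qed

lemma subspace_Toeplitz_fibre: "complex_vector.subspace (Toeplitz_fibre \<sigma> N)"
proof -
  have mult: "g * (f + f') = g * f + g * f'" "g * (c *\<^sub>C f) = c *\<^sub>C (g * f)" "g * 0 = 0"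
    for g f f' :: "circle \<Rightarrow>\<^sub>C complex" and c
    by (rule bcontfun_eqI, simp add: distrib_left)+
  show ?thesis
    unfolding complex_vector.subspace_def Toeplitz_fibre_def
    by (auto simp: zero_prod_def scaleC_prod_def Toeplitz_zero Toeplitz_add Toeplitz_scaleC symbol_zero symbol_add
      symbol_scaleC mult)
qed

lemma Toeplitz_fibre_action:
  assumes b: "b \<in> C_S2 \<sigma>" and t: "t \<in> Toeplitz_fibre \<sigma> N"
  shows "b * t \<in> Toeplitz_fibre \<sigma> N"
proof -
  have "U_pow N * \<sigma> (fst b * fst t) = \<sigma> (snd b * snd t)"
  proof -
    have bt: "fst b \<in> Toeplitz" "snd b \<in> Toeplitz" "\<sigma> (fst b) = \<sigma> (snd b)"
      "fst t \<in> Toeplitz" "snd t \<in> Toeplitz" "\<sigma> (snd t) = U_pow N * \<sigma> (fst t)"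
      using b t by (auto simp: C_S2_def Toeplitz_fibre_def)
    show ?thesis
      by (rule bcontfun_eqI) (simp add: symbol_mult bt mult_ac)
  qed
  then show ?thesis using b t by (auto simp: times_prod_def C_S2_def Toeplitz_fibre_def Toeplitz_mult)
qed

lemma C_S3_action_tensor:
  "C_S3_action b (tensor s\<^sub>0 f, tensor s\<^sub>1 f) = (tensor (fst (b * (s\<^sub>0, s\<^sub>1))) f, tensor (snd (b * (s\<^sub>0, s\<^sub>1))) f)"
proof -
  have "1 * f = f" by (rule bcontfun_eqI) simp
  then show ?thesis by (simp add: C_S3_action_def times_prod_def tensor_mult)
qed

text \<open>
  An element of degree \<open>N\<close> is determined by its value at \<open>1\<close>: it is \<open>t \<otimes> U\<^sup>N\<close> in both components.
\<close>

theorem line_bundle_isomorphic: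
  "left_module_isomorphic (C_S2 \<sigma>) C_S3_action (C_S3_line \<sigma> N) (*) (Toeplitz_fibre \<sigma> N)"
  unfolding left_module_isomorphic_def
proof (intro conjI)
  let ?\<psi> = "\<lambda>t :: ell2 cop \<times> ell2 cop. (tensor (fst t) (U_pow N), tensor (snd t) (U_pow N))"
  let ?\<phi> = "\<lambda>x :: (circle \<Rightarrow>\<^sub>C ell2 cop) \<times> (circle \<Rightarrow>\<^sub>C ell2 cop). (apply_bcontfun (fst x) 1, apply_bcontfun (snd x) 1)"
  have line: "C_S3_line \<sigma> N = ?\<psi> ` Toeplitz_fibre \<sigma> N"
    by (rule set_eqI) (simp only: C_S3_line_iff image_iff)
  have \<phi>\<psi>: "?\<phi> (?\<psi> t) = t" for t by (simp add: U_pow_apply scaleC_one)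
  have \<psi>_linear: "?\<psi> (s + t) = ?\<psi> s + ?\<psi> t" "?\<psi> (c *\<^sub>C t) = c *\<^sub>C ?\<psi> t" "?\<psi> 0 = 0" for s t c
    by (rule pair_bcontfun_eqI; simp add: scaleC_prod_def scaleC_add_right scaleC_scaleC mult.commute
        complex_vector.scale_zero_right)+
  have act: "C_S3_action b (?\<psi> t) = ?\<psi> (b * t)" for b t
    using C_S3_action_tensor[of b "fst t" "U_pow N" "snd t"] by simp
  have ring: "(b * b') * t = b * (b' * t)" "(b + b') * t = b * t + b' * t" "b * (s + t) = b * s + b * t"
    "(c *\<^sub>C b) * t = c *\<^sub>C (b * t)" "b * (c *\<^sub>C t) = c *\<^sub>C (b * t)"
    for b b' s t :: "ell2 cop \<times> ell2 cop" and c
    by (simp_all add: times_prod_def scaleC_prod_def algebra_simps scaleC_times_left scaleC_times_right)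
  show fibre: "left_module_on (C_S2 \<sigma>) (*) (Toeplitz_fibre \<sigma> N)"
    unfolding left_module_on_def
    by (intro conjI ballI allI subspace_Toeplitz_fibre Toeplitz_fibre_action ring mult_1_left)
  have sub: "complex_vector.subspace (C_S3_line \<sigma> N)"
    unfolding line complex_vector.subspace_def
  proof (intro conjI ballI allI)
    note S = subspace_Toeplitz_fibre[of N]
    show "0 \<in> ?\<psi> ` Toeplitz_fibre \<sigma> N"
      by (rule image_eqI[of _ _ 0]) (simp_all only: \<psi>_linear complex_vector.subspace_0[OF S])
    fix x assume "x \<in> ?\<psi> ` Toeplitz_fibre \<sigma> N"
    then obtain s where s: "s \<in> Toeplitz_fibre \<sigma> N" "x = ?\<psi> s" by blast
    then show "c *\<^sub>C x \<in> ?\<psi> ` Toeplitz_fibre \<sigma> N" for c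
      by (intro image_eqI[of _ _ "c *\<^sub>C s"]) (simp_all only: \<psi>_linear complex_vector.subspace_scale[OF S])
    fix y assume "y \<in> ?\<psi> ` Toeplitz_fibre \<sigma> N"
    then obtain t where t: "t \<in> Toeplitz_fibre \<sigma> N" "y = ?\<psi> t" by blast
    show "x + y \<in> ?\<psi> ` Toeplitz_fibre \<sigma> N"
      using s t by (intro image_eqI[of _ _ "s + t"]) (simp_all only: \<psi>_linear complex_vector.subspace_add[OF S])
  qed
  show "left_module_on (C_S2 \<sigma>) C_S3_action (C_S3_line \<sigma> N)"
    unfolding left_module_on_def
  proof (intro conjI ballI allI sub)
    fix x assume "x \<in> C_S3_line \<sigma> N"
    then obtain t where t: "t \<in> Toeplitz_fibre \<sigma> N" and x: "x = ?\<psi> t" unfolding line by blast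
    show "C_S3_action 1 x = x" unfolding x act mult_1_left ..
    fix b assume b: "b \<in> C_S2 \<sigma>"
    show "C_S3_action b x \<in> C_S3_line \<sigma> N"
      unfolding x act unfolding line by (intro imageI Toeplitz_fibre_action[OF b t])
    show "C_S3_action (c *\<^sub>C b) x = c *\<^sub>C C_S3_action b x" "C_S3_action b (c *\<^sub>C x) = c *\<^sub>C C_S3_action b x" for c
      unfolding x \<psi>_linear(2)[symmetric] act ring by (rule refl)+
    show "C_S3_action (b * b') x = C_S3_action b (C_S3_action b' x)"
      "C_S3_action (b + b') x = C_S3_action b x + C_S3_action b' x" for b'
      unfolding x \<psi>_linear(2)[symmetric] act ring \<psi>_linear(1) by (rule refl)+
    fix y assume "y \<in> C_S3_line \<sigma> N"
    then obtain s where y: "y = ?\<psi> s" unfolding line by blast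
    show "C_S3_action b (x + y) = C_S3_action b x + C_S3_action b y"
      unfolding x y \<psi>_linear(1)[symmetric] act ring by (rule refl)
  qed
  show "\<exists>\<phi>. bij_betw \<phi> (C_S3_line \<sigma> N) (Toeplitz_fibre \<sigma> N) \<and>
    (\<forall>x\<in>C_S3_line \<sigma> N. \<forall>y\<in>C_S3_line \<sigma> N. \<phi> (x + y) = \<phi> x + \<phi> y) \<and>
    (\<forall>c. \<forall>x\<in>C_S3_line \<sigma> N. \<phi> (c *\<^sub>C x) = c *\<^sub>C \<phi> x) \<and>
    (\<forall>b\<in>C_S2 \<sigma>. \<forall>x\<in>C_S3_line \<sigma> N. \<phi> (C_S3_action b x) = b * \<phi> x)"
  proof (intro exI[of _ ?\<phi>] conjI)
    show "bij_betw ?\<phi> (C_S3_line \<sigma> N) (Toeplitz_fibre \<sigma> N)"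
      unfolding line by (rule bij_betw_byWitness[where f' = ?\<psi>]) (auto simp: U_pow_apply scaleC_one)
    show "\<forall>x\<in>C_S3_line \<sigma> N. \<forall>y\<in>C_S3_line \<sigma> N. ?\<phi> (x + y) = ?\<phi> x + ?\<phi> y" by simp
    show "\<forall>c. \<forall>x\<in>C_S3_line \<sigma> N. ?\<phi> (c *\<^sub>C x) = c *\<^sub>C ?\<phi> x" by (simp add: scaleC_prod_def)
    show "\<forall>b\<in>C_S2 \<sigma>. \<forall>x\<in>C_S3_line \<sigma> N. ?\<phi> (C_S3_action b x) = b * ?\<phi> x"
    proof (intro ballI)
      fix b x assume "x \<in> C_S3_line \<sigma> N"
      then obtain t where x: "x = ?\<psi> t" unfolding line by blast
      show "?\<phi> (C_S3_action b x) = b * ?\<phi> x" unfolding x act \<phi>\<psi> ..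
    qed
  qed
qed

end

text \<open>
  An element of \<open>L\<^sub>N\<close> is represented by its component of degree \<open>N\<close>, on which \<open>\<iota>\<close> is \<open>U\<^sup>N\<close> times a
  constant in both components.
\<close>

theorem (in quantum_sphere) iota_L_S3: "iota p q ` L_S3 p q N \<subseteq> C_S3_line \<sigma> N"
proof (rule image_subsetI)
  fix X assume X: "X \<in> L_S3 p q N"
  then obtain f where f: "X = S3_class p q f" by (auto simp: L_S3_def O_S3_eq_range)
  have "O_S3_coaction p q X N = O_S3_tensor_U p q X N N" using X by (simp add: L_S3_def)
  then have X': "X = S3_class p q (component N f)"
    by (simp add: f O_S3_coaction_class O_S3_tensor_U_def)
  let ?t = "(star_eval (case_S3_gen (disc_gen q) 1) (component N f), star_eval (case_S3_gen 1 (disc_gen p)) (component N f))"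
  have "iota p q X = (tensor (fst ?t) (U_pow N), tensor (snd ?t) (U_pow N))"
    by (simp add: X' iota_class star_eval_iota_gen_homogeneous[OF homogeneous_component])
  moreover from this have "?t \<in> Toeplitz_fibre \<sigma> N"
    using iota_in_C_S3[of f] C_S3_tensor_iff by (metis f fst_conv snd_conv)
  ultimately show "iota p q X \<in> C_S3_line \<sigma> N" unfolding C_S3_line_iff by blast
qed

section \<open>Normal forms in the coordinate algebra\<close>

definition powz :: "'r::{monoid_mult,star} \<Rightarrow> int \<Rightarrow> 'r"
  where "powz x k = (if 0 \<le> k then x ^ nat k else star x ^ nat (- k))"

definition disc_monomial :: "'r::{monoid_mult,minus,star} \<Rightarrow> int \<Rightarrow> nat \<Rightarrow> 'r"
  where "disc_monomial x k n = powz x k * (1 - x * star x) ^ n"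

lemma powz_zero [simp]: "powz x 0 = 1"
  by (simp add: powz_def)

lemma powz_Suc: "0 \<le> k \<Longrightarrow> powz x (k + 1) = x * powz x k"
  by (simp add: powz_def nat_add_distrib)

lemma powz_pred: "k \<le> 0 \<Longrightarrow> powz x (k - 1) = star x * powz x k"
proof -
  assume "k \<le> 0"
  then have "nat (- (k - 1)) = Suc (nat (- k))" by linarith
  with \<open>k \<le> 0\<close> show ?thesis by (simp add: powz_def)
qed

definition ideal_cong :: "'g free_star_algebra set \<Rightarrow> 'g free_star_algebra \<Rightarrow> 'g free_star_algebra \<Rightarrow> bool"
  where "ideal_cong R f g \<longleftrightarrow> f - g \<in> star_ideal R"

context
  fixes R :: "'g free_star_algebra set"
begin

abbreviation icong (infix "\<doteq>" 50) where "f \<doteq> g \<equiv> ideal_cong R f g"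

lemma cong_refl [simp]: "f \<doteq> f"
  by (simp add: ideal_cong_def star_ideal.zero)

lemma cong_sym: "f \<doteq> g \<Longrightarrow> g \<doteq> f"
  using star_ideal_minus[of "f - g" R] by (simp add: ideal_cong_def)

lemma cong_trans [trans]: "f \<doteq> g \<Longrightarrow> g \<doteq> h \<Longrightarrow> f \<doteq> h"
  using star_ideal.add[of "f - g" R "g - h"] by (simp add: ideal_cong_def)

lemma cong_diff: "f \<doteq> g \<Longrightarrow> f' \<doteq> g' \<Longrightarrow> f - f' \<doteq> g - g'"
  using star_ideal_diff[of "f - g" R "f' - g'"] by (simp add: ideal_cong_def algebra_simps)

lemma cong_scaleC: "f \<doteq> g \<Longrightarrow> c *\<^sub>C f \<doteq> c *\<^sub>C g"
  using star_ideal_scaleC[of "f - g" R c] by (simp add: ideal_cong_def complex_vector.scale_right_diff_distrib)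

lemma cong_mult: 
  assumes "f \<doteq> g" "f' \<doteq> g'"
  shows "f * f' \<doteq> g * g'"
proof -
  have "f * f' - g * g' = (f - g) * f' + g * (f' - g')" by (simp add: algebra_simps)
  then show ?thesis
    using assms by (simp add: ideal_cong_def star_ideal.add star_ideal.mult_left star_ideal.mult_right)
qed

lemma cong_star: "f \<doteq> g \<Longrightarrow> star f \<doteq> star g"
  using star_ideal.star[of "f - g" R] by (simp add: ideal_cong_def star_free_diff)

lemma cong_q_power:
  assumes "d * y \<doteq> c *\<^sub>C (y * d)"
  shows "d * y ^ n \<doteq> (c ^ n) *\<^sub>C (y ^ n * d)"
proof (induction n)
  case (Suc n)
  have "d * y ^ Suc n = (d * y) * y ^ n" by (simp add: mult.assoc)
  also have "\<dots> \<doteq> (c *\<^sub>C (y * d)) * y ^ n" by (intro cong_mult assms cong_refl)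
  also have "\<dots> = c *\<^sub>C (y * (d * y ^ n))" by (simp add: scaleC_free_mult_left mult.assoc)
  also have "\<dots> \<doteq> c *\<^sub>C (y * ((c ^ n) *\<^sub>C (y ^ n * d)))" by (intro cong_scaleC cong_mult Suc cong_refl)
  also have "\<dots> = (c ^ Suc n) *\<^sub>C (y ^ Suc n * d)"
    by (simp add: scaleC_free_mult_right scaleC_scaleC mult.assoc)
  finally show ?case .
qed (simp add: scaleC_one)

lemma cong_comm_power: "d * y \<doteq> y * d \<Longrightarrow> d * y ^ n \<doteq> y ^ n * d"
  using cong_q_power[of d y 1 n] by (simp add: scaleC_one)

lemma cong_comm_mult:
  assumes "d * y \<doteq> y * d" "d * z \<doteq> z * d"
  shows "d * (y * z) \<doteq> (y * z) * d"
proof -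
  have "d * (y * z) = (d * y) * z" by (simp add: mult.assoc)
  also have "\<dots> \<doteq> (y * d) * z" by (intro cong_mult assms cong_refl)
  also have "\<dots> = y * (d * z)" by (simp add: mult.assoc)
  also have "\<dots> \<doteq> y * (z * d)" by (intro cong_mult assms cong_refl)
  finally show ?thesis by (simp add: mult.assoc)
qed

lemma cong_comm_monomial:
  assumes "d * x \<doteq> x * d" "d * star x \<doteq> star x * d"
  shows "d * disc_monomial x k n \<doteq> disc_monomial x k n * d"
proof -
  have "d * (x * star x) \<doteq> (x * star x) * d" by (rule cong_comm_mult[OF assms])
  then have "d * (1 - x * star x) \<doteq> (1 - x * star x) * d"
    using cong_diff[OF cong_refl[of d]] by (simp add: left_diff_distrib right_diff_distrib)
  then show ?thesis
    unfolding disc_monomial_def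
    by (intro cong_comm_mult cong_comm_power) (auto simp: powz_def intro: cong_comm_power assms)
qed

text \<open>
  The relation of the quantum disc reads \<open>x\<^sup>* x \<doteq> 1 - r D\<close> for the defect \<open>D = 1 - x x\<^sup>*\<close>, which
  then satisfies \<open>D x \<doteq> r x D\<close>.
\<close>

context
  fixes x :: "'g free_star_algebra" and r :: complex
  assumes rel: "star x * x \<doteq> 1 - r *\<^sub>C (1 - x * star x)" and r: "r \<noteq> 0"
begin

lemma defect_cong: "1 - star x * x \<doteq> r *\<^sub>C (1 - x * star x)"
  using cong_diff[OF cong_refl[of 1] rel] by simp

lemma defect_gen: "(1 - x * star x) * x \<doteq> r *\<^sub>C (x * (1 - x * star x))"
proof -
  have "(1 - x * star x) * x = x * (1 - star x * x)" by (simp add: algebra_simps)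
  also have "\<dots> \<doteq> x * (r *\<^sub>C (1 - x * star x))" by (intro cong_mult defect_cong cong_refl)
  finally show ?thesis by (simp add: scaleC_free_mult_right)
qed

lemma defect_star_gen: "(1 - x * star x) * star x \<doteq> inverse r *\<^sub>C (star x * (1 - x * star x))"
proof -
  have "star x * (1 - x * star x) = (1 - star x * x) * star x" by (simp add: algebra_simps)
  also have "\<dots> \<doteq> (r *\<^sub>C (1 - x * star x)) * star x" by (intro cong_mult defect_cong cong_refl)
  finally have "inverse r *\<^sub>C (star x * (1 - x * star x)) \<doteq> inverse r *\<^sub>C ((r *\<^sub>C (1 - x * star x)) * star x)"
    by (rule cong_scaleC)
  then show ?thesis using r by (simp add: scaleC_free_mult_left scaleC_scaleC scaleC_one cong_sym)
qed

lemma gen_monomial: "\<exists>c. x * disc_monomial x k n \<doteq> disc_monomial x (k + 1) n - c *\<^sub>C disc_monomial x (k + 1) (Suc n)"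
proof (cases "0 \<le> k")
  case True
  then show ?thesis
    by (intro exI[of _ 0]) (simp add: disc_monomial_def powz_Suc mult.assoc complex_vector.scale_zero_left)
next
  case False
  let ?D = "1 - x * star x"
  define y where "y = powz x (k + 1)"
  have k: "powz x k = star x * y" using False powz_pred[of "k + 1" x] by (simp add: y_def)
  obtain c where c: "?D * y \<doteq> c *\<^sub>C (y * ?D)"
  proof -
    have "y = star x ^ nat (- (k + 1))" using False by (cases "k + 1 = 0") (auto simp: y_def powz_def)
    then show ?thesis using that cong_q_power[OF defect_star_gen, of "nat (- (k + 1))"] by simp
  qed
  have "x * disc_monomial x k n = (y - ?D * y) * ?D ^ n"
    by (simp add: disc_monomial_def k algebra_simps)
  also have "\<dots> \<doteq> (y - c *\<^sub>C (y * ?D)) * ?D ^ n"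
    by (intro cong_mult cong_diff c cong_refl)
  also have "\<dots> = disc_monomial x (k + 1) n - c *\<^sub>C disc_monomial x (k + 1) (Suc n)"
    by (simp add: disc_monomial_def left_diff_distrib scaleC_free_mult_left mult.assoc flip: y_def)
  finally show ?thesis by blast
qed

lemma star_gen_monomial:
  "\<exists>c. star x * disc_monomial x k n \<doteq> disc_monomial x (k - 1) n - c *\<^sub>C disc_monomial x (k - 1) (Suc n)"
proof (cases "k \<le> 0")
  case True
  then show ?thesis
    by (intro exI[of _ 0]) (simp add: disc_monomial_def powz_pred mult.assoc complex_vector.scale_zero_left)
next
  case False
  let ?D = "1 - x * star x"
  define y where "y = powz x (k - 1)"
  have k: "powz x k = x * y" using False powz_Suc[of "k - 1" x] by (simp add: y_def)
  obtain c where c: "?D * y \<doteq> c *\<^sub>C (y * ?D)"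
    using False cong_q_power[OF defect_gen, of "nat (k - 1)"] by (auto simp: y_def powz_def split: if_splits)
  have "star x * disc_monomial x k n = (star x * x) * y * ?D ^ n"
    by (simp add: disc_monomial_def k mult.assoc)
  also have "\<dots> \<doteq> (1 - r *\<^sub>C ?D) * y * ?D ^ n"
    by (intro cong_mult rel cong_refl)
  also have "\<dots> = (y - r *\<^sub>C (?D * y)) * ?D ^ n"
    by (simp add: left_diff_distrib scaleC_free_mult_left)
  also have "\<dots> \<doteq> (y - r *\<^sub>C (c *\<^sub>C (y * ?D))) * ?D ^ n"
    by (intro cong_mult cong_diff cong_scaleC c cong_refl)
  also have "\<dots> = disc_monomial x (k - 1) n - (r * c) *\<^sub>C disc_monomial x (k - 1) (Suc n)"
    by (simp add: disc_monomial_def left_diff_distrib scaleC_free_mult_left mult.assoc scaleC_scaleC flip: y_def)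
  finally show ?thesis by blast
qed

end

end

definition S3_monomial :: "int \<Rightarrow> int \<Rightarrow> nat \<Rightarrow> nat \<Rightarrow> S3_free"
  where "S3_monomial k l n m = disc_monomial (free_gen Gen_a) k n * disc_monomial (free_gen Gen_b) l m"

definition S3_normal :: "S3_free set"
  where "S3_normal = {S3_monomial k l n m | k l n m. n = 0 \<or> m = 0}"

context
  fixes p q :: real
  assumes pq: "0 < p" "0 < q"
begin

abbreviation "ga \<equiv> free_gen Gen_a"
abbreviation "gb \<equiv> free_gen Gen_b"
abbreviation "rels \<equiv> S3_relations p q"
abbreviation icong' (infix "\<doteq>" 50) where "f \<doteq> g \<equiv> ideal_cong rels f g"

lemma S3_cong:
  "star ga * ga \<doteq> 1 - complex_of_real q *\<^sub>C (1 - ga * star ga)"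
  "star gb * gb \<doteq> 1 - complex_of_real p *\<^sub>C (1 - gb * star gb)"
  "(1 - ga * star ga) * (1 - gb * star gb) \<doteq> 0"
  "ga * gb \<doteq> gb * ga" "star ga * gb \<doteq> gb * star ga"
proof -
  have e: "f - (1 - complex_of_real r *\<^sub>C (1 - g)) = f - complex_of_real r *\<^sub>C g - complex_of_real (1 - r) *\<^sub>C 1"
    for f g :: S3_free and r
    by (simp add: complex_vector.scale_right_diff_distrib complex_vector.scale_left_diff_distrib scaleC_one)
  show "star ga * ga \<doteq> 1 - complex_of_real q *\<^sub>C (1 - ga * star ga)"
    "star gb * gb \<doteq> 1 - complex_of_real p *\<^sub>C (1 - gb * star gb)"
    "(1 - ga * star ga) * (1 - gb * star gb) \<doteq> 0"
    "ga * gb \<doteq> gb * ga" "star ga * gb \<doteq> gb * star ga"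
    unfolding ideal_cong_def e
    by (rule star_ideal.base, simp add: S3_relations_def Let_def)+
qed

lemma S3_cong_comm:
  "gb * ga \<doteq> ga * gb" "gb * star ga \<doteq> star ga * gb" "star gb * ga \<doteq> ga * star gb" "star gb * star ga \<doteq> star ga * star gb"
  using S3_cong(4,5)[THEN cong_sym] cong_star[OF S3_cong(5)] cong_star[OF S3_cong(4)]
  by (simp_all add: star_free_mult)

text \<open>
  Adding the ideal to the spanning set turns reduction modulo the ideal into membership in a span.
\<close>

definition normalizable :: "S3_free set"
  where "normalizable = complex_span (S3_normal \<union> star_ideal rels)"

lemma normalizable_cong: "f \<doteq> g \<Longrightarrow> g \<in> normalizable \<Longrightarrow> f \<in> normalizable"
  unfolding normalizable_def ideal_cong_def
  using complex_vector.span_add[of g "S3_normal \<union> star_ideal rels" "f - g"]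
    complex_vector.span_base[of "f - g" "S3_normal \<union> star_ideal rels"] by simp

lemma subspace_normalizable: "complex_vector.subspace normalizable"
  unfolding normalizable_def by (rule complex_vector.subspace_span)

text \<open>
  If both exponents are positive, the two defects can be moved next to each other, and their
  product is a relation.
\<close>

lemma normalizable_monomial: "S3_monomial k l n m \<in> normalizable"
proof (cases "n = 0 \<or> m = 0")
  case True
  then show ?thesis unfolding normalizable_def S3_normal_def by (intro complex_vector.span_base) blast
next
  case False
  then obtain n' m' where nm: "n = Suc n'" "m = Suc m'" by (metis not0_implies_Suc)
  let ?D = "1 - ga * star ga" and ?E = "1 - gb * star gb"
  have D_comm: "gb * ?D \<doteq> ?D * gb" "star gb * ?D \<doteq> ?D * star gb"
    using cong_comm_monomial[OF S3_cong_comm(1,2), of 0 1] cong_comm_monomial[OF S3_cong_comm(3,4), of 0 1]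
    by (simp_all add: disc_monomial_def)
  have "?D * disc_monomial gb l m \<doteq> disc_monomial gb l m' * (?D * ?E)"
  proof -
    have "disc_monomial gb l m = disc_monomial gb l m' * ?E"
      by (simp only: disc_monomial_def nm power_Suc2 mult.assoc)
    then have "?D * disc_monomial gb l m = (?D * disc_monomial gb l m') * ?E" by (simp add: mult.assoc)
    also have "\<dots> \<doteq> (disc_monomial gb l m' * ?D) * ?E"
      by (intro cong_mult cong_comm_monomial cong_sym[OF D_comm(1)] cong_sym[OF D_comm(2)] cong_refl)
    finally show ?thesis by (simp add: mult.assoc)
  qed
  also have "\<dots> \<doteq> disc_monomial gb l m' * 0" by (intro cong_mult S3_cong cong_refl)
  finally have "?D * disc_monomial gb l m \<doteq> 0" by simp
  moreover have "S3_monomial k l n m = disc_monomial ga k n' * (?D * disc_monomial gb l m)"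
    by (simp only: S3_monomial_def disc_monomial_def[of ga] nm(1) power_Suc2 mult.assoc)
  ultimately have "S3_monomial k l n m \<doteq> disc_monomial ga k n' * 0"
    by (simp only: cong_mult cong_refl)
  then show ?thesis
    by (rule normalizable_cong) (simp add: complex_vector.subspace_0[OF subspace_normalizable])
qed

lemma normalizable_letter:
  assumes "f \<in> normalizable"
  shows "eval_letter free_gen x * f \<in> normalizable"
proof -
  obtain g b where x: "x = (g, b)" by (cases x)
  have "complex_vector.subspace {f. eval_letter free_gen x * f \<in> normalizable}"
    by (auto simp: complex_vector.subspace_def distrib_left scaleC_free_mult_right
        complex_vector.subspace_0[OF subspace_normalizable] complex_vector.subspace_add[OF subspace_normalizable]
        complex_vector.subspace_scale[OF subspace_normalizable])
  moreover have "eval_letter free_gen x * S3_monomial k l n m \<in> normalizable" for k l n m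
  proof (cases g)
    case Gen_a
    obtain k' c where "eval_letter free_gen x * disc_monomial ga k n \<doteq> disc_monomial ga k' n - c *\<^sub>C disc_monomial ga k' (Suc n)"
      using gen_monomial[OF S3_cong(1), of k n] star_gen_monomial[OF S3_cong(1), of k n] pq
      by (cases b) (auto simp: x Gen_a)
    then have "eval_letter free_gen x * S3_monomial k l n m \<doteq>
        (disc_monomial ga k' n - c *\<^sub>C disc_monomial ga k' (Suc n)) * disc_monomial gb l m"
      unfolding S3_monomial_def mult.assoc[symmetric] by (intro cong_mult cong_refl)
    then show ?thesis
    proof (rule normalizable_cong)
      show "(disc_monomial ga k' n - c *\<^sub>C disc_monomial ga k' (Suc n)) * disc_monomial gb l m \<in> normalizable"
        unfolding left_diff_distrib scaleC_free_mult_left S3_monomial_def[symmetric]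
        by (intro complex_vector.subspace_diff[OF subspace_normalizable]
            complex_vector.subspace_scale[OF subspace_normalizable] normalizable_monomial)
    qed
  next
    case Gen_b
    obtain l' c where lc: "eval_letter free_gen x * disc_monomial gb l m \<doteq> disc_monomial gb l' m - c *\<^sub>C disc_monomial gb l' (Suc m)"
      using gen_monomial[OF S3_cong(2), of l m] star_gen_monomial[OF S3_cong(2), of l m] pq
      by (cases b) (auto simp: x Gen_b)
    have "eval_letter free_gen x * S3_monomial k l n m = (eval_letter free_gen x * disc_monomial ga k n) * disc_monomial gb l m"
      by (simp add: S3_monomial_def mult.assoc)
    also have "\<dots> \<doteq> (disc_monomial ga k n * eval_letter free_gen x) * disc_monomial gb l m"
    proof (rule cong_mult[OF _ cong_refl])
      show "eval_letter free_gen x * disc_monomial ga k n \<doteq> disc_monomial ga k n * eval_letter free_gen x"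
        using cong_comm_monomial[OF S3_cong_comm(1,2)] cong_comm_monomial[OF S3_cong_comm(3,4)]
        by (cases b) (simp_all add: x Gen_b)
    qed
    also have "\<dots> = disc_monomial ga k n * (eval_letter free_gen x * disc_monomial gb l m)" by (rule mult.assoc)
    also have "\<dots> \<doteq> disc_monomial ga k n * (disc_monomial gb l' m - c *\<^sub>C disc_monomial gb l' (Suc m))"
      by (intro cong_mult cong_refl lc)
    finally show ?thesis
    proof (rule normalizable_cong)
      show "disc_monomial ga k n * (disc_monomial gb l' m - c *\<^sub>C disc_monomial gb l' (Suc m)) \<in> normalizable"
        unfolding right_diff_distrib scaleC_free_mult_right S3_monomial_def[symmetric]
        by (intro complex_vector.subspace_diff[OF subspace_normalizable]
            complex_vector.subspace_scale[OF subspace_normalizable] normalizable_monomial)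
    qed
  qed
  moreover have "eval_letter free_gen x * f \<in> normalizable" if "f \<in> star_ideal rels" for f
    unfolding normalizable_def using that by (intro complex_vector.span_base UnI2 star_ideal.mult_left)
  ultimately have "complex_span (S3_normal \<union> star_ideal rels) \<subseteq> {f. eval_letter free_gen x * f \<in> normalizable}"
    by (intro complex_vector.span_minimal) (auto simp: S3_normal_def)
  then show ?thesis using assms by (auto simp: normalizable_def)
qed

lemma all_normalizable: "f \<in> normalizable"
proof -
  have one: "1 \<in> normalizable"
    using normalizable_monomial[of 0 0 0 0] by (simp add: S3_monomial_def disc_monomial_def)
  have word: "eval_word free_gen l \<in> normalizable" for l
    by (induction l) (simp_all add: one normalizable_letter)
  have "f = star_eval free_gen f"
    using free_star_hom_eq_star_eval[of "\<lambda>f. f" f] by simp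
  also have "\<dots> \<in> normalizable"
    unfolding star_eval_eq_sum[OF finite_keys order_refl]
    by (intro complex_vector.subspace_sum[OF subspace_normalizable]
        complex_vector.subspace_scale[OF subspace_normalizable] word)
  finally show ?thesis .
qed

lemma normal_form:
  obtains g where "g \<in> complex_span S3_normal" "f - g \<in> star_ideal rels"
proof -
  have "complex_vector.subspace (star_ideal rels)"
    by (auto simp: complex_vector.subspace_def intro: star_ideal.zero star_ideal.add star_ideal_scaleC)
  then have I: "complex_span (star_ideal rels) = star_ideal rels" by (rule complex_vector.span_eq_iff[THEN iffD2])
  have "f \<in> complex_span (S3_normal \<union> star_ideal rels)" using all_normalizable[of f] by (simp add: normalizable_def)
  then obtain g h where "f = g + h" "g \<in> complex_span S3_normal" "h \<in> star_ideal rels"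
    unfolding complex_vector.span_Un I by blast
  then show ?thesis using that[of g] by simp
qed

end

section \<open>Linear independence of the normal forms\<close>

text \<open>
  This is \<open>convolution_bound\<close> for \<open>C = 0\<close>, applied to a sequence with a single nonzero entry.
\<close>

lemma circle_laurent_unique:
  assumes I: "finite I" and zero: "\<And>u. (\<Sum>i\<in>I. c i * circle_val u powi \<delta> i) = 0"
  shows "(\<Sum>i | i \<in> I \<and> \<delta> i = d. c i) = 0"
proof -
  define g where "g n = (if n = (0 :: int) then ell2_basis 0 else 0)" for n
  have "(\<Sum>m\<in>{- d}. (norm (\<Sum>i\<in>I. cop_apply (c i *\<^sub>C 1) (g (m + \<delta> i))))\<^sup>2) \<le> 0\<^sup>2 * (\<Sum>n\<in>{0}. (norm (g n))\<^sup>2)"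
  proof (rule convolution_bound[OF I, where N = UNIV])
    fix u and \<eta> :: ell2 assume "cmod u = 1"
    then obtain w where w: "circle_val w = u" by (rule circle_obtain)
    have "(\<Sum>i\<in>I. (u powi \<delta> i) *\<^sub>C cop_apply (c i *\<^sub>C 1) \<eta>) = (\<Sum>i\<in>I. c i * u powi \<delta> i) *\<^sub>C \<eta>"
      by (simp add: scaleC_cop_apply scaleC_scaleC complex_vector.scale_sum_left mult.commute)
    then show "norm (\<Sum>i\<in>I. (u powi \<delta> i) *\<^sub>C cop_apply (c i *\<^sub>C 1) \<eta>) \<le> 0 * norm \<eta>"
      using zero[of w] by (simp add: w complex_vector.scale_zero_left)
  qed (auto simp: g_def complex_vector.subspace_UNIV)
  then have "(\<Sum>i\<in>I. c i *\<^sub>C g (\<delta> i - d)) = 0" by (simp add: scaleC_cop_apply)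
  also have "(\<Sum>i\<in>I. c i *\<^sub>C g (\<delta> i - d)) = (\<Sum>i\<in>I. (if \<delta> i = d then c i else 0)) *\<^sub>C ell2_basis 0"
    unfolding complex_vector.scale_sum_left
    by (intro sum.cong refl) (auto simp: g_def complex_vector.scale_zero_left complex_vector.scale_zero_right)
  finally have "(\<Sum>i\<in>I. (if \<delta> i = d then c i else 0)) *\<^sub>C ell2_basis 0 = 0" .
  then have "(\<Sum>i\<in>I. (if \<delta> i = d then c i else 0)) = 0"
    using norm_basis[of 0] by (metis complex_vector.scale_eq_0_iff norm_zero zero_neq_one)
  then show ?thesis using I by (simp add: sum.inter_filter)
qed

lemma powz_disc_gen_basis:
  assumes r: "0 < r" "r < 1"
  shows "\<exists>\<omega>. cop_apply (powz (disc_gen r) k) (ell2_basis j) = \<omega> *\<^sub>C ell2_basis (nat (int j + k)) \<and>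
    (\<omega> \<noteq> 0 \<longleftrightarrow> 0 \<le> int j + k)"
proof -
  have nz: "sqrt (1 - r ^ Suc n) \<noteq> 0" for n
    using power_Suc_less_one[of r n] r by simp
  have pos: "\<exists>\<omega>. cop_apply (disc_gen r ^ i) (ell2_basis j) = \<omega> *\<^sub>C ell2_basis (j + i) \<and> \<omega> \<noteq> 0" for i
  proof (induction i)
    case 0
    show ?case by (intro exI[of _ 1]) (simp add: scaleC_one)
  next
    case (Suc i)
    then obtain \<omega> where "cop_apply (disc_gen r ^ i) (ell2_basis j) = \<omega> *\<^sub>C ell2_basis (j + i)" "\<omega> \<noteq> 0" by blast
    then show ?case
      using nz[of "j + i"]
      by (intro exI[of _ "\<omega> * complex_of_real (sqrt (1 - r ^ Suc (j + i)))"])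
        (simp add: times_cop_apply cop_linear disc_gen_basis[OF r] scaleC_scaleC del: power_Suc of_real_diff
          add: power_Suc[of "disc_gen r"])
  qed
  have neg: "\<exists>\<omega>. cop_apply (star (disc_gen r) ^ i) (ell2_basis j) = \<omega> *\<^sub>C ell2_basis (j - i) \<and> (\<omega> \<noteq> 0 \<longleftrightarrow> i \<le> j)" for i
  proof (induction i)
    case 0
    show ?case by (intro exI[of _ 1]) (simp add: scaleC_one)
  next
    case (Suc i)
    then obtain \<omega> where \<omega>: "cop_apply (star (disc_gen r) ^ i) (ell2_basis j) = \<omega> *\<^sub>C ell2_basis (j - i)" "\<omega> \<noteq> 0 \<longleftrightarrow> i \<le> j" by blast
    show ?case
    proof (cases "Suc i \<le> j")
      case True
      then obtain m where m: "j - i = Suc m" "j - Suc i = m" by (metis Suc_diff_Suc Suc_le_lessD)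
      show ?thesis
        using nz[of m] \<omega> True
        by (intro exI[of _ "\<omega> * complex_of_real (sqrt (1 - r ^ Suc m))"])
          (simp add: times_cop_apply cop_linear star_disc_gen_basis[OF r] scaleC_scaleC m del: power_Suc of_real_diff
            add: power_Suc[of "star (disc_gen r)"])
    next
      case False
      then have "cop_apply (star (disc_gen r)) (\<omega> *\<^sub>C ell2_basis (j - i)) = 0"
        using \<omega>(2) by (cases "j - i") (auto simp: cop_linear star_disc_gen_basis[OF r] complex_vector.scale_zero_left
            complex_vector.scale_zero_right)
      then show ?thesis using False \<omega> by (intro exI[of _ 0]) (simp add: times_cop_apply complex_vector.scale_zero_left)
    qed
  qed
  show ?thesis
  proof (cases "0 \<le> k")
    case True
    then show ?thesis using pos[of "nat k"] by (auto simp: powz_def nat_add_distrib)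
  next
    case False
    have "nat (int j + k) = j - nat (- k)" "(nat (- k) \<le> j) = (0 \<le> int j + k)" using False by linarith+
    then show ?thesis using neg[of "nat (- k)"] False by (simp add: powz_def)
  qed
qed

text \<open>
  For \<open>j + k \<ge> 0\<close> the coefficient of a disc monomial between the basis vectors \<open>e\<^sub>j\<close> and \<open>e\<^sub>j\<^sub>+\<^sub>k\<close> is a
  nonzero multiple of \<open>r\<^sup>j\<^sup>n\<close>, with a factor independent of \<open>n\<close>.  For fixed \<open>k\<close> and fixed Fourier index a relation becomes a polynomial with the infinitely
  many roots \<open>r\<^sup>j\<close>.
\<close>

lemma disc_monomials_independent:
  assumes r: "0 < r" "r < 1" and I: "finite I" and inj: "inj_on (\<lambda>i. (\<kappa> i, \<delta> i, \<nu> i)) I"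
    and zero: "\<And>u. (\<Sum>i\<in>I. (c i * circle_val u powi \<delta> i) *\<^sub>C disc_monomial (disc_gen r) (\<kappa> i) (\<nu> i)) = 0"
    and i0: "i\<^sub>0 \<in> I"
  shows "c i\<^sub>0 = 0"
proof -
  let ?z = "disc_gen r" and ?k = "\<kappa> i\<^sub>0" and ?d = "\<delta> i\<^sub>0"
  obtain \<omega> where \<omega>: "\<And>k j. cop_apply (powz ?z k) (ell2_basis j) = \<omega> k j *\<^sub>C ell2_basis (nat (int j + k))"
    "\<And>k j. \<omega> k j \<noteq> 0 \<longleftrightarrow> 0 \<le> int j + k"
    using powz_disc_gen_basis[OF r] by metis
  have D: "cop_apply ((1 - ?z * star ?z) ^ n) (ell2_basis j) = complex_of_real (r ^ j) ^ n *\<^sub>C ell2_basis j" for n j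
    by (induction n)
      (simp_all add: times_cop_apply cop_linear disc_gen_defect_basis[OF r] scaleC_scaleC scaleC_one mult.commute)
  define I\<^sub>0 where "I\<^sub>0 = {i \<in> I. \<kappa> i = ?k \<and> \<delta> i = ?d}"
  have I0: "finite I\<^sub>0" using I by (simp add: I\<^sub>0_def)
  have root: "(\<Sum>i\<in>I\<^sub>0. c i * complex_of_real (r ^ j) ^ \<nu> i) = 0" if j: "0 \<le> int j + ?k" for j
  proof -
    let ?e = "\<lambda>i. if \<kappa> i = ?k then c i * complex_of_real (r ^ j) ^ \<nu> i * \<omega> ?k j else 0"
    have "(\<Sum>i\<in>I. ?e i * circle_val u powi \<delta> i) = 0" for u
    proof -
      have "0 = ell2_coeff (cop_apply (\<Sum>i\<in>I. (c i * circle_val u powi \<delta> i) *\<^sub>C disc_monomial ?z (\<kappa> i) (\<nu> i)) (ell2_basis j)) (nat (int j + ?k))"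
        by (simp add: zero)
      also have "\<dots> = (\<Sum>i\<in>I. ?e i * circle_val u powi \<delta> i)"
        unfolding sum_cop_apply ell2_coeff_sum
      proof (intro sum.cong refl)
        fix i
        have "ell2_coeff (\<omega> (\<kappa> i) j *\<^sub>C ell2_basis (nat (int j + \<kappa> i))) (nat (int j + ?k)) = (if \<kappa> i = ?k then \<omega> ?k j else 0)"
        proof (cases "0 \<le> int j + \<kappa> i")
          case True
          then show ?thesis using j by (auto simp: ell2_coeff_basis nat_eq_iff)
        next
          case False
          then show ?thesis using \<omega>(2)[of "\<kappa> i" j] j by (auto simp: complex_vector.scale_zero_left)
        qed
        moreover have "cop_apply ((c i * circle_val u powi \<delta> i) *\<^sub>C disc_monomial ?z (\<kappa> i) (\<nu> i)) (ell2_basis j) =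
            (c i * circle_val u powi \<delta> i * complex_of_real (r ^ j) ^ \<nu> i) *\<^sub>C \<omega> (\<kappa> i) j *\<^sub>C ell2_basis (nat (int j + \<kappa> i))"
          by (simp add: scaleC_cop_apply disc_monomial_def times_cop_apply D cop_linear \<omega>(1) scaleC_scaleC mult.assoc)
        ultimately show "ell2_coeff (cop_apply ((c i * circle_val u powi \<delta> i) *\<^sub>C disc_monomial ?z (\<kappa> i) (\<nu> i)) (ell2_basis j)) (nat (int j + ?k))
            = ?e i * circle_val u powi \<delta> i"
          by (simp only: ell2_coeff_scaleC[of "c i * circle_val u powi \<delta> i * complex_of_real (r ^ j) ^ \<nu> i"]) simp
      qed
      finally show ?thesis by simp
    qed
    from circle_laurent_unique[OF I this, of ?d]
    have "(\<Sum>i | i \<in> I \<and> \<delta> i = ?d. ?e i) = 0" .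
    also have "(\<Sum>i | i \<in> I \<and> \<delta> i = ?d. ?e i) = (\<Sum>i\<in>I\<^sub>0. c i * complex_of_real (r ^ j) ^ \<nu> i * \<omega> ?k j)"
      using I by (intro sum.mono_neutral_cong_right) (auto simp: I\<^sub>0_def)
    finally have "(\<Sum>i\<in>I\<^sub>0. c i * complex_of_real (r ^ j) ^ \<nu> i) * \<omega> ?k j = 0" by (simp only: sum_distrib_right)
    then show ?thesis using \<omega>(2)[of ?k j] j by simp
  qed
  define C where "C n = (\<Sum>i | i \<in> I\<^sub>0 \<and> \<nu> i = n. c i)" for n
  obtain M where M: "\<And>i. i \<in> I\<^sub>0 \<Longrightarrow> \<nu> i \<le> M"
    using finite_nat_set_iff_bounded_le[of "\<nu> ` I\<^sub>0"] I0 by auto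
  have poly: "(\<Sum>n\<le>M. C n * x ^ n) = (\<Sum>i\<in>I\<^sub>0. c i * x ^ \<nu> i)" for x
  proof -
    have "(\<Sum>n\<le>M. C n * x ^ n) = (\<Sum>n\<le>M. \<Sum>i | i \<in> I\<^sub>0 \<and> \<nu> i = n. c i * x ^ \<nu> i)"
      by (simp add: C_def sum_distrib_right)
    also have "\<dots> = (\<Sum>i\<in>I\<^sub>0. c i * x ^ \<nu> i)"
      using I0 M by (intro sum.group) auto
    finally show ?thesis .
  qed
  have "infinite {x. (\<Sum>n\<le>M. C n * x ^ n) = 0}"
  proof -
    have "inj (\<lambda>j. complex_of_real (r ^ j))"
      using r by (auto simp: inj_on_def power_inject_exp' simp del: of_real_power)
    then have "inj_on (\<lambda>j. complex_of_real (r ^ j)) {nat (- ?k)..}" by (rule inj_on_subset) simp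
    then have "infinite ((\<lambda>j. complex_of_real (r ^ j)) ` {nat (- ?k)..})"
      by (simp add: finite_image_iff infinite_Ici)
    moreover have "(\<lambda>j. complex_of_real (r ^ j)) ` {nat (- ?k)..} \<subseteq> {x. (\<Sum>n\<le>M. C n * x ^ n) = 0}"
      unfolding poly by (auto intro!: root simp del: of_real_power)
    ultimately show ?thesis using infinite_super by blast
  qed
  then have "C n = 0" if "n \<le> M" for n using that polyfun_finite_roots[of C M] by blast
  then have "C (\<nu> i\<^sub>0) = 0" using M i0 by (simp add: I\<^sub>0_def)
  moreover have "{i \<in> I\<^sub>0. \<nu> i = \<nu> i\<^sub>0} = {i\<^sub>0}" using inj i0 by (auto simp: I\<^sub>0_def inj_on_def)
  ultimately show ?thesis by (simp add: C_def)
qed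

lemma star_eval_powz: "star_eval v (powz f k) = powz (star_eval v f) k"
  for v :: "'g \<Rightarrow> 'h::complex_hilbert cop"
proof -
  have "star_eval v (f ^ n) = star_eval v f ^ n" for f n
    by (induction n) (simp_all add: star_eval_mult)
  then show ?thesis by (simp add: powz_def star_eval_star)
qed

lemma star_eval_disc_monomial: "star_eval v (disc_monomial f k n) = disc_monomial (star_eval v f) k n"
  for v :: "'g \<Rightarrow> 'h::complex_hilbert cop"
proof -
  have "star_eval v (f ^ n) = star_eval v f ^ n" for f n
    by (induction n) (simp_all add: star_eval_mult)
  then show ?thesis
    by (simp add: disc_monomial_def star_eval_mult star_eval_powz star_eval_diff star_eval_star)
qed

lemma disc_monomial_one: "disc_monomial (1 :: 'h::complex_hilbert cop) k n = (if n = 0 then 1 else 0)"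
  by (cases n) (simp_all add: disc_monomial_def powz_def)

lemma homogeneous_S3_monomial: "homogeneous (l - k) (S3_monomial k l n m)"
proof -
  have pow: "homogeneous (int n * d) (f ^ n)" if "homogeneous d f" for d f n
    by (induction n) (auto simp: homogeneous_one algebra_simps intro: homogeneous_mult[OF that])
  have mon: "homogeneous (k * d) (disc_monomial f k n)"
    if f: "homogeneous d f" "homogeneous (- d) (star f)" for d f k n
  proof -
    have "homogeneous (k * d) (powz f k)"
      using pow[OF f(1), of "nat k"] pow[OF f(2), of "nat (- k)"]
      by (cases "0 \<le> k") (simp_all add: powz_def)
    moreover have "homogeneous 0 (f * star f)" using homogeneous_mult[OF f] by simp
    then have "homogeneous 0 ((1 - f * star f) ^ n)"
      using pow[OF homogeneous_diff[OF homogeneous_one]] by fastforce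
    ultimately show ?thesis using homogeneous_mult by (fastforce simp: disc_monomial_def)
  qed
  have "homogeneous (k * -1 + l * 1) (S3_monomial k l n m)"
    unfolding S3_monomial_def by (intro homogeneous_mult mon) (simp_all add: homogeneous_gen)
  then show ?thesis by simp
qed

context quantum_sphere
begin

text \<open>
  One of the components of \<open>\<iota>\<close> maps the defect of \<open>b\<close> to zero, the other one that of \<open>a\<close>; so each
  component detects the normal monomials without the respective defect.
\<close>

lemma normal_iota_injective:
  assumes g: "g \<in> complex_span S3_normal" and zero: "star_eval (iota_gen p q) g = 0"
  shows "g = 0"
proof -
  define \<phi> where "\<phi> = (\<lambda>(k, l, n, m). S3_monomial k l n m)"
  obtain F a where F: "finite F" "F \<subseteq> S3_normal" "g = (\<Sum>x\<in>F. a x *\<^sub>C x)"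
    using g unfolding complex_vector.span_explicit by blast
  have "\<forall>x\<in>F. \<exists>i. x = \<phi> i \<and> (case i of (k, l, n, m) \<Rightarrow> n = 0 \<or> m = 0)"
    using F(2) by (fastforce simp: S3_normal_def \<phi>_def)
  from bchoice[OF this] obtain ind where
    ind': "\<forall>x\<in>F. x = \<phi> (ind x) \<and> (case ind x of (k, l, n, m) \<Rightarrow> n = 0 \<or> m = 0)" by (rule exE)
  have ind: "x = \<phi> (ind x)" "case ind x of (k, l, n, m) \<Rightarrow> n = 0 \<or> m = 0" if "x \<in> F" for x
    using bspec[OF ind' that] by (rule conjunct1, rule conjunct2)
  define K L Nn Mm where "K x = fst (ind x)" and "L x = fst (snd (ind x))" and "Nn x = fst (snd (snd (ind x)))"
    and "Mm x = snd (snd (snd (ind x)))" for x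
  have x: "x = S3_monomial (K x) (L x) (Nn x) (Mm x)" and nm: "Nn x = 0 \<or> Mm x = 0" if "x \<in> F" for x
    using ind[OF that] by (auto simp: \<phi>_def K_def L_def Nn_def Mm_def split: prod.splits)
  have iota_x: "star_eval (iota_gen p q) x =
      (tensor (if Mm x = 0 then disc_monomial (disc_gen q) (K x) (Nn x) else 0) (U_pow (L x - K x)),
       tensor (if Nn x = 0 then disc_monomial (disc_gen p) (L x) (Mm x) else 0) (U_pow (L x - K x)))" if "x \<in> F" for x
  proof -
    have "homogeneous (L x - K x) x" using homogeneous_S3_monomial x[OF that] by metis
    moreover have "star_eval (case_S3_gen (disc_gen q) 1) x =
        (if Mm x = 0 then disc_monomial (disc_gen q) (K x) (Nn x) else 0)"
      by (subst x[OF that]) (simp add: S3_monomial_def star_eval_mult star_eval_disc_monomial star_eval_free_gen disc_monomial_one)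
    moreover have "star_eval (case_S3_gen 1 (disc_gen p)) x =
        (if Nn x = 0 then disc_monomial (disc_gen p) (L x) (Mm x) else 0)"
      by (subst x[OF that]) (simp add: S3_monomial_def star_eval_mult star_eval_disc_monomial star_eval_free_gen disc_monomial_one)
    ultimately show ?thesis by (simp add: star_eval_iota_gen_homogeneous)
  qed
  have lin: "star_eval (iota_gen p q) g = (\<Sum>x\<in>F. a x *\<^sub>C star_eval (iota_gen p q) x)"
    unfolding F(3)
    by (induction F rule: infinite_finite_induct) (simp_all add: star_eval_add star_eval_scaleC)
  have inj: "inj_on (\<lambda>x. (K x, L x, Nn x, Mm x)) F"
    by (rule inj_onI) (metis x prod.inject)
  have "a y = 0" if y: "y \<in> F" for y
  proof (cases "Mm y = 0")
    case True
    show ?thesis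
    proof (rule disc_monomials_independent[where I = "{x \<in> F. Mm x = 0}" and \<kappa> = K and \<delta> = "\<lambda>x. L x - K x" and \<nu> = Nn])
      show "inj_on (\<lambda>x. (K x, L x - K x, Nn x)) {x \<in> F. Mm x = 0}"
        using inj by (auto simp: inj_on_def)
      fix u
      have "(\<Sum>x\<in>F. a x *\<^sub>C apply_bcontfun (fst (star_eval (iota_gen p q) x)) u) = apply_bcontfun (fst (star_eval (iota_gen p q) g)) u"
        unfolding lin by (induction F rule: infinite_finite_induct) (simp_all add: scaleC_prod_def)
      then have "(\<Sum>x\<in>F. a x *\<^sub>C apply_bcontfun (fst (star_eval (iota_gen p q) x)) u) = 0" by (simp add: zero)
      also have "(\<Sum>x\<in>F. a x *\<^sub>C apply_bcontfun (fst (star_eval (iota_gen p q) x)) u) =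
          (\<Sum>x | x \<in> F \<and> Mm x = 0. (a x * circle_val u powi (L x - K x)) *\<^sub>C disc_monomial (disc_gen q) (K x) (Nn x))"
        using F(1) by (intro sum.mono_neutral_cong_right)
          (auto simp: iota_x U_pow_apply scaleC_scaleC complex_vector.scale_zero_right)
      finally show "(\<Sum>x | x \<in> F \<and> Mm x = 0. (a x * circle_val u powi (L x - K x)) *\<^sub>C disc_monomial (disc_gen q) (K x) (Nn x)) = 0" .
    qed (use pq F(1) y True in auto)
  next
    case False
    then have Ny: "Nn y = 0" using nm[OF y] by simp
    show ?thesis
    proof (rule disc_monomials_independent[where I = "{x \<in> F. Nn x = 0}" and \<kappa> = L and \<delta> = "\<lambda>x. L x - K x" and \<nu> = Mm])
      show "inj_on (\<lambda>x. (L x, L x - K x, Mm x)) {x \<in> F. Nn x = 0}"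
        using inj by (auto simp: inj_on_def)
      fix u
      have "(\<Sum>x\<in>F. a x *\<^sub>C apply_bcontfun (snd (star_eval (iota_gen p q) x)) u) = apply_bcontfun (snd (star_eval (iota_gen p q) g)) u"
        unfolding lin by (induction F rule: infinite_finite_induct) (simp_all add: scaleC_prod_def)
      then have "(\<Sum>x\<in>F. a x *\<^sub>C apply_bcontfun (snd (star_eval (iota_gen p q) x)) u) = 0" by (simp add: zero)
      also have "(\<Sum>x\<in>F. a x *\<^sub>C apply_bcontfun (snd (star_eval (iota_gen p q) x)) u) =
          (\<Sum>x | x \<in> F \<and> Nn x = 0. (a x * circle_val u powi (L x - K x)) *\<^sub>C disc_monomial (disc_gen p) (L x) (Mm x))"
        using F(1) by (intro sum.mono_neutral_cong_right)
          (auto simp: iota_x U_pow_apply scaleC_scaleC complex_vector.scale_zero_right)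
      finally show "(\<Sum>x | x \<in> F \<and> Nn x = 0. (a x * circle_val u powi (L x - K x)) *\<^sub>C disc_monomial (disc_gen p) (L x) (Mm x)) = 0" .
    qed (use pq F(1) y Ny in auto)
  qed
  then show ?thesis unfolding F(3) by (intro sum.neutral) (simp add: complex_vector.scale_zero_left)
qed

theorem inj_on_iota: "inj_on (iota p q) (O_S3 p q)"
proof (rule inj_onI)
  fix X Y assume "X \<in> O_S3 p q" "Y \<in> O_S3 p q" and eq: "iota p q X = iota p q Y"
  then obtain f g where f: "X = S3_class p q f" and g: "Y = S3_class p q g" by (auto simp: O_S3_eq_range)
  have zero: "star_eval (iota_gen p q) (f - g) = 0" using eq by (simp add: f g iota_class star_eval_diff)
  obtain h where h: "h \<in> complex_span S3_normal" "(f - g) - h \<in> S3_ideal p q"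
    using normal_form[OF pq(1,3)] by metis
  have "star_eval (iota_gen p q) h = 0"
    using star_eval_iota_gen_ideal[OF h(2)] zero by (simp add: star_eval_diff)
  then have "h = 0" by (rule normal_iota_injective[OF h(1)])
  then show "X = Y" using h(2) by (simp add: f g S3_class_eq_iff)
qed

end

section \<open>Laurent polynomials are dense\<close>

text \<open>
  The product is a parameter \<open>m\<close> so that the lemma serves operators as well as functions.
\<close>

lemma span_product_closed:
  fixes A :: "'a::complex_vector set"
  assumes base: "\<And>x y. x \<in> A \<Longrightarrow> y \<in> A \<Longrightarrow> m x y \<in> complex_span A"
    and add: "\<And>x y z. m (x + y) z = m x z + m y z" "\<And>x y z. m x (y + z) = m x y + m x z"
    and sc: "\<And>c x y. m (c *\<^sub>C x) y = c *\<^sub>C m x y" "\<And>c x y. m x (c *\<^sub>C y) = c *\<^sub>C m x y"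
    and x: "x \<in> complex_span A" and y: "y \<in> complex_span A"
  shows "m x y \<in> complex_span A"
proof -
  have z: "m 0 z = 0" "m z 0 = 0" for z
    using add(1)[of 0 0 z] add(2)[of z 0 0] by simp_all
  have "m a y \<in> complex_span A" if a: "a \<in> A" for a
    using y
  proof (rule complex_vector.span_induct)
    show "complex_vector.subspace {y. m a y \<in> complex_span A}"
      by (auto simp: complex_vector.subspace_def z add sc complex_vector.span_zero complex_vector.span_add
          complex_vector.span_scale)
  qed (rule base[OF a])
  note left = this
  show ?thesis
    using x
  proof (rule complex_vector.span_induct)
    show "complex_vector.subspace {x. m x y \<in> complex_span A}"
      by (auto simp: complex_vector.subspace_def z add sc complex_vector.span_zero complex_vector.span_add
          complex_vector.span_scale)
  qed (rule left)
qed

abbreviation "laurent \<equiv> complex_span (range U_pow)"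

lemma laurent_mult: "f \<in> laurent \<Longrightarrow> g \<in> laurent \<Longrightarrow> f * g \<in> laurent"
proof (rule span_product_closed[where m = "(*)"])
  show "f * g \<in> laurent" if "f \<in> range U_pow" "g \<in> range U_pow" for f g
    using that by (auto simp: U_pow_mult intro: complex_vector.span_base)
qed (auto intro!: bcontfun_eqI simp: algebra_simps)

text \<open>
  On the circle the real and imaginary part are \<open>(U + U\<^sup>*)/2\<close> and \<open>(U - U\<^sup>*)/2\<i>\<close>.
\<close>

lemma polynomial_laurent:
  assumes "real_polynomial_function r"
  shows "\<exists>P\<in>laurent. \<forall>u. apply_bcontfun P u = complex_of_real (r (circle_val u))"
  using assms
proof (induction r rule: real_polynomial_function.induct)
  case (linear f)
  interpret bounded_linear f by fact
  define A B where "A = U_pow 1 + U_pow (-1)" and "B = U_pow 1 - U_pow (-1)"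
  let ?P = "(complex_of_real (f 1) / 2) *\<^sub>C A + (complex_of_real (f \<i>) / (2 * \<i>)) *\<^sub>C B"
  have "?P \<in> laurent"
    unfolding A_def B_def
    by (intro complex_vector.span_add complex_vector.span_diff complex_vector.span_scale complex_vector.span_base) auto
  moreover have "apply_bcontfun ?P u = complex_of_real (f (circle_val u))" for u
  proof -
    let ?z = "circle_val u"
    have "?z = Re ?z *\<^sub>R 1 + Im ?z *\<^sub>R \<i>" by (simp add: complex_eq_iff)
    then have "f ?z = Re ?z * f 1 + Im ?z * f \<i>" by (metis add scaleR real_scaleR_def)
    moreover have "apply_bcontfun A u = complex_of_real (2 * Re ?z)"
      using complex_add_cnj[of ?z] circle_val_powi_minus[of u] by (simp add: A_def U_pow_apply)
    moreover have "apply_bcontfun B u = complex_of_real (2 * Im ?z) * \<i>"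
      using complex_diff_cnj[of ?z] circle_val_powi_minus[of u] by (simp add: B_def U_pow_apply)
    ultimately show ?thesis by (simp add: mult_ac)
  qed
  ultimately show ?case by blast
next
  case (const c)
  have "complex_of_real c *\<^sub>C U_pow 0 \<in> laurent"
    by (intro complex_vector.span_scale complex_vector.span_base) auto
  then show ?case by (intro bexI[of _ "complex_of_real c *\<^sub>C U_pow 0"]) (simp_all add: U_pow_apply)
next
  case (add f g)
  then obtain P Q where "P \<in> laurent" "\<forall>u. apply_bcontfun P u = complex_of_real (f (circle_val u))"
    "Q \<in> laurent" "\<forall>u. apply_bcontfun Q u = complex_of_real (g (circle_val u))" by blast
  then show ?case by (intro bexI[of _ "P + Q"]) (simp_all add: complex_vector.span_add)
next
  case (mult f g)
  then obtain P Q where "P \<in> laurent" "\<forall>u. apply_bcontfun P u = complex_of_real (f (circle_val u))"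
    "Q \<in> laurent" "\<forall>u. apply_bcontfun Q u = complex_of_real (g (circle_val u))" by blast
  then show ?case by (intro bexI[of _ "P * Q"]) (simp_all add: laurent_mult)
qed

lemma laurent_dense: "f \<in> closure laurent" for f :: "circle \<Rightarrow>\<^sub>C complex"
  unfolding closure_approachable
proof (intro allI impI)
  fix \<epsilon> :: real assume \<epsilon>: "0 < \<epsilon>"
  let ?h = "\<lambda>z. apply_bcontfun f (Circle z)"
  have "continuous_on (sphere 0 1) Circle"
    unfolding continuous_on_iff by (auto simp: dist_circle_def Circle_inverse)
  then have "continuous_on (sphere 0 1) ?h"
    by (rule continuous_on_compose2[OF continuous_on_apply_bcontfun[of UNIV]]) auto
  then obtain g where g: "polynomial_function g" "\<And>z. z \<in> sphere 0 1 \<Longrightarrow> norm (?h z - g z) < \<epsilon> / 2"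
    using Stone_Weierstrass_polynomial_function[of "sphere 0 1" ?h "\<epsilon> / 2"] \<epsilon> by auto
  have "real_polynomial_function (Re \<circ> g)" "real_polynomial_function (Im \<circ> g)"
    using g(1) bounded_linear_Re bounded_linear_Im unfolding polynomial_function_def by blast+
  then obtain P Q where P: "P \<in> laurent" "\<And>u. apply_bcontfun P u = complex_of_real ((Re \<circ> g) (circle_val u))"
    and Q: "Q \<in> laurent" "\<And>u. apply_bcontfun Q u = complex_of_real ((Im \<circ> g) (circle_val u))"
    using polynomial_laurent[of "Re \<circ> g"] polynomial_laurent[of "Im \<circ> g"] by blast
  have "P + \<i> *\<^sub>C Q \<in> laurent"
    using P(1) Q(1) by (intro complex_vector.span_add complex_vector.span_scale)
  moreover have "dist (P + \<i> *\<^sub>C Q) f \<le> \<epsilon> / 2"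
    unfolding dist_norm
  proof (rule norm_bound)
    fix u
    have "apply_bcontfun (P + \<i> *\<^sub>C Q) u = g (circle_val u)"
      by (simp add: P Q complex_eq[symmetric])
    then show "norm (apply_bcontfun (P + \<i> *\<^sub>C Q - f) u) \<le> \<epsilon> / 2"
      using g(2)[of "circle_val u"] by (simp add: norm_circle_val circle_val_inverse norm_minus_commute)
  qed
  ultimately show "\<exists>g\<in>laurent. dist g f < \<epsilon>"
    using \<epsilon> by (intro bexI[of _ "P + \<i> *\<^sub>C Q"]) auto
qed

section \<open>Toeplitz operators with polynomial symbols\<close>

abbreviation "toeplitz k \<equiv> powz shift k"

lemma toeplitz_coeff:
  "ell2_coeff (cop_apply (toeplitz k) x) n = (if 0 \<le> int n - k then ell2_coeff x (nat (int n - k)) else 0)"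
proof (cases "0 \<le> k")
  case True
  then have "nat k \<le> n \<longleftrightarrow> 0 \<le> int n - k" "n - nat k = nat (int n - k)" by linarith+
  then show ?thesis using True by (simp add: powz_def shift_power_coeff)
next
  case False
  then have "n + nat (- k) = nat (int n - k)" by linarith
  then show ?thesis using False by (simp add: powz_def star_shift_power_coeff)
qed

lemma toeplitz_in_Toeplitz: "toeplitz k \<in> Toeplitz"
  by (simp add: powz_def Toeplitz_power Toeplitz_star shift_in_Toeplitz)

lemma (in symbol) symbol_toeplitz: "apply_bcontfun (\<sigma> (toeplitz k)) u = circle_val u powi k"
proof -
  have pw: "apply_bcontfun (f ^ n) u = apply_bcontfun f u ^ n" for f :: "circle \<Rightarrow>\<^sub>C complex" and n
    by (induction n) simp_all
  have spw: "\<sigma> (s ^ n) = \<sigma> s ^ n" if "s \<in> Toeplitz" for s n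
    by (induction n) (simp_all add: symbol_one symbol_mult that Toeplitz_power)
  show ?thesis
  proof (cases "0 \<le> k")
    case True
    then show ?thesis
      by (simp add: powz_def spw shift_in_Toeplitz symbol_shift pw U_pow_apply power_int_def)
  next
    case False
    have "apply_bcontfun (\<sigma> (star shift)) u = inverse (circle_val u)"
      by (simp only: symbol_star[OF shift_in_Toeplitz] symbol_shift star_U_pow U_pow_apply) simp
    then show ?thesis using False
      by (simp add: powz_def spw Toeplitz_star shift_in_Toeplitz pw power_int_def)
  qed
qed

definition toeplitz_poly :: "ell2 cop set"
  where "toeplitz_poly = complex_span (range (powz shift))"

definition finite_matrix :: "ell2 cop set"
  where "finite_matrix = complex_span {matrix_unit m n | m n. True}"

text \<open>
  A Toeplitz operator is a compression of convolution by its symbol, hence bounded by the maximum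
  of the symbol.
\<close>

lemma (in symbol) norm_toeplitz_poly_le:
  assumes t: "t \<in> toeplitz_poly" and C: "\<And>u. cmod (apply_bcontfun (\<sigma> t) u) \<le> C"
  shows "norm t \<le> C"
proof -
  obtain F a where F: "finite F" "F \<subseteq> range (powz shift)" "t = (\<Sum>x\<in>F. a x *\<^sub>C x)"
    using t unfolding toeplitz_poly_def complex_vector.span_explicit by blast
  have "\<forall>x\<in>F. \<exists>k. x = toeplitz k" using F(2) by auto
  from bchoice[OF this] obtain d where d: "\<forall>x\<in>F. x = toeplitz (d x)" by (rule exE)
  have dT: "x \<in> Toeplitz" if "x \<in> F" for x
    using toeplitz_in_Toeplitz[of "d x"] bspec[OF d that] by simp
  have sym: "apply_bcontfun (\<sigma> t) u = (\<Sum>x\<in>F. a x * circle_val u powi d x)" for u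
  proof -
    have "\<sigma> t = (\<Sum>x\<in>F. a x *\<^sub>C \<sigma> x)"
      unfolding F(3) by (subst symbol_sum) (auto simp: Toeplitz_scaleC dT symbol_scaleC intro!: sum.cong)
    moreover have "apply_bcontfun (\<Sum>x\<in>F. f x) u = (\<Sum>x\<in>F. apply_bcontfun (f x) u)" for f :: "ell2 cop \<Rightarrow> circle \<Rightarrow>\<^sub>C complex"
      by (induction F rule: infinite_finite_induct) simp_all
    moreover have "apply_bcontfun (\<sigma> x) u = circle_val u powi d x" if "x \<in> F" for x
      using symbol_toeplitz[of "d x" u] bspec[OF d that] by simp
    ultimately show ?thesis by simp
  qed
  have C0: "0 \<le> C" by (rule order_trans[OF norm_ge_zero C[of 1]])
  show ?thesis
  proof (rule norm_cop_bound[OF C0], rule ell2_norm_le)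
    fix x :: ell2 and M :: nat
    obtain B where B: "\<And>i. i \<in> F \<Longrightarrow> nat \<bar>d i\<bar> \<le> B"
      using finite_nat_set_iff_bounded_le[of "(\<lambda>i. nat \<bar>d i\<bar>) ` F"] F(1) by auto
    \<comment> \<open>The first \<open>M\<close> coefficients of the image depend on the first \<open>L\<close> coefficients of \<open>x\<close> only.\<close>
    define L where "L = M + B"
    define g where "g n = (if 0 \<le> n \<and> n < int L then ell2_coeff x (nat n) *\<^sub>C ell2_basis 0 else 0)" for n
    have "(\<Sum>m\<in>int ` {..<M}. (norm (\<Sum>i\<in>F. cop_apply (a i *\<^sub>C 1) (g (m + (- d i)))))\<^sup>2)
        \<le> C\<^sup>2 * (\<Sum>n\<in>int ` {..<L}. (norm (g n))\<^sup>2)"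
    proof (rule convolution_bound[OF F(1), where N = UNIV])
      fix u and \<eta> :: ell2 assume "cmod u = 1"
      then have "cmod (cnj u) = 1" by simp
      then obtain w where w: "circle_val w = cnj u" by (rule circle_obtain)
      have "circle_val w powi k = u powi (- k)" for k
        using cnj_powi[OF \<open>cmod u = 1\<close>, of k] by (simp add: w)
      then have "(\<Sum>i\<in>F. (u powi (- d i)) *\<^sub>C cop_apply (a i *\<^sub>C 1) \<eta>) = apply_bcontfun (\<sigma> t) w *\<^sub>C \<eta>"
        by (simp add: sym scaleC_cop_apply scaleC_scaleC complex_vector.scale_sum_left mult.commute)
      then show "norm (\<Sum>i\<in>F. (u powi (- d i)) *\<^sub>C cop_apply (a i *\<^sub>C 1) \<eta>) \<le> C * norm \<eta>"
        using C[of w] by (simp add: norm_scaleC mult_right_mono)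
    next
      fix n assume n: "n \<notin> int ` {..<L}"
      have "n \<in> int ` {..<L}" if "0 \<le> n" "n < int L"
        using that by (intro image_eqI[of _ _ "nat n"]) auto
      then show "g n = 0" using n by (auto simp: g_def)
    qed (simp_all add: C0 complex_vector.subspace_UNIV)
    also have "(\<Sum>n\<in>int ` {..<L}. (norm (g n))\<^sup>2) = (\<Sum>n<L. (cmod (ell2_coeff x n))\<^sup>2)"
      by (subst sum.reindex) (auto simp: g_def norm_scaleC intro!: sum.cong)
    also have "C\<^sup>2 * (\<Sum>n<L. (cmod (ell2_coeff x n))\<^sup>2) \<le> C\<^sup>2 * (norm x)\<^sup>2"
      by (intro mult_left_mono ell2_sum_le) simp
    also have "(\<Sum>m\<in>int ` {..<M}. (norm (\<Sum>i\<in>F. cop_apply (a i *\<^sub>C 1) (g (m + (- d i)))))\<^sup>2) =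
        (\<Sum>n<M. (cmod (ell2_coeff (cop_apply t x) n))\<^sup>2)"
    proof (subst sum.reindex, simp, intro sum.cong refl)
      fix n assume n: "n \<in> {..<M}"
      have "cop_apply (a i *\<^sub>C 1) (g (int n + (- d i))) = (a i * ell2_coeff (cop_apply i x) n) *\<^sub>C ell2_basis 0"
        if i: "i \<in> F" for i
      proof -
        have "int n - d i < int L" using n B[OF i] unfolding L_def by auto
        moreover have "ell2_coeff (cop_apply i x) n = (if 0 \<le> int n - d i then ell2_coeff x (nat (int n - d i)) else 0)"
          using toeplitz_coeff[of "d i" x n] bspec[OF d i] by simp
        ultimately show ?thesis
          by (simp add: g_def scaleC_cop_apply scaleC_scaleC complex_vector.scale_zero_left complex_vector.scale_zero_right)
      qed
      then have "(\<Sum>i\<in>F. cop_apply (a i *\<^sub>C 1) (g (int n + (- d i)))) = ell2_coeff (cop_apply t x) n *\<^sub>C ell2_basis 0"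
        unfolding F(3) sum_cop_apply ell2_coeff_sum
        by (simp add: complex_vector.scale_sum_left scaleC_cop_apply)
      then show "((\<lambda>m. (norm (\<Sum>i\<in>F. cop_apply (a i *\<^sub>C 1) (g (m + (- d i)))))\<^sup>2) \<circ> int) n =
          (cmod (ell2_coeff (cop_apply t x) n))\<^sup>2"
        by (simp add: norm_scaleC)
    qed
    finally show "(\<Sum>n<M. (cmod (ell2_coeff (cop_apply t x) n))\<^sup>2) \<le> (C * norm x)\<^sup>2"
      by (simp add: power_mult_distrib)
  qed (use C0 in simp)
qed

section \<open>Generators of the Toeplitz algebra as a Banach space\<close>

definition shift_words :: "ell2 cop set"
  where "shift_words = {shift ^ i * star shift ^ j | i j. True}"

lemma star_shift_power_shift_power:
  "star shift ^ j * shift ^ k = (if j \<le> k then shift ^ (k - j) else star shift ^ (j - k))"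
  by (intro cop_eqI ell2_eqI) (auto simp: times_cop_apply star_shift_power_coeff shift_power_coeff)

lemma shift_words_mult: "x \<in> shift_words \<Longrightarrow> y \<in> shift_words \<Longrightarrow> x * y \<in> shift_words"
proof -
  assume "x \<in> shift_words" "y \<in> shift_words"
  then obtain i j k l where "x = shift ^ i * star shift ^ j" "y = shift ^ k * star shift ^ l"
    by (auto simp: shift_words_def)
  then have "x * y = shift ^ i * (star shift ^ j * shift ^ k) * star shift ^ l" by (simp add: mult.assoc)
  also have "\<dots> = (if j \<le> k then shift ^ (i + (k - j)) * star shift ^ l else shift ^ i * star shift ^ ((j - k) + l))"
    by (cases "j \<le> k") (simp_all only: star_shift_power_shift_power if_True if_False power_add mult.assoc)
  also have "\<dots> \<in> shift_words" unfolding shift_words_def by auto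
  finally show ?thesis .
qed

text \<open>
  Since \<open>S\<^sup>*S = 1\<close>, the words \<open>S\<^sup>i S\<^sup>*\<^sup>j\<close> are closed under products and adjoints, so their closed
  span is a C*-algebra.
\<close>

lemma Toeplitz_subset_closure: "Toeplitz \<subseteq> closure (complex_span shift_words)"
  unfolding Toeplitz_def Cstar_generated_def
proof (rule Inter_lower, intro CollectI conjI ballI allI)
  let ?S = "complex_span shift_words"
  have sub: "complex_vector.subspace (closure ?S)"
    by (intro subspace_closure complex_vector.subspace_span)
  have "shift = shift ^ 1 * star shift ^ 0" by simp
  then have "shift \<in> shift_words" unfolding shift_words_def by blast
  then show "{shift} \<subseteq> closure ?S"
    using closure_subset[of ?S] complex_vector.span_base by blast
  show "closed (closure ?S)" by simp
  fix x assume x: "x \<in> closure ?S"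
  then obtain X where X: "\<And>n. X n \<in> ?S" "X \<longlonglongrightarrow> x" by (auto simp: closure_sequential)
  show "c *\<^sub>C x \<in> closure ?S" for c using x by (rule complex_vector.subspace_scale[OF sub])
  have "star x \<in> ?S" if "x \<in> ?S" for x
    using that
  proof (rule complex_vector.span_induct)
    show "complex_vector.subspace {x. star x \<in> ?S}"
      by (auto simp: complex_vector.subspace_def star_plus_cop star_scaleC_cop complex_vector.span_zero
          complex_vector.span_add complex_vector.span_scale)
    fix y assume "y \<in> shift_words"
    then show "star y \<in> ?S"
      by (auto simp: shift_words_def star_times_cop star_power_cop intro!: complex_vector.span_base) metis
  qed
  then have "star (X n) \<in> ?S" for n using X(1) by blast
  moreover have "(\<lambda>n. star (X n)) \<longlonglongrightarrow> star x"
  proof (rule LIM_zero_cancel, rule Lim_null_comparison)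
    show "\<forall>\<^sub>F n in sequentially. norm (star (X n) - star x) \<le> norm (X n - x)"
      by (simp flip: star_diff_cop)
    show "(\<lambda>n. norm (X n - x)) \<longlonglongrightarrow> 0" by (intro tendsto_norm_zero LIM_zero X(2))
  qed
  ultimately show "star x \<in> closure ?S" unfolding closure_sequential by (intro exI[of _ "\<lambda>n. star (X n)"]) blast
  fix y assume y: "y \<in> closure ?S"
  then obtain Y where Y: "\<And>n. Y n \<in> ?S" "Y \<longlonglongrightarrow> y" by (auto simp: closure_sequential)
  show "x + y \<in> closure ?S" using x y by (rule complex_vector.subspace_add[OF sub])
  have "X n * Y n \<in> ?S" for n
  proof (rule span_product_closed[where m = "(*)", OF _ _ _ _ _ X(1) Y(1)])
    show "a * b \<in> ?S" if "a \<in> shift_words" "b \<in> shift_words" for a b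
      using shift_words_mult[OF that] by (rule complex_vector.span_base)
  qed (simp_all add: algebra_simps scaleC_times_left scaleC_times_right)
  moreover have "(\<lambda>n. X n * Y n) \<longlonglongrightarrow> x * y" by (intro tendsto_mult X Y)
  ultimately show "x * y \<in> closure ?S" unfolding closure_sequential by (intro exI[of _ "\<lambda>n. X n * Y n"]) blast
qed

text \<open>
  Cancelling \<open>S S\<^sup>* = 1 - e\<^sub>0\<^sub>0\<close> in the middle of \<open>S\<^sup>i S\<^sup>*\<^sup>j\<close> costs one matrix unit at each step.
\<close>

lemma shift_word_decomposition:
  "shift ^ i * star shift ^ j - toeplitz (int i - int j) \<in> finite_matrix"
proof (induction i arbitrary: j)
  case 0
  show ?case by (cases j) (simp_all add: powz_def finite_matrix_def complex_vector.span_zero nat_add_distrib)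
next
  case (Suc i)
  show ?case
  proof (cases j)
    case 0
    then show ?thesis by (simp add: powz_def nat_add_distrib finite_matrix_def complex_vector.span_zero)
  next
    case j: (Suc j')
    have "shift ^ Suc i * star shift ^ j = shift ^ i * (shift * star shift) * star shift ^ j'"
      by (simp only: j power_Suc2[of shift] power_Suc[of "star shift"] mult.assoc)
    also have "\<dots> = shift ^ i * star shift ^ j' - matrix_unit i j'"
      by (simp add: matrix_unit_def algebra_simps)
    finally have "shift ^ Suc i * star shift ^ j - toeplitz (int (Suc i) - int j) =
        (shift ^ i * star shift ^ j' - toeplitz (int i - int j')) - matrix_unit i j'"
      by (simp add: j)
    moreover have "matrix_unit i j' \<in> finite_matrix"
      unfolding finite_matrix_def by (rule complex_vector.span_base) blast
    ultimately show ?thesis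
      using Suc[of j'] unfolding finite_matrix_def by (simp add: complex_vector.span_diff)
  qed
qed

definition tensor_poly :: "(circle \<Rightarrow>\<^sub>C ell2 cop) set"
  where "tensor_poly = complex_span {tensor (toeplitz k) (U_pow m) | k m. True}"

definition tensor_finite_matrix :: "(circle \<Rightarrow>\<^sub>C ell2 cop) set"
  where "tensor_finite_matrix = complex_span {tensor (matrix_unit i j) (U_pow m) | i j m. True}"

lemma bounded_linear_tensor_left: "bounded_linear (\<lambda>t. tensor t f)" for f :: "'x::topological_space \<Rightarrow>\<^sub>C complex"
proof (rule bounded_linear_intro[where K = "norm f"])
  show "norm (tensor t f) \<le> norm t * norm f" for t :: "'a"
    by (rule norm_bound) (simp add: norm_scaleC mult.commute mult_left_mono norm_bounded)
qed (simp_all add: tensor_add_left tensor_scaleC_left scaleR_scaleC)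

lemma bounded_linear_tensor_right: "bounded_linear (tensor t)" for t :: "'a::complex_normed_vector"
proof (rule bounded_linear_intro[where K = "norm t"])
  show "norm (tensor t f) \<le> norm f * norm t" for f :: "'b \<Rightarrow>\<^sub>C complex"
    by (rule norm_bound) (simp add: norm_scaleC mult_right_mono norm_bounded)
qed (auto intro!: bcontfun_eqI simp: scaleC_add_left scaleC_scaleC scaleR_scaleC)

lemma tensor_scaleC_right: "tensor t (c *\<^sub>C f) = c *\<^sub>C tensor t f"
  by (rule bcontfun_eqI) (simp add: scaleC_scaleC)

lemma linear_image_closure_span:
  fixes h :: "'a::complex_normed_vector \<Rightarrow> 'b::{complex_vector,real_normed_vector}"
  assumes bl: "bounded_linear h" and sc: "\<And>c x. h (c *\<^sub>C x) = c *\<^sub>C h x"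
    and V: "complex_vector.subspace V" "closed V" and A: "\<And>x. x \<in> A \<Longrightarrow> h x \<in> V"
    and x: "x \<in> closure (complex_span A)"
  shows "h x \<in> V"
proof -
  interpret bounded_linear h by fact
  have "complex_vector.subspace {x. h x \<in> V}"
    using V(1) by (auto simp: complex_vector.subspace_def add sc zero)
  then have "complex_span A \<subseteq> {x. h x \<in> V}" using A by (intro complex_vector.span_minimal) auto
  moreover have "closed {x. h x \<in> V}"
    using closed_vimage[OF V(2) linear_continuous_on[OF bl]] by (simp add: vimage_def)
  ultimately have "closure (complex_span A) \<subseteq> {x. h x \<in> V}" by (intro closure_minimal)
  then show ?thesis using x by blast
qed

lemma Toeplitz_circle_approx: "Toeplitz_circle \<subseteq> closure {Y + R | Y R. Y \<in> tensor_poly \<and> R \<in> tensor_finite_matrix}"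
proof -
  let ?P = "{Y + R | Y R. Y \<in> tensor_poly \<and> R \<in> tensor_finite_matrix}"
  have P: "?P = complex_span ({tensor (toeplitz k) (U_pow m) | k m. True} \<union> {tensor (matrix_unit i j) (U_pow m) | i j m. True})"
    unfolding complex_vector.span_Un tensor_poly_def tensor_finite_matrix_def by blast
  have sub: "complex_vector.subspace (closure ?P)"
    unfolding P by (intro subspace_closure complex_vector.subspace_span)
  have word: "tensor (shift ^ i * star shift ^ j) (U_pow m) \<in> closure ?P" for i j m
  proof -
    have "tensor (toeplitz (int i - int j)) (U_pow m) \<in> closure ?P"
      unfolding P by (intro subsetD[OF closure_subset] complex_vector.span_base) blast
    moreover have "tensor (shift ^ i * star shift ^ j - toeplitz (int i - int j)) (U_pow m) \<in> closure ?P"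
    proof (rule linear_image_closure_span[OF bounded_linear_tensor_left tensor_scaleC_left sub closed_closure])
      show "tensor x (U_pow m) \<in> closure ?P" if "x \<in> {matrix_unit m n | m n. True}" for x
        unfolding P using that by (intro subsetD[OF closure_subset] complex_vector.span_base) blast
      show "shift ^ i * star shift ^ j - toeplitz (int i - int j) \<in> closure (complex_span {matrix_unit m n | m n. True})"
        using shift_word_decomposition[of i j] closure_subset unfolding finite_matrix_def by blast
    qed
    ultimately have "tensor (toeplitz (int i - int j)) (U_pow m) +
        tensor (shift ^ i * star shift ^ j - toeplitz (int i - int j)) (U_pow m) \<in> closure ?P"
      by (rule complex_vector.subspace_add[OF sub])
    then show ?thesis by (simp flip: tensor_add_left)
  qed
  have mono: "tensor t (U_pow m) \<in> closure ?P" if t: "t \<in> Toeplitz" for t m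
  proof (rule linear_image_closure_span[OF bounded_linear_tensor_left tensor_scaleC_left sub closed_closure])
    show "t \<in> closure (complex_span shift_words)" using Toeplitz_subset_closure t by blast
    show "tensor x (U_pow m) \<in> closure ?P" if "x \<in> shift_words" for x
      using that word by (auto simp: shift_words_def)
  qed
  have "tensor t f \<in> closure ?P" if t: "t \<in> Toeplitz" for t f
    by (rule linear_image_closure_span[OF bounded_linear_tensor_right tensor_scaleC_right sub closed_closure _ laurent_dense[of f]])
      (use mono[OF t] in blast)
  then have "complex_span {tensor t f | t f. t \<in> Toeplitz} \<subseteq> closure ?P"
    by (intro complex_vector.span_minimal[OF _ sub]) auto
  then show ?thesis unfolding Toeplitz_circle_def by (intro closure_minimal closed_closure)
qed

section \<open>The image of the coordinate algebra is dense\<close>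

lemma tendsto_mult_bcontfun:
  fixes F G :: "nat \<Rightarrow> 'x::topological_space \<Rightarrow>\<^sub>C 'h::complex_hilbert cop"
  assumes "F \<longlonglongrightarrow> f" "G \<longlonglongrightarrow> g"
  shows "(\<lambda>n. F n * G n) \<longlonglongrightarrow> f * g"
proof -
  have "bounded_bilinear (\<lambda>f g :: 'x \<Rightarrow>\<^sub>C 'h cop. f * g)"
  proof
    show "\<exists>K. \<forall>f g :: 'x \<Rightarrow>\<^sub>C 'h cop. norm (f * g) \<le> norm f * norm g * K"
    proof (intro exI[of _ 1] allI)
      fix f g :: "'x \<Rightarrow>\<^sub>C 'h cop"
      have "norm (f * g) \<le> norm f * norm g"
      proof (rule norm_bound)
        fix x
        have "norm (apply_bcontfun f x * apply_bcontfun g x) \<le> norm (apply_bcontfun f x) * norm (apply_bcontfun g x)"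
          by (rule norm_mult_ineq)
        also have "\<dots> \<le> norm f * norm g" by (intro mult_mono norm_bounded norm_ge_zero)
        finally show "norm (apply_bcontfun (f * g) x) \<le> norm f * norm g" by simp
      qed
      then show "norm (f * g) \<le> norm f * norm g * 1" by simp
    qed
  qed (auto intro!: bcontfun_eqI simp: algebra_simps)
  from bounded_bilinear.tendsto[OF this assms] show ?thesis .
qed

lemma tendsto_star_bcontfun:
  fixes F :: "nat \<Rightarrow> 'x::topological_space \<Rightarrow>\<^sub>C 'h::complex_hilbert cop"
  assumes "F \<longlonglongrightarrow> f"
  shows "(\<lambda>n. star (F n)) \<longlonglongrightarrow> star f"
proof (rule LIM_zero_cancel, rule Lim_null_comparison)
  have "norm (star (F n) - star f) \<le> norm (F n - f)" for n
  proof (rule norm_bound)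
    show "norm (apply_bcontfun (star (F n) - star f) x) \<le> norm (F n - f)" for x
      using norm_bounded[of "F n - f" x] by (simp flip: star_diff_cop)
  qed
  then show "\<forall>\<^sub>F n in sequentially. norm (star (F n) - star f) \<le> norm (F n - f)" by simp
  show "(\<lambda>n. norm (F n - f)) \<longlonglongrightarrow> 0" by (intro tendsto_norm_zero LIM_zero assms)
qed

text \<open>
  The defect is diagonal with entries \<open>r\<^sup>n\<close>, so its \<open>j\<close>-th power is within \<open>r\<^sup>j\<close> of the projection onto \<open>e\<^sub>0\<close>.
\<close>

lemma disc_gen_defect_power_tendsto:
  assumes r: "0 < r" "r < 1"
  shows "(\<lambda>j. (1 - disc_gen r * star (disc_gen r)) ^ j) \<longlonglongrightarrow> matrix_unit 0 0"
proof (rule LIM_zero_cancel, rule Lim_null_comparison)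
  let ?D = "1 - disc_gen r * star (disc_gen r)"
  have D: "cop_apply (?D ^ j) (ell2_basis n) = complex_of_real (r ^ n) ^ j *\<^sub>C ell2_basis n" for n j
    by (induction j)
      (simp_all add: times_cop_apply cop_linear disc_gen_defect_basis[OF r] scaleC_scaleC scaleC_one mult.commute)
  have "norm (?D ^ j - matrix_unit 0 0) \<le> r ^ j" if j: "j > 0" for j
  proof -
    let ?w = "\<lambda>n. if n = 0 then 0 else complex_of_real (r ^ n) ^ j"
    have w: "cmod (?w n) \<le> r ^ j" for n
    proof (cases n)
      case (Suc m)
      have "r ^ n \<le> r" using r power_decreasing[of 1 n r] by (simp add: Suc)
      then have "(r ^ n) ^ j \<le> r ^ j" using r by (intro power_mono) auto
      then show ?thesis using r Suc by (simp add: norm_power norm_mult)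
    qed (use r in simp)
    have bw: "bounded (range ?w)" unfolding bounded_iff using w by blast
    have "?D ^ j - matrix_unit 0 0 = star shift * weighted_shift ?w"
    proof (rule cop_eq_on_basis)
      fix n
      have "cop_apply (star shift) (ell2_basis (Suc n)) = ell2_basis n"
        by (rule ell2_eqI) (simp add: star_shift_coeff ell2_coeff_basis)
      then show "cop_apply (?D ^ j - matrix_unit 0 0) (ell2_basis n) = cop_apply (star shift * weighted_shift ?w) (ell2_basis n)"
        using j by (simp add: minus_cop_apply D matrix_unit_apply ell2_coeff_basis times_cop_apply
            weighted_shift_basis[OF bw] cop_linear scaleC_one complex_vector.scale_zero_left)
    qed
    then have "norm (?D ^ j - matrix_unit 0 0) \<le> norm (star shift) * norm (weighted_shift ?w)"
      by (simp only: norm_mult_ineq)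
    also have "\<dots> \<le> 1 * r ^ j"
    proof (rule mult_mono)
      show "norm (star shift) \<le> 1"
        unfolding norm_star_cop unilateral_shift_def by (rule norm_weighted_shift_le) simp
    qed (use w norm_weighted_shift_le[of ?w] in auto)
    finally show ?thesis by simp
  qed
  then show "\<forall>\<^sub>F j in sequentially. norm (?D ^ j - matrix_unit 0 0) \<le> r ^ j"
    by (intro eventually_sequentiallyI[of 1]) simp
  show "(\<lambda>j. r ^ j) \<longlonglongrightarrow> 0" using r by (intro LIMSEQ_power_zero) auto
qed

lemma disc_gen_matrix_unit:
  assumes r: "0 < r" "r < 1"
  shows "\<exists>c. c \<noteq> 0 \<and> disc_gen r ^ i * matrix_unit 0 0 * star (disc_gen r) ^ j = c *\<^sub>C matrix_unit i j"
proof -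
  have "\<exists>\<omega>. cop_apply (disc_gen r ^ n) (ell2_basis 0) = \<omega> *\<^sub>C ell2_basis n \<and> \<omega> \<noteq> 0" for n
    using powz_disc_gen_basis[OF r, of "int n" 0] by (auto simp: powz_def)
  then obtain \<omega> where \<omega>: "\<And>n. cop_apply (disc_gen r ^ n) (ell2_basis 0) = \<omega> n *\<^sub>C ell2_basis n" "\<And>n. \<omega> n \<noteq> 0"
    by metis
  have "ell2_coeff (cop_apply (star (disc_gen r) ^ j) x) 0 = cnj (\<omega> j) * ell2_coeff x j" for x
    unfolding star_power_cop[symmetric] ell2_coeff_star \<omega>(1) by (simp add: cinner_scaleC_left cinner_basis_left)
  then have "disc_gen r ^ i * matrix_unit 0 0 * star (disc_gen r) ^ j = (cnj (\<omega> j) * \<omega> i) *\<^sub>C matrix_unit i j"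
    by (intro cop_eqI) (simp add: times_cop_apply matrix_unit_apply cop_linear \<omega>(1) scaleC_cop_apply scaleC_scaleC mult_ac)
  then show ?thesis using \<omega>(2) by (intro exI[of _ "cnj (\<omega> j) * \<omega> i"]) simp
qed

lemma powz_tensor: "powz (tensor t (U_pow d)) k = tensor (powz t k) (U_pow (d * k))"
  for t :: "'h::complex_hilbert cop"
proof -
  have pow: "tensor t (U_pow d) ^ n = tensor (t ^ n) (U_pow (d * int n))" for t :: "'h cop" and d n
    by (induction n) (simp_all add: U_pow_zero one_tensor tensor_mult U_pow_mult distrib_left)
  show ?thesis by (simp add: powz_def star_tensor star_U_pow pow)
qed

lemma powz_Pair: "powz (x, y) k = (powz x k, powz y k)"
proof -
  have "(x, y) ^ n = (x ^ n, y ^ n)" for x :: "'a::{monoid_mult,star}" and y :: "'b::{monoid_mult,star}" and n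
    by (induction n) (simp_all add: one_prod_def times_prod_def)
  then show ?thesis by (simp add: powz_def star_prod_def)
qed

context quantum_sphere
begin

definition iota_closure :: "((circle \<Rightarrow>\<^sub>C ell2 cop) \<times> (circle \<Rightarrow>\<^sub>C ell2 cop)) set"
  where "iota_closure = closure (range (star_eval (iota_gen p q)))"

lemma iota_image: "iota p q ` O_S3 p q = range (star_eval (iota_gen p q))"
  by (auto simp: O_S3_eq_range iota_class image_iff)

lemma star_eval_in_iota_closure: "star_eval (iota_gen p q) f \<in> iota_closure"
  unfolding iota_closure_def by (rule subsetD[OF closure_subset]) simp

lemma closed_iota_closure: "closed iota_closure"
  by (simp add: iota_closure_def)

lemma star_eval_iota_gen_mult:
  "star_eval (iota_gen p q) (f * g) = star_eval (iota_gen p q) f * star_eval (iota_gen p q) g"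
  "star_eval (iota_gen p q) (star f) = star (star_eval (iota_gen p q) f)"
  using O_S3_star_hom_iota unfolding O_S3_star_hom_def iota_class by blast+

lemma subspace_iota_closure: "complex_vector.subspace iota_closure"
proof -
  have sub: "complex_vector.subspace (range (star_eval (iota_gen p q)))"
    unfolding complex_vector.subspace_def
    by (auto simp flip: star_eval_add star_eval_scaleC) (metis rangeI star_eval_zero)
  show ?thesis
    unfolding complex_vector.subspace_def
  proof (intro conjI ballI allI)
    show "0 \<in> iota_closure" using star_eval_in_iota_closure[of 0] by simp
    fix x assume "x \<in> iota_closure"
    then obtain X where X: "\<And>n. X n \<in> range (star_eval (iota_gen p q))" "X \<longlonglongrightarrow> x"
      by (auto simp: iota_closure_def closure_sequential)
    have l: "(\<lambda>n. fst (X n)) \<longlonglongrightarrow> fst x" "(\<lambda>n. snd (X n)) \<longlonglongrightarrow> snd x" by (intro tendsto_intros X)+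
    show "c *\<^sub>C x \<in> iota_closure" for c
      unfolding iota_closure_def closure_sequential
    proof (intro exI[of _ "\<lambda>n. c *\<^sub>C X n"] conjI allI)
      show "c *\<^sub>C X n \<in> range (star_eval (iota_gen p q))" for n by (rule complex_vector.subspace_scale[OF sub X(1)])
      show "(\<lambda>n. c *\<^sub>C X n) \<longlonglongrightarrow> c *\<^sub>C x"
        unfolding scaleC_prod_def
        by (intro tendsto_Pair bounded_linear.tendsto[OF bounded_linear_scaleC] l)
    qed
    fix y assume "y \<in> iota_closure"
    then obtain Y where Y: "\<And>n. Y n \<in> range (star_eval (iota_gen p q))" "Y \<longlonglongrightarrow> y"
      by (auto simp: iota_closure_def closure_sequential)
    show "x + y \<in> iota_closure"
      unfolding iota_closure_def closure_sequential
      by (intro exI[of _ "\<lambda>n. X n + Y n"] conjI allI complex_vector.subspace_add[OF sub] X Y tendsto_add)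
  qed
qed

lemma iota_closure_mult:
  assumes x: "x \<in> iota_closure" and y: "y \<in> iota_closure"
  shows "x * y \<in> iota_closure"
proof -
  obtain X Y where X: "\<And>n. X n \<in> range (star_eval (iota_gen p q))" "X \<longlonglongrightarrow> x"
    and Y: "\<And>n. Y n \<in> range (star_eval (iota_gen p q))" "Y \<longlonglongrightarrow> y"
    using x y by (auto simp: iota_closure_def closure_sequential)
  show ?thesis
    unfolding iota_closure_def closure_sequential
  proof (intro exI[of _ "\<lambda>n. X n * Y n"] conjI allI)
    show "X n * Y n \<in> range (star_eval (iota_gen p q))" for n
      using X(1)[of n] Y(1)[of n] by (auto simp flip: star_eval_iota_gen_mult)
    show "(\<lambda>n. X n * Y n) \<longlonglongrightarrow> x * y"
      unfolding times_prod_def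
      by (intro tendsto_Pair tendsto_mult_bcontfun tendsto_fst tendsto_snd X Y)
  qed
qed

lemma iota_closure_star:
  assumes x: "x \<in> iota_closure"
  shows "star x \<in> iota_closure"
proof -
  obtain X where X: "\<And>n. X n \<in> range (star_eval (iota_gen p q))" "X \<longlonglongrightarrow> x"
    using x by (auto simp: iota_closure_def closure_sequential)
  show ?thesis
    unfolding iota_closure_def closure_sequential
  proof (intro exI[of _ "\<lambda>n. star (X n)"] conjI allI)
    show "star (X n) \<in> range (star_eval (iota_gen p q))" for n
      using X(1)[of n] by (auto simp flip: star_eval_iota_gen_mult)
    show "(\<lambda>n. star (X n)) \<longlonglongrightarrow> star x"
      unfolding star_prod_def
      by (intro tendsto_Pair tendsto_star_bcontfun tendsto_fst tendsto_snd X)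
  qed
qed

lemma iota_closure_powz:
  assumes "x \<in> iota_closure"
  shows "powz x k \<in> iota_closure"
proof -
  have "1 \<in> iota_closure" using star_eval_in_iota_closure[of 1] by simp
  then have "y ^ n \<in> iota_closure" if "y \<in> iota_closure" for y n
    by (induction n) (auto intro: iota_closure_mult that)
  then show ?thesis using assms by (simp add: powz_def iota_closure_star)
qed

lemma star_eval_iota_gen_monomial:
  "star_eval (iota_gen p q) (S3_monomial k l n m) =
    (tensor (if m = 0 then disc_monomial (disc_gen q) k n else 0) (U_pow (l - k)),
     tensor (if n = 0 then disc_monomial (disc_gen p) l m else 0) (U_pow (l - k)))"
  unfolding star_eval_iota_gen_homogeneous[OF homogeneous_S3_monomial]
  by (simp add: S3_monomial_def star_eval_mult star_eval_disc_monomial star_eval_free_gen disc_monomial_one)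

lemma tensor_zero_left: "tensor 0 f = (0 :: circle \<Rightarrow>\<^sub>C ell2 cop)"
  by (rule bcontfun_eqI) (simp add: complex_vector.scale_zero_right)

lemma bcontfun_zero_mult: "F * 0 = 0" "0 * F = (0 :: circle \<Rightarrow>\<^sub>C ell2 cop)"
  by (rule bcontfun_eqI, simp)+

text \<open>
  The powers of the defect of the generator \<open>a\<close> converge to a rank one projection in the first
  component, and moving this projection with the generators produces all matrix units.
\<close>

lemma matrix_unit_left_in_closure: "(tensor (matrix_unit i j) (U_pow m), 0) \<in> iota_closure"
proof -
  let ?z = "disc_gen q"
  have "(tensor (matrix_unit 0 0) 1, 0) \<in> iota_closure"
  proof (rule closed_sequentially[OF closed_iota_closure])
    show "star_eval (iota_gen p q) (S3_monomial 0 0 (Suc n) 0) \<in> iota_closure" for n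
      by (rule star_eval_in_iota_closure)
    have "(\<lambda>n. tensor ((1 - ?z * star ?z) ^ Suc n) 1) \<longlonglongrightarrow> tensor (matrix_unit 0 0) (1 :: circle \<Rightarrow>\<^sub>C complex)"
      by (intro bounded_linear.tendsto[OF bounded_linear_tensor_left] LIMSEQ_Suc disc_gen_defect_power_tendsto pq)
    then show "(\<lambda>n. star_eval (iota_gen p q) (S3_monomial 0 0 (Suc n) 0)) \<longlonglongrightarrow> (tensor (matrix_unit 0 0) 1, 0)"
      unfolding star_eval_iota_gen_monomial
      by (intro tendsto_Pair) (simp_all add: U_pow_zero disc_monomial_def tensor_zero_left)
  qed
  then have "star_eval (iota_gen p q) (S3_monomial (int i) 0 0 0) * (tensor (matrix_unit 0 0) 1, 0) *
      star_eval (iota_gen p q) (S3_monomial (- int j) (m + int i - int j) 0 0) \<in> iota_closure"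
    by (intro iota_closure_mult star_eval_in_iota_closure)
  also have "star_eval (iota_gen p q) (S3_monomial (int i) 0 0 0) * (tensor (matrix_unit 0 0) 1, 0) *
      star_eval (iota_gen p q) (S3_monomial (- int j) (m + int i - int j) 0 0) =
      (tensor (?z ^ i * matrix_unit 0 0 * star ?z ^ j) (U_pow m), 0)"
  proof -
    have "U_pow (- int i) * 1 * U_pow (m + int i) = U_pow m"
      using U_pow_mult[of "- int i" 0] by (simp add: U_pow_mult flip: U_pow_zero)
    then show ?thesis
      unfolding star_eval_iota_gen_monomial
      by (simp add: disc_monomial_def times_prod_def tensor_mult powz_def bcontfun_zero_mult)
  qed
  finally have in_cl: "(tensor (?z ^ i * matrix_unit 0 0 * star ?z ^ j) (U_pow m), 0) \<in> iota_closure" .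
  obtain c where c: "c \<noteq> 0" "?z ^ i * matrix_unit 0 0 * star ?z ^ j = c *\<^sub>C matrix_unit i j"
    using disc_gen_matrix_unit pq by blast
  have "(tensor (matrix_unit i j) (U_pow m), 0) = inverse c *\<^sub>C (tensor (?z ^ i * matrix_unit 0 0 * star ?z ^ j) (U_pow m), 0)"
    unfolding c(2) using c(1)
    by (simp add: scaleC_prod_def tensor_scaleC_left scaleC_scaleC scaleC_one complex_vector.scale_zero_right)
  then show ?thesis using complex_vector.subspace_scale[OF subspace_iota_closure in_cl] by metis
qed

lemma matrix_unit_right_in_closure: "(0, tensor (matrix_unit i j) (U_pow m)) \<in> iota_closure"
proof -
  let ?y = "disc_gen p"
  have "(0, tensor (matrix_unit 0 0) 1) \<in> iota_closure"
  proof (rule closed_sequentially[OF closed_iota_closure])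
    show "star_eval (iota_gen p q) (S3_monomial 0 0 0 (Suc n)) \<in> iota_closure" for n
      by (rule star_eval_in_iota_closure)
    have "(\<lambda>n. tensor ((1 - ?y * star ?y) ^ Suc n) 1) \<longlonglongrightarrow> tensor (matrix_unit 0 0) (1 :: circle \<Rightarrow>\<^sub>C complex)"
      by (intro bounded_linear.tendsto[OF bounded_linear_tensor_left] LIMSEQ_Suc disc_gen_defect_power_tendsto pq)
    then show "(\<lambda>n. star_eval (iota_gen p q) (S3_monomial 0 0 0 (Suc n))) \<longlonglongrightarrow> (0, tensor (matrix_unit 0 0) 1)"
      unfolding star_eval_iota_gen_monomial
      by (intro tendsto_Pair) (simp_all add: U_pow_zero disc_monomial_def tensor_zero_left)
  qed
  then have "star_eval (iota_gen p q) (S3_monomial 0 (int i) 0 0) * (0, tensor (matrix_unit 0 0) 1) *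
      star_eval (iota_gen p q) (S3_monomial (int i - int j - m) (- int j) 0 0) \<in> iota_closure"
    by (intro iota_closure_mult star_eval_in_iota_closure)
  also have "star_eval (iota_gen p q) (S3_monomial 0 (int i) 0 0) * (0, tensor (matrix_unit 0 0) 1) *
      star_eval (iota_gen p q) (S3_monomial (int i - int j - m) (- int j) 0 0) =
      (0, tensor (?y ^ i * matrix_unit 0 0 * star ?y ^ j) (U_pow m))"
  proof -
    have "U_pow (int i) * 1 * U_pow (m - int i) = U_pow m"
      using U_pow_mult[of "int i" 0] by (simp add: U_pow_mult flip: U_pow_zero)
    then show ?thesis
      unfolding star_eval_iota_gen_monomial
      by (simp add: disc_monomial_def times_prod_def tensor_mult powz_def bcontfun_zero_mult)
  qed
  finally have in_cl: "(0, tensor (?y ^ i * matrix_unit 0 0 * star ?y ^ j) (U_pow m)) \<in> iota_closure" .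
  obtain c where c: "c \<noteq> 0" "?y ^ i * matrix_unit 0 0 * star ?y ^ j = c *\<^sub>C matrix_unit i j"
    using disc_gen_matrix_unit pq by blast
  have "(0, tensor (matrix_unit i j) (U_pow m)) = inverse c *\<^sub>C (0, tensor (?y ^ i * matrix_unit 0 0 * star ?y ^ j) (U_pow m))"
    unfolding c(2) using c(1)
    by (simp add: scaleC_prod_def tensor_scaleC_left scaleC_scaleC scaleC_one complex_vector.scale_zero_right)
  then show ?thesis using complex_vector.subspace_scale[OF subspace_iota_closure in_cl] by metis
qed

lemma finite_matrix_in_closure:
  assumes "R \<in> tensor_finite_matrix"
  shows "(R, 0) \<in> iota_closure" "(0, R) \<in> iota_closure"
proof -
  have R: "R \<in> closure (complex_span {tensor (matrix_unit i j) (U_pow m) | i j m. True})"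
    using assms closure_subset unfolding tensor_finite_matrix_def by blast
  show "(R, 0) \<in> iota_closure"
    by (rule linear_image_closure_span[OF bounded_linear_Pair[OF bounded_linear_ident bounded_linear_zero] _
        subspace_iota_closure closed_iota_closure _ R])
      (auto simp: scaleC_prod_def complex_vector.scale_zero_right matrix_unit_left_in_closure)
  show "(0, R) \<in> iota_closure"
    by (rule linear_image_closure_span[OF bounded_linear_Pair[OF bounded_linear_zero bounded_linear_ident] _
        subspace_iota_closure closed_iota_closure _ R])
      (auto simp: scaleC_prod_def complex_vector.scale_zero_right matrix_unit_right_in_closure)
qed

lemma compact_tensor_in_closure:
  assumes "t \<in> closure (complex_span {matrix_unit m n | m n. True})"
  shows "(tensor t (U_pow m), 0) \<in> iota_closure" "(0, tensor t (U_pow m)) \<in> iota_closure"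
proof -
  show "(tensor t (U_pow m), 0) \<in> iota_closure"
    by (rule linear_image_closure_span[OF bounded_linear_Pair[OF bounded_linear_tensor_left bounded_linear_zero] _
        subspace_iota_closure closed_iota_closure _ assms])
      (auto simp: scaleC_prod_def tensor_scaleC_left complex_vector.scale_zero_right matrix_unit_left_in_closure)
  show "(0, tensor t (U_pow m)) \<in> iota_closure"
    by (rule linear_image_closure_span[OF bounded_linear_Pair[OF bounded_linear_zero bounded_linear_tensor_left] _
        subspace_iota_closure closed_iota_closure _ assms])
      (auto simp: scaleC_prod_def tensor_scaleC_left complex_vector.scale_zero_right matrix_unit_right_in_closure)
qed

text \<open>
  Modulo limits of combinations of matrix units, the two generators are \<open>(S \<otimes> U\<^sup>*, 1 \<otimes> U\<^sup>*)\<close> and \<open>(1 \<otimes> U, S \<otimes> U)\<close>, whose \<open>k\<close>-th and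
  \<open>(k + m)\<close>-th powers multiply to the given pair.
\<close>

lemma toeplitz_pair_in_closure:
  "(tensor (toeplitz k) (U_pow m), tensor (toeplitz (k + m)) (U_pow m)) \<in> iota_closure"
proof -
  have gen: "iota_gen p q g \<in> iota_closure" for g
    using star_eval_in_iota_closure[of "free_gen g"] by (simp add: star_eval_free_gen)
  have "iota_gen p q Gen_a - (tensor (disc_gen q - shift) (U_pow (-1)), 0) \<in> iota_closure"
    by (intro complex_vector.subspace_diff[OF subspace_iota_closure] gen compact_tensor_in_closure disc_gen_minus_shift pq)
  moreover have "iota_gen p q Gen_a - (tensor (disc_gen q - shift) (U_pow (-1)), 0) =
      (tensor shift (U_pow (-1)), tensor 1 (U_pow (-1)))"
    using tensor_add_left[of "disc_gen q - shift" shift "U_pow (-1)"] by (simp add: iota_gen_def)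
  ultimately have a: "(tensor shift (U_pow (-1)), tensor 1 (U_pow (-1))) \<in> iota_closure" by simp
  have "iota_gen p q Gen_b - (0, tensor (disc_gen p - shift) (U_pow 1)) \<in> iota_closure"
    by (intro complex_vector.subspace_diff[OF subspace_iota_closure] gen compact_tensor_in_closure disc_gen_minus_shift pq)
  moreover have "iota_gen p q Gen_b - (0, tensor (disc_gen p - shift) (U_pow 1)) =
      (tensor 1 (U_pow 1), tensor shift (U_pow 1))"
    using tensor_add_left[of "disc_gen p - shift" shift "U_pow 1"] by (simp add: iota_gen_def)
  ultimately have b: "(tensor 1 (U_pow 1), tensor shift (U_pow 1)) \<in> iota_closure" by simp
  have "powz (tensor shift (U_pow (-1)), tensor 1 (U_pow (-1))) k *
      powz (tensor 1 (U_pow 1), tensor shift (U_pow 1)) (k + m) \<in> iota_closure"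
    by (intro iota_closure_mult iota_closure_powz a b)
  moreover have "powz (1 :: ell2 cop) i = 1" for i by (simp add: powz_def)
  ultimately show ?thesis
    by (simp add: powz_Pair powz_tensor times_prod_def tensor_mult U_pow_mult)
qed

lemma tensor_poly_Toeplitz_circle: "tensor_poly \<subseteq> Toeplitz_circle" "tensor_finite_matrix \<subseteq> Toeplitz_circle"
  unfolding tensor_poly_def tensor_finite_matrix_def
  by (intro complex_vector.span_minimal[OF _ subspace_Toeplitz_circle];
      auto intro: tensor_in_Toeplitz_circle toeplitz_in_Toeplitz matrix_unit_in_Toeplitz)+

lemma apply_tensor_poly:
  assumes "Y \<in> tensor_poly"
  shows "apply_bcontfun Y v \<in> toeplitz_poly"
  using assms unfolding tensor_poly_def
proof (rule complex_vector.span_induct)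
  show "complex_vector.subspace {Y. apply_bcontfun Y v \<in> toeplitz_poly}"
    unfolding toeplitz_poly_def
    by (auto simp: complex_vector.subspace_def complex_vector.span_zero complex_vector.span_add complex_vector.span_scale)
  fix Y assume "Y \<in> {tensor (toeplitz k) (U_pow m) | k m. True}"
  then obtain k m where "Y = tensor (toeplitz k) (U_pow m)" by blast
  then show "apply_bcontfun Y v \<in> toeplitz_poly"
    unfolding toeplitz_poly_def by (simp add: complex_vector.span_scale[OF complex_vector.span_base])
qed

text \<open>
  The Toeplitz part of a first component extends to a pair in the closure; the symbol of the second
  entry is forced by the matching condition.
\<close>

lemma tensor_poly_partner:
  assumes "Y \<in> tensor_poly"
  shows "\<exists>Y'\<in>tensor_poly. (Y, Y') \<in> iota_closure \<and>
    (\<forall>u v. apply_bcontfun (\<sigma> (apply_bcontfun Y' v)) u = apply_bcontfun (\<sigma> (apply_bcontfun Y (u * v))) u)"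
proof -
  let ?P = "\<lambda>Y Y'. Y \<in> tensor_poly \<and> Y' \<in> tensor_poly \<and> (Y, Y') \<in> iota_closure \<and>
    (\<forall>u v. apply_bcontfun (\<sigma> (apply_bcontfun Y' v)) u = apply_bcontfun (\<sigma> (apply_bcontfun Y (u * v))) u)"
  have T: "apply_bcontfun Y v \<in> Toeplitz" if "Y \<in> tensor_poly" for Y v
    using that tensor_poly_Toeplitz_circle(1) by (intro Toeplitz_circle_apply) blast
  have lin: "0 \<in> tensor_poly" "Y \<in> tensor_poly \<Longrightarrow> Z \<in> tensor_poly \<Longrightarrow> Y + Z \<in> tensor_poly"
    "Y \<in> tensor_poly \<Longrightarrow> c *\<^sub>C Y \<in> tensor_poly" for Y Z c
    unfolding tensor_poly_def by (simp_all add: complex_vector.span_zero complex_vector.span_add complex_vector.span_scale)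
  have P0: "?P 0 0"
    using complex_vector.subspace_0[OF subspace_iota_closure] lin(1) by (simp add: zero_prod_def)
  have Padd: "?P (Y + Z) (Y' + Z')" if "?P Y Y'" "?P Z Z'" for Y Y' Z Z'
    using that complex_vector.subspace_add[OF subspace_iota_closure, of "(Y, Y')" "(Z, Z')"]
    by (simp add: lin symbol_add T)
  have Psc: "?P (c *\<^sub>C Y) (c *\<^sub>C Y')" if "?P Y Y'" for c Y Y'
    using that complex_vector.subspace_scale[OF subspace_iota_closure, of "(Y, Y')" c]
    by (simp add: lin symbol_scaleC T scaleC_prod_def)
  have "\<exists>Y'. ?P Y Y'"
    using assms unfolding tensor_poly_def
  proof (rule complex_vector.span_induct, fold tensor_poly_def)
    show "complex_vector.subspace {Y. \<exists>Y'. ?P Y Y'}"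
      unfolding complex_vector.subspace_def
    proof (intro conjI ballI allI)
      show "0 \<in> {Y. \<exists>Y'. ?P Y Y'}" by (rule CollectI, rule exI, rule P0)
      fix Y assume "Y \<in> {Y. \<exists>Y'. ?P Y Y'}"
      then have "\<exists>Y'. ?P Y Y'" by (rule CollectD)
      then obtain Y' where Y: "?P Y Y'" by (rule exE)
      show "c *\<^sub>C Y \<in> {Y. \<exists>Y'. ?P Y Y'}" for c by (rule CollectI, rule exI, rule Psc[OF Y])
      fix Z assume "Z \<in> {Y. \<exists>Y'. ?P Y Y'}"
      then have "\<exists>Y'. ?P Z Y'" by (rule CollectD)
      then obtain Z' where Z: "?P Z Z'" by (rule exE)
      show "Y + Z \<in> {Y. \<exists>Y'. ?P Y Y'}" by (rule CollectI, rule exI, rule Padd[OF Y Z])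
    qed
    fix Y assume "Y \<in> {tensor (toeplitz k) (U_pow m) | k m. True}"
    then obtain k m where Y: "Y = tensor (toeplitz k) (U_pow m)" by blast
    have base: "tensor (toeplitz k) (U_pow m) \<in> tensor_poly" for k m
      unfolding tensor_poly_def by (rule complex_vector.span_base) blast
    have "?P Y (tensor (toeplitz (k + m)) (U_pow m))"
      unfolding Y using toeplitz_pair_in_closure[of k m] base
      by (simp add: symbol_scaleC toeplitz_in_Toeplitz symbol_toeplitz U_pow_apply circle_val_mult
          power_int_mult_distrib power_int_add mult_ac)
    then show "\<exists>Y'. ?P Y Y'" by (rule exI)
  qed
  then obtain Y' where "?P Y Y'" by (rule exE)
  then show ?thesis by (intro bexI[of _ Y']) simp_all
qed

lemma symbol_tensor_finite_matrix:
  assumes "R \<in> tensor_finite_matrix"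
  shows "\<sigma> (apply_bcontfun R v) = 0"
proof -
  have "apply_bcontfun R v \<in> Toeplitz \<and> \<sigma> (apply_bcontfun R v) = 0"
    using assms unfolding tensor_finite_matrix_def
  proof (rule complex_vector.span_induct)
    show "complex_vector.subspace {R. apply_bcontfun R v \<in> Toeplitz \<and> \<sigma> (apply_bcontfun R v) = 0}"
      by (auto simp: complex_vector.subspace_def Toeplitz_zero symbol_zero Toeplitz_add symbol_add Toeplitz_scaleC
          symbol_scaleC complex_vector.scale_zero_right)
  qed (auto simp: Toeplitz_scaleC matrix_unit_in_Toeplitz symbol_scaleC symbol_matrix_unit complex_vector.scale_zero_right)
  then show ?thesis ..
qed

text \<open>
  The second approximant is replaced by the partner of the first one.  Their difference has a symbol
  of size at most \<open>2 \<delta>\<close>, and by \<open>norm_toeplitz_poly_le\<close> so is the difference itself.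
\<close>

theorem C_S3_subset_closure: "C_S3 \<sigma> \<subseteq> iota_closure"
proof
  fix x assume x: "x \<in> C_S3 \<sigma>"
  obtain x1 x2 where x12: "x = (x1, x2)" by (cases x)
  have xT: "x1 \<in> Toeplitz_circle" "x2 \<in> Toeplitz_circle"
    and xs: "\<And>u v. apply_bcontfun (\<sigma> (apply_bcontfun x1 (u * v))) u = apply_bcontfun (\<sigma> (apply_bcontfun x2 v)) u"
    using x by (simp_all add: C_S3_iff x12)
  have "\<exists>y\<in>iota_closure. dist y x < \<epsilon>" if \<epsilon>: "0 < \<epsilon>" for \<epsilon>
  proof -
    define \<delta> where "\<delta> = \<epsilon> / 5"
    have \<delta>: "0 < \<delta>" using \<epsilon> by (simp add: \<delta>_def)
    have approx: "\<exists>Y R. Y \<in> tensor_poly \<and> R \<in> tensor_finite_matrix \<and> dist (Y + R) F < \<delta>" if F: "F \<in> Toeplitz_circle" for F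
    proof -
      have "F \<in> closure {Y + R | Y R. Y \<in> tensor_poly \<and> R \<in> tensor_finite_matrix}"
        using Toeplitz_circle_approx F by blast
      from this[unfolded closure_approachable, rule_format, OF \<delta>] show ?thesis by blast
    qed
    from approx[OF xT(1)] obtain Y1 R1 where 1: "Y1 \<in> tensor_poly" "R1 \<in> tensor_finite_matrix" "dist (Y1 + R1) x1 < \<delta>"
      by blast
    from approx[OF xT(2)] obtain Y2 R2 where 2: "Y2 \<in> tensor_poly" "R2 \<in> tensor_finite_matrix" "dist (Y2 + R2) x2 < \<delta>"
      by blast
    from tensor_poly_partner[OF 1(1)] obtain Y' where Y': "Y' \<in> tensor_poly" "(Y1, Y') \<in> iota_closure"
      "\<And>u v. apply_bcontfun (\<sigma> (apply_bcontfun Y' v)) u = apply_bcontfun (\<sigma> (apply_bcontfun Y1 (u * v))) u" by blast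
    have T: "apply_bcontfun F v \<in> Toeplitz" if "F \<in> tensor_poly \<or> F \<in> tensor_finite_matrix \<or> F \<in> Toeplitz_circle" for F v
      using that tensor_poly_Toeplitz_circle by (intro Toeplitz_circle_apply) blast
    have close: "cmod (apply_bcontfun (\<sigma> (apply_bcontfun Y v)) u - apply_bcontfun (\<sigma> (apply_bcontfun F v)) u) \<le> \<delta>"
      if "Y \<in> tensor_poly" "R \<in> tensor_finite_matrix" "F \<in> Toeplitz_circle" "dist (Y + R) F < \<delta>" for Y R F u v
    proof -
      have "cmod (apply_bcontfun (\<sigma> (apply_bcontfun (Y + R) v - apply_bcontfun F v)) u) \<le> norm (apply_bcontfun (Y + R - F) v)"
        using cmod_symbol_le[of "apply_bcontfun (Y + R) v - apply_bcontfun F v" u] that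
        by (simp add: Toeplitz_diff Toeplitz_add T)
      also have "\<dots> \<le> norm (Y + R - F)" by (rule norm_bounded)
      also have "\<dots> \<le> \<delta>" using that(4) by (simp add: dist_norm)
      finally show ?thesis
        using that by (simp add: symbol_diff symbol_add Toeplitz_add T symbol_tensor_finite_matrix)
    qed
    have "norm (Y2 - Y') \<le> 2 * \<delta>"
    proof (rule norm_bound)
      fix v
      have Z: "Y2 - Y' \<in> tensor_poly"
        using 2(1) Y'(1) unfolding tensor_poly_def by (rule complex_vector.span_diff)
      show "norm (apply_bcontfun (Y2 - Y') v) \<le> 2 * \<delta>"
      proof (rule norm_toeplitz_poly_le[OF apply_tensor_poly[OF Z]])
        fix u
        have "apply_bcontfun (\<sigma> (apply_bcontfun (Y2 - Y') v)) u =
            (apply_bcontfun (\<sigma> (apply_bcontfun Y2 v)) u - apply_bcontfun (\<sigma> (apply_bcontfun x2 v)) u) -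
            (apply_bcontfun (\<sigma> (apply_bcontfun Y1 (u * v))) u - apply_bcontfun (\<sigma> (apply_bcontfun x1 (u * v))) u)"
          using 2(1) Y'(1) by (simp add: symbol_diff T Y'(3) xs)
        then show "cmod (apply_bcontfun (\<sigma> (apply_bcontfun (Y2 - Y') v)) u) \<le> 2 * \<delta>"
          using norm_triangle_ineq4 close[OF 1(1,2) xT(1) 1(3), of "u * v" u] close[OF 2(1,2) xT(2) 2(3), of v u]
          by (smt (verit, best))
      qed
    qed
    have "(Y1, Y') + ((R1, 0) + (0, R2)) \<in> iota_closure"
      by (intro complex_vector.subspace_add[OF subspace_iota_closure] Y' finite_matrix_in_closure 1 2)
    moreover have "dist ((Y1, Y') + ((R1, 0) + (0, R2))) x < \<epsilon>"
    proof -
      have "dist ((Y1, Y') + ((R1, 0) + (0, R2))) x = norm (Y1 + R1 - x1, Y' + R2 - x2)"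
        by (simp add: dist_norm x12)
      also have "\<dots> \<le> norm (Y1 + R1 - x1) + norm (Y' + R2 - x2)" by (rule norm_Pair_le)
      also have "norm (Y' + R2 - x2) \<le> norm (Y2 + R2 - x2) + norm (Y2 - Y')"
        using norm_triangle_ineq4[of "Y2 + R2 - x2" "Y2 - Y'"] by (simp add: algebra_simps)
      finally have "dist ((Y1, Y') + ((R1, 0) + (0, R2))) x \<le>
          norm (Y1 + R1 - x1) + (norm (Y2 + R2 - x2) + norm (Y2 - Y'))" by simp
      moreover have "norm (Y1 + R1 - x1) < \<delta>" "norm (Y2 + R2 - x2) < \<delta>"
        using 1(3) 2(3) by (simp_all add: dist_norm)
      moreover have "4 * \<delta> < \<epsilon>" using \<epsilon> by (simp add: \<delta>_def)
      ultimately show ?thesis using \<open>norm (Y2 - Y') \<le> 2 * \<delta>\<close> by linarith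
    qed
    ultimately show ?thesis by blast
  qed
  then have "x \<in> closure iota_closure" by (simp add: closure_approachable)
  then show "x \<in> iota_closure" using closed_iota_closure by simp
qed

theorem closure_iota: "closure (iota p q ` O_S3 p q) = C_S3 \<sigma>"
proof
  have "iota p q ` O_S3 p q \<subseteq> C_S3 \<sigma>" by (auto simp: O_S3_eq_range iota_in_C_S3)
  then show "closure (iota p q ` O_S3 p q) \<subseteq> C_S3 \<sigma>" by (intro closure_minimal closed_C_S3)
  show "C_S3 \<sigma> \<subseteq> closure (iota p q ` O_S3 p q)"
    using C_S3_subset_closure by (simp add: iota_image iota_closure_def)
qed

end

section \<open>The quantum sphere and its line bundles\<close>

theorem proposition3p1:
  fixes p q :: real and \<sigma> :: "ell2 cop \<Rightarrow> circle \<Rightarrow>\<^sub>C complex"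
  assumes "0 < p" "p < 1" "0 < q" "q < 1"
    and "symbol_map \<sigma>"
  shows "universal_Cstar_algebra TYPE('h::complex_hilbert) p q (C_S3 \<sigma>) max_norm (iota p q) \<and>
    (\<forall>N::int. left_module_isomorphic (C_S2 \<sigma>) C_S3_action (C_S3_line \<sigma> N) (*) (Toeplitz_fibre \<sigma> N) \<and>
      iota p q ` L_S3 p q N \<subseteq> C_S3_line \<sigma> N)"
proof -
  interpret quantum_sphere \<sigma> p q
    using assms by unfold_locales
  have "norm (\<rho> X) \<le> universal_norm p q X"
    if "O_S3_star_hom p q \<rho>" "X \<in> O_S3 p q" for \<rho> :: "S3_free set \<Rightarrow> 'h cop" and X
    using norm_representation_le[OF that] by (simp add: universal_norm_eq that)
  then have "universal_Cstar_algebra TYPE('h) p q (C_S3 \<sigma>) max_norm (iota p q)"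
    unfolding universal_Cstar_algebra_def
    using O_S3_star_hom_iota inj_on_iota closure_iota universal_norm_eq by simp
  then show ?thesis using line_bundle_isomorphic iota_L_S3 by blast
qed

end
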